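(* Let $\nu$ be a probability measure on $\mathbb{R}$ with $\nu\{0\}=0$. Then the stopping time $$T^\nu:=\inf\{t>0:\ \ell^0[0,t]=\ell^\nu[0,t]\}$$ embeds $\nu$ and is an unbiased shift.
   Context: Let $\Omega$ be the set of continuous functions $\omega:\mathbb{R}\to\mathbb{R}$ with the Kolmogorov product $\sigma$-algebra $\mathcal{A}$, let $B=(B_t)_{t\in\mathbb{R}}$ be the identity (coordinate process) on $\Omega$, and let $\mathbb{P}_0$ be the law of a two-sided standard Brownian motion with $B_0=0$. Put $\mathbb{P}_x:=\mathbb{P}_0\{B+x\in\cdot\}$ for $x\in\mathbb{R}$, and $(\theta_t\omega)_s:=\omega_{t+s}$ for $s,t\in\mathbb{R}$. Random times. A random time is a measurable function $T$ of $B$ with values in $\mathbb{R}$ (a time given by a formula that may be infinite on a $\mathbb{P}_0$-null set is understood up to that null set). $T$ is an unbiased shift if, under $\mathbb{P}_0$, $(B_{T+t}-B_T)_{t\in\mathbb{R}}$ is a two-sided standard Brownian motion independent of $B_T$. $T$ embeds $\nu$ if $B_T$ has distribution $\nu$ under $\mathbb{P}_0$. Stopping times $T\ge 0$ are with respect to the filtration $(\sigma\{B_s: s\le t\})_{t\ge0}$, understood modulo $\mathbb{P}_0$-null sets. Local times. $\ell^x$ denotes the random measure on $\mathbb{R}$ associated with the local time of $B$ at $x\in\mathbb{R}$: for all measurable $f:\mathbb{R}^2\to[0,\infty)$, $\int f(B_s,s)\,ds=\iint f(x,s)\,\ell^x(ds)\,dx$, $\mathbb{P}_0$-a.s. A version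 is fixed such that: $\ell^0$ is $\mathbb{P}_x$-a.e. diffuse (atomless) for every $x$; $\ell^0(\theta_t\omega,C-t)=\ell^0(\omega,C)$ for all Borel $C\subset\mathbb{R}$ and $t\in\mathbb{R}$, $\mathbb{P}_x$-a.s. for every $x$; $\ell^y(\omega,\cdot)=\ell^0(\omega-y,\cdot)$ for all $\omega,y$; and $\int \mathbf{1}\{B_t\neq x\}\,\ell^x(\omega,dt)=0$ for all $\omega,x$. For a locally finite measure $\nu$ on $\mathbb{R}$, $\ell^\nu(\omega,\cdot):=\int\ell^x(\omega,\cdot)\,\nu(dx)$. *)

theory Defs
  imports "HOL-Probability.Probability"
begin

definition path_space :: "(real \<Rightarrow> real) measure" where
  "path_space = restrict_space (PiM UNIV (\<lambda>_. borel)) {\<omega>. continuous_on UNIV \<omega>}"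

definition two_sided_brownian_motion :: "'a measure \<Rightarrow> (real \<Rightarrow> 'a \<Rightarrow> real) \<Rightarrow> bool" where
  "two_sided_brownian_motion M X \<longleftrightarrow>
     prob_space M \<and>
     (\<forall>t. X t \<in> borel_measurable M) \<and>
     (AE \<omega> in M. X 0 \<omega> = 0 \<and> continuous_on UNIV (\<lambda>t. X t \<omega>)) \<and>
     (\<forall>s t. s < t \<longrightarrow>
        distributed M lborel (\<lambda>\<omega>. X t \<omega> - X s \<omega>) (normal_density 0 (sqrt (t - s)))) \<and>
     (\<forall>(s :: nat \<Rightarrow> real) n. strict_mono s \<longrightarrow>
        prob_space.indep_vars M (\<lambda>_. borel) (\<lambda>i \<omega>. X (s (Suc i)) \<omega> - X (s i) \<omega>) {..<n})"

text \<open>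
  The conditions below determine the measure \<open>P\<^sub>0\<close> uniquely. It is characterized rather than
  constructed, because the library does not provide the existence of Brownian motion.
\<close>
definition two_sided_wiener_measure :: "(real \<Rightarrow> real) measure \<Rightarrow> bool" where
  "two_sided_wiener_measure P\<^sub>0 \<longleftrightarrow>
     sets P\<^sub>0 = sets path_space \<and> two_sided_brownian_motion P\<^sub>0 (\<lambda>t \<omega>. \<omega> t)"

definition started_at :: "(real \<Rightarrow> real) measure \<Rightarrow> real \<Rightarrow> (real \<Rightarrow> real) measure" where
  "started_at P\<^sub>0 x = distr P\<^sub>0 path_space (\<lambda>\<omega> t. \<omega> t + x)"

definition path_shift :: "real \<Rightarrow> (real \<Rightarrow> real) \<Rightarrow> real \<Rightarrow> real" where
  "path_shift t \<omega> = (\<lambda>s. \<omega> (t + s))"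

definition random_measure :: "'a measure \<Rightarrow> ('a \<Rightarrow> real measure) \<Rightarrow> bool" where
  "random_measure M \<xi> \<longleftrightarrow>
     (\<forall>\<omega>\<in>space M. sets (\<xi> \<omega>) = sets borel) \<and>
     (\<forall>C\<in>sets borel. (\<lambda>\<omega>. emeasure (\<xi> \<omega>) C) \<in> borel_measurable M) \<and>
     (AE \<omega> in M. \<forall>a b. emeasure (\<xi> \<omega>) {a..b} < \<infinity>)"

text \<open>
  \<open>L x \<omega>\<close> is the local time measure of the path \<open>\<omega>\<close> at level \<open>x\<close>. The exceptional
  null set in the occupation formula may depend on \<open>f\<close>; the one in the shift covariance depends
  neither on \<open>t\<close> nor on \<open>C\<close>.
\<close>
definition brownian_local_time ::
    "(real \<Rightarrow> real) measure \<Rightarrow> (real \<Rightarrow> (real \<Rightarrow> real) \<Rightarrow> real measure) \<Rightarrow> bool" where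
  "brownian_local_time P\<^sub>0 L \<longleftrightarrow>
     (\<forall>x. random_measure P\<^sub>0 (L x)) \<and>
     (\<forall>f :: real \<times> real \<Rightarrow> real. f \<in> borel_measurable borel \<longrightarrow> (\<forall>p. 0 \<le> f p) \<longrightarrow>
        (AE \<omega> in P\<^sub>0. (\<integral>\<^sup>+s. ennreal (f (\<omega> s, s)) \<partial>lborel)
                  = (\<integral>\<^sup>+x. (\<integral>\<^sup>+s. ennreal (f (x, s)) \<partial>L x \<omega>) \<partial>lborel))) \<and>
     (\<forall>x. AE \<omega> in started_at P\<^sub>0 x. \<forall>s. emeasure (L 0 \<omega>) {s} = 0) \<and>
     (\<forall>x. AE \<omega> in started_at P\<^sub>0 x. \<forall>t. \<forall>C\<in>sets borel.
        emeasure (L 0 (path_shift t \<omega>)) ((\<lambda>s. s - t) ` C) = emeasure (L 0 \<omega>) C) \<and>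
     (\<forall>\<omega>\<in>space path_space. \<forall>y. L y \<omega> = L 0 (\<lambda>s. \<omega> s - y)) \<and>
     (\<forall>\<omega>\<in>space path_space. \<forall>x. (\<integral>\<^sup>+t. indicator {t. \<omega> t \<noteq> x} t \<partial>L x \<omega>) = 0)"

definition mixed_local_time ::
    "(real \<Rightarrow> (real \<Rightarrow> real) \<Rightarrow> real measure) \<Rightarrow> real measure \<Rightarrow> (real \<Rightarrow> real) \<Rightarrow> real measure" where
  "mixed_local_time L \<nu> \<omega> =
     measure_of UNIV (sets borel) (\<lambda>C. \<integral>\<^sup>+x. emeasure (L x \<omega>) C \<partial>\<nu>)"

text \<open>The infimum is \<open>\<infinity>\<close> if the two local times never agree at a positive time.\<close>
definition balancing_time ::
    "(real \<Rightarrow> (real \<Rightarrow> real) \<Rightarrow> real measure) \<Rightarrow> real measure \<Rightarrow> (real \<Rightarrow> real) \<Rightarrow> ereal" where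
  "balancing_time L \<nu> \<omega> =
     Inf {ereal t | t. 0 < t \<and> emeasure (L 0 \<omega>) {0..t} = emeasure (mixed_local_time L \<nu> \<omega>) {0..t}}"

definition random_time :: "(real \<Rightarrow> real) measure \<Rightarrow> ((real \<Rightarrow> real) \<Rightarrow> real) \<Rightarrow> bool" where
  "random_time P\<^sub>0 T \<longleftrightarrow> T \<in> borel_measurable P\<^sub>0"

text \<open>
  The \<open>\<sigma>\<close>-algebra generated by the coordinates \<open>B\<^sub>s\<close>, \<open>s \<le> t\<close> (negative \<open>s\<close> included), and the
  \<open>P\<^sub>0\<close>-null events. It is not made right-continuous.
\<close>
definition path_filtration :: "(real \<Rightarrow> real) measure \<Rightarrow> real \<Rightarrow> (real \<Rightarrow> real) measure" where
  "path_filtration P\<^sub>0 t =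
     sigma (space P\<^sub>0)
       ({(\<lambda>\<omega>. \<omega> s) -` A \<inter> space P\<^sub>0 | s A. s \<le> t \<and> A \<in> sets borel} \<union> null_sets P\<^sub>0)"

text \<open>
  \<open>stopping_time\<close> also constrains \<open>{T \<le> t}\<close> for negative \<open>t\<close>. This is no restriction here,
  because these events are null.
\<close>
definition nonneg_stopping_time ::
    "(real \<Rightarrow> real) measure \<Rightarrow> ((real \<Rightarrow> real) \<Rightarrow> real) \<Rightarrow> bool" where
  "nonneg_stopping_time P\<^sub>0 T \<longleftrightarrow>
     random_time P\<^sub>0 T \<and> (AE \<omega> in P\<^sub>0. 0 \<le> T \<omega>) \<and> stopping_time (path_filtration P\<^sub>0) T"

definition embeds :: "(real \<Rightarrow> real) measure \<Rightarrow> ((real \<Rightarrow> real) \<Rightarrow> real) \<Rightarrow> real measure \<Rightarrow> bool" where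
  "embeds P\<^sub>0 T \<nu> \<longleftrightarrow> random_time P\<^sub>0 T \<and> distr P\<^sub>0 borel (\<lambda>\<omega>. \<omega> (T \<omega>)) = \<nu>"

text \<open>
  Independence is stated for the generated \<open>\<sigma>\<close>-algebras because \<open>indep_var\<close> requires both random
  variables to have values in the same type.
\<close>
definition unbiased_shift :: "(real \<Rightarrow> real) measure \<Rightarrow> ((real \<Rightarrow> real) \<Rightarrow> real) \<Rightarrow> bool" where
  "unbiased_shift P\<^sub>0 T \<longleftrightarrow>
     random_time P\<^sub>0 T \<and>
     two_sided_brownian_motion P\<^sub>0 (\<lambda>t \<omega>. \<omega> (T \<omega> + t) - \<omega> (T \<omega>)) \<and>
     prob_space.indep_set P\<^sub>0
       (sets (vimage_algebra (space P\<^sub>0) (\<lambda>\<omega> t. \<omega> (T \<omega> + t) - \<omega> (T \<omega>)) path_space))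
       (sets (vimage_algebra (space P\<^sub>0) (\<lambda>\<omega>. \<omega> (T \<omega>)) borel))"

end

theory Submission
  imports Defs
begin

text \<open>
  Write \<open>\<ell>\<^sub>t\<close> and \<open>m\<^sub>t\<close> for the local time at \<open>0\<close> and the \<open>\<nu>\<close>-mixed local time. They live on
  disjoint sets of times, and the excursions of \<open>H = \<ell> - m\<close> match the mass of \<open>\<ell>\<close> at \<open>s\<close> with
  mass of \<open>m\<close> at the first return time \<open>\<tau>\<^sub>s\<close> of \<open>H\<close> to \<open>H\<^sub>s\<close>: the image of \<open>\<ell>\<close> under \<open>\<tau>\<close> is
  at most \<open>m\<close>, by the continuous analogue of matching parentheses. Under the stationary measure
  \<open>\<integral> P\<^sub>x dx\<close> both measures have intensity one, and the path seen from their typical points is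
  \<open>P\<^sub>0\<close> and \<open>P\<^sub>\<nu>\<close>, respectively. If \<open>\<tau>\<close> is finite, the image of \<open>\<ell>\<close> is therefore \<open>m\<close>, and by
  mass transport the path seen from \<open>T\<^sup>\<nu> = \<tau>\<^sub>0\<close> has law \<open>P\<^sub>\<nu>\<close> under \<open>P\<^sub>0\<close>: this is the embedding
  and the unbiasedness at once.

  Finiteness: by a zero-one law \<open>sup H\<close> over the future is either infinite or finite for all
  starting points. In the first case time reversal gives \<open>inf H = -\<infinity>\<close> over the past, which
  leaves no mass of \<open>m\<close> unmatched, so that the intensities force \<open>\<tau> < \<infinity>\<close>. In the second case the
  unmatched mass of \<open>\<ell>\<close> in the future is finite, and by recurrence it cannot decrease in time,
  so it vanishes.
\<close>

section \<open>Integration against locally finite kernels\<close>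

text \<open>The local time \<open>L\<close> is known only up to null sets that depend on the test
  function, on the level or on the starting point, whereas matching, reversal, freezing and
  adaptedness call for one functional of the path. Hence a canonical version \<open>ltime\<close> is
  built from normalized occupation times of shrinking windows. It commutes with shifts and reversal
  on every continuous path, and on regular paths it is compatible with freezing the path at a level
  other than 0. The scale \<epsilon> of the windows is a diagonal choice that upgrades L1
  convergence to convergence almost everywhere. This identifies \<open>ltime\<close> with
  \<open>L 0\<close> for Lebesgue almost every starting point; the Palm formula for a level, applied
  to a shift invariant null set, reaches every starting point. Freezing forces strictly positive
  times, at which the path avoids each given level almost surely. The vanishing mass of \<nu> at 0
  enters twice, in the mutual singularity of the two local times and in excluding a return at time
  0. Recurrence is used in the form that an event of the future is null for the stationary measure
  once its probabilities along integer times are summable.\<close>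

definition locally_finite_kernel :: "'a measure \<Rightarrow> ('a \<Rightarrow> real measure) \<Rightarrow> bool" where
  "locally_finite_kernel M K \<longleftrightarrow>
     (\<forall>x\<in>space M. sets (K x) = sets borel) \<and>
     (\<forall>x\<in>space M. \<forall>a b. emeasure (K x) {a<..b} < \<infinity>) \<and>
     (\<forall>a b. (\<lambda>x. emeasure (K x) {a<..b}) \<in> borel_measurable M)"

lemma sigma_sets_Ioc: "sets (borel :: real measure) = sigma_sets UNIV (range (\<lambda>(a, b). {a<..b}))"
  by (subst borel_sigma_sets_Ioc) (simp add: sets_measure_of)

lemma Int_stable_Ioc: "Int_stable (range (\<lambda>(a, b). {a<..b::real}))"
proof (rule Int_stableI)
  fix a b assume "a \<in> range (\<lambda>(a, b). {a<..b::real})" "b \<in> range (\<lambda>(a, b). {a<..b::real})"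
  then obtain p q r s where "a = {p<..q}" "b = {r<..s}" by auto
  then have "a \<inter> b = (\<lambda>(a, b). {a<..b}) (max p r, min q s)" by auto
  then show "a \<inter> b \<in> range (\<lambda>(a, b). {a<..b::real})" by blast
qed

lemma UN_Ioc_UNIV: "(\<Union>n::nat. {-real n<..real n}) = UNIV"
proof -
  have "\<exists>n. -real n < x \<and> x \<le> real n" for x
  proof -
    obtain n where "\<bar>x\<bar> < real n" using reals_Archimedean2 by blast
    then show ?thesis by (intro exI[of _ n]) auto
  qed
  then show ?thesis by auto
qed

lemma real_measure_eqI_Ioc:
  fixes M N :: "real measure"
  assumes "sets M = sets borel" "sets N = sets borel"
    and "\<And>a b. emeasure M {a<..b} = emeasure N {a<..b}" "\<And>a b. emeasure M {a<..b} < \<infinity>"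
  shows "M = N"
proof (rule measure_eqI_generator_eq[OF Int_stable_Ioc, where \<Omega>=UNIV and A="\<lambda>n. {-real n<..real n}"])
  show "emeasure M X = emeasure N X" if "X \<in> range (\<lambda>(a, b). {a<..b})" for X using that assms by auto
  show "range (\<lambda>n. {-real n<..real n}) \<subseteq> range (\<lambda>(a, b). {a<..b})" by auto
  show "emeasure M {-real i<..real i} \<noteq> \<infinity>" for i using assms(4)[of "-real i" "real i"] by auto
qed (use assms sigma_sets_Ioc UN_Ioc_UNIV in auto)

text \<open>Integrals against subprobability kernels are measurable in the parameter. The kernel is
  therefore cut down to (-n,n] and normalized, and the original integral is the supremum over
  \<open>n\<close> of the rescaled ones.\<close>

lemma locally_finite_kernel_measurable:
  assumes K: "locally_finite_kernel M K"
    and f[measurable]: "(\<lambda>(x, s). f x s) \<in> borel_measurable (M \<Otimes>\<^sub>M borel)"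
  shows "(\<lambda>x. \<integral>\<^sup>+s. f x s \<partial>K x) \<in> borel_measurable M"
proof -
  \<comment> \<open>The summand 1 keeps the normalizing factor nonzero; the truncation keeps it
    finite.\<close>
  define Z where "Z n x = 1 + emeasure (K x) {-real n<..real n}" for n x
  define k where "k n x = density (K x) (\<lambda>s. indicator {-real n<..real n} s / Z n x)" for n x
  have sK: "sets (K x) = sets borel" if "x \<in> space M" for x
    using K that by (auto simp: locally_finite_kernel_def)
  have fin: "emeasure (K x) {a<..b} < \<infinity>" if "x \<in> space M" for x a b
    using K that by (auto simp: locally_finite_kernel_def)
  have meas[measurable]: "(\<lambda>x. emeasure (K x) {a<..b}) \<in> borel_measurable M" for a b
    using K by (auto simp: locally_finite_kernel_def)
  have Zm[measurable]: "Z n \<in> borel_measurable M" for n unfolding Z_def by measurable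
  have Z0: "Z n x \<noteq> 0" for n x by (auto simp: Z_def)
  have ZF: "Z n x < \<infinity>" if "x \<in> space M" for n x using fin[OF that] by (auto simp: Z_def)
  have ek: "emeasure (k n x) {a<..b} = emeasure (K x) {max a (-real n)<..min b (real n)} / Z n x"
    if "x \<in> space M" for n x a b
  proof -
    have "emeasure (k n x) {a<..b} = (\<integral>\<^sup>+s. indicator {-real n<..real n} s / Z n x * indicator {a<..b} s \<partial>K x)"
      using sK[OF that] unfolding k_def by (subst emeasure_density) (auto cong: measurable_cong_sets)
    also have "\<dots> = (\<integral>\<^sup>+s. indicator {max a (-real n)<..min b (real n)} s / Z n x \<partial>K x)"
      by (intro nn_integral_cong) (auto simp: indicator_def)
    also have "\<dots> = (\<integral>\<^sup>+s. indicator {max a (-real n)<..min b (real n)} s \<partial>K x) / Z n x"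
      using sK[OF that] by (intro nn_integral_divide) (auto cong: measurable_cong_sets)
    also have "\<dots> = emeasure (K x) {max a (-real n)<..min b (real n)} / Z n x"
      using sK[OF that] by simp
    finally show ?thesis .
  qed
  have ekU: "emeasure (k n x) UNIV = emeasure (K x) {-real n<..real n} / Z n x"
    if "x \<in> space M" for n x
  proof -
    have "emeasure (k n x) UNIV = (\<integral>\<^sup>+s. indicator {-real n<..real n} s / Z n x * indicator UNIV s \<partial>K x)"
      using sK[OF that] unfolding k_def by (subst emeasure_density) (auto cong: measurable_cong_sets)
    also have "\<dots> = (\<integral>\<^sup>+s. indicator {-real n<..real n} s \<partial>K x) / Z n x"
      using sK[OF that] by (subst nn_integral_divide[symmetric]) (auto cong: measurable_cong_sets)
    finally show ?thesis using sK[OF that] by simp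
  qed
  have k[measurable]: "k n \<in> measurable M (subprob_algebra borel)" for n
  proof (rule measurable_subprob_algebra_generated[OF sigma_sets_Ioc Int_stable_Ioc])
    show "subprob_space (k n x)" if "x \<in> space M" for x
    proof (rule subprob_spaceI)
      have "emeasure (K x) {-real n<..real n} / Z n x \<le> Z n x / Z n x"
        by (intro divide_right_mono_ennreal) (auto simp: Z_def)
      also have "\<dots> = 1" using Z0 ZF[OF that] by (simp add: ennreal_divide_self)
      finally have "emeasure (k n x) UNIV \<le> 1" using ekU[OF that] by simp
      moreover have "space (k n x) = UNIV" using sets_eq_imp_space_eq[OF sK[OF that]] by (simp add: k_def)
      ultimately show "emeasure (k n x) (space (k n x)) \<le> 1" "space (k n x) \<noteq> {}" by auto
    qed
    show "sets (k n x) = sets borel" if "x \<in> space M" for x using sK[OF that] by (simp add: k_def)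
    show "(\<lambda>x. emeasure (k n x) A) \<in> borel_measurable M" if A: "A \<in> range (\<lambda>(a, b). {a<..b})" for A
    proof -
      from A obtain a b where "A = {a<..b}" by auto
      have "(\<lambda>x. emeasure (K x) {max a (-real n)<..min b (real n)} / Z n x) \<in> borel_measurable M"
        by measurable
      then show ?thesis using ek unfolding \<open>A = {a<..b}\<close> by (simp cong: measurable_cong)
    qed
    show "(\<lambda>x. emeasure (k n x) UNIV) \<in> borel_measurable M"
      by (subst measurable_cong[OF ekU]) auto
  qed auto
  have "(\<integral>\<^sup>+s. f x s \<partial>K x) = (SUP n. Z n x * (\<integral>\<^sup>+s. f x s \<partial>k n x))" if x: "x \<in> space M" for x
  proof -
    have fx: "f x \<in> borel_measurable (K x)"
      using measurable_compose[OF measurable_Pair1'[OF x, of borel] f] sK[OF x]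
      by (simp cong: measurable_cong_sets)
    have "Z n x * (\<integral>\<^sup>+s. f x s \<partial>k n x) = (\<integral>\<^sup>+s. f x s * indicator {-real n<..real n} s \<partial>K x)" for n
    proof -
      have "(\<integral>\<^sup>+s. f x s \<partial>k n x) = (\<integral>\<^sup>+s. indicator {-real n<..real n} s / Z n x * f x s \<partial>K x)"
        unfolding k_def using sK[OF x] fx by (intro nn_integral_density) (auto cong: measurable_cong_sets)
      also have "\<dots> = (\<integral>\<^sup>+s. (f x s * indicator {-real n<..real n} s) / Z n x \<partial>K x)"
        by (intro nn_integral_cong) (auto simp: indicator_def divide_ennreal_def mult.commute)
      also have "\<dots> = (\<integral>\<^sup>+s. f x s * indicator {-real n<..real n} s \<partial>K x) / Z n x"
        using sK[OF x] fx by (intro nn_integral_divide) (auto cong: measurable_cong_sets)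
      finally show ?thesis using Z0[of n x] ZF[OF x, of n]
        by (simp add: ennreal_times_divide mult.commute[of "Z n x"] ennreal_mult_divide_eq)
    qed
    moreover have "(\<integral>\<^sup>+s. f x s \<partial>K x) = (SUP n. \<integral>\<^sup>+s. f x s * indicator {-real n<..real n} s \<partial>K x)"
    proof (subst nn_integral_monotone_convergence_SUP[symmetric])
      show "incseq (\<lambda>n s. f x s * indicator {- real n<..real n} s)"
        by (auto simp: incseq_def le_fun_def indicator_def)
      show "(\<lambda>s. f x s * indicator {- real n<..real n} s) \<in> borel_measurable (K x)" for n
        using sK[OF x] fx by (auto cong: measurable_cong_sets)
      have "(SUP n. f x s * indicator {- real n<..real n} s) = f x s" for s
      proof -
        have "s \<in> (\<Union>n::nat. {-real n<..real n})" unfolding UN_Ioc_UNIV by simp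
        then obtain n :: nat where "s \<in> {-real n<..real n}" by blast
        then have "f x s = f x s * indicator {-real n<..real n} s" by simp
        then show ?thesis by (intro antisym SUP_least) (auto simp: indicator_def intro!: SUP_upper2[of n])
      qed
      then show "(\<integral>\<^sup>+s. f x s \<partial>K x) = (\<integral>\<^sup>+s. (SUP n. f x s * indicator {- real n<..real n} s) \<partial>K x)"
        by simp
    qed
    ultimately show ?thesis by simp
  qed
  moreover have "(\<lambda>x. SUP n. Z n x * (\<integral>\<^sup>+s. f x s \<partial>k n x)) \<in> borel_measurable M"
    by (intro borel_measurable_SUP borel_measurable_times_ennreal Zm
          nn_integral_measurable_subprob_algebra2[OF f k]) auto
  ultimately show ?thesis by (subst measurable_cong) auto
qed

text \<open>The measure M(dx) K(x, ds). Assembling a family of measures into one lets image measures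
  and uniqueness theorems act on the whole family, also when the single measures have infinite
  mass.\<close>

definition kernel_prod :: "'a measure \<Rightarrow> ('a \<Rightarrow> real measure) \<Rightarrow> ('a \<times> real) measure" where
  "kernel_prod M K = measure_of (space M \<times> UNIV) (sets (M \<Otimes>\<^sub>M borel))
     (\<lambda>D. \<integral>\<^sup>+x. emeasure (K x) (Pair x -` D) \<partial>M)"

lemma sets_kernel_prod[simp, measurable_cong]: "sets (kernel_prod M K) = sets (M \<Otimes>\<^sub>M borel)"
proof -
  have "space M \<times> UNIV = space (M \<Otimes>\<^sub>M (borel :: real measure))" by (simp add: space_pair_measure)
  then show ?thesis unfolding kernel_prod_def
    by (simp only: sets_measure_of[OF sets.space_closed] sets.sigma_sets_eq)
qed

lemma emeasure_kernel_prod: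
  assumes K: "locally_finite_kernel M K" and D: "D \<in> sets (M \<Otimes>\<^sub>M borel)"
  shows "emeasure (kernel_prod M K) D = (\<integral>\<^sup>+x. emeasure (K x) (Pair x -` D) \<partial>M)"
proof (rule emeasure_measure_of[OF kernel_prod_def])
  have sK: "sets (K x) = sets borel" if "x \<in> space M" for x
    using K that by (auto simp: locally_finite_kernel_def)
  show "sets (M \<Otimes>\<^sub>M borel) \<subseteq> Pow (space M \<times> (UNIV :: real set))"
    using sets.space_closed[of "M \<Otimes>\<^sub>M (borel :: real measure)"] unfolding space_pair_measure by simp
  show "D \<in> sets (kernel_prod M K)" using D by simp
  show "positive (sets (kernel_prod M K)) (\<lambda>D. \<integral>\<^sup>+x. emeasure (K x) (Pair x -` D) \<partial>M)"
    by (simp add: positive_def)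
  show "countably_additive (sets (kernel_prod M K)) (\<lambda>D. \<integral>\<^sup>+x. emeasure (K x) (Pair x -` D) \<partial>M)"
  proof (rule countably_additiveI)
    fix A :: "nat \<Rightarrow> _" assume A: "range A \<subseteq> sets (kernel_prod M K)" "disjoint_family A"
    have Ai: "A i \<in> sets (M \<Otimes>\<^sub>M borel)" for i using A by auto
    have cut: "Pair x -` A i \<in> sets (K x)" if "x \<in> space M" for x i
      using sets_Pair1[OF Ai] sK[OF that] by simp
    have "(\<lambda>x. \<integral>\<^sup>+s. indicator (A i) (x, s) \<partial>K x) \<in> borel_measurable M" for i
      using Ai[of i] by (intro locally_finite_kernel_measurable[OF K]) (simp add: case_prod_beta')
    moreover have "(\<integral>\<^sup>+s. indicator (A i) (x, s) \<partial>K x) = emeasure (K x) (Pair x -` A i)"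
      if "x \<in> space M" for x i
    proof -
      have "(\<integral>\<^sup>+s. indicator (A i) (x, s) \<partial>K x) = (\<integral>\<^sup>+s. indicator (Pair x -` A i) s \<partial>K x)"
        by (intro nn_integral_cong) (auto simp: indicator_def)
      then show ?thesis using cut[OF that] by simp
    qed
    ultimately have m: "(\<lambda>x. emeasure (K x) (Pair x -` A i)) \<in> borel_measurable M" for i
      by (simp cong: measurable_cong)
    have "(\<Sum>i. \<integral>\<^sup>+x. emeasure (K x) (Pair x -` A i) \<partial>M) = (\<integral>\<^sup>+x. (\<Sum>i. emeasure (K x) (Pair x -` A i)) \<partial>M)"
      using m by (subst nn_integral_suminf) auto
    also have "\<dots> = (\<integral>\<^sup>+x. emeasure (K x) (Pair x -` (\<Union>i. A i)) \<partial>M)"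
    proof (rule nn_integral_cong)
      fix x assume x: "x \<in> space M"
      have "(\<Sum>i. emeasure (K x) (Pair x -` A i)) = emeasure (K x) (\<Union>i. Pair x -` A i)"
        using A(2) cut[OF x] by (intro suminf_emeasure) (auto simp: disjoint_family_on_def)
      then show "(\<Sum>i. emeasure (K x) (Pair x -` A i)) = emeasure (K x) (Pair x -` (\<Union>i. A i))"
        by (simp add: vimage_UN)
    qed
    finally show "(\<Sum>i. \<integral>\<^sup>+x. emeasure (K x) (Pair x -` A i) \<partial>M) = (\<integral>\<^sup>+x. emeasure (K x) (Pair x -` (\<Union>i. A i)) \<partial>M)" .
  qed
qed

lemma nn_integral_kernel_prod:
  assumes K: "locally_finite_kernel M K"
    and f: "f \<in> borel_measurable (M \<Otimes>\<^sub>M borel)"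
  shows "(\<integral>\<^sup>+z. f z \<partial>kernel_prod M K) = (\<integral>\<^sup>+x. \<integral>\<^sup>+s. f (x, s) \<partial>K x \<partial>M)"
  using f
proof (induction rule: borel_measurable_induct)
  have sK: "sets (K x) = sets borel" if "x \<in> space M" for x
    using K that by (auto simp: locally_finite_kernel_def)
  have fx: "(\<lambda>s. h (x, s)) \<in> borel_measurable (K x)" if "h \<in> borel_measurable (M \<Otimes>\<^sub>M borel)" "x \<in> space M"
    for h :: "_ \<Rightarrow> ennreal" and x
    using measurable_compose[OF measurable_Pair1'[OF that(2), of borel] that(1)] sK[OF that(2)]
    by (simp cong: measurable_cong_sets)
  have km: "h \<in> borel_measurable (kernel_prod M K)" if "h \<in> borel_measurable (M \<Otimes>\<^sub>M borel)"
    for h :: "_ \<Rightarrow> ennreal"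
    using that by (simp cong: measurable_cong_sets)
  have fm: "(\<lambda>x. \<integral>\<^sup>+s. h (x, s) \<partial>K x) \<in> borel_measurable M" if "h \<in> borel_measurable (M \<Otimes>\<^sub>M borel)"
    for h :: "_ \<Rightarrow> ennreal"
    using that by (intro locally_finite_kernel_measurable[OF K]) (simp add: case_prod_beta')
  { case (cong f g)
    have "(\<integral>\<^sup>+z. f z \<partial>kernel_prod M K) = (\<integral>\<^sup>+z. g z \<partial>kernel_prod M K)"
      using cong by (intro nn_integral_cong) (auto dest!: sets_eq_imp_space_eq[OF sets_kernel_prod, THEN equalityD1, THEN subsetD])
    moreover have "(\<integral>\<^sup>+x. \<integral>\<^sup>+s. f (x, s) \<partial>K x \<partial>M) = (\<integral>\<^sup>+x. \<integral>\<^sup>+s. g (x, s) \<partial>K x \<partial>M)"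
      using cong by (intro nn_integral_cong) (auto simp: space_pair_measure)
    ultimately show ?case using cong by simp
  next
    case (set A)
    have "emeasure (K x) (Pair x -` A) = (\<integral>\<^sup>+s. indicator A (x, s) \<partial>K x)" if "x \<in> space M" for x
    proof -
      have "(\<integral>\<^sup>+s. indicator A (x, s) \<partial>K x) = (\<integral>\<^sup>+s. indicator (Pair x -` A) s \<partial>K x)"
        by (intro nn_integral_cong) (auto simp: indicator_def)
      then show ?thesis using sets_Pair1[OF set] sK[OF that] by simp
    qed
    then have "(\<integral>\<^sup>+x. \<integral>\<^sup>+s. indicator A (x, s) \<partial>K x \<partial>M) = (\<integral>\<^sup>+x. emeasure (K x) (Pair x -` A) \<partial>M)"
      by (intro nn_integral_cong) simp
    then show ?case using set by (simp add: emeasure_kernel_prod[OF K])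
  next
    case (mult u c)
    have "(\<integral>\<^sup>+x. \<integral>\<^sup>+s. c * u (x, s) \<partial>K x \<partial>M) = (\<integral>\<^sup>+x. c * (\<integral>\<^sup>+s. u (x, s) \<partial>K x) \<partial>M)"
      by (intro nn_integral_cong nn_integral_cmult fx mult)
    also have "\<dots> = c * (\<integral>\<^sup>+x. \<integral>\<^sup>+s. u (x, s) \<partial>K x \<partial>M)"
      by (intro nn_integral_cmult fm mult)
    moreover have "(\<integral>\<^sup>+z. c * u z \<partial>kernel_prod M K) = c * (\<integral>\<^sup>+z. u z \<partial>kernel_prod M K)"
      by (intro nn_integral_cmult km mult)
    ultimately show ?case using mult by simp
  next
    case (add u v)
    have "(\<integral>\<^sup>+x. \<integral>\<^sup>+s. v (x, s) + u (x, s) \<partial>K x \<partial>M)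
        = (\<integral>\<^sup>+x. (\<integral>\<^sup>+s. v (x, s) \<partial>K x) + (\<integral>\<^sup>+s. u (x, s) \<partial>K x) \<partial>M)"
      by (intro nn_integral_cong nn_integral_add fx add)
    also have "\<dots> = (\<integral>\<^sup>+x. \<integral>\<^sup>+s. v (x, s) \<partial>K x \<partial>M) + (\<integral>\<^sup>+x. \<integral>\<^sup>+s. u (x, s) \<partial>K x \<partial>M)"
      by (intro nn_integral_add fm add)
    moreover have "(\<integral>\<^sup>+z. v z + u z \<partial>kernel_prod M K) = (\<integral>\<^sup>+z. v z \<partial>kernel_prod M K) + (\<integral>\<^sup>+z. u z \<partial>kernel_prod M K)"
      by (intro nn_integral_add km add)
    ultimately show ?case using add by simp
  next
    case (seq U)
    have inc: "incseq (\<lambda>i. U i z)" for z using seq(3) unfolding incseq_def le_fun_def by blast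
    have "(\<integral>\<^sup>+z. (SUP i. U i) z \<partial>kernel_prod M K) = (SUP i. \<integral>\<^sup>+z. U i z \<partial>kernel_prod M K)"
      unfolding SUP_apply by (intro nn_integral_monotone_convergence_SUP km seq)
    also have "\<dots> = (SUP i. \<integral>\<^sup>+x. \<integral>\<^sup>+s. U i (x, s) \<partial>K x \<partial>M)" by (simp only: seq(5))
    also have "\<dots> = (\<integral>\<^sup>+x. (SUP i. \<integral>\<^sup>+s. U i (x, s) \<partial>K x) \<partial>M)"
      using inc by (intro nn_integral_monotone_convergence_SUP[symmetric] fm seq)
        (auto simp: incseq_def le_fun_def intro!: nn_integral_mono)
    also have "\<dots> = (\<integral>\<^sup>+x. \<integral>\<^sup>+s. (SUP i. U i) (x, s) \<partial>K x \<partial>M)"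
    proof (rule nn_integral_cong)
      fix x assume "x \<in> space M"
      then have "(\<integral>\<^sup>+s. (SUP i. U i (x, s)) \<partial>K x) = (SUP i. \<integral>\<^sup>+s. U i (x, s) \<partial>K x)"
        using inc by (intro nn_integral_monotone_convergence_SUP fx seq) (auto simp: incseq_def le_fun_def)
      then show "(SUP i. \<integral>\<^sup>+s. U i (x, s) \<partial>K x) = (\<integral>\<^sup>+s. (SUP i. U i) (x, s) \<partial>K x)"
        by (simp add: image_comp)
    qed
    finally show ?case .
  }
qed

section \<open>Matching two mutually singular diffuse measures on the line\<close>

text \<open>Diffuse locally finite measures on the line are handled through these functions:
  continuity excludes atoms, and \<open>interval_measure\<close> turns them back into
  measures.\<close>

definition distribution_function :: "(real \<Rightarrow> real) \<Rightarrow> bool" where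
  "distribution_function F \<longleftrightarrow> mono F \<and> continuous_on UNIV F"

lemma distribution_functionD:
  assumes "distribution_function F"
  shows "x \<le> y \<Longrightarrow> F x \<le> F y" "continuous_on A F" "isCont F x"
  using assms unfolding distribution_function_def mono_def
  by (auto intro: continuous_on_subset[of UNIV F A] simp: continuous_on_eq_continuous_at[OF open_UNIV, of F])

lemma emeasure_Ioc:
  assumes "distribution_function F" "a \<le> b"
  shows "emeasure (interval_measure F) {a<..b} = ennreal (F b - F a)"
  using distribution_functionD[OF assms(1)] assms(2)
  by (intro emeasure_interval_measure_Ioc) (auto intro: continuous_at_imp_continuous_within)

lemma emeasure_Ioc_finite:
  assumes "distribution_function F"
  shows "emeasure (interval_measure F) {a<..b} < \<infinity>"
  using emeasure_Ioc[OF assms, of a b] by (cases "a \<le> b") auto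

lemma emeasure_Icc:
  assumes "distribution_function F" "a \<le> b"
  shows "emeasure (interval_measure F) {a..b} = ennreal (F b - F a)"
  using distribution_functionD[OF assms(1)] assms(2) by (intro emeasure_interval_measure_Icc) auto

lemma emeasure_point:
  assumes "distribution_function F"
  shows "emeasure (interval_measure F) {a} = 0"
  using emeasure_Icc[OF assms, of a a] by simp

lemma interval_measure_eqI:
  assumes "distribution_function F" "sets M = sets borel"
    "\<And>a b. a \<le> b \<Longrightarrow> emeasure M {a<..b} = ennreal (F b - F a)"
  shows "M = interval_measure F"
proof (rule real_measure_eqI_Ioc)
  have "emeasure M {a<..b} = emeasure (interval_measure F) {a<..b}" for a b
    using assms emeasure_Ioc[of F a b] by (cases "a \<le> b") auto
  then show "emeasure M {a<..b} = emeasure (interval_measure F) {a<..b}" "emeasure M {a<..b} < \<infinity>" for a b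
    using emeasure_Ioc_finite[OF assms(1)] by auto
qed (use assms in auto)

text \<open>\<open>q\<close> is the first time from \<open>a\<close> on at which \<open>F\<close>
  reaches the level \<open>y\<close>; the last claim is the Galois connection between
  \<open>F\<close> and this inverse.\<close>

lemma level_inverse:
  assumes F: "distribution_function F" and y: "F a < y" "y \<le> F b"
  defines "q \<equiv> Inf {t. a \<le> t \<and> y \<le> F t}"
  shows "a < q" "q \<le> b" "F q = y" "\<And>t. a \<le> t \<Longrightarrow> q \<le> t \<longleftrightarrow> y \<le> F t"
proof -
  let ?S = "{t. a \<le> t \<and> y \<le> F t}"
  have cl: "closed ?S"
    using distribution_functionD(2)[OF F]
    by (intro closed_Collect_conj closed_Collect_le continuous_intros) auto
  have ab: "a \<le> b" using distribution_functionD(1)[OF F, of b a] y by linarith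
  then have bS: "b \<in> ?S" using y by auto
  have bdd: "bdd_below ?S" by (intro bdd_belowI[of _ a]) auto
  have qS: "q \<in> ?S" unfolding q_def using closed_contains_Inf[OF _ bdd cl] bS by blast
  show "q \<le> b" unfolding q_def by (rule cInf_lower[OF bS bdd])
  have "q \<noteq> a" using qS y by auto
  then show aq: "a < q" using qS by auto
  show *: "q \<le> t \<longleftrightarrow> y \<le> F t" if "a \<le> t" for t
  proof
    assume "q \<le> t" then show "y \<le> F t" using qS distribution_functionD(1)[OF F, of q t] by auto
  next
    assume "y \<le> F t" then show "q \<le> t" unfolding q_def using that by (intro cInf_lower[OF _ bdd]) auto
  qed
  obtain x where x: "a \<le> x" "x \<le> q" "F x = y"
    using IVT'[of F a y q] aq y qS distribution_functionD(2)[OF F] by auto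
  with *[of x] show "F q = y" by auto
qed

text \<open>The inverse \<open>q\<close> carries Lebesgue measure on the levels (F a, F b] to the
  measure of \<open>F\<close> on (a,b]. Questions about the mass of a set of times thereby become
  questions about sets of levels.\<close>

lemma emeasure_level_set:
  assumes F: "distribution_function F" and E: "E \<in> sets borel" "E \<subseteq> {a<..b}"
  defines "q \<equiv> \<lambda>y. Inf {t. a \<le> t \<and> y \<le> F t}"
  shows "{y \<in> {F a<..F b}. q y \<in> E} \<in> sets borel"
    and "emeasure (interval_measure F) E = emeasure lborel {y \<in> {F a<..F b}. q y \<in> E}"
proof -
  have L: "a < q y" "q y \<le> b" "F (q y) = y" "\<And>t. a \<le> t \<Longrightarrow> q y \<le> t \<longleftrightarrow> y \<le> F t"
    if "F a < y" "y \<le> F b" for y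
    using level_inverse[OF F that] unfolding q_def by auto
  have qm: "q \<in> borel_measurable (restrict_space borel {F a<..F b})"
  proof (rule borel_measurable_mono_on_fnc, rule mono_onI)
    fix r s assume rs: "r \<in> {F a<..F b}" "s \<in> {F a<..F b}" "r \<le> s"
    then have "F a < r" "r \<le> F b" "F a < s" "s \<le> F b" by auto
    then show "q r \<le> q s" using rs(3) L(1)[of s] L(3)[of s] L(4)[of r "q s"] by auto
  qed
  then have qm': "q \<in> borel_measurable (restrict_space lborel {F a<..F b})"
    by (simp cong: measurable_cong_sets add: sets_restrict_space)
  show m: "{y \<in> {F a<..F b}. q y \<in> E} \<in> sets borel"
  proof -
    have "q -` E \<inter> space (restrict_space borel {F a<..F b}) \<in> sets (restrict_space borel {F a<..F b})"
      by (rule measurable_sets[OF qm E(1)])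
    moreover have "q -` E \<inter> space (restrict_space borel {F a<..F b}) = {y \<in> {F a<..F b}. q y \<in> E}"
      by (auto simp: space_restrict_space)
    ultimately show ?thesis by (simp add: sets_restrict_space_iff)
  qed
  have "density (interval_measure F) (indicator {a<..b}) = distr (restrict_space lborel {F a<..F b}) borel q"
  proof (rule measure_eqI_lessThan)
    fix x :: real
    have e1: "emeasure (density (interval_measure F) (indicator {a<..b})) {x<..} = ennreal (if x \<le> b then F b - F (max a x) else 0)"
      if "a \<le> b"
    proof -
      have "emeasure (density (interval_measure F) (indicator {a<..b})) {x<..}
          = (\<integral>\<^sup>+t. indicator {a<..b} t * indicator {x<..} t \<partial>interval_measure F)"
        by (rule emeasure_density) auto
      also have "\<dots> = (\<integral>\<^sup>+t. indicator {max a x<..b} t \<partial>interval_measure F)"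
        by (rule nn_integral_cong) (auto simp: indicator_def)
      also have "\<dots> = emeasure (interval_measure F) {max a x<..b}" by simp
      finally show ?thesis using that emeasure_Ioc[OF F, of "max a x" b] by auto
    qed
    have e2: "emeasure (distr (restrict_space lborel {F a<..F b}) borel q) {x<..} = ennreal (if x \<le> b then F b - F (max a x) else 0)"
      if "a \<le> b"
    proof -
      have "emeasure (distr (restrict_space lborel {F a<..F b}) borel q) {x<..}
        = emeasure lborel (q -` {x<..} \<inter> {F a<..F b})"
        using qm' by (subst emeasure_distr) (auto simp: emeasure_restrict_space space_restrict_space)
      \<comment> \<open>By the Galois connection the inverse exceeds \<open>x\<close> exactly at the
        levels above \<open>F x\<close>; for \<open>x < a\<close> all levels qualify.\<close>
      also have "q -` {x<..} \<inter> {F a<..F b} = (if x \<le> b then {F (max a x)<..F b} else {})"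
      proof (cases "a \<le> x")
        case True
        have "x < q y \<longleftrightarrow> F x < y" if "F a < y" "y \<le> F b" for y
          using L(4)[OF that True] by auto
        moreover have "q y \<le> b" if "F a < y" "y \<le> F b" for y using L(2)[OF that] .
        moreover have "F a \<le> F x" using distribution_functionD(1)[OF F True] .
        ultimately show ?thesis using True by (force simp: max_def)
      next
        case False
        then have "x < q y" if "F a < y" "y \<le> F b" for y
          using L(1)[OF that] by auto
        then show ?thesis using False that by (auto simp: max_def)
      qed
      finally show ?thesis using distribution_functionD(1)[OF F, of "max a x" b] that by auto
    qed
    have e3: "a > b \<Longrightarrow> {F a<..F b} = {} \<and> {a<..b} = {}" using distribution_functionD(1)[OF F, of b a] by auto
    have z: "emeasure (density (interval_measure F) (indicator {a<..b})) {x<..} = 0"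
      "emeasure (distr (restrict_space lborel {F a<..F b}) borel q) {x<..} = 0" if "b < a"
      using e3[OF that] qm' by (auto simp: emeasure_density emeasure_distr emeasure_restrict_space space_restrict_space)
    show "emeasure (density (interval_measure F) (indicator {a<..b})) {x<..} < \<infinity>"
      using e1 z by (cases "a \<le> b") auto
    show "emeasure (density (interval_measure F) (indicator {a<..b})) {x<..}
       = emeasure (distr (restrict_space lborel {F a<..F b}) borel q) {x<..}"
      using e1 e2 z by (cases "a \<le> b") auto
  qed auto
  then have "emeasure (density (interval_measure F) (indicator {a<..b})) E
     = emeasure (distr (restrict_space lborel {F a<..F b}) borel q) E" by simp
  moreover have "emeasure (density (interval_measure F) (indicator {a<..b})) E = emeasure (interval_measure F) E"
  proof -
    have "emeasure (density (interval_measure F) (indicator {a<..b})) E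
        = (\<integral>\<^sup>+t. indicator {a<..b} t * indicator E t \<partial>interval_measure F)"
      using E by (intro emeasure_density) auto
    also have "\<dots> = (\<integral>\<^sup>+t. indicator E t \<partial>interval_measure F)"
      using E by (intro nn_integral_cong) (auto simp: indicator_def)
    finally show ?thesis using E by simp
  qed
  moreover have "emeasure (distr (restrict_space lborel {F a<..F b}) borel q) E = emeasure lborel {y \<in> {F a<..F b}. q y \<in> E}"
  proof -
    have "emeasure (distr (restrict_space lborel {F a<..F b}) borel q) E
        = emeasure (restrict_space lborel {F a<..F b}) (q -` E \<inter> {F a<..F b})"
      using qm' E by (subst emeasure_distr) (auto simp: space_restrict_space)
    also have "\<dots> = emeasure lborel (q -` E \<inter> {F a<..F b})"
      by (rule emeasure_restrict_space) auto
    also have "q -` E \<inter> {F a<..F b} = {y \<in> {F a<..F b}. q y \<in> E}" by auto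
    finally show ?thesis .
  qed
  ultimately show "emeasure (interval_measure F) E = emeasure lborel {y \<in> {F a<..F b}. q y \<in> E}" by simp
qed

text \<open>
  Both sides are the Lebesgue measure of the set of levels that are reached in \<open>E\<close>, up to the
  countably many levels at which one of the functions is locally constant.
\<close>

lemma emeasure_eq_on_coincidence_set:
  assumes F: "distribution_function F" and G: "distribution_function G"
    and E: "E \<in> sets borel" "E \<subseteq> {a<..b}" and eq: "\<And>t. t \<in> E \<Longrightarrow> F t = G t"
  shows "emeasure (interval_measure F) E = emeasure (interval_measure G) E"
proof -
  define q where "q H = (\<lambda>y. Inf {t. a \<le> t \<and> y \<le> H t})" for H :: "real \<Rightarrow> real"
  let ?S = "\<lambda>H. {y \<in> {H a<..H b}. q H y \<in> E}"
  have sub: "?S F \<subseteq> ?S G \<union> (insert (G a) (G ` \<rat>))"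
    if F: "distribution_function F" and G: "distribution_function G" and eq: "\<And>t. t \<in> E \<Longrightarrow> F t = G t"
    for F G
  proof
    fix y assume "y \<in> ?S F"
    then have y: "F a < y" "y \<le> F b" "q F y \<in> E" by auto
    have LF: "a < q F y" "q F y \<le> b" "F (q F y) = y"
      using level_inverse[OF F y(1,2)] unfolding q_def by auto
    have Gy: "G (q F y) = y" using eq[OF y(3)] LF by simp
    then have "G a \<le> y" "y \<le> G b"
      using distribution_functionD(1)[OF G, of a "q F y"] distribution_functionD(1)[OF G, of "q F y" b] LF by auto
    show "y \<in> ?S G \<union> (insert (G a) (G ` \<rat>))"
    proof (cases "y = G a")
      case False
      then have ya: "G a < y" using \<open>G a \<le> y\<close> by auto
      have LG: "a < q G y" "q G y \<le> b" "G (q G y) = y" "q G y \<le> q F y"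
        using level_inverse[OF G ya \<open>y \<le> G b\<close>] LF(1) Gy unfolding q_def by auto
      show ?thesis
      proof (cases "q G y = q F y")
        case True then show ?thesis using y ya \<open>y \<le> G b\<close> by auto
      next
        case False
        \<comment> \<open>Between the two hitting times \<open>G\<close> is constant with value
          \<open>y\<close>, so \<open>y\<close> is the value of \<open>G\<close> at a rational
          time.\<close>
        then have "q G y < q F y" using LG by auto
        then obtain r where r: "r \<in> \<rat>" "q G y < r" "r < q F y" using Rats_dense_in_real by blast
        then have "G r = y"
          using distribution_functionD(1)[OF G, of "q G y" r] distribution_functionD(1)[OF G, of r "q F y"] LG Gy by auto
        then show ?thesis using r by auto
      qed
    qed auto
  qed
  have null: "AE y in lborel. y \<notin> insert (G a) (G ` \<rat>)" "AE y in lborel. y \<notin> insert (F a) (F ` \<rat>)"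
    by (intro AE_not_in countable_imp_null_set_lborel; simp add: countable_rat)+
  have "emeasure lborel (?S F) = emeasure lborel (?S G)"
  proof (rule emeasure_eq_AE)
    show "AE y in lborel. y \<in> ?S F \<longleftrightarrow> y \<in> ?S G"
      using null
    proof eventually_elim
      case (elim y)
      then show ?case using sub[OF F G eq] sub[OF G F eq[symmetric]] by blast
    qed
  qed (use emeasure_level_set(1)[OF F E] emeasure_level_set(1)[OF G E] in \<open>auto simp: q_def\<close>)
  then show ?thesis
    using emeasure_level_set(2)[OF F E] emeasure_level_set(2)[OF G E] by (simp add: q_def)
qed

lemma distribution_function_add:
  "distribution_function F \<Longrightarrow> distribution_function G \<Longrightarrow> distribution_function (\<lambda>t. F t + G t)"
  by (auto simp: distribution_function_def mono_def add_mono intro!: continuous_intros)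

lemma emeasure_interval_measure_add:
  assumes F: "distribution_function F" and G: "distribution_function G" and E: "E \<in> sets borel"
  shows "emeasure (interval_measure (\<lambda>t. F t + G t)) E
    = emeasure (interval_measure F) E + emeasure (interval_measure G) E"
proof -
  \<comment> \<open>The sum of the two measures is the second marginal of a kernel over a two-point
    space.\<close>
  define K where "K b = (if b then interval_measure F else interval_measure G)" for b :: bool
  let ?C = "count_space (UNIV :: bool set)"
  have K: "locally_finite_kernel ?C K"
    using emeasure_Ioc_finite[OF F] emeasure_Ioc_finite[OF G] by (auto simp: locally_finite_kernel_def K_def)
  have *: "emeasure (distr (kernel_prod ?C K) borel snd) A = emeasure (interval_measure F) A + emeasure (interval_measure G) A"
    if A: "A \<in> sets borel" for A
  proof -
    have "snd \<in> borel_measurable (kernel_prod ?C K)"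
      using measurable_snd[of ?C borel] by (simp cong: measurable_cong_sets)
    moreover have "space (kernel_prod ?C K) = UNIV"
      using sets_eq_imp_space_eq[OF sets_kernel_prod[of ?C K]] by (simp add: space_pair_measure)
    moreover have "(snd -` A :: (bool \<times> real) set) = UNIV \<times> A" by auto
    ultimately have "emeasure (distr (kernel_prod ?C K) borel snd) A = emeasure (kernel_prod ?C K) (UNIV \<times> A)"
      using A by (simp add: emeasure_distr)
    also have "\<dots> = (\<integral>\<^sup>+b. emeasure (K b) (Pair b -` (UNIV \<times> A)) \<partial>?C)"
      using A by (intro emeasure_kernel_prod[OF K]) auto
    also have "\<dots> = emeasure (K True) A + emeasure (K False) A"
      by (subst nn_integral_count_space_finite) (auto simp: UNIV_bool add.commute)
    finally show ?thesis by (simp add: K_def)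
  qed
  have "distr (kernel_prod ?C K) borel snd = interval_measure (\<lambda>t. F t + G t)"
  proof (rule interval_measure_eqI[OF distribution_function_add[OF F G]])
    fix a b :: real assume "a \<le> b"
    then show "emeasure (distr (kernel_prod ?C K) borel snd) {a<..b} = ennreal (F b + G b - (F a + G a))"
      using distribution_functionD(1)[OF F, of a b] distribution_functionD(1)[OF G, of a b]
      by (subst *) (simp_all add: emeasure_Ioc F G ennreal_plus[symmetric] del: ennreal_plus)
  qed simp
  then show ?thesis using * E by metis
qed

section \<open>The running infimum of a continuous function up to a fixed right end point\<close>

text \<open>The clipping \<open>min s b\<close> extends the future infimum beyond \<open>b\<close>
  by the constant \<open>H b\<close>, so that it is a distribution function on the whole
  line.\<close>

definition running_inf :: "(real \<Rightarrow> real) \<Rightarrow> real \<Rightarrow> real \<Rightarrow> real" where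
  "running_inf H b s = Inf (H ` {min s b..b})"

lemma running_inf_attained:
  assumes "continuous_on UNIV H"
  obtains x where "min s b \<le> x" "x \<le> b" "running_inf H b s = H x" "\<And>y. min s b \<le> y \<Longrightarrow> y \<le> b \<Longrightarrow> H x \<le> H y"
proof -
  have "compact {min s b..b}" "{min s b..b} \<noteq> {}" "continuous_on {min s b..b} H"
    using assms by (auto intro: continuous_on_subset)
  then obtain x where x: "x \<in> {min s b..b}" "\<forall>y\<in>{min s b..b}. H x \<le> H y"
    using continuous_attains_inf by metis
  then have "running_inf H b s = H x" unfolding running_inf_def
    by (intro cInf_eq_minimum) auto
  with x that show ?thesis by auto
qed

lemma running_inf_le:
  assumes "continuous_on UNIV H" "s \<le> y" "y \<le> b"
  shows "running_inf H b s \<le> H y"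
  by (rule running_inf_attained[OF assms(1), of s b]) (use assms in auto)

lemma running_inf_self: "running_inf H b b = H b"
  by (simp add: running_inf_def)

lemma distribution_function_running_inf:
  assumes H: "continuous_on UNIV H"
  shows "distribution_function (running_inf H b)"
  unfolding distribution_function_def
proof
  have mon: "running_inf H b s \<le> running_inf H b t" if "s \<le> t" for s t
  proof -
    obtain x where "min t b \<le> x" "x \<le> b" "running_inf H b t = H x" by (rule running_inf_attained[OF H])
    moreover obtain y where "\<And>z. min s b \<le> z \<Longrightarrow> z \<le> b \<Longrightarrow> H y \<le> H z" "running_inf H b s = H y"
      by (rule running_inf_attained[OF H]) blast
    ultimately show ?thesis using that by auto
  qed
  then show "mono (running_inf H b)" by (rule monoI)
  \<comment> \<open>If the minimum over the longer interval is attained beyond \<open>t\<close>,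
    nothing changes; otherwise it is attained between \<open>s\<close> and \<open>t\<close>, where
    \<open>H\<close> is close to its value at \<open>min t b\<close>.\<close>
  have close: "running_inf H b t \<le> running_inf H b s + e"
    if d: "\<And>x. \<bar>x - r\<bar> < d \<Longrightarrow> \<bar>H x - H r\<bar> < e / 2" and st: "s \<le> t" "\<bar>s - r\<bar> < d" "\<bar>t - r\<bar> < d" and "0 < e" for s t r d e
  proof -
    obtain x where x: "min s b \<le> x" "x \<le> b" "running_inf H b s = H x" by (rule running_inf_attained[OF H])
    show ?thesis
    proof (cases "min t b \<le> x")
      case True
      obtain y where "\<And>z. min t b \<le> z \<Longrightarrow> z \<le> b \<Longrightarrow> H y \<le> H z" "running_inf H b t = H y"
        by (rule running_inf_attained[OF H]) blast
      then show ?thesis using x True \<open>0 < e\<close> by fastforce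
    next
      case False
      then have "x < b" "x < t" "s \<le> x" using x by auto
      then have "\<bar>x - r\<bar> < d" using st by auto
      have mtb: "\<bar>min t b - r\<bar> < d" using st \<open>s \<le> x\<close> \<open>x < b\<close> \<open>x < t\<close> by (auto simp: min_def)
      obtain y where "\<And>z. min t b \<le> z \<Longrightarrow> z \<le> b \<Longrightarrow> H y \<le> H z" "running_inf H b t = H y"
        by (rule running_inf_attained[OF H]) blast
      then have "running_inf H b t \<le> H (min t b)" by auto
      then show ?thesis using d[OF mtb] d[OF \<open>\<bar>x - r\<bar> < d\<close>] x by linarith
    qed
  qed
  show "continuous_on UNIV (running_inf H b)"
    unfolding continuous_on_iff
  proof (intro ballI allI impI)
    fix r e :: real assume "0 < e"
    obtain d where d: "d > 0" "\<And>x. dist x r < d \<Longrightarrow> dist (H x) (H r) < (e / 2) / 2"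
      using H \<open>0 < e\<close> unfolding continuous_on_iff by (metis UNIV_I half_gt_zero)
    then have d': "\<And>x. \<bar>x - r\<bar> < d \<Longrightarrow> \<bar>H x - H r\<bar> < (e / 2) / 2" by (auto simp: dist_real_def)
    have "dist (running_inf H b x) (running_inf H b r) < e" if "dist x r < d" for x
    proof -
      have "running_inf H b x \<le> running_inf H b r + e / 2" if "r \<le> x"
        using close[OF d' that] \<open>dist x r < d\<close> d(1) \<open>0 < e\<close> by (auto simp: dist_real_def)
      moreover have "running_inf H b r \<le> running_inf H b x + e / 2" if "x \<le> r"
        using close[OF d' that] \<open>dist x r < d\<close> d(1) \<open>0 < e\<close> by (auto simp: dist_real_def)
      ultimately show ?thesis using mon[of x r] mon[of r x] \<open>0 < e\<close>
        by (cases "x \<le> r") (auto simp: dist_real_def)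
    qed
    then show "\<exists>d>0. \<forall>x\<in>UNIV. dist x r < d \<longrightarrow> dist (running_inf H b x) (running_inf H b r) < e"
      using d(1) by blast
  qed
qed

text \<open>On \<open>E\<close> the function \<open>F\<close> coincides with the sum of
  \<open>G\<close> and the running infimum. Both are distribution functions, so they give
  \<open>E\<close> the same measure.\<close>

lemma emeasure_running_inf_coincidence:
  assumes F: "distribution_function F" and G: "distribution_function G"
    and E: "E \<in> sets borel" "E \<subseteq> {a<..b}" "\<And>t. t \<in> E \<Longrightarrow> running_inf (\<lambda>t. F t - G t) b t = F t - G t"
  shows "emeasure (interval_measure F) E = emeasure (interval_measure G) E
    + emeasure (interval_measure (running_inf (\<lambda>t. F t - G t) b)) E"
proof -
  have m: "distribution_function (running_inf (\<lambda>t. F t - G t) b)"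
    by (intro distribution_function_running_inf continuous_intros distribution_functionD(2) F G)
  have "emeasure (interval_measure F) E = emeasure (interval_measure (\<lambda>t. G t + running_inf (\<lambda>t. F t - G t) b t)) E"
    using E by (intro emeasure_eq_on_coincidence_set[OF F distribution_function_add[OF G m] E(1,2)]) auto
  then show ?thesis using emeasure_interval_measure_add[OF G m E(1)] by simp
qed

lemma emeasure_level_set_null:
  assumes F: "distribution_function F" and E: "E \<in> sets borel" "E \<subseteq> {a<..b}" "\<And>t. t \<in> E \<Longrightarrow> F t = c"
  shows "emeasure (interval_measure F) E = 0"
proof -
  have c: "distribution_function (\<lambda>_. c)" by (auto simp: distribution_function_def mono_def)
  have "emeasure (interval_measure F) E = emeasure (interval_measure (\<lambda>_. c)) E"
    using E by (intro emeasure_eq_on_coincidence_set[OF F c E(1,2)]) auto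
  also have "\<dots> \<le> emeasure (interval_measure (\<lambda>_. c)) {a<..b}" using E by (intro emeasure_mono) auto
  also have "\<dots> = 0" using emeasure_Ioc[OF c, of a b] by (cases "a \<le> b") auto
  finally show ?thesis by simp
qed

section \<open>Mutually singular pairs and the mass of points without return\<close>

locale singular_pair =
  fixes F G :: "real \<Rightarrow> real" and A :: "real set"
  assumes F: "distribution_function F" and G: "distribution_function G"
    and A: "A \<in> sets borel" and FA: "emeasure (interval_measure F) (- A) = 0"
    and GA: "emeasure (interval_measure G) A = 0"
begin

abbreviation H :: "real \<Rightarrow> real" where "H t \<equiv> F t - G t"

lemma continuous_H: "continuous_on S H"
  by (intro continuous_intros distribution_functionD(2) F G)

lemma F_restrict: "E \<in> sets borel \<Longrightarrow> emeasure (interval_measure F) (E \<inter> A) = emeasure (interval_measure F) E"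
proof (rule emeasure_eq_AE)
  have "AE t in interval_measure F. t \<notin> - A"
    using FA A by (intro AE_not_in) (auto simp: null_sets_def)
  then show "AE t in interval_measure F. t \<in> E \<inter> A \<longleftrightarrow> t \<in> E" by eventually_elim auto
qed (use A in auto)

lemma F_diff: "E \<in> sets borel \<Longrightarrow> emeasure (interval_measure F) (E - A) = 0"
  using emeasure_mono[of "E - A" "- A" "interval_measure F"] FA A by auto

lemma G_Int: "E \<in> sets borel \<Longrightarrow> emeasure (interval_measure G) (E \<inter> A) = 0"
  using emeasure_mono[of "E \<inter> A" "A" "interval_measure G"] GA A by auto

text \<open>
  The increase of the running infimum is carried by \<open>F\<close> alone, because \<open>F\<close> and \<open>G\<close> are
  mutually singular.
\<close>

lemma emeasure_future_strict_minima:
  assumes ab: "a \<le> b"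
    and N: "N \<in> sets borel" "N = {s \<in> {a<..b}. \<forall>t\<in>{s<..b}. H t \<noteq> H s}"
  shows "emeasure (interval_measure F) N = ennreal (H b - running_inf H b a)"
proof -
  define m where "m = running_inf H b"
  have m: "distribution_function m"
    unfolding m_def by (intro distribution_function_running_inf continuous_H)
  \<comment> \<open>At the points of \<open>Z\<close> the function \<open>H\<close> attains its
    minimum over the rest of the interval; at those of \<open>S q\<close> the running infimum stays
    flat up to \<open>q\<close>.\<close>
  define Z where "Z = {s \<in> {a<..b}. m s = H s}"
  define S where "S q = {s \<in> {a<..b}. s < q \<and> m s = m q}" for q
  have [measurable]: "m \<in> borel_measurable borel" "F \<in> borel_measurable borel" "G \<in> borel_measurable borel"
    using m F G by (auto intro!: borel_measurable_continuous_onI distribution_functionD(2))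
  have Zb[measurable]: "Z \<in> sets borel" unfolding Z_def by measurable
  have Sb[measurable]: "S q \<in> sets borel" for q unfolding S_def by measurable
  have S0: "emeasure (interval_measure m) (S q) = 0" for q
    by (rule emeasure_level_set_null[OF m Sb, where c="m q"]) (auto simp: S_def)
  have Zeq: "emeasure (interval_measure F) E = emeasure (interval_measure G) E + emeasure (interval_measure m) E"
    if "E \<in> sets borel" "E \<subseteq> Z" for E
    unfolding m_def using that
    by (intro emeasure_running_inf_coincidence[OF F G, where a=a]) (auto simp: Z_def m_def)
  \<comment> \<open>On \<open>Z\<close> the measure of \<open>F\<close> splits into those of
    \<open>G\<close> and \<open>m\<close>; inside \<open>A\<close> the part of \<open>G\<close>
    vanishes, and \<open>m\<close> does not charge its flat pieces.\<close>
  have ZSnull: "emeasure (interval_measure F) (Z \<inter> S q) = 0" for q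
  proof -
    have "emeasure (interval_measure F) (Z \<inter> S q) = emeasure (interval_measure F) (Z \<inter> S q \<inter> A)"
      by (simp add: F_restrict)
    also have "\<dots> = emeasure (interval_measure m) (Z \<inter> S q \<inter> A)"
      using A by (subst Zeq) (auto simp: G_Int)
    also have "\<dots> \<le> emeasure (interval_measure m) (S q)" by (intro emeasure_mono) auto
    finally show ?thesis using S0 by simp
  qed
  \<comment> \<open>The same construction for the negative of \<open>H\<close> detects the points
    where \<open>H\<close> attains its future maximum. There the roles of \<open>F\<close> and
    \<open>G\<close> are exchanged: \<open>G\<close> dominates \<open>F\<close>, and since
    \<open>G\<close> vanishes on \<open>A\<close>, so does \<open>F\<close>.\<close>
  define m' where "m' = running_inf (\<lambda>t. G t - F t) b"
  have m': "distribution_function m'"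
    unfolding m'_def by (intro distribution_function_running_inf continuous_intros distribution_functionD(2) F G)
  have [measurable]: "m' \<in> borel_measurable borel"
    using m' by (auto intro!: borel_measurable_continuous_onI distribution_functionD(2))
  define Z' where "Z' = {s \<in> {a<..b}. m' s = G s - F s}"
  have Z'b[measurable]: "Z' \<in> sets borel" unfolding Z'_def by measurable
  have Z'null: "emeasure (interval_measure F) Z' = 0"
  proof -
    have "emeasure (interval_measure G) (Z' \<inter> A) = emeasure (interval_measure F) (Z' \<inter> A) + emeasure (interval_measure m') (Z' \<inter> A)"
      unfolding m'_def using A Z'b
      by (intro emeasure_running_inf_coincidence[OF G F, where a=a] sets.Int) (auto simp: Z'_def m'_def)
    then have "emeasure (interval_measure F) (Z' \<inter> A) = 0" using G_Int[OF Z'b] by simp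
    then show ?thesis using F_restrict[OF Z'b] by simp
  qed
  have flat: "\<exists>q\<in>\<rat>. s \<in> S q" if "s \<in> {a<..b}" "s < t" "m t \<le> m s" for s t
  proof -
    obtain q where q: "q \<in> \<rat>" "s < q" "q < t" using Rats_dense_in_real \<open>s < t\<close> by blast
    then have "m s \<le> m q" "m q \<le> m t" using distribution_functionD(1)[OF m] by auto
    then show ?thesis using q that by (intro bexI[of _ q]) (auto simp: S_def)
  qed
  \<comment> \<open>Without a return, the intermediate value theorem keeps \<open>H\<close> on one
    side of its level, so the point is a future minimum or a future maximum.\<close>
  have NZ: "s \<in> Z' \<union> Z" if "s \<in> N" for s
  proof -
    have s: "s \<in> {a<..b}" and ne: "\<And>t. s < t \<Longrightarrow> t \<le> b \<Longrightarrow> H t \<noteq> H s" using that N by auto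
    have "(\<forall>t\<in>{s..b}. H s \<le> H t) \<or> (\<forall>t\<in>{s..b}. H t \<le> H s)"
    proof (rule ccontr)
      assume "\<not> ?thesis"
      then obtain t u where tu: "t \<in> {s..b}" "u \<in> {s..b}" "H t < H s" "H s < H u" by force
      then have tu': "t \<noteq> s" "u \<noteq> s" by auto
      obtain x where "min t u \<le> x" "x \<le> max t u" "H x = H s"
      proof (cases "t \<le> u")
        case True then show ?thesis using IVT'[of H t "H s" u] tu continuous_H that by auto
      next
        case False then show ?thesis using IVT2'[of H t "H s" u] tu continuous_H that by auto
      qed
      then show False using ne[of x] tu tu' by (auto simp: min_def max_def split: if_splits)
    qed
    then show ?thesis
    proof
      assume *: "\<forall>t\<in>{s..b}. H s \<le> H t"
      have "m s = H s" unfolding m_def running_inf_def using * s by (intro cInf_eq_minimum) auto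
      then show ?thesis using s by (auto simp: Z_def)
    next
      assume *: "\<forall>t\<in>{s..b}. H t \<le> H s"
      have "m' s = G s - F s" unfolding m'_def running_inf_def using * s by (intro cInf_eq_minimum) force+
      then show ?thesis using s by (auto simp: Z'_def)
    qed
  qed
  \<comment> \<open>A future minimum whose value is taken again lies on a flat piece of the running
    infimum.\<close>
  have ZN: "s \<in> N \<or> (\<exists>q\<in>\<rat>. s \<in> S q)" if "s \<in> Z" for s
  proof (rule disjCI)
    assume "\<not> (\<exists>q\<in>\<rat>. s \<in> S q)"
    note nf = this
    have s: "s \<in> {a<..b}" "m s = H s" using that by (auto simp: Z_def)
    have "H t \<noteq> H s" if t: "t \<in> {s<..b}" for t
    proof
      assume "H t = H s"
      moreover have "m t \<le> H t" unfolding m_def using t by (intro running_inf_le continuous_H) auto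
      ultimately have "m t \<le> m s" using s by simp
      then show False using flat[of s t] nf t s by auto
    qed
    then show "s \<in> N" using s N by auto
  qed
  have "emeasure (interval_measure F) N = emeasure (interval_measure F) Z"
  proof (rule emeasure_eq_AE)
    have "AE s in interval_measure F. s \<notin> Z'"
      using Z'null by (intro AE_not_in) (auto simp: null_sets_def)
    moreover have "AE s in interval_measure F. \<forall>q\<in>\<rat>. s \<notin> Z \<inter> S q"
      using ZSnull by (intro AE_ball_countable[THEN iffD2] ballI AE_not_in) (auto simp: null_sets_def countable_rat)
    ultimately show "AE s in interval_measure F. s \<in> N \<longleftrightarrow> s \<in> Z"
    proof eventually_elim
      case (elim s)
      then show ?case using NZ ZN by blast
    qed
  qed (use N in auto)
  also have "\<dots> = emeasure (interval_measure F) (Z \<inter> A)" by (simp add: F_restrict)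
  also have "\<dots> = emeasure (interval_measure m) (Z \<inter> A)" using A by (subst Zeq) (auto simp: G_Int)
  \<comment> \<open>Off \<open>Z\<close> the running infimum is flat. On \<open>Z - A\<close> the
    decomposition valid on \<open>Z\<close> bounds \<open>m\<close> by \<open>F\<close>, which has
    no mass there.\<close>
  also have "\<dots> = emeasure (interval_measure m) {a<..b}"
  proof (rule emeasure_eq_AE)
    have "emeasure (interval_measure m) (Z - A) = 0" using Zeq[of "Z - A"] A F_diff[OF Zb] by simp
    then have "AE s in interval_measure m. s \<notin> Z - A" using A by (intro AE_not_in) (auto simp: null_sets_def)
    moreover have "AE s in interval_measure m. \<forall>q\<in>\<rat>. s \<notin> S q"
      using S0 by (intro AE_ball_countable[THEN iffD2] ballI AE_not_in) (auto simp: null_sets_def countable_rat)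
    ultimately show "AE s in interval_measure m. s \<in> Z \<inter> A \<longleftrightarrow> s \<in> {a<..b}"
    proof eventually_elim
      case (elim s)
      have "s \<in> Z" if s: "s \<in> {a<..b}"
      proof (rule ccontr)
        assume "s \<notin> Z"
        obtain x where x: "min s b \<le> x" "x \<le> b" "m s = H x"
          unfolding m_def by (rule running_inf_attained[OF continuous_H])
        with \<open>s \<notin> Z\<close> s have "s < x" by (cases "s = x") (auto simp: Z_def)
        moreover have "m x \<le> m s" using running_inf_le[OF continuous_H, of x x b] x by (simp add: m_def)
        ultimately show False using flat[OF s] elim by blast
      qed
      then show ?case using elim by (auto simp: Z_def)
    qed
  qed (use A in auto)
  also have "\<dots> = ennreal (m b - m a)" by (rule emeasure_Ioc[OF m ab])
  finally show ?thesis by (simp add: m_def running_inf_self)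
qed

end

section \<open>Return times and the mass matched with a window\<close>

definition return_time :: "(real \<Rightarrow> real) \<Rightarrow> real \<Rightarrow> ereal" where
  "return_time H s = Inf {ereal t | t. s < t \<and> H t = H s}"

lemma return_time_ge: "ereal s \<le> return_time H s"
  unfolding return_time_def by (intro Inf_greatest) auto

text \<open>The level set is closed, so an infimum of at most \<open>d\<close> comes with a return
  in (s,d]. Strictness of \<open>s < d\<close> matters: returns may accumulate at \<open>s\<close>,
  in which case the infimum is \<open>s\<close> itself and is not attained.\<close>

lemma return_time_le_iff:
  assumes H: "continuous_on UNIV H" and "s < d"
  shows "return_time H s \<le> ereal d \<longleftrightarrow> (\<exists>t\<in>{s<..d}. H t = H s)"
proof
  assume "\<exists>t\<in>{s<..d}. H t = H s"
  then obtain t where "s < t" "t \<le> d" "H t = H s" by auto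
  then have "return_time H s \<le> ereal t" unfolding return_time_def by (intro Inf_lower) auto
  then show "return_time H s \<le> ereal d" using \<open>t \<le> d\<close> by (meson ereal_less_eq(3) order_trans)
next
  assume le: "return_time H s \<le> ereal d"
  show "\<exists>t\<in>{s<..d}. H t = H s"
  proof (rule ccontr)
    assume no: "\<not> ?thesis"
    then have "H d \<noteq> H s" using \<open>s < d\<close> by auto
    moreover have "open {t. H t \<noteq> H s}" using H by (intro open_Collect_neq continuous_intros)
    ultimately obtain e where e: "e > 0" "\<And>t. dist t d < e \<Longrightarrow> H t \<noteq> H s"
      unfolding open_dist by blast
    have "ereal (d + e) \<le> return_time H s"
      unfolding return_time_def
    proof (rule Inf_greatest)
      fix z assume "z \<in> {ereal t | t. s < t \<and> H t = H s}"
      then obtain t where t: "z = ereal t" "s < t" "H t = H s" by auto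
      then have "d < t" using no by force
      moreover have "\<not> dist t d < e" using e t by auto
      ultimately show "ereal (d + e) \<le> z" using t by (auto simp: dist_real_def)
    qed
    then have "ereal (d + e) \<le> ereal d" using le by (rule order_trans)
    then show False using e by simp
  qed
qed

context singular_pair
begin

text \<open>Up to the single point \<open>b\<close>, the points of (a,b] that return by time
  \<open>b\<close> are the complement of the points without return, whose mass is known. The window
  (c,d] is the difference of the cases \<open>b = d\<close> and \<open>b = c\<close>.\<close>

lemma emeasure_matched_window:
  assumes M[measurable]: "(\<lambda>s. return_time H s) \<in> borel_measurable borel" and "a \<le> c" "c \<le> d"
  shows "emeasure (interval_measure F) {s. a < s \<and> ereal c < return_time H s \<and> return_time H s \<le> ereal d}
    = ennreal (G d - G c - (running_inf H c a - running_inf H d a))"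
proof -
  define D where "D b = {s \<in> {a<..b}. return_time H s \<le> ereal b}" for b
  have [measurable]: "D b \<in> sets borel" for b unfolding D_def by measurable
  define N where "N b = {s \<in> {a<..b}. \<forall>t\<in>{s<..b}. H t \<noteq> H s}" for b
  have N: "N b = insert b {s \<in> {a<..b}. \<not> return_time H s \<le> ereal b} \<inter> {a<..b}" for b
  proof -
    have "(\<forall>t\<in>{s<..b}. H t \<noteq> H s) \<longleftrightarrow> s = b \<or> \<not> return_time H s \<le> ereal b" if "s \<in> {a<..b}" for s
      using that return_time_le_iff[OF continuous_H, of s b] by (cases "s = b") auto
    then show ?thesis unfolding N_def by blast
  qed
  have Nb[measurable]: "N b \<in> sets borel" for b unfolding N by measurable
  have eD: "emeasure (interval_measure F) (D b) = ennreal (F b - F a - (H b - running_inf H b a))"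
    and le: "H b - running_inf H b a \<le> F b - F a" and ge: "0 \<le> H b - running_inf H b a" if "a \<le> b" for b
  proof -
    have eN: "emeasure (interval_measure F) (N b) = ennreal (H b - running_inf H b a)"
      using that by (intro emeasure_future_strict_minima Nb N_def)
    show g: "0 \<le> H b - running_inf H b a" using running_inf_le[OF continuous_H, of a b b] that by simp
    have "emeasure (interval_measure F) (N b) \<le> emeasure (interval_measure F) {a<..b}"
      by (intro emeasure_mono) (auto simp: N_def)
    then have "ennreal (H b - running_inf H b a) \<le> ennreal (F b - F a)"
      using eN emeasure_Ioc[OF F that] by simp
    then show "H b - running_inf H b a \<le> F b - F a"
      using distribution_functionD(1)[OF F that] by (simp add: ennreal_le_iff)
    have "emeasure (interval_measure F) (D b) = emeasure (interval_measure F) ({a<..b} - N b)"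
    proof (rule emeasure_eq_AE)
      have "AE s in interval_measure F. s \<noteq> b"
        using emeasure_point[OF F, of b] AE_not_in[of "{b}" "interval_measure F"] by (auto simp: null_sets_def)
      then show "AE s in interval_measure F. s \<in> D b \<longleftrightarrow> s \<in> {a<..b} - N b"
        unfolding N D_def by eventually_elim auto
    qed auto
    also have "\<dots> = emeasure (interval_measure F) {a<..b} - emeasure (interval_measure F) (N b)"
      using eN by (intro emeasure_Diff) (simp_all, auto simp: N_def)
    also have "\<dots> = ennreal (F b - F a - (H b - running_inf H b a))"
      using eN emeasure_Ioc[OF F that] g by (simp add: ennreal_minus)
    finally show "emeasure (interval_measure F) (D b) = ennreal (F b - F a - (H b - running_inf H b a))" .
  qed
  have sub: "D c \<subseteq> D d"
    unfolding D_def using \<open>c \<le> d\<close> by (auto intro: order_trans[of _ "ereal c"])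
  have "{s. a < s \<and> ereal c < return_time H s \<and> return_time H s \<le> ereal d} = D d - D c"
  proof -
    have "s \<le> d" if "return_time H s \<le> ereal d" for s
      using return_time_ge[of s H] that by (meson ereal_less_eq(3) order_trans)
    moreover have "ereal c < return_time H s" if "c < s" for s
      using return_time_ge[of s H] that by (meson ereal_less(2) less_ereal.simps(1) less_le_trans)
    ultimately show ?thesis unfolding D_def by (auto simp: not_le)
  qed
  then have "emeasure (interval_measure F) {s. a < s \<and> ereal c < return_time H s \<and> return_time H s \<le> ereal d}
     = emeasure (interval_measure F) (D d) - emeasure (interval_measure F) (D c)"
    using sub eD[OF \<open>a \<le> c\<close>] by (simp add: emeasure_Diff)
  also have "\<dots> = ennreal ((F d - F a - (H d - running_inf H d a)) - (F c - F a - (H c - running_inf H c a)))"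
    using le[OF \<open>a \<le> c\<close>] eD[of c] eD[of d] \<open>a \<le> c\<close> \<open>c \<le> d\<close> by (simp add: ennreal_minus)
  finally show ?thesis by (simp add: algebra_simps)
qed

lemma incseq_matched:
  "(\<Union>n. {s. -real n < s \<and> ereal c < return_time H s \<and> return_time H s \<le> ereal d})
    = {s. ereal c < return_time H s \<and> return_time H s \<le> ereal d}"
proof -
  have "\<exists>n. -real n < s" for s
    using reals_Archimedean2[of "-s"] by (auto simp: minus_less_iff)
  then show ?thesis by auto
qed

text \<open>Moving \<open>a\<close> to minus infinity removes the lower cut. The correction by the
  two running infima has a favourable sign, because the infimum up to \<open>d\<close> is taken over
  the longer interval.\<close>

lemma emeasure_matched_le:
  assumes M[measurable]: "(\<lambda>s. return_time H s) \<in> borel_measurable borel" and "c \<le> d"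
  shows "emeasure (interval_measure F) {s. ereal c < return_time H s \<and> return_time H s \<le> ereal d}
    \<le> ennreal (G d - G c)"
proof -
  let ?E = "\<lambda>n::nat. {s. -real n < s \<and> ereal c < return_time H s \<and> return_time H s \<le> ereal d}"
  have "(\<lambda>n. emeasure (interval_measure F) (?E n)) \<longlonglongrightarrow> emeasure (interval_measure F) (\<Union>n. ?E n)"
    by (rule Lim_emeasure_incseq) (auto simp: incseq_def)
  moreover have "\<exists>N. \<forall>n\<ge>N. emeasure (interval_measure F) (?E n) \<le> ennreal (G d - G c)"
  proof -
    obtain N :: nat where N: "- c < real N" using reals_Archimedean2 by blast
    have "emeasure (interval_measure F) (?E n) \<le> ennreal (G d - G c)" if "N \<le> n" for n
    proof -
      have nc: "-real n \<le> c" using N that by (simp add: order_trans minus_le_iff)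
      obtain x where "min (-real n) c \<le> x" "x \<le> c" "running_inf H c (-real n) = H x"
        by (rule running_inf_attained[OF continuous_H])
      then have "running_inf H d (-real n) \<le> running_inf H c (-real n)"
        using running_inf_le[OF continuous_H, of "-real n" x d] nc \<open>c \<le> d\<close> by auto
      then show ?thesis using emeasure_matched_window[OF M nc \<open>c \<le> d\<close>] by (auto intro: ennreal_leI)
    qed
    then show ?thesis by blast
  qed
  ultimately show ?thesis unfolding incseq_matched using LIMSEQ_le_const2 by blast
qed

text \<open>If \<open>H\<close> has no lower bound in the past, then for \<open>a\<close> far to the
  left the infimum up to \<open>d\<close> is attained before \<open>c\<close>, and the two running
  infima in the window formula cancel.\<close>

lemma emeasure_matched_eq:
  assumes M[measurable]: "(\<lambda>s. return_time H s) \<in> borel_measurable borel" and "c \<le> d"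
    and unb: "\<And>B. \<exists>a\<le>c. H a < B"
  shows "emeasure (interval_measure F) {s. ereal c < return_time H s \<and> return_time H s \<le> ereal d}
    = ennreal (G d - G c)"
proof -
  let ?E = "\<lambda>n::nat. {s. -real n < s \<and> ereal c < return_time H s \<and> return_time H s \<le> ereal d}"
  have "(\<lambda>n. emeasure (interval_measure F) (?E n)) \<longlonglongrightarrow> emeasure (interval_measure F) (\<Union>n. ?E n)"
    by (rule Lim_emeasure_incseq) (auto simp: incseq_def)
  moreover have "\<forall>\<^sub>F n in sequentially. emeasure (interval_measure F) (?E n) = ennreal (G d - G c)"
  proof -
    obtain a where a: "a \<le> c" "H a < running_inf H d c" using unb by blast
    obtain N :: nat where N: "- a < real N" using reals_Archimedean2 by blast
    have "emeasure (interval_measure F) (?E n) = ennreal (G d - G c)" if "N \<le> n" for n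
    proof -
      have na: "-real n \<le> a" using N that by (simp add: order_trans minus_le_iff)
      obtain x where x: "min (-real n) c \<le> x" "x \<le> c" "running_inf H c (-real n) = H x"
        by (rule running_inf_attained[OF continuous_H])
      obtain y where y: "min (-real n) d \<le> y" "y \<le> d" "running_inf H d (-real n) = H y"
        "\<And>z. min (-real n) d \<le> z \<Longrightarrow> z \<le> d \<Longrightarrow> H y \<le> H z"
        using running_inf_attained[OF continuous_H] by blast
      have "y < c"
      proof (rule ccontr)
        assume "\<not> y < c"
        then have "running_inf H d c \<le> H y" using running_inf_le[OF continuous_H, of c y d] y by auto
        then show False using y(4)[of a] a na \<open>c \<le> d\<close> by auto
      qed
      then have "running_inf H c (-real n) \<le> H y"
        using running_inf_le[OF continuous_H, of "-real n" y c] y na a \<open>c \<le> d\<close> by auto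
      moreover have "H y \<le> H x" using x y(4)[of x] na a \<open>c \<le> d\<close> by auto
      ultimately have "running_inf H d (-real n) = running_inf H c (-real n)" using x y by auto
      then show ?thesis using emeasure_matched_window[OF M _ \<open>c \<le> d\<close>, of "-real n"] na a by simp
    qed
    then show ?thesis by (auto simp: eventually_sequentially)
  qed
  ultimately show ?thesis unfolding incseq_matched
    using LIMSEQ_unique[OF _ tendsto_eventually] by blast
qed

lemma emeasure_unmatched_le:
  assumes M[measurable]: "(\<lambda>s. return_time H s) \<in> borel_measurable borel" and "a \<le> b"
  shows "emeasure (interval_measure F) {s \<in> {a<..b}. return_time H s = \<infinity>}
    \<le> ennreal (H b - running_inf H b a)"
proof -
  define N where "N = {s \<in> {a<..b}. \<forall>t\<in>{s<..b}. H t \<noteq> H s}"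
  have Neq: "N = insert b {s \<in> {a<..b}. \<not> return_time H s \<le> ereal b} \<inter> {a<..b}"
  proof -
    have "(\<forall>t\<in>{s<..b}. H t \<noteq> H s) \<longleftrightarrow> s = b \<or> \<not> return_time H s \<le> ereal b" if "s \<in> {a<..b}" for s
      using that return_time_le_iff[OF continuous_H, of s b] by (cases "s = b") auto
    then show ?thesis unfolding N_def by blast
  qed
  have Nb[measurable]: "N \<in> sets borel" unfolding Neq by measurable
  have "emeasure (interval_measure F) {s \<in> {a<..b}. return_time H s = \<infinity>} \<le> emeasure (interval_measure F) N"
    by (intro emeasure_mono) (auto simp: Neq)
  also have "\<dots> = ennreal (H b - running_inf H b a)"
    by (rule emeasure_future_strict_minima[OF \<open>a \<le> b\<close> Nb N_def])
  finally show ?thesis .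
qed

text \<open>The unmatched mass of (a,b] is at most \<open>H b\<close> minus the minimum of
  \<open>H\<close> over [a,b]. If \<open>H\<close> is bounded below after \<open>a\<close>, this is
  bounded in \<open>b\<close>; if not, there are arbitrarily late times \<open>b\<close> at which
  \<open>H\<close> attains a new minimum, and the bound is zero.\<close>

lemma unmatched_finite:
  assumes M[measurable]: "(\<lambda>s. return_time H s) \<in> borel_measurable borel"
    and bdd: "\<And>t. a \<le> t \<Longrightarrow> H t \<le> B"
  shows "emeasure (interval_measure F) {s. a < s \<and> return_time H s = \<infinity>} < \<infinity>"
proof -
  let ?E = "\<lambda>n::nat. {s \<in> {a<..a + real n}. return_time H s = \<infinity>}"
  have "s \<le> a + real (nat \<lceil>s - a\<rceil>)" for s by linarith
  then have U: "(\<Union>n. ?E n) = {s. a < s \<and> return_time H s = \<infinity>}" by auto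
  have lim: "(\<lambda>n. emeasure (interval_measure F) (?E n)) \<longlonglongrightarrow> emeasure (interval_measure F) (\<Union>n. ?E n)"
    by (rule Lim_emeasure_incseq) (auto simp: incseq_def)
  show ?thesis
  proof (cases "\<exists>C. \<forall>t\<ge>a. C \<le> H t")
    case True
    then obtain C where C: "\<And>t. a \<le> t \<Longrightarrow> C \<le> H t" by auto
    have "emeasure (interval_measure F) (?E n) \<le> ennreal (B - C)" for n
    proof -
      obtain x where "min a (a + real n) \<le> x" "running_inf H (a + real n) a = H x"
        by (rule running_inf_attained[OF continuous_H])
      then have "C \<le> running_inf H (a + real n) a" using C by (auto simp: min_def)
      moreover have "H (a + real n) \<le> B" by (rule bdd) simp
      ultimately show ?thesis
        by (intro order_trans[OF emeasure_unmatched_le[OF M]] ennreal_leI) auto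
    qed
    then have "emeasure (interval_measure F) (\<Union>n. ?E n) \<le> ennreal (B - C)"
      using LIMSEQ_le_const2[OF lim] by blast
    then show ?thesis unfolding U by (auto simp: less_top[symmetric] top_unique)
  next
    case False
    have "emeasure (interval_measure F) (?E n) = 0" for n
    proof -
      \<comment> \<open>Going below the minimum over [a,a+n] forces the minimizer up to time
        \<open>u\<close> to lie beyond \<open>a + n\<close>.\<close>
      define B' where "B' = running_inf H (a + real n) a"
      obtain u where u: "u \<ge> a" "H u < B'" using False by (meson not_le)
      obtain y where y: "min a u \<le> y" "y \<le> u" "\<And>z. min a u \<le> z \<Longrightarrow> z \<le> u \<Longrightarrow> H y \<le> H z" "running_inf H u a = H y"
        using running_inf_attained[OF continuous_H] by blast
      have "running_inf H y a = H y"
        using y u by (subst running_inf_def, intro cInf_eq_minimum) auto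
      moreover have "a + real n < y"
      proof (rule ccontr)
        assume "\<not> a + real n < y"
        then have "B' \<le> H y" unfolding B'_def using y u by (intro running_inf_le[OF continuous_H]) auto
        then show False using y(3)[of u] u by auto
      qed
      ultimately have "emeasure (interval_measure F) {s \<in> {a<..y}. return_time H s = \<infinity>} = 0"
        using emeasure_unmatched_le[OF M, of a y] y u by simp
      moreover have "emeasure (interval_measure F) (?E n) \<le> emeasure (interval_measure F) {s \<in> {a<..y}. return_time H s = \<infinity>}"
        using \<open>a + real n < y\<close> by (intro emeasure_mono) auto
      ultimately show ?thesis by simp
    qed
    then have "emeasure (interval_measure F) (\<Union>n. ?E n) = 0"
      using lim LIMSEQ_unique[of "\<lambda>_. 0::ennreal"] by auto
    then show ?thesis unfolding U by simp
  qed
qed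

end

section \<open>Path space and Wiener measure\<close>

lemma space_path_space[simp]: "space path_space = {w. continuous_on UNIV w}"
  by (auto simp: path_space_def space_restrict_space space_PiM)

lemma measurable_path_spaceI:
  assumes "\<And>x. x \<in> space M \<Longrightarrow> continuous_on UNIV (f x)" and "\<And>t. (\<lambda>x. f x t) \<in> borel_measurable M"
  shows "f \<in> measurable M path_space"
  unfolding path_space_def
proof (rule measurable_restrict_space2)
  have "(\<lambda>x t. f x t) \<in> measurable M (PiM UNIV (\<lambda>_. borel))"
    by (rule measurable_PiM_single') (use assms in auto)
  then show "f \<in> measurable M (PiM UNIV (\<lambda>_. borel))" by simp
qed (use assms in auto)

lemma eval_measurable[measurable]: "(\<lambda>w. w t) \<in> borel_measurable path_space"
  unfolding path_space_def by (intro measurable_restrict_space1 measurable_component_singleton) auto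

text \<open>By continuity the value at a random time is the limit of the values at its
  approximations on grids of mesh 1/(i+1), each of which involves only countably many
  coordinates.\<close>

lemma measurable_path_space_eval:
  assumes f: "f \<in> measurable M path_space" and g: "g \<in> borel_measurable M"
  shows "(\<lambda>x. f x (g x)) \<in> borel_measurable M"
proof -
  define u where "u i x = f x (real_of_int \<lfloor>g x * real (Suc i)\<rfloor> / real (Suc i))" for i x
  have "u i \<in> borel_measurable M" for i
    unfolding u_def
  proof (rule measurable_compose_countable[where f="\<lambda>k x. f x (real_of_int k / real (Suc i))" and g="\<lambda>x. \<lfloor>g x * real (Suc i)\<rfloor>"])
    show "(\<lambda>x. f x (real_of_int k / real (Suc i))) \<in> borel_measurable M" for k
      using measurable_compose[OF f eval_measurable] .
    show "(\<lambda>x. \<lfloor>g x * real (Suc i)\<rfloor>) \<in> measurable M (count_space UNIV)" using g by measurable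
  qed
  moreover have "(\<lambda>i. u i x) \<longlonglongrightarrow> f x (g x)" if "x \<in> space M" for x
  proof -
    have "continuous_on UNIV (f x)" using measurable_space[OF f that] by simp
    moreover have "(\<lambda>i. real_of_int \<lfloor>g x * real (Suc i)\<rfloor> / real (Suc i)) \<longlonglongrightarrow> g x"
    proof (rule real_tendsto_sandwich[of "\<lambda>i. g x - 1 / real (Suc i)" _ _ "\<lambda>_. g x"])
      show "(\<lambda>i. g x - 1 / real (Suc i)) \<longlonglongrightarrow> g x"
        using tendsto_diff[OF tendsto_const[of "g x"] LIMSEQ_Suc[OF lim_1_over_n]] by simp
      show "\<forall>\<^sub>F i in sequentially. g x - 1 / real (Suc i) \<le> real_of_int \<lfloor>g x * real (Suc i)\<rfloor> / real (Suc i)"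
      proof (rule always_eventually, rule allI)
        fix i
        have "g x * real (Suc i) - 1 \<le> real_of_int \<lfloor>g x * real (Suc i)\<rfloor>" by linarith
        then have "(g x * real (Suc i) - 1) / real (Suc i) \<le> real_of_int \<lfloor>g x * real (Suc i)\<rfloor> / real (Suc i)"
          by (intro divide_right_mono) auto
        then show "g x - 1 / real (Suc i) \<le> real_of_int \<lfloor>g x * real (Suc i)\<rfloor> / real (Suc i)"
          by (simp add: diff_divide_distrib del: of_nat_Suc)
      qed
      show "\<forall>\<^sub>F i in sequentially. real_of_int \<lfloor>g x * real (Suc i)\<rfloor> / real (Suc i) \<le> g x"
        by (auto simp: divide_le_eq simp del: of_nat_Suc)
    qed simp
    ultimately show ?thesis unfolding u_def by (intro continuous_on_tendsto_compose[of UNIV "f x"]) auto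
  qed
  ultimately show ?thesis by (intro borel_measurable_LIMSEQ_real[of M u "\<lambda>x. f x (g x)"]) auto
qed

lemma measurable_fst_path_space: "f \<in> measurable M path_space \<Longrightarrow> (\<lambda>x. f x t) \<in> borel_measurable M"
  by (rule measurable_compose[OF _ eval_measurable])

lemma path_shift_measurable[measurable (raw)]:
  assumes "g \<in> borel_measurable M" "f \<in> measurable M path_space"
  shows "(\<lambda>x. path_shift (g x) (f x)) \<in> measurable M path_space"
proof (rule measurable_path_spaceI)
  show "continuous_on UNIV (path_shift (g x) (f x))" if "x \<in> space M" for x
  proof -
    have "continuous_on UNIV (f x)" using measurable_space[OF assms(2) that] by simp
    then show ?thesis unfolding path_shift_def
      by (rule continuous_on_compose2) (auto intro!: continuous_intros)
  qed
  show "(\<lambda>x. path_shift (g x) (f x) t) \<in> borel_measurable M" for t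
    unfolding path_shift_def using assms(1) by (intro measurable_path_space_eval[OF assms(2)]) auto
qed

definition vshift :: "real \<Rightarrow> (real \<Rightarrow> real) \<Rightarrow> real \<Rightarrow> real" where
  "vshift x w = (\<lambda>s. w s + x)"

definition reverse_path :: "(real \<Rightarrow> real) \<Rightarrow> real \<Rightarrow> real" where
  "reverse_path w = (\<lambda>s. w (- s))"

text \<open>Concatenation at time \<open>t\<close>: the increments before \<open>t\<close> are those
  of \<open>w\<close>, the ones after \<open>t\<close> are those of \<open>w'\<close> after time 0.
  Two independent Wiener paths yield a Wiener path for t \<ge> 0, which is how the Markov property
  is obtained.\<close>

definition splice_paths :: "real \<Rightarrow> (real \<Rightarrow> real) \<Rightarrow> (real \<Rightarrow> real) \<Rightarrow> real \<Rightarrow> real" where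
  "splice_paths t w w' = (\<lambda>s. w (min s t) + (w' (max (s - t) 0) - w' 0))"

lemma vshift_measurable[measurable (raw)]:
  assumes "g \<in> borel_measurable M" "f \<in> measurable M path_space"
  shows "(\<lambda>x. vshift (g x) (f x)) \<in> measurable M path_space"
proof (rule measurable_path_spaceI)
  show "continuous_on UNIV (vshift (g x) (f x))" if "x \<in> space M" for x
    using measurable_space[OF assms(2) that] unfolding vshift_def by (auto intro!: continuous_intros)
  show "(\<lambda>x. vshift (g x) (f x) t) \<in> borel_measurable M" for t
    unfolding vshift_def using assms measurable_fst_path_space[OF assms(2)] by auto
qed

lemma reparametrize_measurable:
  assumes "continuous_on UNIV c" "f \<in> measurable M path_space"
  shows "(\<lambda>x s. f x (c s)) \<in> measurable M path_space"
proof (rule measurable_path_spaceI)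
  show "continuous_on UNIV (\<lambda>s. f x (c s))" if "x \<in> space M" for x
  proof -
    have "continuous_on UNIV (f x)" using measurable_space[OF assms(2) that] by simp
    then show ?thesis by (rule continuous_on_compose2[OF _ assms(1)]) auto
  qed
  show "(\<lambda>x. f x (c t)) \<in> borel_measurable M" for t
    using measurable_fst_path_space[OF assms(2)] by auto
qed

lemma reverse_path_measurable[measurable (raw)]:
  "f \<in> measurable M path_space \<Longrightarrow> (\<lambda>x. reverse_path (f x)) \<in> measurable M path_space"
  unfolding reverse_path_def by (rule reparametrize_measurable) (auto intro!: continuous_intros)

lemma splice_paths_measurable[measurable (raw)]:
  assumes "f \<in> measurable M path_space" "g \<in> measurable M path_space"
  shows "(\<lambda>x. splice_paths t (f x) (g x)) \<in> measurable M path_space"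
proof (rule measurable_path_spaceI)
  show "continuous_on UNIV (splice_paths t (f x) (g x))" if "x \<in> space M" for x
  proof -
    have c: "continuous_on UNIV (f x)" using measurable_space[OF assms(1) that] by simp
    have d: "continuous_on UNIV (g x)" using measurable_space[OF assms(2) that] by simp
    have "continuous_on UNIV (\<lambda>s. f x (min s t))"
      by (rule continuous_on_compose2[OF c]) (simp_all add: continuous_on_min continuous_on_id continuous_on_const)
    moreover have "continuous_on UNIV (\<lambda>s. g x (max (s - t) 0))"
      by (rule continuous_on_compose2[OF d]) (simp_all add: continuous_on_max continuous_on_diff continuous_on_id continuous_on_const)
    ultimately show ?thesis unfolding splice_paths_def by (intro continuous_on_add continuous_on_diff continuous_on_const)
  qed
  show "(\<lambda>x. splice_paths t (f x) (g x) s) \<in> borel_measurable M" for s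
    unfolding splice_paths_def
    by (intro borel_measurable_add borel_measurable_diff measurable_fst_path_space[OF assms(1)] measurable_fst_path_space[OF assms(2)])
qed

section \<open>Uniqueness of measures on path space with given increments\<close>

definition path_cylinders :: "(real \<Rightarrow> real) set set" where
  "path_cylinders = {{w \<in> space path_space. \<forall>t\<in>J. w t \<in> A t} | J A. finite J \<and> (\<forall>t. A t \<in> sets borel)}"

lemma path_cylinders_sets: "path_cylinders \<subseteq> sets path_space"
proof
  fix X assume "X \<in> path_cylinders"
  then obtain J A where X: "X = {w \<in> space path_space. \<forall>t\<in>J. w t \<in> A t}" and J: "finite J" "\<And>t. A t \<in> sets borel"
    unfolding path_cylinders_def by blast
  have "{w \<in> space path_space. w t \<in> A t} \<in> sets path_space" for t
    using measurable_sets[OF eval_measurable J(2), of t t] by (simp add: vimage_def Int_def conj_commute)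
  then show "X \<in> sets path_space" unfolding X using J(1) by (intro sets.sets_Collect_finite_All) auto
qed

text \<open>The identity is measurable from the sigma-algebra of the cylinders, because
  measurability into \<open>path_space\<close> is tested at single times.\<close>

lemma sets_path_space_cylinders: "sets path_space = sigma_sets (space path_space) path_cylinders"
proof
  let ?S = "sigma (space path_space) path_cylinders"
  have P: "path_cylinders \<subseteq> Pow (space path_space)" using path_cylinders_sets sets.sets_into_space by blast
  show "sigma_sets (space path_space) path_cylinders \<subseteq> sets path_space"
    by (intro sets.sigma_sets_subset path_cylinders_sets)
  have "(\<lambda>w. w) \<in> measurable ?S path_space"
  proof (rule measurable_path_spaceI)
    show "(\<lambda>w. w t) \<in> borel_measurable ?S" for t
    proof (rule measurableI)
      fix A :: "real set" assume "A \<in> sets borel"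
      then have "{w \<in> space path_space. \<forall>t\<in>{t}. w t \<in> A} \<in> path_cylinders"
        unfolding path_cylinders_def by (intro CollectI exI[of _ "{t}"] exI[of _ "\<lambda>_. A"]) auto
      moreover have "(\<lambda>w. w t) -` A \<inter> space ?S = {w \<in> space path_space. \<forall>t\<in>{t}. w t \<in> A}"
        by (auto simp: space_measure_of[OF P] simp del: space_path_space)
      ultimately show "(\<lambda>w. w t) -` A \<inter> space ?S \<in> sets ?S" by (simp add: sets_measure_of[OF P] sigma_sets.Basic del: space_path_space)
    qed simp
  qed (use space_measure_of[OF P] in auto)
  then have "X \<in> sets ?S" if "X \<in> sets path_space" for X
    using measurable_sets[OF _ that, of "\<lambda>w. w" ?S] sets.sets_into_space[OF that] by (simp add: space_measure_of[OF P] Int_absorb2 del: space_path_space)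
  then show "sets path_space \<subseteq> sigma_sets (space path_space) path_cylinders" by (simp add: sets_measure_of[OF P] subset_eq del: space_path_space)
qed

lemma Int_stable_path_cylinders: "Int_stable path_cylinders"
proof (rule Int_stableI)
  fix X Y assume "X \<in> path_cylinders" "Y \<in> path_cylinders"
  then obtain J A K B where
    X: "X = {w \<in> space path_space. \<forall>t\<in>J. w t \<in> A t}" and J: "finite J" "\<And>t. A t \<in> sets borel" and
    Y: "Y = {w \<in> space path_space. \<forall>t\<in>K. w t \<in> B t}" and K: "finite K" "\<And>t. B t \<in> sets borel"
    unfolding path_cylinders_def by blast
  let ?C = "\<lambda>t. (if t \<in> J then A t else UNIV) \<inter> (if t \<in> K then B t else UNIV)"
  have "X \<inter> Y = {w \<in> space path_space. \<forall>t\<in>J \<union> K. w t \<in> ?C t}" unfolding X Y by auto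
  moreover have "\<dots> \<in> path_cylinders"
    unfolding path_cylinders_def using J K by (intro CollectI exI[of _ "J \<union> K"] exI[of _ ?C]) auto
  ultimately show "X \<inter> Y \<in> path_cylinders" by simp
qed

lemma space_in_path_cylinders: "space path_space \<in> path_cylinders"
  unfolding path_cylinders_def by (intro CollectI exI[of _ "{}"] exI[of _ "\<lambda>_. UNIV"]) auto

lemma path_measure_eqI:
  assumes "sets M = sets path_space" "sets N = sets path_space" "emeasure M (space path_space) \<noteq> \<infinity>"
    and "\<And>X. X \<in> path_cylinders \<Longrightarrow> emeasure M X = emeasure N X"
  shows "M = N"
proof (rule measure_eqI_generator_eq[OF Int_stable_path_cylinders, where \<Omega>="space path_space" and A="\<lambda>_. space path_space"])
  show "path_cylinders \<subseteq> Pow (space path_space)" using path_cylinders_sets sets.sets_into_space by blast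
qed (use assms sets_path_space_cylinders space_in_path_cylinders in auto)

definition gaussian :: "real \<Rightarrow> real measure" where
  "gaussian v = density lborel (\<lambda>x. ennreal (normal_density 0 (sqrt v) x))"

text \<open>
  The finite-dimensional distributions of the increments over all grids that contain the
  prescribed points \<open>K\<close>.
\<close>

definition gaussian_increments :: "(real \<Rightarrow> real) measure \<Rightarrow> real set \<Rightarrow> bool" where
  "gaussian_increments M K \<longleftrightarrow>
    (\<forall>s n B. strict_mono (s :: nat \<Rightarrow> real) \<longrightarrow> K \<subseteq> s ` {..n} \<longrightarrow> (\<forall>i. B i \<in> sets borel) \<longrightarrow>
      emeasure M {w \<in> space path_space. \<forall>i<n. w (s (Suc i)) - w (s i) \<in> B i}
        = (\<Prod>i<n. emeasure (gaussian (s (Suc i) - s i)) (B i)))"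

lemma finite_set_grid:
  fixes S :: "real set" assumes "finite S" "S \<noteq> {}"
  shows "\<exists>(s :: nat \<Rightarrow> real) n. strict_mono s \<and> s ` {..n} = S"
  using assms
proof (induction S rule: finite_linorder_max_induct)
  case (insert b A)
  show ?case
  proof (cases "A = {}")
    case True
    have "strict_mono (\<lambda>i::nat. b + real i)" by (auto simp: strict_mono_def)
    moreover have "(\<lambda>i::nat. b + real i) ` {..0} = {b}" by auto
    ultimately show ?thesis using True by blast
  next
    case False
    then obtain s :: "nat \<Rightarrow> real" and n where s: "strict_mono s" "s ` {..n} = A" using insert by auto
    \<comment> \<open>Beyond the largest point the enumeration continues in unit steps, since a grid
      is a strictly increasing sequence indexed by all of \<open>nat\<close>.\<close>
    define s' where "s' i = (if i \<le> n then s i else b + real (i - Suc n))" for i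
    have sb: "i \<le> n \<Longrightarrow> s i < b" for i using s(2) insert(2) by auto
    have "strict_mono s'"
    proof (rule strict_monoI)
      fix i j :: nat assume "i < j"
      then show "s' i < s' j"
        using strict_monoD[OF s(1), of i j] sb[of i] by (auto simp: s'_def intro: less_le_trans)
    qed
    moreover have "s' ` {..Suc n} = insert b A"
    proof -
      have "s' ` {..n} = A" unfolding s(2)[symmetric] by (intro image_cong) (auto simp: s'_def)
      moreover have "s' (Suc n) = b" by (simp add: s'_def)
      ultimately show ?thesis by (simp add: atMost_Suc)
    qed
    ultimately show ?thesis by blast
  qed
qed simp

text \<open>A grid through 0, the times of the cylinder and \<open>K\<close> reduces the claim to
  the joint law of finitely many increments, which is determined by boxes. As the path vanishes at
  0, its values at grid points are differences of partial sums of the increments.\<close>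

lemma gaussian_increments_unique:
  assumes M: "prob_space M" "sets M = sets path_space" "AE w in M. w 0 = 0" "gaussian_increments M K"
    and N: "prob_space N" "sets N = sets path_space" "AE w in N. w 0 = 0" "gaussian_increments N K"
    and K: "finite K"
  shows "M = N"
proof (rule path_measure_eqI)
  show "sets M = sets path_space" "sets N = sets path_space" by fact+
  have spM: "space M = space path_space" "space N = space path_space"
    using M(2) N(2) sets_eq_imp_space_eq by blast+
  then show "emeasure M (space path_space) \<noteq> \<infinity>" using prob_space.emeasure_space_1[OF M(1)] by simp
  fix X assume "X \<in> path_cylinders"
  then obtain J A where X: "X = {w \<in> space path_space. \<forall>t\<in>J. w t \<in> A t}" and J: "finite J"
    and [measurable]: "\<And>t. A t \<in> sets borel"
    unfolding path_cylinders_def by blast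
  obtain s :: "nat \<Rightarrow> real" and n where s: "strict_mono s" "s ` {..n} = insert 0 (J \<union> K)"
    using finite_set_grid[of "insert 0 (J \<union> K)"] J K by auto
  have "0 \<in> s ` {..n}" unfolding s(2) by simp
  then obtain k where k: "k \<le> n" "s k = 0" by auto
  define Y where "Y w = (\<lambda>i\<in>{..<n}. w (s (Suc i)) - w (s i))" for w :: "real \<Rightarrow> real"
  have Ym[measurable]: "Y \<in> measurable path_space (PiM {..<n} (\<lambda>_. borel))" unfolding Y_def by measurable
  have eqY: "distr M (PiM {..<n} (\<lambda>_. borel)) Y = distr N (PiM {..<n} (\<lambda>_. borel)) Y"
  proof (rule measure_eqI_PiM_finite[where I="{..<n}" and M="\<lambda>_. borel" and A="\<lambda>_::nat. space (PiM {..<n} (\<lambda>_. borel :: real measure))"])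
    have box: "emeasure (distr Q (PiM {..<n} (\<lambda>_. borel)) Y) (Pi\<^sub>E {..<n} B)
       = (\<Prod>i<n. emeasure (gaussian (s (Suc i) - s i)) (B i))"
      if B: "\<And>i. i \<in> {..<n} \<Longrightarrow> B i \<in> sets borel" and Q: "sets Q = sets path_space" "gaussian_increments Q K" for B Q
    proof -
      define B' where "B' i = (if i < n then B i else UNIV)" for i
      have spQ: "space Q = space path_space" using Q sets_eq_imp_space_eq by blast
      have "emeasure (distr Q (PiM {..<n} (\<lambda>_. borel)) Y) (Pi\<^sub>E {..<n} B) = emeasure Q (Y -` (Pi\<^sub>E {..<n} B) \<inter> space Q)"
      proof (rule emeasure_distr)
        show "Y \<in> measurable Q (PiM {..<n} (\<lambda>_. borel))" using Ym by (simp add: measurable_cong_sets[OF Q(1) refl])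
        show "Pi\<^sub>E {..<n} B \<in> sets (PiM {..<n} (\<lambda>_. borel))" using B by (intro sets_PiM_I_finite) auto
      qed
      also have "Y -` (Pi\<^sub>E {..<n} B) \<inter> space Q = {w \<in> space path_space. \<forall>i<n. w (s (Suc i)) - w (s i) \<in> B' i}"
      proof -
        have "Y w \<in> Pi\<^sub>E {..<n} B \<longleftrightarrow> (\<forall>i<n. w (s (Suc i)) - w (s i) \<in> B' i)" for w
          unfolding Y_def B'_def by (simp add: PiE_iff Ball_def)
        then show ?thesis unfolding spQ by blast
      qed
      also have "emeasure Q \<dots> = (\<Prod>i<n. emeasure (gaussian (s (Suc i) - s i)) (B' i))"
        by (rule Q(2)[unfolded gaussian_increments_def, rule_format, OF s(1)])
          (use s(2) B in \<open>auto simp: B'_def\<close>)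
      also have "\<dots> = (\<Prod>i<n. emeasure (gaussian (s (Suc i) - s i)) (B i))" by (auto simp: B'_def)
      finally show ?thesis .
    qed
    then show "emeasure (distr M (PiM {..<n} (\<lambda>_. borel)) Y) (Pi\<^sub>E {..<n} B) = emeasure (distr N (PiM {..<n} (\<lambda>_. borel)) Y) (Pi\<^sub>E {..<n} B)"
      if "\<And>i. i \<in> {..<n} \<Longrightarrow> B i \<in> sets borel" for B using that M N by simp
    show "range (\<lambda>_::nat. space (PiM {..<n} (\<lambda>_. borel :: real measure))) \<subseteq> prod_algebra {..<n} (\<lambda>_. borel)"
      by (auto simp: space_PiM intro!: prod_algebraI_finite)
    have "prob_space (distr M (PiM {..<n} (\<lambda>_. borel)) Y)"
      using Ym by (intro prob_space.prob_space_distr M) (simp add: measurable_cong_sets[OF M(2) refl])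
    then show "emeasure (distr M (PiM {..<n} (\<lambda>_. borel)) Y) (space (PiM {..<n} (\<lambda>_. borel))) \<noteq> \<infinity>"
      using prob_space.emeasure_space_1 by fastforce
  qed auto
  \<comment> \<open>The cylinder in terms of the increments: \<open>s k = 0\<close>, so subtracting
    the partial sum up to \<open>k\<close> anchors the path at 0.\<close>
  define C where "C = {v \<in> space (PiM {..<n} (\<lambda>_. borel)).
      \<forall>j\<le>n. s j \<in> J \<longrightarrow> (\<Sum>i<j. v i) - (\<Sum>i<k. v i) \<in> A (s j)}"
  have Cm: "C \<in> sets (PiM {..<n} (\<lambda>_. borel))"
  proof -
    have "{v \<in> space (PiM {..<n} (\<lambda>_. borel)). (\<Sum>i<j. v i) - (\<Sum>i<k. v i) \<in> A (s j)} \<in> sets (PiM {..<n} (\<lambda>_. borel :: real measure))"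
      if "j \<le> n" for j
    proof -
      have "(\<lambda>v. \<Sum>i<l. v i) \<in> borel_measurable (PiM {..<n} (\<lambda>_. borel :: real measure))" if "l \<le> n" for l
        using that by (intro borel_measurable_sum measurable_component_singleton) auto
      then have [measurable]: "(\<lambda>v. (\<Sum>i<j. v i) - (\<Sum>i<k. v i)) \<in> borel_measurable (PiM {..<n} (\<lambda>_. borel :: real measure))"
        using that k by (intro borel_measurable_diff) auto
      show ?thesis by measurable
    qed
    then have *: "{v \<in> space (PiM {..<n} (\<lambda>_. borel)). s j \<in> J \<longrightarrow> (\<Sum>i<j. v i) - (\<Sum>i<k. v i) \<in> A (s j)} \<in> sets (PiM {..<n} (\<lambda>_. borel :: real measure))"
      if "j \<in> {..n}" for j using that by (cases "s j \<in> J") auto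
    have "{v \<in> space (PiM {..<n} (\<lambda>_. borel)). \<forall>j\<in>{..n}. s j \<in> J \<longrightarrow> (\<Sum>i<j. v i) - (\<Sum>i<k. v i) \<in> A (s j)} \<in> sets (PiM {..<n} (\<lambda>_. borel :: real measure))"
      by (rule sets.sets_Collect_finite_All[OF *]) auto
    then show ?thesis unfolding C_def Ball_def atMost_iff .
  qed
  have sum: "(\<Sum>i<j. Y w i) = w (s j) - w (s 0)" if "j \<le> n" for j w
  proof -
    have "(\<Sum>i<j. Y w i) = (\<Sum>i<j. w (s (Suc i)) - w (s i))"
      using that by (intro sum.cong) (auto simp: Y_def)
    also have "\<dots> = w (s j) - w (s 0)" by (rule sum_lessThan_telescope[of "\<lambda>i. w (s i)"])
    finally show ?thesis .
  qed
  have "emeasure Q X = emeasure (distr Q (PiM {..<n} (\<lambda>_. borel)) Y) C"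
    if Q: "sets Q = sets path_space" "AE w in Q. w 0 = 0" for Q
  proof -
    have spQ: "space Q = space path_space" using Q sets_eq_imp_space_eq by blast
    have YQ: "Y \<in> measurable Q (PiM {..<n} (\<lambda>_. borel))" using Ym by (simp add: measurable_cong_sets[OF Q(1) refl])
    have "emeasure Q X = emeasure Q (Y -` C \<inter> space Q)"
    proof (rule emeasure_eq_AE)
      show "AE w in Q. w \<in> X \<longleftrightarrow> w \<in> Y -` C \<inter> space Q"
        using Q(2) AE_space[of Q]
      proof eventually_elim
        case (elim w)
        have "Y w \<in> space (PiM {..<n} (\<lambda>_. borel))" using measurable_space[OF YQ elim(2)] .
        then have "w \<in> Y -` C \<inter> space Q \<longleftrightarrow> (\<forall>j\<le>n. s j \<in> J \<longrightarrow> w (s j) \<in> A (s j))"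
        proof -
          have eq: "(\<Sum>i<j. Y w i) - (\<Sum>i<k. Y w i) = w (s j)" if "j \<le> n" for j
            unfolding sum[OF that] sum[OF k(1)] k(2) elim(1) by simp
          have "Y w \<in> C \<longleftrightarrow> (\<forall>j. j \<le> n \<longrightarrow> s j \<in> J \<longrightarrow> (\<Sum>i<j. Y w i) - (\<Sum>i<k. Y w i) \<in> A (s j))"
            using \<open>Y w \<in> space _\<close> unfolding C_def by (simp only: mem_Collect_eq simp_thms)
          also have "\<dots> \<longleftrightarrow> (\<forall>j\<le>n. s j \<in> J \<longrightarrow> w (s j) \<in> A (s j))"
            by (simp only: eq cong: imp_cong)
          finally show ?thesis using elim(2) by (simp only: vimage_eq Int_iff simp_thms)
        qed
        also have "\<dots> \<longleftrightarrow> (\<forall>t\<in>J. w t \<in> A t)"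
        proof
          assume *: "\<forall>j\<le>n. s j \<in> J \<longrightarrow> w (s j) \<in> A (s j)"
          show "\<forall>t\<in>J. w t \<in> A t"
          proof
            fix t assume "t \<in> J"
            then have "t \<in> s ` {..n}" unfolding s(2) by simp
            then obtain j where "t = s j" "j \<in> {..n}" by (rule imageE)
            then show "w t \<in> A t" using * \<open>t \<in> J\<close> by simp
          qed
        next
          assume "\<forall>t\<in>J. w t \<in> A t"
          then show "\<forall>j\<le>n. s j \<in> J \<longrightarrow> w (s j) \<in> A (s j)" by simp
        qed
        finally show ?case using elim(2) unfolding X spQ by (simp only: mem_Collect_eq simp_thms)
      qed
      show "X \<in> sets Q" using \<open>X \<in> path_cylinders\<close> path_cylinders_sets Q by auto
      show "Y -` C \<inter> space Q \<in> sets Q" by (rule measurable_sets[OF YQ Cm])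
    qed
    then show ?thesis using emeasure_distr[OF YQ Cm] by simp
  qed
  then show "emeasure M X = emeasure N X" using M N eqY by simp
qed

locale wiener =
  fixes P0 :: "(real \<Rightarrow> real) measure"
  assumes wiener: "two_sided_wiener_measure P0"
begin

lemma bm: "two_sided_brownian_motion P0 (\<lambda>t w. w t)"
  and sets_P0[simp, measurable_cong]: "sets P0 = sets path_space"
  using wiener unfolding two_sided_wiener_measure_def by blast+

lemma space_P0: "space P0 = {w. continuous_on UNIV w}"
  using sets_eq_imp_space_eq[OF sets_P0] by simp

lemmas bm_conditions = bm[unfolded two_sided_brownian_motion_def]

lemma prob_space_P0: "prob_space P0"
  by (rule bm_conditions[THEN conjunct1])

lemma AE_P0: "AE w in P0. w 0 = 0 \<and> continuous_on UNIV (\<lambda>t. w t)"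
  by (rule bm_conditions[THEN conjunct2, THEN conjunct2, THEN conjunct1])

lemma distributed_increment:
  "s < t \<Longrightarrow> distributed P0 lborel (\<lambda>w. w t - w s) (normal_density 0 (sqrt (t - s)))"
  by (rule bm_conditions[THEN conjunct2, THEN conjunct2, THEN conjunct2, THEN conjunct1, rule_format])

lemma indep_increments:
  "strict_mono (r :: nat \<Rightarrow> real)
    \<Longrightarrow> prob_space.indep_vars P0 (\<lambda>_. borel) (\<lambda>i w. w (r (Suc i)) - w (r i)) {..<n}"
  by (rule bm_conditions[THEN conjunct2, THEN conjunct2, THEN conjunct2, THEN conjunct2, rule_format])

sublocale prob_space P0
  by (rule prob_space_P0)

lemma AE_zero: "AE w in P0. w 0 = 0"
  using AE_P0 by eventually_elim simp

lemma distr_increment: "s < t \<Longrightarrow> distr P0 borel (\<lambda>w. w t - w s) = gaussian (t - s)"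
proof -
  assume "s < t"
  then have "distributed P0 lborel (\<lambda>w. w t - w s) (normal_density 0 (sqrt (t - s)))"
    by (rule distributed_increment)
  then have "distr P0 lborel (\<lambda>w. w t - w s) = gaussian (t - s)"
    by (simp add: distributed_def gaussian_def)
  moreover have "distr P0 lborel (\<lambda>w. w t - w s) = distr P0 borel (\<lambda>w. w t - w s)"
    by (rule distr_cong) auto
  ultimately show ?thesis by simp
qed

lemma gaussian_increments_P0: "gaussian_increments P0 {}"
  unfolding gaussian_increments_def
proof (intro allI impI)
  fix s :: "nat \<Rightarrow> real" and n and B :: "nat \<Rightarrow> real set" assume s: "strict_mono s" and B: "\<forall>i. B i \<in> sets (borel :: real measure)"
  show "emeasure P0 {w \<in> space path_space. \<forall>i<n. w (s (Suc i)) - w (s i) \<in> B i}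
        = (\<Prod>i<n. emeasure (gaussian (s (Suc i) - s i)) (B i))"
  proof (cases "n = 0")
    case True then show ?thesis using emeasure_space_1 by (simp add: space_P0)
  next
    case False
    let ?X = "\<lambda>i w. w (s (Suc i)) - w (s i)"
    have "indep_vars (\<lambda>_. borel) ?X {..<n}" by (rule indep_increments[OF s])
    then have "prob (\<Inter>i\<in>{..<n}. ?X i -` B i \<inter> space P0) = (\<Prod>i<n. prob (?X i -` B i \<inter> space P0))"
      using False B by (intro indep_varsD) auto
    moreover have "emeasure P0 (?X i -` B i \<inter> space P0) = emeasure (gaussian (s (Suc i) - s i)) (B i)" for i
      using B s by (subst distr_increment[symmetric]) (auto simp: emeasure_distr strict_mono_def)
    moreover have "(\<Inter>i\<in>{..<n}. ?X i -` B i \<inter> space P0) = {w \<in> space path_space. \<forall>i<n. w (s (Suc i)) - w (s i) \<in> B i}"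
      using False by (auto simp: space_P0)
    ultimately show ?thesis by (simp add: emeasure_eq_measure prod_ennreal[symmetric] del: space_path_space)
  qed
qed

lemma P0_eqI:
  assumes "prob_space N" "sets N = sets path_space" "AE w in N. w 0 = 0" "gaussian_increments N K" "finite K"
  shows "N = P0"
proof (rule gaussian_increments_unique[OF assms(1-4) _ _ _ _ assms(5)])
  show "gaussian_increments P0 K" using gaussian_increments_P0 by (auto simp: gaussian_increments_def)
qed (use AE_zero prob_space_axioms in auto)

end

declare eval_measurable[measurable del]

definition recenter :: "real \<Rightarrow> (real \<Rightarrow> real) \<Rightarrow> real \<Rightarrow> real" where
  "recenter t w = vshift (- w t) (path_shift t w)"

text \<open>Freezing the path before time 0, instead of restricting it, keeps it in
  \<open>path_space\<close>; invariance of a functional under this map expresses that it depends on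
  the future only. \<open>stopped_path\<close> does the same for the past of
  \<open>t\<close>.\<close>

definition future_path :: "(real \<Rightarrow> real) \<Rightarrow> real \<Rightarrow> real" where
  "future_path w = (\<lambda>s. w (max s 0))"

definition stopped_path :: "real \<Rightarrow> (real \<Rightarrow> real) \<Rightarrow> real \<Rightarrow> real" where
  "stopped_path t w = (\<lambda>s. w (min s t))"

lemma future_path_measurable[measurable (raw)]:
  "f \<in> measurable M path_space \<Longrightarrow> (\<lambda>x. future_path (f x)) \<in> measurable M path_space"
  unfolding future_path_def by (rule reparametrize_measurable) (auto intro!: continuous_intros)

lemma stopped_path_measurable[measurable (raw)]:
  "f \<in> measurable M path_space \<Longrightarrow> (\<lambda>x. stopped_path t (f x)) \<in> measurable M path_space"
  unfolding stopped_path_def by (rule reparametrize_measurable) (auto intro!: continuous_intros)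

lemma recenter_measurable[measurable (raw)]:
  assumes "g \<in> borel_measurable M" and f: "f \<in> measurable M path_space"
  shows "(\<lambda>x. recenter (g x) (f x)) \<in> measurable M path_space"
proof -
  note measurable_path_space_eval[OF f assms(1), measurable]
  show ?thesis unfolding recenter_def using assms by measurable
qed

lemma path_maps_measurable[measurable]:
  "path_shift t \<in> measurable path_space path_space"
  "vshift z \<in> measurable path_space path_space"
  "recenter t \<in> measurable path_space path_space"
  "reverse_path \<in> measurable path_space path_space"
  "future_path \<in> measurable path_space path_space"
  "stopped_path t \<in> measurable path_space path_space"
proof -
  have "(\<lambda>w. path_shift t w) \<in> measurable path_space path_space" "(\<lambda>w. vshift z w) \<in> measurable path_space path_space"
    "(\<lambda>w. recenter t w) \<in> measurable path_space path_space" "(\<lambda>w. reverse_path w) \<in> measurable path_space path_space"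
    "(\<lambda>w. future_path w) \<in> measurable path_space path_space" "(\<lambda>w. stopped_path t w) \<in> measurable path_space path_space"
    by measurable
  then show "path_shift t \<in> measurable path_space path_space" "vshift z \<in> measurable path_space path_space"
    "recenter t \<in> measurable path_space path_space" "reverse_path \<in> measurable path_space path_space"
    "future_path \<in> measurable path_space path_space" "stopped_path t \<in> measurable path_space path_space"
    by simp_all
qed

lemma continuous_path_shift[simp]: "continuous_on UNIV w \<Longrightarrow> continuous_on UNIV (path_shift t w)"
  and continuous_vshift[simp]: "continuous_on UNIV w \<Longrightarrow> continuous_on UNIV (vshift x w)"
  and continuous_recenter[simp]: "continuous_on UNIV w \<Longrightarrow> continuous_on UNIV (recenter t w)"
  and continuous_reverse_path[simp]: "continuous_on UNIV w \<Longrightarrow> continuous_on UNIV (reverse_path w)"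
  and continuous_future_path[simp]: "continuous_on UNIV w \<Longrightarrow> continuous_on UNIV (future_path w)"
  and continuous_stopped_path[simp]: "continuous_on UNIV w \<Longrightarrow> continuous_on UNIV (stopped_path t w)"
proof -
  assume c: "continuous_on UNIV w"
  have *: "continuous_on UNIV (\<lambda>s. w (g s))" if "continuous_on UNIV g" for g
    by (rule continuous_on_compose2[OF c that]) simp
  have ps: "continuous_on UNIV (path_shift t w)" for t unfolding path_shift_def by (intro * continuous_intros)
  then show "continuous_on UNIV (path_shift t w)" .
  show "continuous_on UNIV (vshift x w)" unfolding vshift_def by (intro continuous_intros c)
  show "continuous_on UNIV (recenter t w)" unfolding recenter_def vshift_def by (intro continuous_intros ps)
  show "continuous_on UNIV (reverse_path w)" unfolding reverse_path_def by (intro * continuous_intros)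
  show "continuous_on UNIV (future_path w)" unfolding future_path_def by (intro * continuous_intros)
  show "continuous_on UNIV (stopped_path t w)" unfolding stopped_path_def by (intro * continuous_intros)
qed

lemma continuous_splice_paths:
  assumes "continuous_on UNIV w" "continuous_on UNIV w'"
  shows "continuous_on UNIV (splice_paths t w w')"
proof -
  have "(\<lambda>_. splice_paths t w w') \<in> measurable (count_space {()}) path_space"
    using assms by (intro splice_paths_measurable measurable_const) auto
  from measurable_space[OF this, of "()"] show ?thesis by simp
qed

lemma emeasure_gaussian_uminus:
  assumes [measurable]: "B \<in> sets borel"
  shows "emeasure (gaussian v) (uminus -` B) = emeasure (gaussian v) B"
proof -
  have [measurable]: "uminus -` B \<in> sets borel"
    using measurable_sets[of uminus borel borel B] by simp
  have "emeasure (gaussian v) B = (\<integral>\<^sup>+x. ennreal (normal_density 0 (sqrt v) x) * indicator B x \<partial>lborel)"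
    unfolding gaussian_def by (rule emeasure_density) auto
  also have "\<dots> = (\<integral>\<^sup>+x. ennreal (normal_density 0 (sqrt v) (- x)) * indicator B (- x) \<partial>lborel)"
    using nn_integral_real_affine[of "\<lambda>x. ennreal (normal_density 0 (sqrt v) x) * indicator B x" "-1" 0] by simp
  also have "\<dots> = (\<integral>\<^sup>+x. ennreal (normal_density 0 (sqrt v) x) * indicator (uminus -` B) x \<partial>lborel)"
    by (intro nn_integral_cong) (auto simp: normal_density_def indicator_def)
  also have "\<dots> = emeasure (gaussian v) (uminus -` B)"
    unfolding gaussian_def by (rule emeasure_density[symmetric]) auto
  finally show ?thesis by simp
qed

lemma increments_measurable:
  assumes "\<And>i. B i \<in> sets borel"
  shows "{w \<in> space path_space. \<forall>i<(n::nat). w (s (Suc i)) - w (s i) \<in> B i} \<in> sets path_space"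
proof -
  have "{w \<in> space path_space. \<forall>i\<in>{..<n}. w (s (Suc i)) - w (s i) \<in> B i} \<in> sets path_space"
  proof (rule sets.sets_Collect_finite_All)
    fix i
    have "(\<lambda>w. w (s (Suc i)) - w (s i)) \<in> borel_measurable path_space"
      by (intro borel_measurable_diff eval_measurable)
    then show "{w \<in> space path_space. w (s (Suc i)) - w (s i) \<in> B i} \<in> sets path_space"
      using measurable_sets[OF _ assms, of "\<lambda>w. w (s (Suc i)) - w (s i)" path_space i]
      by (simp add: vimage_def Int_def conj_commute)
  qed simp
  then show ?thesis by (simp add: Ball_def)
qed

lemma gaussian_incrementsD:
  assumes "gaussian_increments M K" "strict_mono (s :: nat \<Rightarrow> real)" "K \<subseteq> s ` {..n}" "\<And>i. B i \<in> sets borel"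
  shows "emeasure M {w \<in> space path_space. \<forall>i<n. w (s (Suc i)) - w (s i) \<in> B i}
        = (\<Prod>i<n. emeasure (gaussian (s (Suc i) - s i)) (B i))"
  by (rule assms(1)[unfolded gaussian_increments_def, rule_format, OF assms(2,3,4)])

section \<open>Symmetries of Wiener measure and the Markov property\<close>

context wiener
begin

lemma measurable_fst_P0[measurable]: "fst \<in> measurable (P0 \<Otimes>\<^sub>M M) path_space"
  and measurable_snd_P0[measurable]: "snd \<in> measurable (M \<Otimes>\<^sub>M P0) path_space"
  using measurable_fst[of P0 M] measurable_snd[of M P0] by (simp_all add: measurable_cong_sets[OF refl sets_P0])

lemma P0_incr:
  assumes "strict_mono (s :: nat \<Rightarrow> real)" "\<And>i. B i \<in> sets borel"
  shows "emeasure P0 {w \<in> space path_space. \<forall>i<n. w (s (Suc i)) - w (s i) \<in> B i}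
        = (\<Prod>i<n. emeasure (gaussian (s (Suc i) - s i)) (B i))"
  using assms by (intro gaussian_incrementsD[OF gaussian_increments_P0]) auto

lemma distr_P0_eqI:
  assumes f: "f \<in> measurable P0 path_space" and "AE w in P0. f w 0 = 0"
    and "gaussian_increments (distr P0 path_space f) {}"
  shows "distr P0 path_space f = P0"
proof (rule P0_eqI)
  show "prob_space (distr P0 path_space f)" by (rule prob_space_distr[OF f])
  have "{w \<in> space path_space. w 0 = 0} \<in> sets path_space"
    supply eval_measurable[measurable] by measurable
  then show "AE w in distr P0 path_space f. w 0 = 0"
    using assms(2) by (subst AE_distr_iff[OF f]) auto
qed (use assms in auto)

lemma distr_P0_recenter: "distr P0 path_space (recenter t) = P0"
proof (rule distr_P0_eqI)
  show m: "recenter t \<in> measurable P0 path_space" by measurable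
  show "AE w in P0. recenter t w 0 = 0" by (simp add: recenter_def vshift_def path_shift_def)
  show "gaussian_increments (distr P0 path_space (recenter t)) {}"
    unfolding gaussian_increments_def
  proof (intro allI impI)
    fix s :: "nat \<Rightarrow> real" and n and B :: "nat \<Rightarrow> real set"
    assume s: "strict_mono s" and B: "\<forall>i. B i \<in> sets borel"
    have "emeasure (distr P0 path_space (recenter t)) {w \<in> space path_space. \<forall>i<n. w (s (Suc i)) - w (s i) \<in> B i}
        = emeasure P0 (recenter t -` {w \<in> space path_space. \<forall>i<n. w (s (Suc i)) - w (s i) \<in> B i} \<inter> space P0)"
      using B by (intro emeasure_distr[OF m] increments_measurable) auto
    also have "recenter t -` {w \<in> space path_space. \<forall>i<n. w (s (Suc i)) - w (s i) \<in> B i} \<inter> space P0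
       = {w \<in> space path_space. \<forall>i<n. w (t + s (Suc i)) - w (t + s i) \<in> B i}"
    proof -
      have "recenter t w (s (Suc i)) - recenter t w (s i) = w (t + s (Suc i)) - w (t + s i)" for w i
        by (simp add: recenter_def vshift_def path_shift_def)
      then show ?thesis unfolding space_P0 by auto
    qed
    also have "emeasure P0 \<dots> = (\<Prod>i<n. emeasure (gaussian (t + s (Suc i) - (t + s i))) (B i))"
      using B s by (intro P0_incr) (auto simp: strict_mono_def)
    finally show "emeasure (distr P0 path_space (recenter t)) {w \<in> space path_space. \<forall>i<n. w (s (Suc i)) - w (s i) \<in> B i}
        = (\<Prod>i<n. emeasure (gaussian (s (Suc i) - s i)) (B i))" by simp
  qed
qed

lemma distr_P0_reverse_path: "distr P0 path_space reverse_path = P0"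
proof (rule distr_P0_eqI)
  show m: "reverse_path \<in> measurable P0 path_space" by measurable
  show "AE w in P0. reverse_path w 0 = 0" using AE_zero by (simp add: reverse_path_def)
  show "gaussian_increments (distr P0 path_space reverse_path) {}"
    unfolding gaussian_increments_def
  proof (intro allI impI)
    fix s :: "nat \<Rightarrow> real" and n and B :: "nat \<Rightarrow> real set"
    assume s: "strict_mono s" and B: "\<forall>i. B i \<in> sets borel"
    \<comment> \<open>The reflected grid in increasing order, continued in unit steps beyond index
      \<open>n\<close>.\<close>
    define r where "r j = (if j \<le> n then - s (n - j) else - s 0 + real (j - n))" for j
    have r: "strict_mono r"
    proof (rule strict_mono_Suc_iff[THEN iffD2], rule allI)
      fix j
      show "r j < r (Suc j)"
        using strict_monoD[OF s, of "n - Suc j" "n - j"] by (cases "Suc j \<le> n") (auto simp: r_def not_le less_Suc_eq_le)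
    qed
    have B': "uminus -` B i \<in> sets borel" for i using B measurable_sets[of uminus borel borel "B i"] by simp
    have "emeasure (distr P0 path_space reverse_path) {w \<in> space path_space. \<forall>i<n. w (s (Suc i)) - w (s i) \<in> B i}
        = emeasure P0 (reverse_path -` {w \<in> space path_space. \<forall>i<n. w (s (Suc i)) - w (s i) \<in> B i} \<inter> space P0)"
      using B by (intro emeasure_distr[OF m] increments_measurable) auto
    also have "reverse_path -` {w \<in> space path_space. \<forall>i<n. w (s (Suc i)) - w (s i) \<in> B i} \<inter> space P0
       = {w \<in> space path_space. \<forall>i<n. w (r (Suc i)) - w (r i) \<in> uminus -` B (n - Suc i)}" (is "?L = ?R")
    proof -
      have eq: "- (w (r (Suc i)) - w (r i)) = w (- s (Suc (n - Suc i))) - w (- s (n - Suc i))" if "i < n" for i and w :: "real \<Rightarrow> real"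
        using that by (simp add: r_def Suc_diff_Suc)
      have all: "(\<forall>i<n. Q i) \<longleftrightarrow> (\<forall>i<n. Q (n - Suc i))" for Q :: "nat \<Rightarrow> bool"
      proof safe
        fix i assume "\<forall>i<n. Q (n - Suc i)" "i < n"
        then have "Q (n - Suc (n - Suc i))" by (metis diff_less_Suc less_Suc_eq_0_disj Suc_pred diff_Suc_less gr_implies_not0 not_less_eq zero_less_iff_neq_zero)
        with \<open>i < n\<close> show "Q i" by simp
      qed simp
      have "(\<forall>i<n. reverse_path w (s (Suc i)) - reverse_path w (s i) \<in> B i)
        \<longleftrightarrow> (\<forall>i<n. w (r (Suc i)) - w (r i) \<in> uminus -` B (n - Suc i))" for w
        unfolding reverse_path_def vimage_eq
        by (subst all) (simp only: eq cong: imp_cong)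
      then show ?thesis unfolding space_P0 by auto
    qed
    also have "emeasure P0 \<dots> = (\<Prod>i<n. emeasure (gaussian (r (Suc i) - r i)) (uminus -` B (n - Suc i)))"
      by (rule P0_incr[OF r B'])
    also have "\<dots> = (\<Prod>i<n. emeasure (gaussian (s (Suc (n - Suc i)) - s (n - Suc i))) (B (n - Suc i)))"
      using B by (intro prod.cong) (auto simp: r_def Suc_diff_Suc emeasure_gaussian_uminus)
    also have "\<dots> = (\<Prod>i<n. emeasure (gaussian (s (Suc i) - s i)) (B i))"
      by (rule prod.nat_diff_reindex)
    finally show "emeasure (distr P0 path_space reverse_path) {w \<in> space path_space. \<forall>i<n. w (s (Suc i)) - w (s i) \<in> B i}
        = (\<Prod>i<n. emeasure (gaussian (s (Suc i) - s i)) (B i))" .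
  qed
qed

lemma prod_lessThan_add: "(\<Prod>i<k + (m::nat). f i) = (\<Prod>i<k. f i) * (\<Prod>i<m. f (k + i) :: ennreal)"
  by (induction m) (auto simp: mult.assoc)

text \<open>On a grid that contains \<open>t\<close> the increments split into a block governed by
  \<open>w\<close> and a block governed by \<open>w'\<close>, and the product measure factorizes. A
  grid interval across \<open>t\<close> would mix the two, hence the prescribed point in
  \<open>gaussian_increments\<close>.\<close>

lemma distr_P0_splice_paths:
  assumes t: "0 \<le> t"
  shows "distr (P0 \<Otimes>\<^sub>M P0) path_space (\<lambda>(w, w'). splice_paths t w w') = P0"
proof (rule P0_eqI[where K="{t}"])
  interpret PP: pair_prob_space P0 P0 ..
  have m[measurable]: "(\<lambda>(w, w'). splice_paths t w w') \<in> measurable (P0 \<Otimes>\<^sub>M P0) path_space" by measurable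
  show "prob_space (distr (P0 \<Otimes>\<^sub>M P0) path_space (\<lambda>(w, w'). splice_paths t w w'))"
    by (rule PP.prob_space_distr[OF m])
  have z: "AE z in P0 \<Otimes>\<^sub>M P0. splice_paths t (fst z) (snd z) 0 = 0"
  proof (rule PP.AE_pair_measure)
    have [measurable]: "(\<lambda>z. splice_paths t (fst z) (snd z) 0) \<in> borel_measurable (P0 \<Otimes>\<^sub>M P0)"
      using measurable_fst_path_space[OF m, of 0] by (simp add: case_prod_beta')
    show "{z \<in> space (P0 \<Otimes>\<^sub>M P0). splice_paths t (fst z) (snd z) 0 = 0} \<in> sets (P0 \<Otimes>\<^sub>M P0)"
      by measurable
    show "AE w in P0. AE w' in P0. splice_paths t (fst (w, w')) (snd (w, w')) 0 = 0"
      using AE_zero by eventually_elim (use t in \<open>simp add: splice_paths_def\<close>)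
  qed
  show "AE w in distr (P0 \<Otimes>\<^sub>M P0) path_space (\<lambda>(w, w'). splice_paths t w w'). w 0 = 0"
  proof -
    have "{w \<in> space path_space. w 0 = 0} \<in> sets path_space"
    supply eval_measurable[measurable] by measurable
    then show ?thesis using z
      by (subst AE_distr_iff[OF m]) (simp_all add: case_prod_beta')
  qed
  show "gaussian_increments (distr (P0 \<Otimes>\<^sub>M P0) path_space (\<lambda>(w, w'). splice_paths t w w')) {t}"
    unfolding gaussian_increments_def
  proof (intro allI impI)
    fix s :: "nat \<Rightarrow> real" and n and B :: "nat \<Rightarrow> real set"
    assume s: "strict_mono s" and K: "{t} \<subseteq> s ` {..n}" and B: "\<forall>i. B i \<in> sets borel"
    from K obtain k where k: "k \<le> n" "t = s k" by auto
    define E where "E = {w \<in> space path_space. \<forall>i<k. w (s (Suc i)) - w (s i) \<in> B i}"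
    define E' where "E' = {w \<in> space path_space. \<forall>i<n - k. w (s (k + Suc i) - t) - w (s (k + i) - t) \<in> B (k + i)}"
    have Em: "E \<in> sets P0" unfolding E_def sets_P0 using B by (intro increments_measurable) auto
    have Em': "E' \<in> sets P0" unfolding E'_def sets_P0
      using B increments_measurable[of "\<lambda>i. B (k + i)" "n - k" "\<lambda>i. s (k + i) - t"] by simp
    have "emeasure (distr (P0 \<Otimes>\<^sub>M P0) path_space (\<lambda>(w, w'). splice_paths t w w')) {w \<in> space path_space. \<forall>i<n. w (s (Suc i)) - w (s i) \<in> B i}
        = emeasure (P0 \<Otimes>\<^sub>M P0) ((\<lambda>(w, w'). splice_paths t w w') -` {w \<in> space path_space. \<forall>i<n. w (s (Suc i)) - w (s i) \<in> B i} \<inter> space (P0 \<Otimes>\<^sub>M P0))"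
      using B by (intro emeasure_distr[OF m] increments_measurable) auto
    also have "(\<lambda>(w, w'). splice_paths t w w') -` {w \<in> space path_space. \<forall>i<n. w (s (Suc i)) - w (s i) \<in> B i} \<inter> space (P0 \<Otimes>\<^sub>M P0) = E \<times> E'"
    proof -
      have before: "splice_paths t w w' (s (Suc i)) - splice_paths t w w' (s i) = w (s (Suc i)) - w (s i)" if "i < k" for i w w'
      proof -
        have "s (Suc i) \<le> t" "s i \<le> t" unfolding k(2) using that by (auto simp: strict_mono_less_eq[OF s])
        then show ?thesis by (simp add: splice_paths_def min_def max_def)
      qed
      have after: "splice_paths t w w' (s (Suc (k + i))) - splice_paths t w w' (s (k + i)) = w' (s (k + Suc i) - t) - w' (s (k + i) - t)" for i w w'
      proof -
        have "t \<le> s (Suc (k + i))" "t \<le> s (k + i)" unfolding k(2) by (auto simp: strict_mono_less_eq[OF s])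
        then show ?thesis by (simp add: splice_paths_def min_def max_def)
      qed
      have split: "(\<forall>i<n. Q i) \<longleftrightarrow> (\<forall>i<k. Q i) \<and> (\<forall>i<n - k. Q (k + i))" for Q
      proof (intro iffI conjI allI impI)
        fix i assume *: "(\<forall>i<k. Q i) \<and> (\<forall>i<n - k. Q (k + i))" "i < n"
        show "Q i"
        proof (cases "i < k")
          case False
          then have "i - k < n - k" using * by auto
          then have "Q (k + (i - k))" using * by blast
          then show ?thesis using False by simp
        qed (use * in blast)
      qed (use k in auto)
      have iff: "(\<forall>i<n. splice_paths t w w' (s (Suc i)) - splice_paths t w w' (s i) \<in> B i) \<longleftrightarrow>
        (\<forall>i<k. w (s (Suc i)) - w (s i) \<in> B i) \<and> (\<forall>i<n - k. w' (s (k + Suc i) - t) - w' (s (k + i) - t) \<in> B (k + i))" for w w'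
        by (subst split) (simp only: before after cong: imp_cong)
      show ?thesis
        unfolding E_def E'_def vimage_def case_prod_beta' mem_Collect_eq iff space_path_space
        by (auto simp: space_pair_measure space_P0 intro: continuous_splice_paths)
    qed
    also have "emeasure (P0 \<Otimes>\<^sub>M P0) (E \<times> E') = emeasure P0 E * emeasure P0 E'"
      using Em Em' by (rule emeasure_pair_measure_Times)
    also have "emeasure P0 E = (\<Prod>i<k. emeasure (gaussian (s (Suc i) - s i)) (B i))"
      unfolding E_def using B by (intro P0_incr s) auto
    also have "emeasure P0 E' = (\<Prod>i<n - k. emeasure (gaussian (s (Suc (k + i)) - s (k + i))) (B (k + i)))"
      unfolding E'_def using B s P0_incr[of "\<lambda>i. s (k + i) - t" "\<lambda>i. B (k + i)" "n - k"] by (simp add: strict_mono_def)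
    also have "(\<Prod>i<k. emeasure (gaussian (s (Suc i) - s i)) (B i)) * \<dots> = (\<Prod>i<n. emeasure (gaussian (s (Suc i) - s i)) (B i))"
      using prod_lessThan_add[of "\<lambda>i. emeasure (gaussian (s (Suc i) - s i)) (B i)" k "n - k"] k(1) by simp
    finally show "emeasure (distr (P0 \<Otimes>\<^sub>M P0) path_space (\<lambda>(w, w'). splice_paths t w w')) {w \<in> space path_space. \<forall>i<n. w (s (Suc i)) - w (s i) \<in> B i}
        = (\<Prod>i<n. emeasure (gaussian (s (Suc i) - s i)) (B i))" .
  qed
qed auto

lemma nn_integral_recenter:
  assumes [measurable]: "f \<in> borel_measurable path_space"
  shows "(\<integral>\<^sup>+w. f (recenter t w) \<partial>P0) = (\<integral>\<^sup>+w. f w \<partial>P0)"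
proof -
  have "(\<integral>\<^sup>+w. f w \<partial>P0) = (\<integral>\<^sup>+w. f w \<partial>distr P0 path_space (recenter t))" by (simp add: distr_P0_recenter)
  also have "\<dots> = (\<integral>\<^sup>+w. f (recenter t w) \<partial>P0)" by (rule nn_integral_distr) measurable
  finally show ?thesis by simp
qed

lemma nn_integral_splice_paths:
  assumes [measurable]: "f \<in> borel_measurable path_space" and "0 \<le> t"
  shows "(\<integral>\<^sup>+w. \<integral>\<^sup>+w'. f (splice_paths t w w') \<partial>P0 \<partial>P0) = (\<integral>\<^sup>+w. f w \<partial>P0)"
proof -
  have "(\<integral>\<^sup>+w. f w \<partial>P0) = (\<integral>\<^sup>+w. f w \<partial>distr (P0 \<Otimes>\<^sub>M P0) path_space (\<lambda>(w, w'). splice_paths t w w'))"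
    by (simp add: distr_P0_splice_paths[OF assms(2)])
  also have "\<dots> = (\<integral>\<^sup>+z. f (splice_paths t (fst z) (snd z)) \<partial>(P0 \<Otimes>\<^sub>M P0))"
    by (subst nn_integral_distr) (measurable, simp add: case_prod_beta')
  also have "\<dots> = (\<integral>\<^sup>+w. \<integral>\<^sup>+w'. f (splice_paths t w w') \<partial>P0 \<partial>P0)"
    by (subst nn_integral_fst[symmetric]) simp_all
  finally show ?thesis by simp
qed

text \<open>In the splicing representation \<open>g\<close> sees only the first path, and
  \<open>f\<close> sees only the second one started at \<open>w t\<close>; the inner integral then
  factorizes.\<close>

lemma markov_property:
  assumes [measurable]: "f \<in> borel_measurable path_space" "g \<in> borel_measurable path_space" and t: "0 \<le> t"
    and f: "\<And>w. continuous_on UNIV w \<Longrightarrow> f (future_path w) = f w"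
    and g: "\<And>w. continuous_on UNIV w \<Longrightarrow> g (stopped_path t w) = g w"
  shows "(\<integral>\<^sup>+w. g w * f (path_shift t w) \<partial>P0) = (\<integral>\<^sup>+w. g w * (\<integral>\<^sup>+w'. f (vshift (w t) w') \<partial>P0) \<partial>P0)"
proof -
  have "(\<integral>\<^sup>+w. g w * f (path_shift t w) \<partial>P0)
    = (\<integral>\<^sup>+w. \<integral>\<^sup>+w'. g (splice_paths t w w') * f (path_shift t (splice_paths t w w')) \<partial>P0 \<partial>P0)"
    by (rule nn_integral_splice_paths[OF _ t, symmetric]) measurable
  also have "\<dots> = (\<integral>\<^sup>+w. g w * (\<integral>\<^sup>+w'. f (vshift (w t) w') \<partial>P0) \<partial>P0)"
  proof (rule nn_integral_cong)
    fix w assume "w \<in> space P0"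
    then have c: "continuous_on UNIV w" by (simp add: space_P0)
    have "(\<integral>\<^sup>+w'. g (splice_paths t w w') * f (path_shift t (splice_paths t w w')) \<partial>P0) = (\<integral>\<^sup>+w'. g w * f (vshift (w t) w') \<partial>P0)"
    proof (rule nn_integral_cong_AE)
      show "AE w' in P0. g (splice_paths t w w') * f (path_shift t (splice_paths t w w')) = g w * f (vshift (w t) w')"
        using AE_zero AE_space
      proof eventually_elim
        case (elim w')
        then have c': "continuous_on UNIV w'" by (simp add: space_P0)
        have cs: "continuous_on UNIV (splice_paths t w w')"
          by (rule continuous_splice_paths[OF c c'])
        have "stopped_path t (splice_paths t w w') = stopped_path t w"
          by (simp add: stopped_path_def splice_paths_def)
        then have "g (splice_paths t w w') = g w" using g[OF cs] g[OF c] by simp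
        moreover have "future_path (path_shift t (splice_paths t w w')) = future_path (vshift (w t) w')"
          using elim(1) by (auto simp: future_path_def path_shift_def splice_paths_def vshift_def fun_eq_iff)
        then have "f (path_shift t (splice_paths t w w')) = f (vshift (w t) w')"
          using f[OF continuous_path_shift[OF cs]] f[OF continuous_vshift[OF c']] by metis
        ultimately show ?case by simp
      qed
    qed
    also have "\<dots> = g w * (\<integral>\<^sup>+w'. f (vshift (w t) w') \<partial>P0)"
      by (rule nn_integral_cmult) measurable
    finally show "(\<integral>\<^sup>+w'. g (splice_paths t w w') * f (path_shift t (splice_paths t w w')) \<partial>P0) = g w * (\<integral>\<^sup>+w'. f (vshift (w t) w') \<partial>P0)" .
  qed
  finally show ?thesis .
qed

lemma nn_integral_eval:
  assumes "f \<in> borel_measurable borel" and t: "0 < t"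
  shows "(\<integral>\<^sup>+w. f (w t) \<partial>P0) = (\<integral>\<^sup>+x. ennreal (normal_density 0 (sqrt t) x) * f x \<partial>lborel)"
proof -
  have "(\<integral>\<^sup>+w. f (w t) \<partial>P0) = (\<integral>\<^sup>+w. f (w t - w 0) \<partial>P0)"
  proof (rule nn_integral_cong_AE)
    show "AE w in P0. f (w t) = f (w t - w 0)" using AE_zero by eventually_elim simp
  qed
  also have "\<dots> = (\<integral>\<^sup>+x. ennreal (normal_density 0 (sqrt (t - 0)) x) * f x \<partial>lborel)"
    by (rule distributed_nn_integral[OF distributed_increment[OF t], symmetric]) (simp add: assms)
  finally show ?thesis by simp
qed

section \<open>The stationary measure with Lebesgue distributed starting point\<close>

definition stationary :: "(real \<Rightarrow> real) measure" where
  "stationary = distr (lborel \<Otimes>\<^sub>M P0) path_space (\<lambda>(x, w). vshift x w)"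

lemma sets_stationary[simp, measurable_cong]: "sets stationary = sets path_space"
  by (simp add: stationary_def)

lemma space_stationary: "space stationary = {w. continuous_on UNIV w}"
  using sets_eq_imp_space_eq[OF sets_stationary] by simp

lemma nn_integral_stationary:
  assumes [measurable]: "f \<in> borel_measurable path_space"
  shows "(\<integral>\<^sup>+w. f w \<partial>stationary) = (\<integral>\<^sup>+x. \<integral>\<^sup>+w. f (vshift x w) \<partial>P0 \<partial>lborel)"
proof -
  have "(\<integral>\<^sup>+w. f w \<partial>stationary) = (\<integral>\<^sup>+z. f (vshift (fst z) (snd z)) \<partial>(lborel \<Otimes>\<^sub>M P0))"
    unfolding stationary_def by (subst nn_integral_distr) (measurable, simp add: case_prod_beta')
  also have "\<dots> = (\<integral>\<^sup>+x. \<integral>\<^sup>+w. f (vshift x w) \<partial>P0 \<partial>lborel)"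
    by (subst nn_integral_fst[symmetric]) simp_all
  finally show ?thesis .
qed

lemma AE_stationary:
  assumes [measurable]: "Measurable.pred path_space Q"
  shows "(AE w in stationary. Q w) \<longleftrightarrow> (AE x in lborel. AE w in P0. Q (vshift x w))"
proof -
  interpret PP: pair_sigma_finite lborel P0 ..
  have "(AE w in stationary. Q w) \<longleftrightarrow> (AE z in lborel \<Otimes>\<^sub>M P0. Q (vshift (fst z) (snd z)))"
    unfolding stationary_def by (subst AE_distr_iff) (measurable, simp add: case_prod_beta')
  also have "\<dots> \<longleftrightarrow> (AE x in lborel. AE w in P0. Q (vshift x w))"
    by (rule PP.AE_pair_iff[symmetric]) measurable
  finally show ?thesis .
qed

lemma AE_stationaryI:
  assumes [measurable]: "Measurable.pred path_space Q" and "\<And>x. AE w in P0. Q (vshift x w)"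
  shows "AE w in stationary. Q w"
  using assms(2) by (subst AE_stationary) auto

text \<open>For a fixed path the shift by \<open>t\<close> is a recentering together with a change
  of the starting point by \<open>w t\<close>. Translation invariance of Lebesgue measure absorbs
  the latter, invariance of \<open>P0\<close> under recentering the former.\<close>

lemma nn_integral_stationary_path_shift:
  assumes [measurable]: "f \<in> borel_measurable path_space"
  shows "(\<integral>\<^sup>+w. f (path_shift t w) \<partial>stationary) = (\<integral>\<^sup>+w. f w \<partial>stationary)"
proof -
  interpret PP: pair_sigma_finite lborel P0 ..
  have "(\<integral>\<^sup>+w. f (path_shift t w) \<partial>stationary) = (\<integral>\<^sup>+x. \<integral>\<^sup>+w. f (path_shift t (vshift x w)) \<partial>P0 \<partial>lborel)"
    by (rule nn_integral_stationary) measurable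
  also have "\<dots> = (\<integral>\<^sup>+w. \<integral>\<^sup>+x. f (path_shift t (vshift x w)) \<partial>lborel \<partial>P0)"
    by (rule PP.Fubini'[symmetric]) measurable
  also have "\<dots> = (\<integral>\<^sup>+w. \<integral>\<^sup>+x. f (vshift x (recenter t w)) \<partial>lborel \<partial>P0)"
  proof (rule nn_integral_cong)
    fix w assume "w \<in> space P0"
    then have [measurable]: "(\<lambda>x. path_shift t (vshift x w)) \<in> measurable borel path_space"
      by (intro path_shift_measurable vshift_measurable measurable_const) (auto simp: space_P0)
    have e: "path_shift t (vshift (- w t + x) w) = vshift x (recenter t w)" for x
      by (auto simp: recenter_def vshift_def path_shift_def fun_eq_iff)
    show "(\<integral>\<^sup>+x. f (path_shift t (vshift x w)) \<partial>lborel) = (\<integral>\<^sup>+x. f (vshift x (recenter t w)) \<partial>lborel)"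
      using nn_integral_real_affine[of "\<lambda>x. f (path_shift t (vshift x w))" 1 "- w t"] by (simp add: e del: uminus_add_conv_diff)
  qed
  also have "\<dots> = (\<integral>\<^sup>+x. \<integral>\<^sup>+w. f (vshift x (recenter t w)) \<partial>P0 \<partial>lborel)"
    by (rule PP.Fubini') measurable
  also have "\<dots> = (\<integral>\<^sup>+x. \<integral>\<^sup>+w. f (vshift x w) \<partial>P0 \<partial>lborel)"
    by (intro nn_integral_cong nn_integral_recenter) measurable
  also have "\<dots> = (\<integral>\<^sup>+w. f w \<partial>stationary)"
    by (rule nn_integral_stationary[symmetric]) measurable
  finally show ?thesis .
qed

lemma AE_stationary_reverse_path:
  assumes [measurable]: "Measurable.pred path_space Q" and ae: "AE w in stationary. Q w"
  shows "AE w in stationary. Q (reverse_path w)"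
proof -
  have "AE x in lborel. AE w in P0. Q (vshift x w)" using ae by (simp add: AE_stationary)
  then have "AE x in lborel. AE w in P0. Q (vshift x (reverse_path w))"
  proof eventually_elim
    case (elim x)
    then have "AE w in distr P0 path_space reverse_path. Q (vshift x w)" by (subst distr_P0_reverse_path)
    then show ?case by (rule AE_distrD[rotated]) measurable
  qed
  moreover have "vshift x (reverse_path w) = reverse_path (vshift x w)" for x w by (simp add: vshift_def reverse_path_def)
  ultimately show ?thesis by (subst AE_stationary) auto
qed

end

section \<open>Zero-one law and recurrence\<close>

lemma lborel_integrable_translate:
  fixes f :: "real \<Rightarrow> real"
  shows "integrable lborel f \<Longrightarrow> integrable lborel (\<lambda>x. f (x + h))"
  using lborel_integrable_real_affine[of f 1 h] by (simp add: add.commute)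

lemma lborel_integral_translate:
  fixes f :: "real \<Rightarrow> real"
  shows "(\<integral>x. f (x + h) \<partial>lborel) = (\<integral>x. f x \<partial>lborel)"
  using lborel_integral_real_affine[of 1 f h] by (simp add: add.commute)

definition L1_continuous :: "(real \<Rightarrow> real) \<Rightarrow> bool" where
  "L1_continuous f \<longleftrightarrow> (\<forall>h. h \<longlonglongrightarrow> 0 \<longrightarrow> (\<lambda>n. \<integral>x. \<bar>f (x + h n) - f x\<bar> \<partial>lborel) \<longlonglongrightarrow> 0)"

lemma L1_continuous_approx:
  assumes f: "integrable lborel f"
    and approx: "\<And>e. 0 < e \<Longrightarrow> \<exists>g. integrable lborel g \<and> L1_continuous g \<and> (\<integral>x. \<bar>f x - g x\<bar> \<partial>lborel) \<le> e"
  shows "L1_continuous f"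
  unfolding L1_continuous_def
proof (intro allI impI)
  fix h :: "nat \<Rightarrow> real" assume h: "h \<longlonglongrightarrow> 0"
  show "(\<lambda>n. \<integral>x. \<bar>f (x + h n) - f x\<bar> \<partial>lborel) \<longlonglongrightarrow> 0"
  proof (rule LIMSEQ_I)
    fix r :: real assume "0 < r"
    then obtain g where g: "integrable lborel g" "L1_continuous g" "(\<integral>x. \<bar>f x - g x\<bar> \<partial>lborel) \<le> r / 4"
      using approx[of "r / 4"] by auto
    have "(\<lambda>n. \<integral>x. \<bar>g (x + h n) - g x\<bar> \<partial>lborel) \<longlonglongrightarrow> 0"
      using g(2) h unfolding L1_continuous_def by blast
    then obtain N where N: "\<And>n. N \<le> n \<Longrightarrow> \<bar>\<integral>x. \<bar>g (x + h n) - g x\<bar> \<partial>lborel\<bar> < r / 4"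
      using LIMSEQ_D[of _ 0 "r / 4"] \<open>0 < r\<close> by force
    have "\<bar>\<integral>x. \<bar>f (x + h n) - f x\<bar> \<partial>lborel\<bar> < r" if "N \<le> n" for n
    proof -
      have i: "integrable lborel (\<lambda>x. \<bar>f (x + h n) - g (x + h n)\<bar>)" "integrable lborel (\<lambda>x. \<bar>f x - g x\<bar>)"
        "integrable lborel (\<lambda>x. \<bar>g (x + h n) - g x\<bar>)" "integrable lborel (\<lambda>x. \<bar>f (x + h n) - f x\<bar>)"
        using f g(1) by (auto intro!: lborel_integrable_translate)
      have "(\<integral>x. \<bar>f (x + h n) - f x\<bar> \<partial>lborel)
        \<le> (\<integral>x. \<bar>f (x + h n) - g (x + h n)\<bar> + \<bar>g (x + h n) - g x\<bar> + \<bar>f x - g x\<bar> \<partial>lborel)"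
        using i by (intro integral_mono) auto
      also have "\<dots> = (\<integral>x. \<bar>f (x + h n) - g (x + h n)\<bar> \<partial>lborel) + (\<integral>x. \<bar>g (x + h n) - g x\<bar> \<partial>lborel) + (\<integral>x. \<bar>f x - g x\<bar> \<partial>lborel)"
        using i by simp
      also have "(\<integral>x. \<bar>f (x + h n) - g (x + h n)\<bar> \<partial>lborel) = (\<integral>x. \<bar>f x - g x\<bar> \<partial>lborel)"
        by (rule lborel_integral_translate)
      finally have "(\<integral>x. \<bar>f (x + h n) - f x\<bar> \<partial>lborel) < r" using g(3) N[OF that] \<open>0 < r\<close> by linarith
      moreover have "0 \<le> (\<integral>x. \<bar>f (x + h n) - f x\<bar> \<partial>lborel)" by simp
      ultimately show ?thesis by simp
    qed
    then show "\<exists>no. \<forall>n\<ge>no. norm ((\<integral>x. \<bar>f (x + h n) - f x\<bar> \<partial>lborel) - 0) < r" by auto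
  qed
qed

text \<open>Translation preserves the measure of \<open>U\<close>, so the L1 distance is twice the
  mass that leaves \<open>U\<close>. Points of an open set stay in it under small translations, and
  dominated convergence applies.\<close>

lemma L1_continuous_open:
  assumes U: "open U" "emeasure lborel U < \<infinity>"
  shows "L1_continuous (indicator U)"
  unfolding L1_continuous_def
proof (intro allI impI)
  fix h :: "nat \<Rightarrow> real" assume h: "h \<longlonglongrightarrow> 0"
  have Ub[measurable]: "U \<in> sets borel" using U by simp
  have iU: "integrable lborel (indicator U :: real \<Rightarrow> real)" using U by (intro integrable_real_indicator) auto
  have "(\<lambda>n. \<integral>x. indicator U x * (1 - indicator U (x + h n)) \<partial>lborel) \<longlonglongrightarrow> (\<integral>x. (0::real) \<partial>(lborel :: real measure))"
  proof (rule integral_dominated_convergence[where w="indicator U"])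
    show "AE x in lborel. (\<lambda>n. indicator U x * (1 - indicator U (x + h n)) :: real) \<longlonglongrightarrow> 0"
    proof (rule AE_I2)
      fix x :: real
      show "(\<lambda>n. indicator U x * (1 - indicator U (x + h n)) :: real) \<longlonglongrightarrow> 0"
      proof (cases "x \<in> U")
        case True
        have "(\<lambda>n. x + h n) \<longlonglongrightarrow> x" using tendsto_add[OF tendsto_const[of x] h] by simp
        then have "\<forall>\<^sub>F n in sequentially. x + h n \<in> U" using U(1) True by (rule topological_tendstoD)
        then have "\<forall>\<^sub>F n in sequentially. indicator U x * (1 - indicator U (x + h n)) = (0::real)"
          by eventually_elim simp
        then show ?thesis by (rule tendsto_eventually)
      qed simp
    qed
    show "AE x in lborel. norm (indicator U x * (1 - indicator U (x + h n)) :: real) \<le> indicator U x" for n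
      by (auto simp: indicator_def)
  qed (use iU in simp_all)
  then have lim: "(\<lambda>n. 2 * (\<integral>x. indicator U x * (1 - indicator U (x + h n)) \<partial>lborel)) \<longlonglongrightarrow> (0::real)"
    using tendsto_mult_right_zero by fastforce
  have "(\<integral>x. \<bar>indicator U (x + h n) - indicator U x\<bar> \<partial>lborel) = (2::real) * (\<integral>x. indicator U x * (1 - indicator U (x + h n)) \<partial>lborel)"
    (is "?l = ?r") for n
  proof -
    have i1: "integrable lborel (\<lambda>x. indicator U (x + h n) :: real)" by (rule lborel_integrable_translate[OF iU])
    have i2: "integrable lborel (\<lambda>x. indicator U x * (1 - indicator U (x + h n)) :: real)"
      by (rule Bochner_Integration.integrable_bound[OF iU])
        (use i1 U in \<open>auto simp: indicator_def intro!: borel_measurable_times borel_measurable_diff\<close>)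
    have "?l = (\<integral>x. (indicator U (x + h n) - indicator U x) + 2 * (indicator U x * (1 - indicator U (x + h n))) \<partial>lborel)"
      by (rule Bochner_Integration.integral_cong) (auto simp: indicator_def)
    also have "\<dots> = ((\<integral>x. indicator U (x + h n) \<partial>lborel) - (\<integral>x. indicator U x \<partial>lborel)) + ?r"
      using i1 i2 iU by simp
    also have "(\<integral>x. indicator U (x + h n) \<partial>lborel) = (\<integral>x. indicator U x \<partial>lborel :: real)"
      by (rule lborel_integral_translate)
    finally show ?thesis by simp
  qed
  with lim show "(\<lambda>n. \<integral>x. \<bar>indicator U (x + h n) - indicator U x\<bar> \<partial>lborel) \<longlonglongrightarrow> (0::real)" by simp
qed

text \<open>Outer regularity approximates \<open>A\<close> in L1 by an open set of finite
  measure.\<close>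

lemma L1_continuous_indicator:
  assumes A: "A \<in> sets lborel" "emeasure lborel A < \<infinity>"
  shows "L1_continuous (indicator A)"
proof (rule L1_continuous_approx)
  show "integrable lborel (indicator A :: real \<Rightarrow> real)" using A by (intro integrable_real_indicator) auto
  fix e :: real assume "0 < e"
  then obtain U where U: "open U" "A \<subseteq> U" "emeasure lborel (U - A) < ennreal e"
    using outer_regular_lborel[of A e] A by auto
  have "emeasure lborel U \<le> emeasure lborel A + emeasure lborel (U - A)"
    using A U emeasure_subadditive[of A lborel "U - A"] by (auto simp: Un_absorb1)
  also have "\<dots> < \<infinity>" using A(2) U(3) by (auto simp: less_top[symmetric] ennreal_add_eq_top)
  finally have fin: "emeasure lborel U < \<infinity>" .
  have "(\<integral>x. \<bar>indicator A x - indicator U x\<bar> \<partial>lborel) = (\<integral>x. indicator (U - A) x \<partial>lborel :: real)"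
    using U(2) by (intro Bochner_Integration.integral_cong) (auto simp: indicator_def)
  also have "\<dots> = measure lborel (U - A)" by simp
  also have "\<dots> \<le> e" using U(3) \<open>0 < e\<close> by (simp add: measure_def enn2real_leI)
  finally show "\<exists>g. integrable lborel g \<and> L1_continuous g \<and> (\<integral>x. \<bar>indicator A x - g x\<bar> \<partial>lborel) \<le> e"
    using U(1) fin L1_continuous_open[OF U(1) fin] by (intro exI[of _ "indicator U"]) (auto intro!: integrable_real_indicator)
qed

lemma L1_continuous_integrable:
  fixes f :: "real \<Rightarrow> real" assumes "integrable lborel f" shows "L1_continuous f"
  using assms
proof (induction rule: integrable_induct)
  case (base A c)
  have "L1_continuous (indicator A)" using base by (intro L1_continuous_indicator) auto
  then have *: "\<And>h. h \<longlonglongrightarrow> 0 \<Longrightarrow> (\<lambda>n. \<integral>x. \<bar>indicator A (x + h n) - indicator A x\<bar> \<partial>lborel) \<longlonglongrightarrow> (0::real)"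
    unfolding L1_continuous_def by blast
  show ?case unfolding L1_continuous_def
  proof (intro allI impI)
    fix h :: "nat \<Rightarrow> real" assume "h \<longlonglongrightarrow> 0"
    have "(\<integral>x. \<bar>indicator A (x + h n) *\<^sub>R c - indicator A x *\<^sub>R c\<bar> \<partial>lborel) = \<bar>c\<bar> * (\<integral>x. \<bar>indicator A (x + h n) - indicator A x\<bar> \<partial>lborel)" for n
    proof -
      have "(\<integral>x. \<bar>indicator A (x + h n) *\<^sub>R c - indicator A x *\<^sub>R c\<bar> \<partial>lborel) = (\<integral>x. \<bar>c\<bar> * \<bar>indicator A (x + h n) - indicator A x\<bar> \<partial>lborel)"
        by (intro Bochner_Integration.integral_cong) (auto simp: indicator_def)
      then show ?thesis by simp
    qed
    then show "(\<lambda>n. \<integral>x. \<bar>indicator A (x + h n) *\<^sub>R c - indicator A x *\<^sub>R c\<bar> \<partial>lborel) \<longlonglongrightarrow> 0"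
      using tendsto_mult_right_zero[OF *[OF \<open>h \<longlonglongrightarrow> 0\<close>], of "\<bar>c\<bar>"] by simp
  qed
next
  case (add f g)
  show ?case unfolding L1_continuous_def
  proof (intro allI impI)
    fix h :: "nat \<Rightarrow> real" assume h: "h \<longlonglongrightarrow> 0"
    let ?N = "\<lambda>f n. \<integral>x. \<bar>f (x + h n) - f x\<bar> \<partial>lborel"
    have lim: "(\<lambda>n. ?N f n + ?N g n) \<longlonglongrightarrow> 0"
      using tendsto_add[of "?N f" 0 sequentially "?N g" 0] add h unfolding L1_continuous_def by auto
    show "?N (\<lambda>x. f x + g x) \<longlonglongrightarrow> 0"
    proof (rule real_tendsto_sandwich[OF _ _ tendsto_const lim])
      show "\<forall>\<^sub>F n in sequentially. ?N (\<lambda>x. f x + g x) n \<le> ?N f n + ?N g n"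
      proof (rule always_eventually, rule allI)
        fix n
        have i: "integrable lborel (\<lambda>x. \<bar>f (x + h n) - f x\<bar>)" "integrable lborel (\<lambda>x. \<bar>g (x + h n) - g x\<bar>)"
          using add by (auto intro!: lborel_integrable_translate)
        have "integrable lborel (\<lambda>x. \<bar>f (x + h n) + g (x + h n) - (f x + g x)\<bar>)"
          using lborel_integrable_translate[OF add(1)] lborel_integrable_translate[OF add(2)] add(1,2)
          by (intro integrable_abs Bochner_Integration.integrable_diff Bochner_Integration.integrable_add)
        then have "?N (\<lambda>x. f x + g x) n \<le> (\<integral>x. \<bar>f (x + h n) - f x\<bar> + \<bar>g (x + h n) - g x\<bar> \<partial>lborel)"
          using i by (intro integral_mono) auto
        then show "?N (\<lambda>x. f x + g x) n \<le> ?N f n + ?N g n" using i by simp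
      qed
    qed (auto intro!: always_eventually)
  qed
next
  case (lim f s)
  show ?case
  proof (rule L1_continuous_approx)
    fix e :: real assume "0 < e"
    have "(\<lambda>i. \<integral>x. \<bar>f x - s i x\<bar> \<partial>lborel) \<longlonglongrightarrow> (\<integral>x. 0 \<partial>(lborel :: real measure))"
    proof (rule integral_dominated_convergence[where w="\<lambda>x. 3 * \<bar>f x\<bar>"])
      show "AE x in lborel. (\<lambda>i. \<bar>f x - s i x\<bar>) \<longlonglongrightarrow> 0"
      proof (rule AE_I2)
        fix x :: real
        have "(\<lambda>i. f x - s i x) \<longlonglongrightarrow> f x - f x" by (rule tendsto_diff[OF tendsto_const lim(2)]) simp
        then show "(\<lambda>i. \<bar>f x - s i x\<bar>) \<longlonglongrightarrow> 0" by (simp add: tendsto_rabs_zero)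
      qed
      show "AE x in lborel. norm \<bar>f x - s i x\<bar> \<le> 3 * \<bar>f x\<bar>" for i
        using lim(3)[of _ i] by (intro AE_I2) (fastforce simp: abs_le_iff)
    qed (use lim in auto)
    then obtain i where "\<bar>\<integral>x. \<bar>f x - s i x\<bar> \<partial>lborel\<bar> < e"
      using LIMSEQ_D[of _ 0 e] \<open>0 < e\<close> by fastforce
    then show "\<exists>g. integrable lborel g \<and> L1_continuous g \<and> (\<integral>x. \<bar>f x - g x\<bar> \<partial>lborel) \<le> e"
      using lim by (intro exI[of _ "s i"]) auto
  qed (rule lim)
qed

section \<open>Functions invariant under the heat semigroup, zero-one law and recurrence\<close>

context wiener
begin

text \<open>After rescaling, \<open>u z\<close> is the average of \<open>u (z + r n * w)\<close>
  over a standard normal \<open>w\<close>, where \<open>r n\<close> is the square root of n + 1.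
  Moving \<open>z\<close> from \<open>a\<close> to \<open>b\<close> amounts to shifting the normal
  density by \<open>(b - a) / r n\<close>, which is negligible in L1 for large
  \<open>n\<close>.\<close>

lemma heat_invariant_constant:
  assumes [measurable]: "u \<in> borel_measurable borel" and u1: "\<And>z. u z \<le> (1::ennreal)"
    and inv: "\<And>z n. u z = (\<integral>\<^sup>+w. u (z + w (real (Suc n))) \<partial>P0)"
  shows "u a = u b"
proof -
  have le: "u a \<le> u b" for a b
  proof -
    define r where "r n = sqrt (real (Suc n))" for n
    have scale: "normal_density 0 c (c * w) * c = std_normal_density w" if "c > 0" for c w
      using that by (simp add: normal_density_def real_sqrt_mult power_mult_distrib)
    have r: "r n > 0" "normal_density 0 (r n) (r n * w) * r n = std_normal_density w" for n w
      using scale[of "r n" w] by (simp_all add: r_def)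
    have rep: "u z = (\<integral>\<^sup>+w. ennreal (std_normal_density w) * u (z + r n * w) \<partial>lborel)" for z n
    proof -
      have "u z = (\<integral>\<^sup>+x. ennreal (normal_density 0 (r n) x) * u (z + x) \<partial>lborel)"
        using inv[of z n] nn_integral_eval[of "\<lambda>x. u (z + x)" "real (Suc n)"] by (simp add: r_def)
      also have "\<dots> = ennreal \<bar>r n\<bar> * (\<integral>\<^sup>+w. ennreal (normal_density 0 (r n) (0 + r n * w)) * u (z + (0 + r n * w)) \<partial>lborel)"
        using r(1)[of n] by (intro nn_integral_real_affine) auto
      also have "\<dots> = (\<integral>\<^sup>+w. ennreal \<bar>r n\<bar> * (ennreal (normal_density 0 (r n) (0 + r n * w)) * u (z + (0 + r n * w))) \<partial>lborel)"
        by (intro nn_integral_cmult[symmetric]) measurable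
      also have "\<dots> = (\<integral>\<^sup>+w. ennreal (std_normal_density w) * u (z + r n * w) \<partial>lborel)"
      proof (rule nn_integral_cong)
        fix w
        have "ennreal \<bar>r n\<bar> * ennreal (normal_density 0 (r n) (r n * w)) = ennreal (std_normal_density w)"
          using r(1)[of n] r(2)[of n w] by (simp add: ennreal_mult[symmetric] mult.commute)
        then show "ennreal \<bar>r n\<bar> * (ennreal (normal_density 0 (r n) (0 + r n * w)) * u (z + (0 + r n * w)))
            = ennreal (std_normal_density w) * u (z + r n * w)" by (simp add: mult.assoc[symmetric])
      qed
      finally show ?thesis .
    qed
    define h where "h n = (b - a) / r n" for n
    have "h \<longlonglongrightarrow> 0"
    proof -
      have "filterlim r at_top sequentially" unfolding r_def
        by (intro filterlim_compose[OF sqrt_at_top] filterlim_compose[OF filterlim_real_sequentially filterlim_Suc])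
      then show ?thesis unfolding h_def by (rule real_tendsto_divide_at_top[OF tendsto_const])
    qed
    define e where "e n = (\<integral>x. \<bar>std_normal_density (x + h n) - std_normal_density x\<bar> \<partial>lborel)" for n
    have int: "integrable lborel std_normal_density" by simp
    have "e \<longlonglongrightarrow> 0"
      using L1_continuous_integrable[OF int] \<open>h \<longlonglongrightarrow> 0\<close> unfolding L1_continuous_def e_def by blast
    have step: "u a \<le> u b + ennreal (e n)" for n
    proof -
      have "u a = (\<integral>\<^sup>+w. ennreal (std_normal_density (h n + w)) * u (a + r n * (h n + w)) \<partial>lborel)"
        using rep[of a n] nn_integral_real_affine[of "\<lambda>w. ennreal (std_normal_density w) * u (a + r n * w)" 1 "h n"] by simp
      also have "\<dots> = (\<integral>\<^sup>+w. ennreal (std_normal_density (w + h n)) * u (b + r n * w) \<partial>lborel)"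
      proof -
        have "r n * h n = b - a" using r(1)[of n] by (simp add: h_def)
        then have "a + r n * (h n + w) = b + r n * w" for w by (simp add: distrib_left)
        then show ?thesis by (simp only: add.commute[of "h n"])
      qed
      also have "\<dots> \<le> (\<integral>\<^sup>+w. ennreal (std_normal_density w) * u (b + r n * w)
          + ennreal \<bar>std_normal_density (w + h n) - std_normal_density w\<bar> \<partial>lborel)"
      proof (rule nn_integral_mono)
        fix w
        have "ennreal (std_normal_density (w + h n)) \<le> ennreal (std_normal_density w) + ennreal \<bar>std_normal_density (w + h n) - std_normal_density w\<bar>"
          unfolding ennreal_plus[OF normal_density_nonneg abs_ge_zero, symmetric] by (intro ennreal_leI) linarith
        then have "ennreal (std_normal_density (w + h n)) * u (b + r n * w)
          \<le> (ennreal (std_normal_density w) + ennreal \<bar>std_normal_density (w + h n) - std_normal_density w\<bar>) * u (b + r n * w)"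
          by (rule mult_right_mono) simp
        also have "\<dots> \<le> ennreal (std_normal_density w) * u (b + r n * w) + ennreal \<bar>std_normal_density (w + h n) - std_normal_density w\<bar>"
          using mult_left_mono[OF u1[of "b + r n * w"], of "ennreal \<bar>std_normal_density (w + h n) - std_normal_density w\<bar>"]
          by (simp add: distrib_right add_left_mono)
        finally show "ennreal (std_normal_density (w + h n)) * u (b + r n * w)
          \<le> ennreal (std_normal_density w) * u (b + r n * w) + ennreal \<bar>std_normal_density (w + h n) - std_normal_density w\<bar>" .
      qed
      also have "\<dots> = (\<integral>\<^sup>+w. ennreal (std_normal_density w) * u (b + r n * w) \<partial>lborel)
          + (\<integral>\<^sup>+w. ennreal \<bar>std_normal_density (w + h n) - std_normal_density w\<bar> \<partial>lborel)"
        by (rule nn_integral_add) measurable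
      also have "\<dots> = u b + ennreal (e n)"
        unfolding e_def rep[of b n, symmetric]
        using int lborel_integrable_translate[OF int, of "h n"]
        by (subst nn_integral_eq_integral) (intro integrable_abs Bochner_Integration.integrable_diff | simp)+
      finally show ?thesis .
    qed
    have "(\<lambda>n. u b + ennreal (e n)) \<longlonglongrightarrow> u b + ennreal 0"
      by (intro tendsto_add tendsto_const tendsto_ennrealI \<open>e \<longlonglongrightarrow> 0\<close>)
    then have lim: "(\<lambda>n. u b + ennreal (e n)) \<longlonglongrightarrow> u b" by simp
    show ?thesis by (rule LIMSEQ_le_const[OF lim]) (use step in blast)
  qed
  then show ?thesis by (intro antisym)
qed

lemma markov_expectation:
  assumes [measurable]: "f \<in> borel_measurable path_space" and t: "0 \<le> t"
    and f: "\<And>w. continuous_on UNIV w \<Longrightarrow> f (future_path w) = f w"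
  shows "(\<integral>\<^sup>+w. f (path_shift t (vshift z w)) \<partial>P0) = (\<integral>\<^sup>+w. (\<integral>\<^sup>+w'. f (vshift (z + w t) w') \<partial>P0) \<partial>P0)"
proof -
  have "(\<integral>\<^sup>+w. 1 * f (vshift z (path_shift t w)) \<partial>P0) = (\<integral>\<^sup>+w. 1 * (\<integral>\<^sup>+w'. f (vshift z (vshift (w t) w')) \<partial>P0) \<partial>P0)"
  proof (rule markov_property[of "\<lambda>w. f (vshift z w)" "\<lambda>_. 1" t])
    fix w :: "real \<Rightarrow> real" assume c: "continuous_on UNIV w"
    have "vshift z (future_path w) = future_path (vshift z w)" by (simp add: vshift_def future_path_def)
    then show "f (vshift z (future_path w)) = f (vshift z w)"
      using f[OF continuous_vshift[OF c]] by simp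
  qed (use t in auto)
  moreover have "vshift z (path_shift t w) = path_shift t (vshift z w)"
    "vshift z (vshift (w t) w') = vshift (z + w t) w'" for w w'
    by (auto simp: vshift_def path_shift_def)
  ultimately show ?thesis by simp
qed

lemma vshift_0[simp]: "vshift 0 w = w" by (simp add: vshift_def)

lemma nn_integral_indicator_mult:
  assumes "A \<in> sets M" "B \<in> sets M"
  shows "(\<integral>\<^sup>+x. indicator A x * indicator B x \<partial>M) = emeasure M (A \<inter> B)"
proof -
  have "(\<integral>\<^sup>+x. indicator A x * indicator B x \<partial>M) = (\<integral>\<^sup>+x. indicator (A \<inter> B) x \<partial>M)"
    by (intro nn_integral_cong) (auto simp: indicator_def)
  then show ?thesis using assms by simp
qed

text \<open>By \<open>fJ\<close> the event \<open>J\<close> can be read off from the path after any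
  time \<open>r\<close>, up to null sets. Its probability is thus invariant under the heat semigroup
  and so constant in the starting point, and the Markov property makes \<open>J\<close> independent
  of all cylinders, therefore of itself.\<close>

lemma zero_one_law:
  fixes f :: "(real \<Rightarrow> real) \<Rightarrow> ennreal"
  assumes J[measurable]: "J \<in> sets path_space" and [measurable]: "f \<in> borel_measurable path_space"
    and f: "\<And>w. continuous_on UNIV w \<Longrightarrow> f (future_path w) = f w"
    and fJ: "\<And>z r. 0 \<le> r \<Longrightarrow> AE w in P0. f (path_shift r (vshift z w)) = indicator J (vshift z w)"
  shows "(\<forall>z. AE w in P0. vshift z w \<notin> J) \<or> (\<forall>z. AE w in P0. vshift z w \<in> J)"
proof -
  define u where "u z = (\<integral>\<^sup>+w. indicator J (vshift z w) \<partial>P0)" for z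
  have um[measurable]: "u \<in> borel_measurable borel" unfolding u_def by measurable
  have uf: "(\<integral>\<^sup>+w. f (path_shift r (vshift z w)) \<partial>P0) = u z" if "0 \<le> r" for z r
    unfolding u_def by (intro nn_integral_cong_AE fJ that)
  have uf0: "(\<integral>\<^sup>+w. f (vshift z w) \<partial>P0) = u z" for z
    using uf[of 0 z] by (simp add: path_shift_def)
  have u1: "u z \<le> 1" for z
  proof -
    have "u z \<le> (\<integral>\<^sup>+w. 1 \<partial>P0)" unfolding u_def by (intro nn_integral_mono) (auto simp: indicator_def)
    then show ?thesis by (simp add: emeasure_space_1)
  qed
  have const: "u z = u 0" for z
  proof (rule heat_invariant_constant[OF um u1])
    fix z n
    show "u z = (\<integral>\<^sup>+w. u (z + w (real (Suc n))) \<partial>P0)"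
      using markov_expectation[of f "real (Suc n)" z] f uf[of "real (Suc n)" z] by (simp add: uf0)
  qed
  have indep: "emeasure P0 (F \<inter> J) = u 0 * emeasure P0 F" if "F \<in> path_cylinders" for F
  proof -
    obtain K A where F: "F = {w \<in> space path_space. \<forall>t\<in>K. w t \<in> A t}" and K: "finite K"
      using \<open>F \<in> path_cylinders\<close> unfolding path_cylinders_def by blast
    have Fm[measurable]: "F \<in> sets path_space" using that path_cylinders_sets by blast
    \<comment> \<open>A time beyond all times of the cylinder; 0 is included because the Markov
      property is applied at a nonnegative time.\<close>
    define r where "r = Max (insert 0 K)"
    have r: "0 \<le> r" "\<And>t. t \<in> K \<Longrightarrow> t \<le> r" using K by (auto simp: r_def)
    have "emeasure P0 (F \<inter> J) = (\<integral>\<^sup>+w. indicator F w * indicator J w \<partial>P0)"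
      by (rule nn_integral_indicator_mult[symmetric]) auto
    also have "\<dots> = (\<integral>\<^sup>+w. indicator F w * f (path_shift r w) \<partial>P0)"
    proof (rule nn_integral_cong_AE)
      show "AE w in P0. indicator F w * indicator J w = indicator F w * f (path_shift r w)"
        using fJ[OF r(1), of 0] by eventually_elim simp
    qed
    also have "\<dots> = (\<integral>\<^sup>+w. indicator F w * (\<integral>\<^sup>+w'. f (vshift (w r) w') \<partial>P0) \<partial>P0)"
    proof (rule markov_property)
      fix w :: "real \<Rightarrow> real" assume "continuous_on UNIV w"
      then show "indicator F (stopped_path r w) = (indicator F w :: ennreal)"
        using r(2) continuous_stopped_path[of w r] by (auto simp: F indicator_def stopped_path_def min_def)
    qed (use r f in auto)
    also have "\<dots> = (\<integral>\<^sup>+w. u 0 * indicator F w \<partial>P0)"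
    proof (rule nn_integral_cong)
      fix w
      have "(\<integral>\<^sup>+w'. f (vshift (w r) w') \<partial>P0) = u 0" unfolding uf0 by (rule const)
      then show "indicator F w * (\<integral>\<^sup>+w'. f (vshift (w r) w') \<partial>P0) = u 0 * indicator F w"
        by (simp add: mult.commute)
    qed
    also have "\<dots> = u 0 * emeasure P0 F" by (subst nn_integral_cmult) auto
    finally show ?thesis .
  qed
  \<comment> \<open>Both sides agree on cylinders, hence also on \<open>J\<close> itself, which
    makes \<open>u 0\<close> equal to its square.\<close>
  have "density P0 (indicator J) = scale_measure (u 0) P0"
  proof (rule path_measure_eqI)
    fix F assume F: "F \<in> path_cylinders"
    then have [measurable]: "F \<in> sets path_space" using path_cylinders_sets by blast
    have "emeasure (density P0 (indicator J)) F = (\<integral>\<^sup>+w. indicator J w * indicator F w \<partial>P0)"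
      by (rule emeasure_density) auto
    also have "\<dots> = emeasure P0 (F \<inter> J)"
      by (subst nn_integral_indicator_mult) (simp_all add: Int_commute)
    finally show "emeasure (density P0 (indicator J)) F = emeasure (scale_measure (u 0) P0) F"
      by (simp add: indep[OF F])
  next
    have "emeasure (density P0 (indicator J)) (space P0) = (\<integral>\<^sup>+w. indicator J w * indicator (space P0) w \<partial>P0)"
      by (rule emeasure_density[OF _ sets.top]) auto
    also have "\<dots> \<le> (\<integral>\<^sup>+w. 1 \<partial>P0)" by (intro nn_integral_mono) (auto simp: indicator_def)
    also have "\<dots> = 1" by (simp add: emeasure_space_1)
    finally show "emeasure (density P0 (indicator J)) (space path_space) \<noteq> \<infinity>" by (auto simp: space_P0 top_unique)
  qed auto
  then have "emeasure (density P0 (indicator J)) J = u 0 * emeasure P0 J" by simp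
  moreover have "emeasure (density P0 (indicator J)) J = emeasure P0 J"
  proof -
    have "emeasure (density P0 (indicator J)) J = (\<integral>\<^sup>+w. indicator J w * indicator J w \<partial>P0)"
      by (rule emeasure_density) auto
    also have "\<dots> = (\<integral>\<^sup>+w. indicator J w \<partial>P0)" by (intro nn_integral_cong) (auto simp: indicator_def)
    finally show ?thesis by simp
  qed
  moreover have "emeasure P0 J = u 0" by (simp add: u_def)
  ultimately have "u 0 = u 0 * u 0" by simp
  moreover have "u 0 < \<infinity>" using u1[of 0] by (auto intro: le_less_trans)
  ultimately have "u 0 = 0 \<or> u 0 = 1"
    by (cases "u 0") (auto simp: ennreal_mult[symmetric])
  then show ?thesis
  proof
    assume "u 0 = 0"
    then have "u z = 0" for z unfolding const[of z] .
    then have "AE w in P0. indicator J (vshift z w) = (0::ennreal)" for z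
      unfolding u_def by (subst (asm) nn_integral_0_iff_AE) measurable
    then have "AE w in P0. vshift z w \<notin> J" for z by (simp add: indicator_eq_0_iff)
    then show ?thesis by blast
  next
    assume "u 0 = 1"
    then have 1: "u z = 1" for z unfolding const[of z] .
    have "AE w in P0. vshift z w \<in> J" for z
    proof -
      have S: "{w \<in> space P0. vshift z w \<in> J} \<in> sets P0" by measurable
      have "u z = emeasure P0 {w \<in> space P0. vshift z w \<in> J}"
        unfolding u_def nn_integral_indicator[OF S, symmetric]
        by (intro nn_integral_cong) (auto simp: indicator_def)
      then have "emeasure P0 {w \<in> space P0. vshift z w \<in> J} = 1" using 1 by simp
      then show ?thesis using AE_in_set_eq_1[OF S] by (simp add: emeasure_eq_measure)
    qed
    then show ?thesis by blast
  qed
qed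

text \<open>
  Brownian motion is recurrent: the probability that it is near a given compact set at time \<open>n\<close> is
  of order at least \<open>1/n\<close>, and the harmonic series diverges.
\<close>

lemma stationary_null_of_summable:
  assumes [measurable]: "f \<in> borel_measurable path_space"
    and f: "\<And>w. continuous_on UNIV w \<Longrightarrow> f (future_path w) = f w"
    and sum: "(\<Sum>n. \<integral>\<^sup>+w. f (path_shift (real (Suc n)) w) \<partial>P0) < \<infinity>"
  shows "AE w in stationary. f w = 0"
proof -
  define u where "u z = (\<integral>\<^sup>+w. f (vshift z w) \<partial>P0)" for z
  have [measurable]: "u \<in> borel_measurable borel" unfolding u_def by measurable
  have eq: "(\<integral>\<^sup>+w. f (path_shift (real (Suc n)) w) \<partial>P0) = (\<integral>\<^sup>+x. ennreal (normal_density 0 (sqrt (real (Suc n))) x) * u x \<partial>lborel)" for n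
  proof -
    have "(\<integral>\<^sup>+w. f (path_shift (real (Suc n)) (vshift 0 w)) \<partial>P0) = (\<integral>\<^sup>+w. u (0 + w (real (Suc n))) \<partial>P0)"
      unfolding u_def using f by (intro markov_expectation) auto
    also have "\<dots> = (\<integral>\<^sup>+x. ennreal (normal_density 0 (sqrt (real (Suc n))) x) * u x \<partial>lborel)"
      using nn_integral_eval[of u "real (Suc n)"] by simp
    finally show ?thesis by simp
  qed
  have zero: "AE x in lborel. \<bar>x\<bar> \<le> K \<longrightarrow> u x = 0" for K :: real
  proof -
    define I where "I = (\<integral>\<^sup>+x. indicator {-K..K} x * u x \<partial>lborel)"
    \<comment> \<open>For |x| \<le> K the normal density of variance m = n + 1 is at least
      exp(-K^2/2)/sqrt(2 pi m), and sqrt m \<le> m turns this into the bound c/m of harmonic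
      order.\<close>
    define c where "c = exp (- (K\<^sup>2 / 2)) / sqrt (2 * pi)"
    have c: "0 < c" by (simp add: c_def)
    have dens: "c / real (Suc n) \<le> normal_density 0 (sqrt (real (Suc n))) x" if "\<bar>x\<bar> \<le> K" for x n
    proof -
      define m where "m = real (Suc n)"
      have m: "1 \<le> m" by (simp add: m_def)
      have "x\<^sup>2 \<le> K\<^sup>2" using power_mono[OF that, of 2] by simp
      then have "x\<^sup>2 / (2 * m) \<le> K\<^sup>2 / 2" using m by (intro frac_le) simp_all
      then have e: "exp (- (K\<^sup>2 / 2)) \<le> exp (- (x\<^sup>2 / (2 * m)))" by simp
      have "m * 1 \<le> m * m" using m by (intro mult_left_mono) simp_all
      then have "sqrt m \<le> m" using m by (intro real_le_lsqrt) (simp_all add: power2_eq_square)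
      then have "sqrt (2 * pi) * sqrt m \<le> sqrt (2 * pi) * m" by (intro mult_left_mono) simp_all
      then have s: "sqrt (2 * pi * m) \<le> sqrt (2 * pi) * m" by (simp only: real_sqrt_mult)
      have "c / m = exp (- (K\<^sup>2 / 2)) / (sqrt (2 * pi) * m)" by (simp add: c_def)
      also have "\<dots> \<le> exp (- (x\<^sup>2 / (2 * m))) / sqrt (2 * pi * m)"
        using e s m by (intro frac_le) simp_all
      also have "\<dots> = normal_density 0 (sqrt m) x" using m by (simp add: normal_density_def)
      finally show ?thesis unfolding m_def .
    qed
    have "(\<Sum>n. ennreal (c / real (Suc n)) * I) \<le> (\<Sum>n. \<integral>\<^sup>+w. f (path_shift (real (Suc n)) w) \<partial>P0)"
    proof (rule suminf_le[OF _ summableI summableI])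
      fix n
      have "ennreal (c / real (Suc n)) * I = (\<integral>\<^sup>+x. ennreal (c / real (Suc n)) * (indicator {-K..K} x * u x) \<partial>lborel)"
        unfolding I_def by (rule nn_integral_cmult[symmetric]) measurable
      also have "\<dots> \<le> (\<integral>\<^sup>+x. ennreal (normal_density 0 (sqrt (real (Suc n))) x) * u x \<partial>lborel)"
        using dens[of _ n] by (intro nn_integral_mono) (auto simp: indicator_def intro!: mult_right_mono ennreal_leI)
      finally show "ennreal (c / real (Suc n)) * I \<le> (\<integral>\<^sup>+w. f (path_shift (real (Suc n)) w) \<partial>P0)" unfolding eq .
    qed
    then have "(\<Sum>n. ennreal (c / real (Suc n))) * I < \<infinity>"
      using sum by (simp add: ennreal_suminf_multc order_le_less_trans)
    moreover have "(\<Sum>n. ennreal (c / real (Suc n))) = \<infinity>"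
    proof (rule ccontr)
      assume "\<not> ?thesis"
      then have "summable (\<lambda>n. c / real (Suc n))"
        using c by (intro summable_suminf_not_top) auto
      then have "summable (\<lambda>n. 1 / c * (c / real (Suc n)))" by (rule summable_mult)
      moreover have "1 / c * (c / real (Suc n)) = inverse (real (Suc n))" for n
        using c by (simp add: inverse_eq_divide del: of_nat_Suc)
      ultimately have "summable (\<lambda>n. inverse (real (Suc n)))" by (simp only:)
      then show False using not_summable_harmonic[where 'a=real]
        unfolding summable_Suc_iff[of "\<lambda>n. inverse (real n)"] by blast
    qed
    ultimately have "I = 0" by (cases "I = 0") (simp_all add: ennreal_top_mult)
    then have "AE x in lborel. indicator {-K..K} x * u x = 0"
      unfolding I_def by (subst (asm) nn_integral_0_iff_AE) measurable
    then show ?thesis by eventually_elim (auto simp: indicator_def)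
  qed
  have "AE x in lborel. \<forall>k::nat. \<bar>x\<bar> \<le> real k \<longrightarrow> u x = 0"
    unfolding AE_all_countable using zero by blast
  then have "AE x in lborel. u x = 0"
  proof eventually_elim
    case (elim x)
    obtain k :: nat where "\<bar>x\<bar> \<le> real k" using real_arch_simple by blast
    with elim show ?case by blast
  qed
  then have "AE x in lborel. AE w in P0. f (vshift x w) = 0"
  proof eventually_elim
    case (elim x)
    then show ?case unfolding u_def by (subst (asm) nn_integral_0_iff_AE) measurable
  qed
  then show ?thesis by (subst AE_stationary) measurable
qed

end

section \<open>Local time as a limit of occupation times\<close>

text \<open>The sign makes the increments additive for end points in any order, so that
  \<open>occupation\<close> is a cocycle over the whole line.\<close>

definition signed_Ioc :: "real \<Rightarrow> real \<Rightarrow> real \<Rightarrow> real" where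
  "signed_Ioc a b s = indicator {a<..b} s - indicator {b<..a} s"

definition occupation :: "real \<Rightarrow> (real \<Rightarrow> real) \<Rightarrow> real \<Rightarrow> real \<Rightarrow> real" where
  "occupation e w a b = (\<integral>s. signed_Ioc a b s * indicator {-e..e} (w s) \<partial>lborel) / (2 * e)"

lemma signed_Ioc_measurable[measurable]: "signed_Ioc a b \<in> borel_measurable borel"
  unfolding signed_Ioc_def[abs_def] by measurable

lemma signed_Ioc_add: "signed_Ioc a b s + signed_Ioc b c s = signed_Ioc a c s"
  by (auto simp: signed_Ioc_def indicator_def)

lemma signed_Ioc_bound: "\<bar>signed_Ioc a b s * indicator A x\<bar> \<le> indicator {min a b..max a b} s"
  by (auto simp: signed_Ioc_def indicator_def)

lemma continuous_borel_measurable: "continuous_on UNIV w \<Longrightarrow> (w :: real \<Rightarrow> real) \<in> borel_measurable borel"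
  by (rule borel_measurable_continuous_onI)

lemma occupation_integrable:
  fixes w :: "real \<Rightarrow> real"
  assumes "continuous_on UNIV w"
  shows "integrable lborel (\<lambda>s. signed_Ioc a b s * indicator {-e..e} (w s))"
proof (rule Bochner_Integration.integrable_bound)
  show "integrable lborel (indicator {min a b..max a b} :: real \<Rightarrow> real)" by (intro integrable_real_indicator) auto
  note continuous_borel_measurable[OF assms, measurable]
  show "(\<lambda>s. signed_Ioc a b s * indicator {-e..e} (w s)) \<in> borel_measurable lborel" by measurable
  show "AE s in lborel. norm (signed_Ioc a b s * indicator {-e..e} (w s)) \<le> norm (indicator {min a b..max a b} s :: real)"
    using signed_Ioc_bound[of a b _ "{-e..e}"] by (intro AE_I2) simp
qed

lemma occupation_add:
  assumes "continuous_on UNIV w"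
  shows "occupation e w a b + occupation e w b c = occupation e w a c"
  unfolding occupation_def
  by (simp add: add_divide_distrib[symmetric] Bochner_Integration.integral_add[OF occupation_integrable[OF assms] occupation_integrable[OF assms], symmetric]
      distrib_right[symmetric] signed_Ioc_add)

lemma occupation_self: "occupation e w a a = 0"
  by (simp add: occupation_def signed_Ioc_def)

lemma occupation_path_shift: "occupation e (path_shift t w) a b = occupation e w (t + a) (t + b)"
proof -
  have "(\<integral>s. signed_Ioc (t + a) (t + b) s * indicator {-e..e} (w s) \<partial>lborel)
    = (\<integral>s. signed_Ioc (t + a) (t + b) (s + t) * indicator {-e..e} (w (s + t)) \<partial>lborel)"
    by (rule lborel_integral_translate[symmetric])
  also have "\<dots> = (\<integral>s. signed_Ioc a b s * indicator {-e..e} (w (t + s)) \<partial>lborel)"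
    by (intro Bochner_Integration.integral_cong) (auto simp: signed_Ioc_def indicator_def add.commute)
  finally show ?thesis by (simp add: occupation_def path_shift_def)
qed

lemma occupation_reverse_path:
  assumes c: "continuous_on UNIV w"
  shows "occupation e (reverse_path w) a b = - occupation e w (- a) (- b)"
proof -
  have "(\<integral>s. signed_Ioc (- a) (- b) s * indicator {-e..e} (w s) \<partial>lborel)
    = (\<integral>s. signed_Ioc (- a) (- b) (- s) * indicator {-e..e} (w (- s)) \<partial>lborel)"
    using lborel_integral_real_affine[of "-1" "\<lambda>s. signed_Ioc (- a) (- b) s * indicator {-e..e} (w s)" 0] by simp
  also have "\<dots> = (\<integral>s. - (signed_Ioc a b s * indicator {-e..e} (w (- s))) \<partial>lborel)"
  proof (rule integral_cong_AE)
    have [measurable]: "(\<lambda>s. w (- s)) \<in> borel_measurable borel"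
      using continuous_borel_measurable[OF continuous_reverse_path[OF c]] by (simp add: reverse_path_def)
    show "(\<lambda>s. signed_Ioc (- a) (- b) (- s) * indicator {-e..e} (w (- s))) \<in> borel_measurable lborel"
      "(\<lambda>s. - (signed_Ioc a b s * indicator {-e..e} (w (- s)))) \<in> borel_measurable lborel" by measurable
    show "AE s in lborel. signed_Ioc (- a) (- b) (- s) * indicator {-e..e} (w (- s)) = - (signed_Ioc a b s * indicator {-e..e} (w (- s)))"
      using AE_lborel_singleton[of a] AE_lborel_singleton[of b]
      by eventually_elim (auto simp: signed_Ioc_def indicator_def)
  qed
  finally show ?thesis by (simp add: occupation_def reverse_path_def)
qed

lemma occupation_nonneg: "a \<le> b \<Longrightarrow> 0 < e \<Longrightarrow> 0 \<le> occupation e w a b"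
  unfolding occupation_def signed_Ioc_def
  by (intro divide_nonneg_pos Bochner_Integration.integral_nonneg) (auto simp: indicator_def)

lemma occupation_mono:
  assumes "continuous_on UNIV w" "a \<le> b" "0 < e"
  shows "occupation e w c a \<le> occupation e w c b"
  using occupation_add[OF assms(1), of e c a b] occupation_nonneg[OF assms(2,3), of w] by linarith

lemma occupation_lipschitz:
  assumes c: "continuous_on UNIV w" and e: "0 < e"
  shows "\<bar>occupation e w c a - occupation e w c b\<bar> \<le> \<bar>a - b\<bar> / (2 * e)"
proof -
  have *: "occupation e w a b \<le> (b - a) / (2 * e)" if "a \<le> b" for a b
  proof -
    have "(\<integral>s. signed_Ioc a b s * indicator {-e..e} (w s) \<partial>lborel) \<le> (\<integral>s. indicator {min a b..max a b} s \<partial>lborel)"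
    proof (rule integral_mono)
      show "integrable lborel (\<lambda>s. signed_Ioc a b s * indicator {-e..e} (w s))" by (rule occupation_integrable[OF c])
      show "integrable lborel (indicator {min a b..max a b} :: real \<Rightarrow> real)" by (intro integrable_real_indicator) auto
      show "signed_Ioc a b s * indicator {-e..e} (w s) \<le> indicator {min a b..max a b} s" for s
        by (rule abs_le_D1[OF signed_Ioc_bound])
    qed
    also have "\<dots> = b - a" using that by simp
    finally show ?thesis unfolding occupation_def using e by (intro divide_right_mono) auto
  qed
  show ?thesis
  proof (cases "a \<le> b")
    case True
    then show ?thesis using *[OF True] occupation_add[OF c, of e c a b] occupation_nonneg[OF True e, of w]
      by (simp add: abs_if)
  next
    case False
    then have "b \<le> a" by simp
    then show ?thesis using *[of b a] occupation_add[OF c, of e c b a] occupation_nonneg[OF \<open>b \<le> a\<close> e, of w]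
      by (simp add: abs_if)
  qed
qed

lemma occupation_continuous:
  assumes "continuous_on UNIV w" "0 < e"
  shows "continuous_on UNIV (occupation e w c)"
proof -
  have "(1 / (2 * e))-lipschitz_on UNIV (occupation e w c)"
  proof (rule lipschitz_onI)
    fix a b
    show "dist (occupation e w c a) (occupation e w c b) \<le> 1 / (2 * e) * dist a b"
      using occupation_lipschitz[OF assms, of c a b] by (simp add: dist_real_def)
  qed (use assms(2) in simp)
  then show ?thesis by (rule lipschitz_on_continuous_on)
qed

lemma occupation_measurable[measurable]: "(\<lambda>w. occupation e w a b) \<in> borel_measurable path_space"
proof -
  have [measurable]: "(\<lambda>z. fst z (snd z)) \<in> borel_measurable (path_space \<Otimes>\<^sub>M borel)"
    by (rule measurable_path_space_eval) measurable
  have "(\<lambda>(w, s). signed_Ioc a b s * indicator {-e..e} (w s)) \<in> borel_measurable (path_space \<Otimes>\<^sub>M lborel)"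
    unfolding case_prod_beta' by measurable
  then show ?thesis unfolding occupation_def
    by (intro borel_measurable_divide lborel.borel_measurable_lebesgue_integral) auto
qed

section \<open>The canonical local time\<close>

definition occupation_regular :: "(nat \<Rightarrow> real) \<Rightarrow> (real \<Rightarrow> real) \<Rightarrow> bool" where
  "occupation_regular \<epsilon> w \<longleftrightarrow> (\<forall>n::nat. uniformly_Cauchy_on {- real n..real n} (\<lambda>k. occupation (\<epsilon> k) w 0))"

text \<open>On regular paths the limit is locally uniform and therefore continuous in time. The
  value 0 on all other paths makes this a distribution function for every continuous path, so that
  the rules for shift and reversal hold without exceptional sets.\<close>

definition local_time_fun :: "(nat \<Rightarrow> real) \<Rightarrow> (real \<Rightarrow> real) \<Rightarrow> real \<Rightarrow> real" where
  "local_time_fun \<epsilon> w t = (if occupation_regular \<epsilon> w then lim (\<lambda>k. occupation (\<epsilon> k) w 0 t) else 0)"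

lemma rational_approx_Icc:
  assumes "t \<in> {- real n..real n}"
  obtains q where "\<And>i. q i \<in> \<rat>" "\<And>i::nat. q i \<in> {- real n..real n}" "q \<longlonglongrightarrow> t"
proof -
  have "\<exists>q\<in>\<rat>. q \<in> {- real n..real n} \<and> \<bar>q - t\<bar> < 1 / real (Suc i)" for i
  proof (cases "t = real n")
    case True
    then show ?thesis by (intro bexI[of _ t]) auto
  next
    case False
    then have "t < min (real n) (t + 1 / real (Suc i))" using assms by auto
    then obtain q where "q \<in> \<rat>" "t < q" "q < min (real n) (t + 1 / real (Suc i))" using Rats_dense_in_real by blast
    then show ?thesis using assms by (intro bexI[of _ q]) auto
  qed
  then obtain q where q: "\<And>i. q i \<in> \<rat>" "\<And>i. q i \<in> {- real n..real n}" "\<And>i. \<bar>q i - t\<bar> < 1 / real (Suc i)"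
    by metis
  have "q \<longlonglongrightarrow> t"
  proof (rule LIM_zero_cancel, rule Lim_null_comparison)
    show "\<forall>\<^sub>F i in sequentially. norm (q i - t) \<le> 1 / real (Suc i)" using q(3) less_imp_le by (intro always_eventually) auto
    show "(\<lambda>i. 1 / real (Suc i)) \<longlonglongrightarrow> 0" by (rule LIMSEQ_Suc[OF lim_1_over_n])
  qed
  with q that show ?thesis by blast
qed

lemma pred_Ball_countable:
  assumes "countable X" "\<And>i. i \<in> X \<Longrightarrow> Measurable.pred M (P i)"
  shows "Measurable.pred M (\<lambda>x. \<forall>i\<in>X. P i x)"
proof -
  have "{x \<in> space M. \<forall>i\<in>X. P i x} = space M - (\<Union>i\<in>X. {x \<in> space M. \<not> P i x})" by auto
  moreover have "{x \<in> space M. \<not> P i x} \<in> sets M" if "i \<in> X" for i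
    using assms(2)[OF that] by measurable
  ultimately have "{x \<in> space M. \<forall>i\<in>X. P i x} \<in> sets M"
    using assms(1) by (auto intro!: sets.countable_UN')
  then show ?thesis by (simp add: Measurable.pred_def)
qed

locale occupation_scale =
  fixes \<epsilon> :: "nat \<Rightarrow> real"
  assumes eps_pos: "\<And>k. 0 < \<epsilon> k" and eps_lim: "\<epsilon> \<longlonglongrightarrow> 0"
begin

abbreviation "occ k w \<equiv> occupation (\<epsilon> k) w"
abbreviation "reg \<equiv> occupation_regular \<epsilon>"
abbreviation "ltime \<equiv> local_time_fun \<epsilon>"

lemma regular_limit: "reg w \<Longrightarrow> (\<lambda>k. occ k w 0 t) \<longlonglongrightarrow> ltime w t"
proof -
  assume r: "reg w"
  obtain n :: nat where "\<bar>t\<bar> \<le> real n" using real_arch_simple by blast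
  then have "t \<in> {- real n..real n}" by auto
  moreover have "uniformly_Cauchy_on {- real n..real n} (\<lambda>k. occ k w 0)"
    using r unfolding occupation_regular_def by blast
  ultimately have "Cauchy (\<lambda>k. occ k w 0 t)" by (intro uniformly_Cauchy_imp_Cauchy)
  then show ?thesis using r by (simp add: local_time_fun_def Cauchy_convergent_iff convergent_LIMSEQ_iff)
qed

lemma regular_cocycle:
  assumes "continuous_on UNIV w" "reg w"
  shows "(\<lambda>k. occ k w a b) \<longlonglongrightarrow> ltime w b - ltime w a"
proof -
  have "occ k w a b = occ k w 0 b - occ k w 0 a" for k
    using occupation_add[OF assms(1), of "\<epsilon> k" 0 a b] by simp
  then show ?thesis using tendsto_diff[OF regular_limit[OF assms(2)] regular_limit[OF assms(2)], of b a] by simp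
qed

lemma not_regular: "\<not> reg w \<Longrightarrow> ltime w t = 0"
  by (simp add: local_time_fun_def)

lemma ltime_unique: "reg w \<Longrightarrow> (\<lambda>k. occ k w 0 t) \<longlonglongrightarrow> x \<Longrightarrow> ltime w t = x"
  using LIMSEQ_unique regular_limit by blast

lemma ltime_zero: "ltime w 0 = 0"
proof (cases "reg w")
  case True then show ?thesis by (intro ltime_unique) (auto simp: occupation_self)
qed (simp add: not_regular)

lemma distribution_function_ltime:
  assumes c: "continuous_on UNIV w"
  shows "distribution_function (ltime w)"
proof (cases "reg w")
  case True
  have "mono (ltime w)"
  proof (rule monoI)
    fix a b :: real assume "a \<le> b"
    then show "ltime w a \<le> ltime w b"
      using occupation_mono[OF c \<open>a \<le> b\<close> eps_pos]
      by (intro LIMSEQ_le[OF regular_limit[OF True, of a] regular_limit[OF True, of b]]) auto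
  qed
  moreover have "continuous_on UNIV (ltime w)"
  proof -
    have "isCont (ltime w) t" for t
    proof -
      obtain n :: nat where n: "\<bar>t\<bar> < real n" using reals_Archimedean2 by blast
      have "uniformly_convergent_on {- real n..real n} (\<lambda>k. occ k w 0)"
        using True unfolding occupation_regular_def by (intro Cauchy_uniformly_convergent) auto
      then have "uniform_limit {- real n..real n} (\<lambda>k. occ k w 0) (\<lambda>x. lim (\<lambda>k. occ k w 0 x)) sequentially"
        by (simp add: uniformly_convergent_uniform_limit_iff)
      then have "continuous_on {- real n..real n} (\<lambda>x. lim (\<lambda>k. occ k w 0 x))"
        by (rule uniform_limit_theorem[rotated])
          (auto intro!: always_eventually continuous_on_subset[OF occupation_continuous[OF c eps_pos]])
      then have "continuous_on {- real n..real n} (ltime w)"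
        by (rule continuous_on_eq) (simp add: local_time_fun_def True)
      then have "continuous_on {- real n<..<real n} (ltime w)" by (rule continuous_on_subset) auto
      moreover have "t \<in> {- real n<..<real n}" using n by auto
      ultimately show ?thesis using continuous_on_eq_continuous_at open_greaterThanLessThan by blast
    qed
    then show ?thesis by (intro continuous_at_imp_continuous_on) blast
  qed
  ultimately show ?thesis by (simp add: distribution_function_def)
next
  case False
  then have "ltime w = (\<lambda>_. 0)" by (auto simp: not_regular)
  then show ?thesis by (auto simp: distribution_function_def mono_def)
qed

text \<open>Occupation times are continuous in time, so uniform closeness may be tested at rational
  times; this exhibits regularity as a measurable property.\<close>

lemma regular_rational_iff:
  assumes c: "continuous_on UNIV w"
  shows "reg w \<longleftrightarrow> (\<forall>n j. \<exists>M. \<forall>m\<ge>M. \<forall>k\<ge>M. \<forall>q\<in>\<rat>. q \<in> {- real n..real n} \<longrightarrow>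
    \<bar>occ m w 0 q - occ k w 0 q\<bar> \<le> 1 / real (Suc j))" (is "_ \<longleftrightarrow> ?R")
proof
  assume r: "reg w"
  show ?R
  proof (intro allI)
    fix n j :: nat
    have "0 < 1 / real (Suc j)" by simp
    then obtain M where M: "\<forall>x\<in>{- real n..real n}. \<forall>m\<ge>M. \<forall>k\<ge>M. dist (occ m w 0 x) (occ k w 0 x) < 1 / real (Suc j)"
      using r[unfolded occupation_regular_def uniformly_Cauchy_on_def, rule_format, of "1 / real (Suc j)" n] by auto
    show "\<exists>M. \<forall>m\<ge>M. \<forall>k\<ge>M. \<forall>q\<in>\<rat>. q \<in> {- real n..real n} \<longrightarrow> \<bar>occ m w 0 q - occ k w 0 q\<bar> \<le> 1 / real (Suc j)"
    proof (intro exI[of _ M] allI impI ballI)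
      fix m k q assume "M \<le> m" "M \<le> k" "q \<in> {- real n..real n}"
      then have "dist (occ m w 0 q) (occ k w 0 q) < 1 / real (Suc j)" using M by simp
      then show "\<bar>occ m w 0 q - occ k w 0 q\<bar> \<le> 1 / real (Suc j)" unfolding dist_real_def by (rule less_imp_le)
    qed
  qed
next
  assume R: ?R
  show "reg w" unfolding occupation_regular_def uniformly_Cauchy_on_def
  proof (intro allI impI)
    fix n :: nat and e :: real assume "0 < e"
    then obtain j where j: "1 / real (Suc j) < e" using nat_approx_posE by blast
    obtain M where "\<forall>m\<ge>M. \<forall>k\<ge>M. \<forall>q\<in>\<rat>. q \<in> {- real n..real n} \<longrightarrow> \<bar>occ m w 0 q - occ k w 0 q\<bar> \<le> 1 / real (Suc j)"
      using R[rule_format, of n j] by (elim exE)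
    note M = this[rule_format]
    have "dist (occ m w 0 x) (occ k w 0 x) < e" if x: "x \<in> {- real n..real n}" and mk: "m \<ge> M" "k \<ge> M" for x m k
    proof -
      obtain q where q: "\<And>i. q i \<in> \<rat>" "\<And>i::nat. q i \<in> {- real n..real n}" "q \<longlonglongrightarrow> x" using rational_approx_Icc[OF x] by blast
      have t: "(\<lambda>i. occ m w 0 (q i)) \<longlonglongrightarrow> occ m w 0 x" for m
        using continuous_on_tendsto_compose[OF occupation_continuous[OF c eps_pos[of m], of 0] q(3)] by simp
      have "(\<lambda>i. \<bar>occ m w 0 (q i) - occ k w 0 (q i)\<bar>) \<longlonglongrightarrow> \<bar>occ m w 0 x - occ k w 0 x\<bar>"
        by (intro tendsto_rabs tendsto_diff t)
      then have "\<bar>occ m w 0 x - occ k w 0 x\<bar> \<le> 1 / real (Suc j)"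
        by (rule LIMSEQ_le_const2) (use M[OF mk q(1,2)] in auto)
      then show ?thesis using j by (simp add: dist_real_def)
    qed
    then show "\<exists>M. \<forall>x\<in>{- real n..real n}. \<forall>m\<ge>M. \<forall>k\<ge>M. dist (occ m w 0 x) (occ k w 0 x) < e"
      by (intro exI[of _ M] ballI allI impI)
  qed
qed

lemma regular_measurable[measurable]: "Measurable.pred path_space reg"
proof -
  let ?R = "\<lambda>w. \<forall>n j. \<exists>M. \<forall>m\<ge>M. \<forall>k\<ge>M. \<forall>q\<in>\<rat>. q \<in> {- real n..real n} \<longrightarrow>
    \<bar>occ m w 0 q - occ k w 0 q\<bar> \<le> 1 / real (Suc j)"
  have "Measurable.pred path_space (\<lambda>w. \<bar>occ m w 0 q - occ k w 0 q\<bar> \<le> 1 / real (Suc j))" for m k q j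
    by measurable
  then have "Measurable.pred path_space ?R"
    by (intro pred_intros_countable pred_Ball_countable[OF countable_rat] pred_intros_imp')
  moreover have "reg w \<longleftrightarrow> ?R w" if "w \<in> space path_space" for w
    using that by (intro regular_rational_iff) simp
  ultimately show ?thesis using measurable_cong[of path_space reg ?R "count_space UNIV"] by blast
qed

lemma ltime_measurable[measurable]: "ltime \<in> measurable path_space path_space"
proof (rule measurable_path_spaceI)
  show "continuous_on UNIV (ltime w)" if "w \<in> space path_space" for w
    using distribution_function_ltime[of w] that by (simp add: distribution_function_def)
  have "(\<lambda>w. if reg w then occ k w 0 t else 0) \<in> borel_measurable path_space" for k t by measurable
  then have "(\<lambda>w. lim (\<lambda>k. if reg w then occ k w 0 t else 0)) \<in> borel_measurable path_space" for t
    by (rule borel_measurable_lim_metric)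
  moreover have "lim (\<lambda>k. if reg w then occ k w 0 t else 0) = ltime w t" for w t by (simp add: local_time_fun_def)
  ultimately show "(\<lambda>w. ltime w t) \<in> borel_measurable path_space" for t by simp
qed

text \<open>A Polya type argument: convergence of monotone functions to a continuous limit is locally uniform.\<close>

lemma regularI:
  assumes c: "continuous_on UNIV w" and G: "distribution_function G"
    and lim: "\<And>q. q \<in> \<rat> \<Longrightarrow> (\<lambda>k. occ k w 0 q) \<longlonglongrightarrow> G q"
  shows "reg w" "ltime w = G"
proof -
  have unif: "uniform_limit {- real n..real n} (\<lambda>k. occ k w 0) G sequentially" for n
  proof (rule uniform_limitI)
    fix e :: real assume "0 < e"
    \<comment> \<open>The interval is enlarged by 1, as the grid neighbours of a point near the
      boundary may lie outside.\<close>
    have "uniformly_continuous_on {- real n - 1..real n + 1} G"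
      by (intro compact_uniformly_continuous distribution_functionD(2)[OF G]) auto
    then obtain d where d: "0 < d" "\<And>x y. x \<in> {- real n - 1..real n + 1} \<Longrightarrow> y \<in> {- real n - 1..real n + 1} \<Longrightarrow> dist y x < d \<Longrightarrow> dist (G y) (G x) < e / 2"
      unfolding uniformly_continuous_on_def using \<open>0 < e\<close> by (metis half_gt_zero)
    define d' where "d' = min d 1"
    have d': "0 < d'" "d' \<le> 1" "d' \<le> d" using d(1) by (auto simp: d'_def)
    define r where "r = real_of_rat (SOME r. 0 < r \<and> of_rat r < d' / 2)"
    obtain r0 where "r0 \<in> \<rat>" "0 < r0" "r0 < d' / 2" using Rats_dense_in_real[of 0 "d' / 2"] d' by auto
    \<comment> \<open>A finite grid of rational mesh below \<open>d' / 2\<close>, to which the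
      pointwise hypothesis applies; monotonicity transfers the estimate to the points in
      between.\<close>
    define Q where "Q = (\<lambda>i::int. of_int i * r0) ` {\<lfloor>(- real n - 1) / r0\<rfloor>..\<lceil>(real n + 1) / r0\<rceil>}"
    have finQ: "finite Q" by (simp add: Q_def)
    have QR: "q \<in> \<rat>" if "q \<in> Q" for q using that \<open>r0 \<in> \<rat>\<close> by (auto simp: Q_def)
    have "\<forall>\<^sub>F k in sequentially. \<forall>q\<in>Q. dist (occ k w 0 q) (G q) < e / 2"
      using finQ QR lim \<open>0 < e\<close> by (intro eventually_ball_finite ballI tendstoD) auto
    then show "\<forall>\<^sub>F k in sequentially. \<forall>x\<in>{- real n..real n}. dist (occ k w 0 x) (G x) < e"
    proof eventually_elim
      case (elim k)
      show ?case
      proof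
        fix x assume x: "x \<in> {- real n..real n}"
        define i where "i = \<lfloor>x / r0\<rfloor>"
        have i: "of_int i * r0 \<le> x" "x \<le> of_int (i + 1) * r0"
        proof -
          have "of_int i \<le> x / r0" "x / r0 \<le> of_int (i + 1)" unfolding i_def by linarith+
          then show "of_int i * r0 \<le> x" "x \<le> of_int (i + 1) * r0"
            using \<open>0 < r0\<close> by (simp_all only: pos_le_divide_eq pos_divide_le_eq)
        qed
        have "(- real n - 1) / r0 \<le> x / r0" "x / r0 \<le> (real n + 1) / r0"
          using x \<open>0 < r0\<close> by (auto intro!: divide_right_mono)
        then have iQ: "\<lfloor>(- real n - 1) / r0\<rfloor> \<le> i" "i \<le> \<lceil>(real n + 1) / r0\<rceil>"
          unfolding i_def by linarith+
        have "x / r0 + 1 \<le> (real n + 1) / r0"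
        proof -
          have "x / r0 + 1 = (x + r0) / r0" using \<open>0 < r0\<close> by (simp add: field_simps)
          also have "\<dots> \<le> (real n + 1) / r0" using x \<open>r0 < d' / 2\<close> d' \<open>0 < r0\<close> by (intro divide_right_mono) auto
          finally show ?thesis .
        qed
        then have iQ': "i + 1 \<le> \<lceil>(real n + 1) / r0\<rceil>" unfolding i_def by linarith
        let ?p = "of_int i * r0" and ?q = "of_int (i + 1) * r0"
        have pq: "?p \<in> Q" "?q \<in> Q" unfolding Q_def using iQ iQ' by (intro imageI; simp)+
        have "?q = ?p + r0" by (simp add: distrib_right)
        then have near: "\<bar>?p - x\<bar> < d'" "\<bar>?q - x\<bar> < d'" using i \<open>r0 < d' / 2\<close> \<open>0 < r0\<close> by auto
        then have "dist (G ?p) (G x) < e / 2" "dist (G ?q) (G x) < e / 2"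
          using x d' by (intro d(2); auto simp: dist_real_def abs_less_iff)+
        moreover have "dist (occ k w 0 ?p) (G ?p) < e / 2" "dist (occ k w 0 ?q) (G ?q) < e / 2"
          using elim pq by auto
        moreover have "occ k w 0 ?p \<le> occ k w 0 x" "occ k w 0 x \<le> occ k w 0 ?q"
          using i by (intro occupation_mono c eps_pos; simp)+
        ultimately show "dist (occ k w 0 x) (G x) < e" unfolding dist_real_def by linarith
      qed
    qed
  qed
  then show r: "reg w" unfolding occupation_regular_def
    by (intro allI uniformly_convergent_Cauchy) (auto simp: uniformly_convergent_on_def)
  have "(\<lambda>k. occ k w 0 t) \<longlonglongrightarrow> G t" for t
  proof -
    obtain n :: nat where "\<bar>t\<bar> \<le> real n" using real_arch_simple by blast
    then have "t \<in> {- real n..real n}" by auto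
    then show ?thesis by (rule tendsto_uniform_limitI[OF unif])
  qed
  then show "ltime w = G" using ltime_unique[OF r] by blast
qed

lemma ltime_transform:
  assumes c: "continuous_on UNIV w" and r: "reg w" and c': "continuous_on UNIV w'"
    and G: "distribution_function G" and lim: "\<And>t. (\<lambda>k. occ k w' 0 t) \<longlonglongrightarrow> G t"
  shows "reg w' \<and> ltime w' = G"
  using regularI[OF c' G lim] by blast

lemma ltime_path_shift_regular:
  assumes c: "continuous_on UNIV w" and r: "reg w"
  shows "reg (path_shift t w)" "ltime (path_shift t w) s = ltime w (t + s) - ltime w t"
proof -
  have G: "distribution_function (\<lambda>s. ltime w (t + s) - ltime w t)"
    using distribution_function_ltime[OF c] unfolding distribution_function_def
    by (auto simp: mono_def intro!: continuous_intros continuous_on_compose2[of UNIV "ltime w"])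
  have "(\<lambda>k. occ k (path_shift t w) 0 s) \<longlonglongrightarrow> ltime w (t + s) - ltime w t" for s
    unfolding occupation_path_shift using regular_cocycle[OF c r] by simp
  from ltime_transform[OF c r continuous_path_shift[OF c] G this]
  show "reg (path_shift t w)" "ltime (path_shift t w) s = ltime w (t + s) - ltime w t" by auto
qed

lemma regular_path_shift:
  assumes c: "continuous_on UNIV w"
  shows "reg (path_shift t w) \<longleftrightarrow> reg w"
proof
  assume "reg (path_shift t w)"
  from ltime_path_shift_regular(1)[OF continuous_path_shift[OF c] this, of "- t"]
  show "reg w" by (simp add: path_shift_def)
qed (rule ltime_path_shift_regular[OF c])

text \<open>Regularity is itself shift invariant, so on irregular paths both sides vanish.\<close>

lemma ltime_path_shift:
  assumes c: "continuous_on UNIV w"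
  shows "ltime (path_shift t w) s = ltime w (t + s) - ltime w t"
  using ltime_path_shift_regular(2)[OF c] regular_path_shift[OF c, of t] by (cases "reg w") (auto simp: not_regular)

lemma ltime_reverse_path_regular:
  assumes c: "continuous_on UNIV w" and r: "reg w"
  shows "reg (reverse_path w)" "ltime (reverse_path w) s = - ltime w (- s)"
proof -
  have G: "distribution_function (\<lambda>s. - ltime w (- s))"
    using distribution_function_ltime[OF c] unfolding distribution_function_def
    by (auto simp: mono_def intro!: continuous_intros continuous_on_compose2[of UNIV "ltime w"])
  have "(\<lambda>k. occ k (reverse_path w) 0 s) \<longlonglongrightarrow> - ltime w (- s)" for s
    unfolding occupation_reverse_path[OF c] using tendsto_minus[OF regular_limit[OF r, of "- s"]] by simp
  from ltime_transform[OF c r continuous_reverse_path[OF c] G this]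
  show "reg (reverse_path w)" "ltime (reverse_path w) s = - ltime w (- s)" by auto
qed

lemma ltime_reverse_path:
  assumes c: "continuous_on UNIV w"
  shows "ltime (reverse_path w) s = - ltime w (- s)"
proof (cases "reg w")
  case False
  then have "\<not> reg (reverse_path w)"
    using ltime_reverse_path_regular(1)[OF continuous_reverse_path[OF c]] by (auto simp: reverse_path_def)
  with False show ?thesis by (simp add: not_regular)
qed (rule ltime_reverse_path_regular(2)[OF c])

lemma occupation_frozen:
  assumes "\<And>s. s \<in> {min a b<..max a b} \<Longrightarrow> e < \<bar>w s\<bar>"
  shows "occupation e w a b = 0"
proof -
  have "signed_Ioc a b s * indicator {-e..e} (w s) = 0" for s
  proof (cases "s \<in> {min a b<..max a b}")
    case True
    then show ?thesis using assms[OF True] by (auto simp: indicator_def abs_if split: if_splits)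
  qed (auto simp: signed_Ioc_def indicator_def)
  then have "(\<lambda>s. signed_Ioc a b s * indicator {-e..e} (w s)) = (\<lambda>_. 0)" by (rule ext)
  then show ?thesis by (simp only: occupation_def) simp
qed

lemma occupation_cong:
  assumes "\<And>s. s \<in> {min a b<..max a b} \<Longrightarrow> w s = w' s"
  shows "occupation e w a b = occupation e w' a b"
proof -
  have "signed_Ioc a b s * indicator {-e..e} (w s) = signed_Ioc a b s * indicator {-e..e} (w' s)" for s
  proof (cases "s \<in> {min a b<..max a b}")
    case True
    then show ?thesis using assms[OF True] by simp
  qed (auto simp: signed_Ioc_def indicator_def)
  then have "(\<lambda>s. signed_Ioc a b s * indicator {-e..e} (w s)) = (\<lambda>s. signed_Ioc a b s * indicator {-e..e} (w' s))"
    by (rule ext)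
  then show ?thesis by (simp only: occupation_def)
qed

lemma eventually_eps_less: "0 < x \<Longrightarrow> \<forall>\<^sub>F k in sequentially. \<epsilon> k < x"
  using order_tendstoD(2)[OF eps_lim] .

lemma distribution_function_compose:
  assumes F: "distribution_function F" and g: "mono g" "continuous_on UNIV g"
  shows "distribution_function (\<lambda>t. F (g t))"
proof -
  have "continuous_on UNIV (\<lambda>t. F (g t))"
    by (rule continuous_on_compose2[OF distribution_functionD(2)[OF F, of UNIV] g(2)]) simp
  then show ?thesis using F g(1) by (auto simp: distribution_function_def mono_def)
qed

text \<open>A path frozen at a level other than 0 stays outside the window around 0 once the window
  is small, and collects no occupation there. Frozen at 0 it would spend all its time in every
  window, hence the condition on \<open>w 0\<close>.\<close>

lemma ltime_future_path:
  assumes c: "continuous_on UNIV w" and r: "reg w" and ne: "w 0 \<noteq> 0"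
  shows "ltime (future_path w) t = ltime w (max t 0)"
proof -
  have G: "distribution_function (\<lambda>t. ltime w (max t 0))"
    by (rule distribution_function_compose[OF distribution_function_ltime[OF c]])
      (auto simp: mono_def intro!: continuous_intros)
  have "(\<lambda>k. occ k (future_path w) 0 t) \<longlonglongrightarrow> ltime w (max t 0)" for t
  proof (cases "0 \<le> t")
    case True
    then have "occ k (future_path w) 0 t = occ k w 0 t" for k
      by (intro occupation_cong) (auto simp: future_path_def)
    then show ?thesis using regular_limit[OF r, of t] True by simp
  next
    case False
    have "\<forall>\<^sub>F k in sequentially. occ k (future_path w) 0 t = 0"
      using eventually_eps_less[of "\<bar>w 0\<bar>"] ne False
      by (auto elim!: eventually_mono intro!: occupation_frozen simp: future_path_def max_def)
    then show ?thesis using False by (simp add: ltime_zero tendsto_eventually max_def)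
  qed
  from ltime_transform[OF c r continuous_future_path[OF c] G this] show ?thesis by auto
qed

lemma ltime_stopped_path:
  assumes c: "continuous_on UNIV w" and r: "reg w" and ne: "w u \<noteq> 0" and u: "0 \<le> u"
  shows "ltime (stopped_path u w) t = ltime w (min t u)"
proof -
  have G: "distribution_function (\<lambda>t. ltime w (min t u))"
    by (rule distribution_function_compose[OF distribution_function_ltime[OF c]])
      (auto simp: mono_def intro!: continuous_intros)
  have cs: "continuous_on UNIV (stopped_path u w)" by (rule continuous_stopped_path[OF c])
  have "(\<lambda>k. occ k (stopped_path u w) 0 t) \<longlonglongrightarrow> ltime w (min t u)" for t
  proof (cases "t \<le> u")
    case True
    then have "occ k (stopped_path u w) 0 t = occ k w 0 t" for k
      using u by (intro occupation_cong) (auto simp: stopped_path_def min_def)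
    then show ?thesis using regular_limit[OF r, of t] True by simp
  next
    case False
    have "\<forall>\<^sub>F k in sequentially. occ k (stopped_path u w) u t = 0"
      using eventually_eps_less[of "\<bar>w u\<bar>"] ne False
      by (auto elim!: eventually_mono intro!: occupation_frozen simp: stopped_path_def min_def)
    moreover have "occ k (stopped_path u w) 0 t = occ k w 0 u + occ k (stopped_path u w) u t" for k
    proof -
      have "occ k (stopped_path u w) 0 u = occ k w 0 u"
        using u by (intro occupation_cong) (auto simp: stopped_path_def min_def)
      then show ?thesis using occupation_add[OF cs, of "\<epsilon> k" 0 u t] by simp
    qed
    ultimately have "\<forall>\<^sub>F k in sequentially. occ k (stopped_path u w) 0 t = occ k w 0 u"
      by (auto elim!: eventually_mono)
    then have "(\<lambda>k. occ k (stopped_path u w) 0 t) \<longlonglongrightarrow> ltime w u"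
      using regular_limit[OF r, of u] by (subst tendsto_cong)
    then show ?thesis using False by (simp add: min_def)
  qed
  from ltime_transform[OF c r cs G this] show ?thesis by auto
qed

text \<open>On a compact rational interval without zeros the path is bounded away from 0, so the
  occupation times vanish eventually and \<open>ltime\<close> is constant. Countably many such
  intervals cover the complement of the zero set.\<close>

lemma emeasure_ltime_support:
  assumes c: "continuous_on UNIV w"
  shows "emeasure (interval_measure (ltime w)) {s. w s \<noteq> 0} = 0"
proof (cases "reg w")
  case r: True
  note D = distribution_function_ltime[OF c]
  define C where "C = {(p, q) \<in> \<rat> \<times> \<rat>. p \<le> q \<and> (\<forall>s\<in>{p..q}. w s \<noteq> 0)}"
  have "emeasure (interval_measure (ltime w)) {p..q} = 0" if "(p, q) \<in> C" for p q
  proof -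
    have pq: "p \<le> q" "\<And>s. s \<in> {p..q} \<Longrightarrow> w s \<noteq> 0" using that by (auto simp: C_def)
    have "continuous_on {p..q} (\<lambda>s. \<bar>w s\<bar>)"
      by (intro continuous_intros continuous_on_subset[OF c]) auto
    then obtain x where x: "x \<in> {p..q}" "\<And>y. y \<in> {p..q} \<Longrightarrow> \<bar>w x\<bar> \<le> \<bar>w y\<bar>"
      using continuous_attains_inf[of "{p..q}" "\<lambda>s. \<bar>w s\<bar>"] pq by auto
    then have pos: "0 < \<bar>w x\<bar>" using pq by auto
    have "\<forall>\<^sub>F k in sequentially. occ k w p q = 0"
      using eventually_eps_less[OF pos]
    proof eventually_elim
      case (elim k)
      show ?case
      proof (rule occupation_frozen)
        fix s assume "s \<in> {min p q<..max p q}"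
        then have "s \<in> {p..q}" using pq(1) by auto
        from x(2)[OF this] elim show "\<epsilon> k < \<bar>w s\<bar>" by linarith
      qed
    qed
    then have "(\<lambda>k. occ k w p q) \<longlonglongrightarrow> 0" by (rule tendsto_eventually)
    then have "ltime w q - ltime w p = 0" using regular_cocycle[OF c r, of p q] LIMSEQ_unique by blast
    then show ?thesis using emeasure_Icc[OF D pq(1)] by simp
  qed
  moreover have "countable C"
    unfolding C_def by (rule countable_subset[of _ "\<rat> \<times> \<rat>"]) (auto simp: countable_rat)
  ultimately have null: "(\<Union>(p, q)\<in>C. {p..q}) \<in> null_sets (interval_measure (ltime w))"
    by (intro null_sets_UN') (auto simp: null_sets_def)
  have "{s. w s \<noteq> 0} \<subseteq> (\<Union>(p, q)\<in>C. {p..q})"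
  proof
    fix s assume "s \<in> {s. w s \<noteq> 0}"
    moreover have "open {s. w s \<noteq> 0}" by (intro open_Collect_neq c continuous_intros)
    ultimately obtain d where d: "0 < d" "\<And>t. dist t s < d \<Longrightarrow> w t \<noteq> 0" unfolding open_dist by blast
    obtain p where p: "p \<in> \<rat>" "s - d < p" "p < s" using Rats_dense_in_real[of "s - d" s] d by auto
    obtain q where q: "q \<in> \<rat>" "s < q" "q < s + d" using Rats_dense_in_real[of s "s + d"] d by auto
    have "w t \<noteq> 0" if "t \<in> {p..q}" for t
      using that p q by (intro d(2)) (auto simp: dist_real_def)
    then have "(p, q) \<in> C" using p q unfolding C_def by auto
    moreover have "s \<in> {p..q}" using p q by simp
    ultimately show "s \<in> (\<Union>(p, q)\<in>C. {p..q})" by blast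
  qed
  then have "emeasure (interval_measure (ltime w)) {s. w s \<noteq> 0}
      \<le> emeasure (interval_measure (ltime w)) (\<Union>(p, q)\<in>C. {p..q})"
    by (rule emeasure_mono) (rule null_setsD2[OF null])
  also have "\<dots> = 0" by (rule null_setsD1[OF null])
  finally show ?thesis by simp
next
  case False
  then have "ltime w = (\<lambda>_. 0)" by (auto simp: not_regular)
  moreover have "null_measure borel = interval_measure (\<lambda>_. 0)"
  proof (rule interval_measure_eqI)
    show "distribution_function (\<lambda>_. 0)" unfolding distribution_function_def by (simp add: mono_def)
  qed simp_all
  ultimately show ?thesis by (metis emeasure_null_measure)
qed

end

section \<open>Convergence of moving averages in L1\<close>

text \<open>The substitution y = x + e v writes the difference as an average over \<open>v\<close>
  in [-1,1] of f(x + e v) - f x. Fubini then leaves the average of the L1 moduli of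
  continuity.\<close>

lemma L1_average_le:
  fixes f :: "real \<Rightarrow> real"
  assumes f: "integrable lborel f" and e: "0 < e"
  shows "(\<integral>\<^sup>+x. ennreal \<bar>(\<integral>y. f y * indicator {x - e..x + e} y \<partial>lborel) / (2 * e) - f x\<bar> \<partial>lborel)
    \<le> (\<integral>\<^sup>+v. indicator {-1..1} v / 2 * ennreal (\<integral>x. \<bar>f (x + e * v) - f x\<bar> \<partial>lborel) \<partial>lborel)"
proof -
  have [measurable]: "f \<in> borel_measurable borel" using borel_measurable_integrable[OF f] by simp
  have pt: "ennreal \<bar>(\<integral>y. f y * indicator {x - e..x + e} y \<partial>lborel) / (2 * e) - f x\<bar>
    \<le> (\<integral>\<^sup>+v. indicator {-1..1} v / 2 * ennreal \<bar>f (x + e * v) - f x\<bar> \<partial>lborel)" for x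
  proof -
    have i1: "integrable lborel (\<lambda>v. f (x + e * v) * indicator {-1..1} v)"
      using lborel_integrable_real_affine[OF f, of e x] e
      by (intro integrable_real_mult_indicator) auto
    have i2: "integrable lborel (\<lambda>v. f x * indicator {-1..1::real} v)"
      by (intro integrable_mult_right integrable_real_indicator) auto
    have "(\<integral>y. f y * indicator {x - e..x + e} y \<partial>lborel) = e * (\<integral>v. f (x + e * v) * indicator {x - e..x + e} (x + e * v) \<partial>lborel)"
      using lborel_integral_real_affine[of e "\<lambda>y. f y * indicator {x - e..x + e} y" x] e by simp
    also have "(\<lambda>v. f (x + e * v) * indicator {x - e..x + e} (x + e * v)) = (\<lambda>v. f (x + e * v) * indicator {-1..1} v)"
    proof (rule ext)
      fix v
      have "x - e \<le> x + e * v \<longleftrightarrow> -1 \<le> v" using mult_le_cancel_left_pos[OF e, of "-1" v] by simp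
      moreover have "x + e * v \<le> x + e \<longleftrightarrow> v \<le> 1" using mult_le_cancel_left_pos[OF e, of v 1] by simp
      ultimately show "f (x + e * v) * indicator {x - e..x + e} (x + e * v) = f (x + e * v) * indicator {-1..1} v"
        by (simp add: indicator_def)
    qed
    finally have eq: "(\<integral>y. f y * indicator {x - e..x + e} y \<partial>lborel) = e * (\<integral>v. f (x + e * v) * indicator {-1..1} v \<partial>lborel)" .
    have "(\<integral>y. f y * indicator {x - e..x + e} y \<partial>lborel) / (2 * e) - f x
       = ((\<integral>v. f (x + e * v) * indicator {-1..1} v \<partial>lborel) - (\<integral>v. f x * indicator {-1..1::real} v \<partial>lborel)) / 2"
    proof -
      have "measure lborel {-1..1::real} = 2" by (subst measure_lborel_Icc) auto
      then have c2: "(\<integral>v. f x * indicator {-1..1::real} v \<partial>lborel) = 2 * f x" by simp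
      have "(\<integral>y. f y * indicator {x - e..x + e} y \<partial>lborel) / (2 * e) - f x
          = ((\<integral>v. f (x + e * v) * indicator {-1..1} v \<partial>lborel) - 2 * f x) / 2"
        using e unfolding eq by (simp add: field_simps)
      then show ?thesis by (simp only: c2)
    qed
    also have "\<dots> = (\<integral>v. f (x + e * v) * indicator {-1..1} v - f x * indicator {-1..1} v \<partial>lborel) / 2"
      using i1 i2 by simp
    finally have "\<bar>(\<integral>y. f y * indicator {x - e..x + e} y \<partial>lborel) / (2 * e) - f x\<bar>
      = \<bar>\<integral>v. f (x + e * v) * indicator {-1..1} v - f x * indicator {-1..1} v \<partial>lborel\<bar> / 2"
      by (simp only: abs_divide abs_numeral)
    also have "\<dots> \<le> (\<integral>v. \<bar>f (x + e * v) * indicator {-1..1} v - f x * indicator {-1..1} v\<bar> \<partial>lborel) / 2"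
      by (intro divide_right_mono integral_abs_bound) auto
    finally have "ennreal \<bar>(\<integral>y. f y * indicator {x - e..x + e} y \<partial>lborel) / (2 * e) - f x\<bar>
      \<le> ennreal ((\<integral>v. \<bar>f (x + e * v) * indicator {-1..1} v - f x * indicator {-1..1} v\<bar> \<partial>lborel) / 2)"
      by (rule ennreal_leI)
    also have "\<dots> = ennreal (\<integral>v. \<bar>f (x + e * v) * indicator {-1..1} v - f x * indicator {-1..1} v\<bar> / 2 \<partial>lborel)" by simp
    also have "\<dots> = (\<integral>\<^sup>+v. ennreal (\<bar>f (x + e * v) * indicator {-1..1} v - f x * indicator {-1..1} v\<bar> / 2) \<partial>lborel)"
      using i1 i2 by (intro nn_integral_eq_integral[symmetric]) auto
    also have "\<dots> = (\<integral>\<^sup>+v. indicator {-1..1} v / 2 * ennreal \<bar>f (x + e * v) - f x\<bar> \<partial>lborel)"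
      by (intro nn_integral_cong)
        (auto simp: indicator_def divide_ennreal[symmetric] ennreal_divide_times)
    finally show ?thesis .
  qed
  have "(\<integral>\<^sup>+x. ennreal \<bar>(\<integral>y. f y * indicator {x - e..x + e} y \<partial>lborel) / (2 * e) - f x\<bar> \<partial>lborel)
    \<le> (\<integral>\<^sup>+x. (\<integral>\<^sup>+v. indicator {-1..1} v / 2 * ennreal \<bar>f (x + e * v) - f x\<bar> \<partial>lborel) \<partial>lborel)"
    by (intro nn_integral_mono pt)
  also have "\<dots> = (\<integral>\<^sup>+v. (\<integral>\<^sup>+x. indicator {-1..1} v / 2 * ennreal \<bar>f (x + e * v) - f x\<bar> \<partial>lborel) \<partial>lborel)"
    by (rule lborel_pair.Fubini') measurable
  also have "\<dots> = (\<integral>\<^sup>+v. indicator {-1..1} v / 2 * ennreal (\<integral>x. \<bar>f (x + e * v) - f x\<bar> \<partial>lborel) \<partial>lborel)"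
  proof (rule nn_integral_cong)
    fix v
    have "(\<integral>\<^sup>+x. indicator {-1..1} v / 2 * ennreal \<bar>f (x + e * v) - f x\<bar> \<partial>lborel) = indicator {-1..1} v / 2 * (\<integral>\<^sup>+x. ennreal \<bar>f (x + e * v) - f x\<bar> \<partial>lborel)"
      by (rule nn_integral_cmult) measurable
    also have "(\<integral>\<^sup>+x. ennreal \<bar>f (x + e * v) - f x\<bar> \<partial>lborel) = ennreal (\<integral>x. \<bar>f (x + e * v) - f x\<bar> \<partial>lborel)"
      using f lborel_integrable_translate[OF f, of "e * v"] by (intro nn_integral_eq_integral) auto
    finally show "(\<integral>\<^sup>+x. indicator {-1..1} v / 2 * ennreal \<bar>f (x + e * v) - f x\<bar> \<partial>lborel) = indicator {-1..1} v / 2 * ennreal (\<integral>x. \<bar>f (x + e * v) - f x\<bar> \<partial>lborel)" .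
  qed
  finally show ?thesis .
qed

lemma L1_translate_diff_le:
  fixes f :: "real \<Rightarrow> real"
  assumes f: "integrable lborel f"
  shows "(\<integral>x. \<bar>f (x + h) - f x\<bar> \<partial>lborel) \<le> 2 * (\<integral>x. \<bar>f x\<bar> \<partial>lborel)"
proof -
  note i = integrable_abs[OF lborel_integrable_translate[OF f, of h]] integrable_abs[OF f]
  have "(\<integral>x. \<bar>f (x + h) - f x\<bar> \<partial>lborel) \<le> (\<integral>x. \<bar>f (x + h)\<bar> + \<bar>f x\<bar> \<partial>lborel)"
    using i f lborel_integrable_translate[OF f, of h] by (intro integral_mono) auto
  also have "\<dots> = (\<integral>x. \<bar>f (x + h)\<bar> \<partial>lborel) + (\<integral>x. \<bar>f x\<bar> \<partial>lborel)" by (rule Bochner_Integration.integral_add[OF i])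
  also have "(\<integral>x. \<bar>f (x + h)\<bar> \<partial>lborel) = (\<integral>x. \<bar>f x\<bar> \<partial>lborel)" by (rule lborel_integral_translate[of "\<lambda>x. \<bar>f x\<bar>"])
  finally show ?thesis by simp
qed

lemma nn_integral_half_window: "(\<integral>\<^sup>+v. indicator {-1..1::real} v / 2 * c \<partial>lborel) = c"
proof -
  have "(\<integral>\<^sup>+v. indicator {-1..1::real} v / 2 * c \<partial>lborel) = (\<integral>\<^sup>+v. c / 2 * indicator {-1..1::real} v \<partial>lborel)"
    by (intro nn_integral_cong) (auto simp: indicator_def divide_ennreal_def mult.commute)
  also have "\<dots> = c / 2 * 2" by (subst nn_integral_cmult_indicator) auto
  also have "\<dots> = c" using ennreal_divide_times[of c 2 2] ennreal_divide_self[of 2] by simp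
  finally show ?thesis .
qed

lemma L1_average_bound:
  fixes f :: "real \<Rightarrow> real"
  assumes f: "integrable lborel f" and e: "0 < e"
  shows "(\<integral>\<^sup>+x. ennreal \<bar>(\<integral>y. f y * indicator {x - e..x + e} y \<partial>lborel) / (2 * e) - f x\<bar> \<partial>lborel)
    \<le> ennreal (2 * (\<integral>x. \<bar>f x\<bar> \<partial>lborel))"
proof -
  have "(\<integral>\<^sup>+v. indicator {-1..1} v / 2 * ennreal (\<integral>x. \<bar>f (x + e * v) - f x\<bar> \<partial>lborel) \<partial>lborel)
    \<le> (\<integral>\<^sup>+v. indicator {-1..1::real} v / 2 * ennreal (2 * (\<integral>x. \<bar>f x\<bar> \<partial>lborel)) \<partial>lborel)"
    by (intro nn_integral_mono mult_left_mono ennreal_leI L1_translate_diff_le f) auto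
  then show ?thesis using L1_average_le[OF f e] by (simp add: nn_integral_half_window)
qed

text \<open>Dominated convergence in the variable \<open>v\<close>: the moduli tend to 0 by L1
  continuity of translations and are bounded by twice the norm of \<open>f\<close>.\<close>

lemma L1_average_tendsto:
  fixes f :: "real \<Rightarrow> real"
  assumes f: "integrable lborel f" and e: "\<And>n. 0 < e n" "e \<longlonglongrightarrow> 0"
  shows "(\<lambda>n. \<integral>\<^sup>+x. ennreal \<bar>(\<integral>y. f y * indicator {x - e n..x + e n} y \<partial>lborel) / (2 * e n) - f x\<bar> \<partial>lborel) \<longlonglongrightarrow> 0"
proof (rule tendsto_sandwich[OF _ _ tendsto_const])
  let ?u = "\<lambda>n v. indicator {-1..1} v / 2 * ennreal (\<integral>x. \<bar>f (x + e n * v) - f x\<bar> \<partial>lborel)"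
  have [measurable]: "f \<in> borel_measurable borel" using borel_measurable_integrable[OF f] by simp
  have "(\<lambda>n. \<integral>\<^sup>+v. ?u n v \<partial>lborel) \<longlonglongrightarrow> (\<integral>\<^sup>+v. 0 \<partial>(lborel :: real measure))"
  proof (rule nn_integral_dominated_convergence[where w="\<lambda>v. indicator {-1..1::real} v / 2 * ennreal (2 * (\<integral>x. \<bar>f x\<bar> \<partial>lborel))"])
    show "AE v in lborel. ?u n v \<le> indicator {-1..1::real} v / 2 * ennreal (2 * (\<integral>x. \<bar>f x\<bar> \<partial>lborel))" for n
      by (intro AE_I2 mult_left_mono ennreal_leI L1_translate_diff_le f) auto
    show "AE v in lborel. (\<lambda>n. ?u n v) \<longlonglongrightarrow> 0"
    proof (rule AE_I2)
      fix v :: real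
      have "(\<lambda>n. e n * v) \<longlonglongrightarrow> 0" using tendsto_mult_left_zero[OF e(2)] .
      then have "(\<lambda>n. \<integral>x. \<bar>f (x + e n * v) - f x\<bar> \<partial>lborel) \<longlonglongrightarrow> 0"
        using L1_continuous_integrable[OF f] unfolding L1_continuous_def by blast
      then have "(\<lambda>n. ennreal (\<integral>x. \<bar>f (x + e n * v) - f x\<bar> \<partial>lborel)) \<longlonglongrightarrow> ennreal 0" by (rule tendsto_ennrealI)
      then have "(\<lambda>n. ?u n v) \<longlonglongrightarrow> indicator {-1..1} v / 2 * ennreal 0"
        by (intro ennreal_tendsto_cmult) (simp_all add: less_top[symmetric] ennreal_divide_eq_top_iff indicator_def)
      then show "(\<lambda>n. ?u n v) \<longlonglongrightarrow> 0" by simp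
    qed
    show "(\<integral>\<^sup>+v. indicator {-1..1::real} v / 2 * ennreal (2 * (\<integral>x. \<bar>f x\<bar> \<partial>lborel)) \<partial>lborel) < \<infinity>"
      by (simp add: nn_integral_half_window)
    show "?u n \<in> borel_measurable lborel" for n
      by (intro borel_measurable_times_ennreal measurable_compose[OF lborel.borel_measurable_lebesgue_integral measurable_ennreal]) measurable
  qed auto
  then show "(\<lambda>n. \<integral>\<^sup>+v. ?u n v \<partial>lborel) \<longlonglongrightarrow> 0" by simp
  show "\<forall>\<^sub>F n in sequentially. (\<integral>\<^sup>+x. ennreal \<bar>(\<integral>y. f y * indicator {x - e n..x + e n} y \<partial>lborel) / (2 * e n) - f x\<bar> \<partial>lborel)
      \<le> (\<integral>\<^sup>+v. ?u n v \<partial>lborel)"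
    by (intro always_eventually allI L1_average_le f e(1))
qed auto

section \<open>Local time as a density of the occupation measure, and the choice of the
  scale\<close>

locale local_time_setup = wiener +
  fixes L :: "real \<Rightarrow> (real \<Rightarrow> real) \<Rightarrow> real measure"
  assumes brownian_local_time: "brownian_local_time P0 L"
begin

lemmas local_time_conditions = brownian_local_time[unfolded brownian_local_time_def]

lemma L_random: "random_measure P0 (L x)"
  by (rule local_time_conditions[THEN conjunct1, rule_format])

lemma L_occupation:
  assumes "f \<in> borel_measurable borel" "\<And>p. 0 \<le> f p"
  shows "AE w in P0. (\<integral>\<^sup>+s. ennreal (f (w s, s)) \<partial>lborel) = (\<integral>\<^sup>+x. (\<integral>\<^sup>+s. ennreal (f (x, s)) \<partial>L x w) \<partial>lborel)"
  by (rule local_time_conditions[THEN conjunct2, THEN conjunct1, rule_format]) (use assms in auto)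

lemma L_started_diffuse: "AE w in started_at P0 x. \<forall>s. emeasure (L 0 w) {s} = 0"
  by (rule local_time_conditions[THEN conjunct2, THEN conjunct2, THEN conjunct1, rule_format])

lemma L_started_shift: "AE w in started_at P0 x. \<forall>t. \<forall>C\<in>sets borel.
        emeasure (L 0 (path_shift t w)) ((\<lambda>s. s - t) ` C) = emeasure (L 0 w) C"
  by (rule local_time_conditions[THEN conjunct2, THEN conjunct2, THEN conjunct2, THEN conjunct1, rule_format])

lemma L_level: "continuous_on UNIV w \<Longrightarrow> L y w = L 0 (vshift (- y) w)"
  using local_time_conditions[THEN conjunct2, THEN conjunct2, THEN conjunct2, THEN conjunct2, THEN conjunct1, rule_format, of w y]
  by (simp add: vshift_def)

lemma sets_L: "continuous_on UNIV w \<Longrightarrow> sets (L y w) = sets borel"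
  using L_random[of y] by (auto simp: random_measure_def space_P0)

lemma emeasure_L_measurable[measurable]: "C \<in> sets borel \<Longrightarrow> (\<lambda>w. emeasure (L 0 w) C) \<in> borel_measurable path_space"
  using L_random[of 0] by (auto simp: random_measure_def measurable_cong_sets[OF sets_P0 refl])

lemma started_at_vshift: "started_at P0 x = distr P0 path_space (vshift x)"
  unfolding started_at_def vshift_def[abs_def] ..

lemma vshift_measurable_P0: "vshift x \<in> measurable P0 path_space"
  by measurable

lemma L_diffuse: "AE w in P0. \<forall>s. emeasure (L 0 (vshift x w)) {s} = 0"
  by (rule AE_distrD[OF vshift_measurable_P0 L_started_diffuse[unfolded started_at_vshift]])

lemma L_shift: "AE w in P0. \<forall>t. \<forall>C\<in>sets borel.
    emeasure (L 0 (path_shift t (vshift x w))) ((\<lambda>s. s - t) ` C) = emeasure (L 0 (vshift x w)) C"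
  by (rule AE_distrD[OF vshift_measurable_P0 L_started_shift[unfolded started_at_vshift]])

lemma L_finite: "AE w in P0. \<forall>a b. emeasure (L 0 (vshift x w)) {a..b} < \<infinity>"
proof -
  have "AE w in P0. \<forall>a b. emeasure (L (- x) w) {a..b} < \<infinity>"
    using L_random[of "- x"] unfolding random_measure_def by blast
  then show ?thesis using AE_space
  proof eventually_elim
    case (elim w)
    then show ?case using L_level[of w "- x"] by (simp add: space_P0)
  qed
qed

text \<open>As a function of the level \<open>x\<close> this is the density of the occupation
  measure of the times in (a,b]. The level enters through \<open>L 0\<close> of a shifted path,
  which makes it jointly measurable in path and level.\<close>

definition window_density :: "real \<Rightarrow> real \<Rightarrow> (real \<Rightarrow> real) \<Rightarrow> real \<Rightarrow> real" where
  "window_density a b w x = enn2real (emeasure (L 0 (vshift (- x) w)) {a<..b})"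

lemma window_density_measurable[measurable]:
  "(\<lambda>(w, x). window_density a b w x) \<in> borel_measurable (P0 \<Otimes>\<^sub>M borel)"
proof -
  have "(\<lambda>z. vshift (- snd z) (fst z)) \<in> measurable (P0 \<Otimes>\<^sub>M borel) path_space" by measurable
  then have "(\<lambda>z. emeasure (L 0 (vshift (- snd z) (fst z))) {a<..b}) \<in> borel_measurable (P0 \<Otimes>\<^sub>M borel)"
    by (rule measurable_compose) measurable
  then show ?thesis unfolding window_density_def case_prod_beta' by measurable
qed

lemma window_average:
  assumes "a \<le> b" and g: "g \<in> borel_measurable borel" "\<And>y. 0 \<le> g y"
  shows "AE w in P0. (\<integral>\<^sup>+s. ennreal (g (w s)) * indicator {a<..b} s \<partial>lborel)
    = (\<integral>\<^sup>+y. ennreal (g y) * emeasure (L 0 (vshift (- y) w)) {a<..b} \<partial>lborel)"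
proof -
  note g(1)[measurable]
  have "(\<lambda>p. g (fst p) * indicator {a<..b} (snd p)) \<in> borel_measurable borel"
    unfolding borel_prod[symmetric] by measurable
  then have "AE w in P0. (\<integral>\<^sup>+s. ennreal (g (fst (w s, s)) * indicator {a<..b} (snd (w s, s))) \<partial>lborel)
    = (\<integral>\<^sup>+y. (\<integral>\<^sup>+s. ennreal (g (fst (y, s)) * indicator {a<..b} (snd (y, s))) \<partial>L y w) \<partial>lborel)"
    by (rule L_occupation) (use g(2) in auto)
  then show ?thesis using AE_space
  proof eventually_elim
    case (elim w)
    then have c: "continuous_on UNIV w" by (simp add: space_P0)
    have "(\<integral>\<^sup>+s. ennreal (g y * indicator {a<..b} s) \<partial>L y w) = ennreal (g y) * emeasure (L 0 (vshift (- y) w)) {a<..b}" for y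
    proof -
      have "(\<integral>\<^sup>+s. ennreal (g y * indicator {a<..b} s) \<partial>L y w) = (\<integral>\<^sup>+s. ennreal (g y) * indicator {a<..b} s \<partial>L y w)"
        by (intro nn_integral_cong) (auto simp: indicator_def)
      also have "\<dots> = ennreal (g y) * emeasure (L y w) {a<..b}"
        by (rule nn_integral_cmult_indicator) (simp add: sets_L[OF c])
      finally show ?thesis by (simp add: L_level[OF c])
    qed
    moreover have "(\<integral>\<^sup>+s. ennreal (g (w s) * indicator {a<..b} s) \<partial>lborel) = (\<integral>\<^sup>+s. ennreal (g (w s)) * indicator {a<..b} s \<partial>lborel)"
      by (intro nn_integral_cong) (auto simp: indicator_def)
    ultimately show ?case using elim(1) by simp
  qed
qed

lemma window_density_integrable:
  assumes "a \<le> b"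
  shows "AE w in P0. integrable lborel (window_density a b w) \<and> (\<integral>x. \<bar>window_density a b w x\<bar> \<partial>lborel) = b - a
    \<and> (AE y in lborel. emeasure (L 0 (vshift (- y) w)) {a<..b} = ennreal (window_density a b w y))"
proof -
  have "AE w in P0. (\<integral>\<^sup>+s. ennreal 1 * indicator {a<..b} s \<partial>lborel)
    = (\<integral>\<^sup>+y. ennreal 1 * emeasure (L 0 (vshift (- y) w)) {a<..b} \<partial>lborel)"
    by (rule window_average[OF assms]) auto
  then show ?thesis using AE_space
  proof eventually_elim
  case (elim w)
  then have c: "continuous_on UNIV w" by (simp add: space_P0)
  have vm: "(\<lambda>y. vshift (- y) w) \<in> measurable lborel path_space"
    by (rule vshift_measurable) (use c in auto)
  have em[measurable]: "(\<lambda>y. emeasure (L 0 (vshift (- y) w)) {a<..b}) \<in> borel_measurable lborel"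
    by (rule measurable_compose[OF vm]) measurable
  have wm[measurable]: "window_density a b w \<in> borel_measurable lborel"
    unfolding window_density_def[abs_def] by measurable
  have tot: "(\<integral>\<^sup>+y. emeasure (L 0 (vshift (- y) w)) {a<..b} \<partial>lborel) = ennreal (b - a)"
    using elim(1) assms by simp
  then have "AE y in lborel. emeasure (L 0 (vshift (- y) w)) {a<..b} \<noteq> \<infinity>"
    by (intro nn_integral_PInf_AE) auto
  then have eq: "AE y in lborel. emeasure (L 0 (vshift (- y) w)) {a<..b} = ennreal (window_density a b w y)"
    by eventually_elim (simp add: window_density_def less_top)
  have nn: "(\<integral>\<^sup>+y. ennreal (window_density a b w y) \<partial>lborel) = ennreal (b - a)"
    unfolding tot[symmetric] using eq by (intro nn_integral_cong_AE) auto
  have nonneg: "0 \<le> window_density a b w y" for y by (simp add: window_density_def)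
  have "integrable lborel (window_density a b w)"
    using nn nonneg wm by (intro integrableI_nonneg) auto
  moreover have "(\<integral>x. window_density a b w x \<partial>lborel) = b - a"
    using nn nonneg wm assms by (subst integral_eq_nn_integral) auto
  ultimately show ?case using eq nonneg by simp
  qed
qed

text \<open>The occupation formula for the indicator of [x-e,x+e] exhibits the canonical
  approximation at level \<open>x\<close> as a moving average of the density in the level
  variable.\<close>

lemma occupation_eq_average:
  assumes "a \<le> b" "0 < e"
  shows "AE w in P0. occupation e (vshift (- x) w) a b = (\<integral>y. window_density a b w y * indicator {x - e..x + e} y \<partial>lborel) / (2 * e)"
proof -
  have "AE w in P0. (\<integral>\<^sup>+s. ennreal (indicator {x - e..x + e} (w s)) * indicator {a<..b} s \<partial>lborel)
    = (\<integral>\<^sup>+y. ennreal (indicator {x - e..x + e} y) * emeasure (L 0 (vshift (- y) w)) {a<..b} \<partial>lborel)"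
    by (rule window_average[OF assms(1)]) auto
  then show ?thesis using window_density_integrable[OF assms(1)] AE_space
  proof eventually_elim
    case (elim w)
    then have c: "continuous_on UNIV w" by (simp add: space_P0)
    note [measurable] = continuous_borel_measurable[OF c]
    have i: "integrable lborel (\<lambda>y. window_density a b w y * indicator {x - e..x + e} y)"
      using elim(2) by (intro integrable_real_mult_indicator) auto
    have nonneg: "0 \<le> window_density a b w y" for y by (simp add: window_density_def)
    have ce: "continuous_on UNIV (vshift (- x) w)" using c by simp
    have "ennreal (\<integral>s. signed_Ioc a b s * indicator {-e..e} (vshift (- x) w s) \<partial>lborel)
      = (\<integral>\<^sup>+s. ennreal (signed_Ioc a b s * indicator {-e..e} (vshift (- x) w s)) \<partial>lborel)"
      using assms(1) by (intro nn_integral_eq_integral[symmetric] occupation_integrable[OF ce]) (auto simp: signed_Ioc_def indicator_def)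
    also have "\<dots> = (\<integral>\<^sup>+s. ennreal (indicator {x - e..x + e} (w s)) * indicator {a<..b} s \<partial>lborel)"
      using assms(1) by (intro nn_integral_cong) (auto simp: signed_Ioc_def indicator_def vshift_def)
    also have "\<dots> = (\<integral>\<^sup>+y. ennreal (window_density a b w y * indicator {x - e..x + e} y) \<partial>lborel)"
      unfolding elim(1) using elim(2) by (intro nn_integral_cong_AE) (auto simp: indicator_def elim!: AE_mp)
    also have "\<dots> = ennreal (\<integral>y. window_density a b w y * indicator {x - e..x + e} y \<partial>lborel)"
      using i nonneg by (intro nn_integral_eq_integral) auto
    finally have "(\<integral>s. signed_Ioc a b s * indicator {-e..e} (vshift (- x) w s) \<partial>lborel) = (\<integral>y. window_density a b w y * indicator {x - e..x + e} y \<partial>lborel)"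
      using assms(1) nonneg
      by (subst (asm) ennreal_inj) (auto intro!: Bochner_Integration.integral_nonneg simp: signed_Ioc_def indicator_def)
    then show ?case by (simp add: occupation_def)
  qed
qed

definition occupation_error :: "real \<Rightarrow> real \<Rightarrow> real \<Rightarrow> ennreal" where
  "occupation_error a b e = (\<integral>\<^sup>+x. \<integral>\<^sup>+w. ennreal \<bar>occupation e (vshift (- x) w) a b - window_density a b w x\<bar> \<partial>P0 \<partial>lborel)"

text \<open>For almost every path the moving averages of its window density converge in L1 of the
  level. The density has total mass \<open>b - a\<close>, which provides the bound
  \<open>2 * (b - a)\<close> for dominated convergence over the paths.\<close>

lemma occupation_error_tendsto:
  assumes ab: "a \<le> b" and e: "\<And>n. 0 < e n" "e \<longlonglongrightarrow> 0"
  shows "(\<lambda>n. occupation_error a b (e n)) \<longlonglongrightarrow> 0"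
proof -
  interpret PP: pair_sigma_finite lborel P0 ..
  interpret QQ: pair_sigma_finite P0 lborel ..
  define A where "A n w x = (\<integral>y. window_density a b w y * indicator {x - e n..x + e n} y \<partial>lborel) / (2 * e n)" for n w x
  have Am[measurable]: "(\<lambda>(w, x). A n w x) \<in> borel_measurable (P0 \<Otimes>\<^sub>M borel)" for n
  proof -
    have [measurable]: "(\<lambda>z. window_density a b (fst (fst z)) (snd z)) \<in> borel_measurable ((P0 \<Otimes>\<^sub>M borel) \<Otimes>\<^sub>M lborel)"
      using measurable_compose[OF _ window_density_measurable[of a b], of "\<lambda>z. (fst (fst z), snd z)" "(P0 \<Otimes>\<^sub>M borel) \<Otimes>\<^sub>M lborel"]
      by simp
    have "(\<lambda>(z, y). window_density a b (fst z) y * indicator {snd z - e n..snd z + e n} y) \<in> borel_measurable ((P0 \<Otimes>\<^sub>M borel) \<Otimes>\<^sub>M lborel)"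
      unfolding case_prod_beta' indicator_def atLeastAtMost_iff by measurable
    then have "(\<lambda>z. \<integral>y. window_density a b (fst z) y * indicator {snd z - e n..snd z + e n} y \<partial>lborel) \<in> borel_measurable (P0 \<Otimes>\<^sub>M borel)"
      by (rule lborel.borel_measurable_lebesgue_integral)
    then show ?thesis unfolding A_def case_prod_beta' by measurable
  qed
  have "occupation_error a b (e n) = (\<integral>\<^sup>+w. \<integral>\<^sup>+x. ennreal \<bar>A n w x - window_density a b w x\<bar> \<partial>lborel \<partial>P0)" for n
  proof -
    have "occupation_error a b (e n) = (\<integral>\<^sup>+x. \<integral>\<^sup>+w. ennreal \<bar>A n w x - window_density a b w x\<bar> \<partial>P0 \<partial>lborel)"
      unfolding occupation_error_def
    proof (rule nn_integral_cong, rule nn_integral_cong_AE)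
      fix x
      show "AE w in P0. ennreal \<bar>occupation (e n) (vshift (- x) w) a b - window_density a b w x\<bar> = ennreal \<bar>A n w x - window_density a b w x\<bar>"
        using occupation_eq_average[OF ab e(1)[of n], of x] by eventually_elim (simp add: A_def)
    qed
    also have "\<dots> = (\<integral>\<^sup>+w. \<integral>\<^sup>+x. ennreal \<bar>A n w x - window_density a b w x\<bar> \<partial>lborel \<partial>P0)"
      by (rule QQ.Fubini') measurable
    finally show ?thesis .
  qed
  moreover have "(\<lambda>n. \<integral>\<^sup>+w. \<integral>\<^sup>+x. ennreal \<bar>A n w x - window_density a b w x\<bar> \<partial>lborel \<partial>P0) \<longlonglongrightarrow> (\<integral>\<^sup>+w. 0 \<partial>P0)"
  proof (rule nn_integral_dominated_convergence[where w="\<lambda>_. ennreal (2 * (b - a))"])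
    show "(\<lambda>w. \<integral>\<^sup>+x. ennreal \<bar>A n w x - window_density a b w x\<bar> \<partial>lborel) \<in> borel_measurable P0" for n
      by (rule lborel.borel_measurable_nn_integral) measurable
    show "AE w in P0. (\<integral>\<^sup>+x. ennreal \<bar>A n w x - window_density a b w x\<bar> \<partial>lborel) \<le> ennreal (2 * (b - a))" for n
      using window_density_integrable[OF ab]
    proof eventually_elim
      case (elim w)
      then show ?case using L1_average_bound[of "window_density a b w" "e n"] e(1) unfolding A_def by auto
    qed
    show "AE w in P0. (\<lambda>n. \<integral>\<^sup>+x. ennreal \<bar>A n w x - window_density a b w x\<bar> \<partial>lborel) \<longlonglongrightarrow> 0"
      using window_density_integrable[OF ab]
    proof eventually_elim
      case (elim w)
      then show ?case using L1_average_tendsto[of "window_density a b w" e] e unfolding A_def by auto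
    qed
  qed (auto simp: emeasure_space_1 ennreal_mult_less_top)
  ultimately show ?thesis by simp
qed

lemma occupation_diff_measurable[measurable]:
  "(\<lambda>(x, w). ennreal \<bar>occupation e (vshift (- x) w) a b - window_density a b w x\<bar>) \<in> borel_measurable (lborel \<Otimes>\<^sub>M P0)"
proof -
  have "(\<lambda>z. window_density a b (snd z) (fst z)) \<in> borel_measurable (lborel \<Otimes>\<^sub>M P0)"
    using measurable_compose[OF _ window_density_measurable[of a b], of "\<lambda>z. (snd z, fst z)" "lborel \<Otimes>\<^sub>M P0"] by simp
  moreover have "(\<lambda>z. occupation e (vshift (- fst z) (snd z)) a b) \<in> borel_measurable (lborel \<Otimes>\<^sub>M P0)"
    by (rule measurable_compose[OF _ occupation_measurable]) measurable
  ultimately show ?thesis unfolding case_prod_beta' by measurable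
qed

text \<open>Convergence in mean gives convergence almost everywhere along a subsequence. The
  rational windows are countably many, so one diagonal subsequence serves them all.\<close>

lemma occupation_scale_exists:
  "\<exists>\<epsilon>. occupation_scale \<epsilon> \<and> (AE x in lborel. AE w in P0. \<forall>q\<in>\<rat>.
    (\<lambda>k. occupation (\<epsilon> k) (vshift (- x) w) (min 0 q) (max 0 q)) \<longlonglongrightarrow> window_density (min 0 q) (max 0 q) w x)"
proof -
  define q :: "nat \<Rightarrow> real" where "q j = from_nat_into \<rat> j" for j
  have qR: "range q = (\<rat> :: real set)"
    unfolding q_def using range_from_nat_into[OF _ countable_rat] Rats_0 by blast
  define D where "D j n = occupation_error (min 0 (q j)) (max 0 (q j)) (1 / real (Suc n))" for j n
  have D: "D j \<longlonglongrightarrow> 0" for j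
    unfolding D_def by (rule occupation_error_tendsto[OF _ _ LIMSEQ_Suc[OF lim_1_over_n]]) auto
  \<comment> \<open>At stage \<open>k\<close> the errors of the windows with index up to
    \<open>k\<close> are made at most 2^-k; taking n \<ge> k makes the scale tend to 0.\<close>
  have "\<exists>n\<ge>k. \<forall>j\<in>{..k}. D j n \<le> ennreal ((1 / 2) ^ k)" for k
  proof -
    have "\<forall>\<^sub>F n in sequentially. D j n < ennreal ((1 / 2) ^ k)" for j
      using order_tendstoD(2)[OF D[of j], of "ennreal ((1 / 2) ^ k)"] by simp
    then have "\<forall>\<^sub>F n in sequentially. \<forall>j\<in>{..k}. D j n < ennreal ((1 / 2) ^ k)"
      by (intro eventually_ball_finite) auto
    then have "\<forall>\<^sub>F n in sequentially. k \<le> n \<and> (\<forall>j\<in>{..k}. D j n < ennreal ((1 / 2) ^ k))"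
      by (intro eventually_conj eventually_ge_at_top)
    then obtain n where "k \<le> n \<and> (\<forall>j\<in>{..k}. D j n < ennreal ((1 / 2) ^ k))"
      using eventually_happens'[OF sequentially_bot] by blast
    then show ?thesis by (intro exI[of _ n]) (auto intro: less_imp_le)
  qed
  then obtain n where n: "\<And>k. k \<le> n k" "\<And>k j. j \<le> k \<Longrightarrow> D j (n k) \<le> ennreal ((1 / 2) ^ k)"
    by (metis atMost_iff)
  define \<epsilon> where "\<epsilon> k = 1 / real (Suc (n k))" for k
  have scale: "occupation_scale \<epsilon>"
  proof
    show "0 < \<epsilon> k" for k by (simp add: \<epsilon>_def)
    show "\<epsilon> \<longlonglongrightarrow> 0"
    proof (rule Lim_null_comparison)
      show "\<forall>\<^sub>F k in sequentially. norm (\<epsilon> k) \<le> 1 / real (Suc k)"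
        unfolding \<epsilon>_def using n(1) by (intro always_eventually allI) (simp add: frac_le)
      show "(\<lambda>k. 1 / real (Suc k)) \<longlonglongrightarrow> 0" by (rule LIMSEQ_Suc[OF lim_1_over_n])
    qed
  qed
  have "AE x in lborel. AE w in P0.
    (\<lambda>k. occupation (\<epsilon> k) (vshift (- x) w) (min 0 (q j)) (max 0 (q j))) \<longlonglongrightarrow> window_density (min 0 (q j)) (max 0 (q j)) w x" for j
  proof -
    define d where "d k x w = ennreal \<bar>occupation (\<epsilon> k) (vshift (- x) w) (min 0 (q j)) (max 0 (q j)) - window_density (min 0 (q j)) (max 0 (q j)) w x\<bar>" for k x w
    have dm[measurable]: "(\<lambda>(x, w). d k x w) \<in> borel_measurable (lborel \<Otimes>\<^sub>M P0)" for k
      unfolding d_def by measurable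
    have dm1[measurable]: "(\<lambda>w. d k x w) \<in> borel_measurable P0" for k x
      using measurable_Pair2[OF dm[of k], of x] by simp
    have dm2[measurable]: "(\<lambda>x. \<integral>\<^sup>+w. d k x w \<partial>P0) \<in> borel_measurable lborel" for k
      by (rule borel_measurable_nn_integral[OF dm])
    have "(\<integral>\<^sup>+x. \<integral>\<^sup>+w. (\<Sum>k. d (k + j) x w) \<partial>P0 \<partial>lborel) = (\<integral>\<^sup>+x. (\<Sum>k. \<integral>\<^sup>+w. d (k + j) x w \<partial>P0) \<partial>lborel)"
      by (intro nn_integral_cong nn_integral_suminf dm1)
    also have "\<dots> = (\<Sum>k. \<integral>\<^sup>+x. \<integral>\<^sup>+w. d (k + j) x w \<partial>P0 \<partial>lborel)"
      by (intro nn_integral_suminf dm2)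
    also have "\<dots> = (\<Sum>k. D j (n (k + j)))"
      unfolding d_def D_def occupation_error_def \<epsilon>_def ..
    \<comment> \<open>The bound for window \<open>j\<close> holds from stage \<open>j\<close> on,
      hence the index shift by \<open>j\<close>.\<close>
    also have "\<dots> \<le> (\<Sum>k. ennreal ((1 / 2) ^ k))"
    proof (rule suminf_le[OF _ summableI summableI])
      fix k
      have "D j (n (k + j)) \<le> ennreal ((1 / 2) ^ (k + j))" by (rule n(2)) simp
      also have "\<dots> \<le> ennreal ((1 / 2) ^ k)" by (intro ennreal_leI power_decreasing) auto
      finally show "D j (n (k + j)) \<le> ennreal ((1 / 2) ^ k)" .
    qed
    also have "\<dots> = ennreal (\<Sum>k. (1 / 2) ^ k)" by (intro suminf_ennreal2 summable_geometric) auto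
    finally have fin: "(\<integral>\<^sup>+x. \<integral>\<^sup>+w. (\<Sum>k. d (k + j) x w) \<partial>P0 \<partial>lborel) \<noteq> \<infinity>" by (auto simp: top_unique)
    have "AE x in lborel. (\<integral>\<^sup>+w. (\<Sum>k. d (k + j) x w) \<partial>P0) \<noteq> \<infinity>"
    proof (rule nn_integral_PInf_AE[OF _ fin])
      have "(\<lambda>x. \<Sum>k. \<integral>\<^sup>+w. d (k + j) x w \<partial>P0) \<in> borel_measurable lborel" by measurable
      then show "(\<lambda>x. \<integral>\<^sup>+w. (\<Sum>k. d (k + j) x w) \<partial>P0) \<in> borel_measurable lborel"
        by (subst nn_integral_suminf) auto
    qed
    then show ?thesis
    proof eventually_elim
      case (elim x)
      then have "AE w in P0. (\<Sum>k. d (k + j) x w) \<noteq> \<infinity>"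
        by (intro nn_integral_PInf_AE borel_measurable_suminf_order dm1)
      then show ?case
      proof eventually_elim
        case (elim w)
        let ?h = "\<lambda>k. occupation (\<epsilon> k) (vshift (- x) w) (min 0 (q j)) (max 0 (q j)) - window_density (min 0 (q j)) (max 0 (q j)) w x"
        have "summable (\<lambda>k. \<bar>?h (k + j)\<bar>)"
          by (rule summable_suminf_not_top) (use elim in \<open>auto simp: d_def\<close>)
        then have "(\<lambda>k. \<bar>?h (k + j)\<bar>) \<longlonglongrightarrow> 0" by (rule summable_LIMSEQ_zero)
        then have "(\<lambda>k. ?h (k + j)) \<longlonglongrightarrow> 0" by (simp only: tendsto_rabs_zero_iff)
        then have "?h \<longlonglongrightarrow> 0" by (rule LIMSEQ_offset)
        then show ?case by (rule LIM_zero_cancel)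
      qed
    qed
  qed
  then have "AE x in lborel. \<forall>j. AE w in P0.
    (\<lambda>k. occupation (\<epsilon> k) (vshift (- x) w) (min 0 (q j)) (max 0 (q j))) \<longlonglongrightarrow> window_density (min 0 (q j)) (max 0 (q j)) w x"
    unfolding AE_all_countable by blast
  then have "AE x in lborel. AE w in P0. \<forall>q\<in>\<rat>.
    (\<lambda>k. occupation (\<epsilon> k) (vshift (- x) w) (min 0 q) (max 0 q)) \<longlonglongrightarrow> window_density (min 0 q) (max 0 q) w x"
  proof eventually_elim
    case (elim x)
    then have "AE w in P0. \<forall>j. (\<lambda>k. occupation (\<epsilon> k) (vshift (- x) w) (min 0 (q j)) (max 0 (q j))) \<longlonglongrightarrow> window_density (min 0 (q j)) (max 0 (q j)) w x"
      unfolding AE_all_countable by blast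
    then show ?case
    proof eventually_elim
      case (elim w)
      then show ?case unfolding qR[symmetric] by (intro ballI) (elim rangeE, simp)
    qed
  qed
  with scale show ?thesis by blast
qed

end

section \<open>The given local time\<close>

lemma sigma_sets_Ioc_Rats: "sets (borel :: real measure) = sigma_sets UNIV ((\<lambda>(p, q). {p<..q}) ` (\<rat> \<times> \<rat>))"
proof -
  have "borel = sigma UNIV ((\<lambda>(p, q). {p<..q::real}) ` (\<rat> \<times> \<rat>))"
  proof (rule borel_eq_sigmaI1[OF borel_sigma_sets_Ioc])
    fix X assume "X \<in> range (\<lambda>(a, b). {a<..b::real})"
    then obtain a b :: real where X: "X = {a<..b}" by auto
    let ?S = "sigma UNIV ((\<lambda>(p, q). {p<..q::real}) ` (\<rat> \<times> \<rat>))"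
    have R: "{p<..q} \<in> sets ?S" if "p \<in> \<rat>" "q \<in> \<rat>" for p q :: real
      using that by (auto intro!: sigma_sets.Basic)
    have I: "(\<Inter>q\<in>{q\<in>\<rat>. b \<le> q}. {p<..q}) \<in> sets ?S" if "p \<in> \<rat>" for p
    proof (rule sets.countable_INT'')
      show "UNIV \<in> sets ?S" using sets.top[of ?S] by simp
      show "countable {q\<in>\<rat>. b \<le> q}" by (rule countable_subset[OF _ countable_rat]) auto
    qed (use R that in auto)
    \<comment> \<open>Both end points are approached from above: the left one by a union, the right
      one by an intersection.\<close>
    have "(\<Union>p\<in>{p\<in>\<rat>. a \<le> p}. \<Inter>q\<in>{q\<in>\<rat>. b \<le> q}. {p<..q}) \<in> sets ?S"
    proof (rule sets.countable_UN')
      show "countable {p\<in>\<rat>. a \<le> p}" by (rule countable_subset[OF _ countable_rat]) auto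
    qed (use I in auto)
    also have "(\<Union>p\<in>{p\<in>\<rat>. a \<le> p}. \<Inter>q\<in>{q\<in>\<rat>. b \<le> q}. {p<..q}) = {a<..b}"
    proof (intro set_eqI iffI)
      fix x assume "x \<in> (\<Union>p\<in>{p\<in>\<rat>. a \<le> p}. \<Inter>q\<in>{q\<in>\<rat>. b \<le> q}. {p<..q})"
      then obtain p where p: "p \<in> \<rat>" "a \<le> p" and x: "\<And>q. q \<in> \<rat> \<Longrightarrow> b \<le> q \<Longrightarrow> p < x \<and> x \<le> q" by auto
      obtain q0 where "q0 \<in> \<rat>" "b < q0" using Rats_dense_in_real[of b "b + 1"] by auto
      then have "a < x" using x[of q0] p by auto
      moreover have "x \<le> b"
      proof (rule ccontr)
        assume "\<not> x \<le> b"
        then obtain q where "q \<in> \<rat>" "b < q" "q < x" using Rats_dense_in_real[of b x] by auto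
        then show False using x[of q] by auto
      qed
      ultimately show "x \<in> {a<..b}" by simp
    next
      fix x assume "x \<in> {a<..b}"
      then obtain p where "p \<in> \<rat>" "a < p" "p < x" "x \<le> b" using Rats_dense_in_real[of a x] by auto
      then show "x \<in> (\<Union>p\<in>{p\<in>\<rat>. a \<le> p}. \<Inter>q\<in>{q\<in>\<rat>. b \<le> q}. {p<..q})"
        by (intro UN_I[of p]) auto
    qed
    finally show "X \<in> sets ?S" by (simp add: X)
  qed auto
  then have "sets borel = sets (sigma UNIV ((\<lambda>(p, q). {p<..q::real}) ` (\<rat> \<times> \<rat>)))" by simp
  then show ?thesis by simp
qed

lemma real_measure_eqI_Rats:
  fixes M N :: "real measure"
  assumes "sets M = sets borel" "sets N = sets borel"
    and eq: "\<And>p q. p \<in> \<rat> \<Longrightarrow> q \<in> \<rat> \<Longrightarrow> p \<le> q \<Longrightarrow> emeasure M {p<..q} = emeasure N {p<..q}"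
    and fin: "\<And>p q. p \<in> \<rat> \<Longrightarrow> q \<in> \<rat> \<Longrightarrow> p \<le> q \<Longrightarrow> emeasure N {p<..q} < \<infinity>"
  shows "M = N"
proof (rule measure_eqI_generator_eq[where E="(\<lambda>(p, q). {p<..q}) ` (\<rat> \<times> \<rat>)" and \<Omega>=UNIV and A="\<lambda>n. {-real n<..real n}"])
  show "Int_stable ((\<lambda>(p, q). {p<..q::real}) ` (\<rat> \<times> \<rat>))"
  proof (rule Int_stableI)
    fix a b assume "a \<in> (\<lambda>(p, q). {p<..q::real}) ` (\<rat> \<times> \<rat>)" "b \<in> (\<lambda>(p, q). {p<..q::real}) ` (\<rat> \<times> \<rat>)"
    then obtain p q r s where "a = {p<..q}" "b = {r<..s}" "p \<in> \<rat>" "q \<in> \<rat>" "r \<in> \<rat>" "s \<in> \<rat>" by auto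
    then have "a \<inter> b = (\<lambda>(p, q). {p<..q}) (max p r, min q s)" "(max p r, min q s) \<in> \<rat> \<times> \<rat>"
      by (auto simp: max_def min_def)
    then show "a \<inter> b \<in> (\<lambda>(p, q). {p<..q::real}) ` (\<rat> \<times> \<rat>)" by blast
  qed
  show "emeasure M X = emeasure N X" if X: "X \<in> (\<lambda>(p, q). {p<..q}) ` (\<rat> \<times> \<rat>)" for X
  proof -
    from X obtain p q where pq: "X = {p<..q}" "p \<in> \<rat>" "q \<in> \<rat>" by auto
    then show ?thesis using eq[of p q] by (cases "p \<le> q") auto
  qed
  show "emeasure M {-real i<..real i} \<noteq> \<infinity>" for i
    using eq[of "-real i" "real i"] fin[of "-real i" "real i"] by auto
qed (use assms sigma_sets_Ioc_Rats UN_Ioc_UNIV in auto)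

lemma locally_finite_kernel_interval_measure:
  assumes "\<And>x. x \<in> space M \<Longrightarrow> distribution_function (F x)" "\<And>t. (\<lambda>x. F x t) \<in> borel_measurable M"
  shows "locally_finite_kernel M (\<lambda>x. interval_measure (F x))"
  unfolding locally_finite_kernel_def
proof (intro conjI ballI allI)
  fix a b :: real
  show "emeasure (interval_measure (F x)) {a<..b} < \<infinity>" if "x \<in> space M" for x
    by (rule emeasure_Ioc_finite[OF assms(1)[OF that]])
  show "(\<lambda>x. emeasure (interval_measure (F x)) {a<..b}) \<in> borel_measurable M"
  proof (cases "a \<le> b")
    case True
    have "(\<lambda>x. ennreal (F x b - F x a)) \<in> borel_measurable M" using assms(2) by measurable
    then show ?thesis using emeasure_Ioc[OF assms(1) True] by (simp cong: measurable_cong)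
  qed simp
qed simp

lemma locally_finite_kernel_comp:
  assumes K: "locally_finite_kernel M K" and f: "f \<in> measurable N M"
  shows "locally_finite_kernel N (\<lambda>x. K (f x))"
  using K measurable_space[OF f] unfolding locally_finite_kernel_def
  by (auto intro: measurable_compose[OF f])

text \<open>\<open>G\<close> is normalized to vanish at 0, as \<open>ltime\<close> does; absence of
  atoms makes it continuous.\<close>

lemma distribution_function_of_measure:
  fixes M :: "real measure"
  assumes s[simp]: "sets M = sets borel" and fin: "\<And>a b. emeasure M {a..b} < \<infinity>" and diff: "\<And>s. emeasure M {s} = 0"
  defines "G \<equiv> \<lambda>t. if 0 \<le> t then measure M {0<..t} else - measure M {t<..0}"
  shows "distribution_function G" "M = interval_measure G"
proof -
  have fin': "emeasure M {a<..b} < \<infinity>" for a b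
    by (rule le_less_trans[OF emeasure_mono fin[of a b]]) auto
  have add: "measure M {a<..b} + measure M {b<..c} = measure M {a<..c}" if "a \<le> b" "b \<le> c" for a b c
  proof -
    have "measure M ({a<..b} \<union> {b<..c}) = measure M {a<..b} + measure M {b<..c}"
      using fin' by (intro measure_Union) (auto simp: less_top)
    moreover have "{a<..b} \<union> {b<..c} = {a<..c}" using that by auto
    ultimately show ?thesis by simp
  qed
  have diffG: "G b - G a = measure M {a<..b}" if "a \<le> b" for a b
    using that add[of 0 a b] add[of a 0 b] add[of a b 0] by (auto simp: G_def)
  have mon: "mono G" using diffG by (intro monoI) (metis diff_ge_0_iff_ge measure_nonneg)
  have "isCont G t" for t
  proof -
    have dec: "decseq (\<lambda>n. {t - 1 / real (Suc n)<..t + 1 / real (Suc n)})"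
      unfolding decseq_def
    proof (intro allI impI)
      fix m n :: nat assume "m \<le> n"
      then have "1 / real (Suc n) \<le> 1 / real (Suc m)" by (simp add: frac_le)
      then show "{t - 1 / real (Suc n)<..t + 1 / real (Suc n)} \<subseteq> {t - 1 / real (Suc m)<..t + 1 / real (Suc m)}"
        by (auto simp del: of_nat_Suc)
    qed
    have "(\<lambda>n. measure M {t - 1 / real (Suc n)<..t + 1 / real (Suc n)}) \<longlonglongrightarrow> measure M (\<Inter>n. {t - 1 / real (Suc n)<..t + 1 / real (Suc n)})"
      using fin' dec by (intro Lim_measure_decseq) (auto simp: less_top)
    also have "(\<Inter>n. {t - 1 / real (Suc n)<..t + 1 / real (Suc n)}) = {t}"
    proof (intro set_eqI iffI)
      fix x assume x: "x \<in> (\<Inter>n. {t - 1 / real (Suc n)<..t + 1 / real (Suc n)})"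
      have "\<not> 0 < \<bar>x - t\<bar>"
      proof
        assume "0 < \<bar>x - t\<bar>"
        then obtain n where "1 / real (Suc n) < \<bar>x - t\<bar>" using nat_approx_posE by blast
        moreover have "x \<in> {t - 1 / real (Suc n)<..t + 1 / real (Suc n)}" using x by blast
        ultimately show False unfolding greaterThanAtMost_iff by linarith
      qed
      then show "x \<in> {t}" by simp
    qed auto
    finally have lim: "(\<lambda>n. measure M {t - 1 / real (Suc n)<..t + 1 / real (Suc n)}) \<longlonglongrightarrow> 0"
      using diff[of t] by (simp add: measure_def)
    show ?thesis unfolding isCont_def LIM_eq
    proof (intro allI impI)
      fix e :: real assume "0 < e"
      then obtain n where n: "measure M {t - 1 / real (Suc n)<..t + 1 / real (Suc n)} < e"
        using LIMSEQ_D[OF lim, of e] by auto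
      define d where "d = 1 / real (Suc n)"
      have d: "0 < d" by (simp add: d_def)
      have "\<bar>G x - G t\<bar> < e" if "\<bar>x - t\<bar> < d" for x
      proof -
        have "G (t - d) \<le> G x" "G x \<le> G (t + d)" "G (t - d) \<le> G t" "G t \<le> G (t + d)"
          using that d by (auto intro!: monoD[OF mon])
        moreover have "G (t + d) - G (t - d) < e" using diffG[of "t - d" "t + d"] d n by (simp add: d_def)
        ultimately show ?thesis by linarith
      qed
      then show "\<exists>s>0. \<forall>x. x \<noteq> t \<and> norm (x - t) < s \<longrightarrow> norm (G x - G t) < e" using d by auto
    qed
  qed
  then show df: "distribution_function G"
    using mon by (auto simp: distribution_function_def intro!: continuous_at_imp_continuous_on)
  show "M = interval_measure G"
  proof (rule interval_measure_eqI[OF df s])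
    fix a b :: real assume "a \<le> b"
    then show "emeasure M {a<..b} = ennreal (G b - G a)"
      using diffG[of a b] fin'[of a b] by (simp add: emeasure_eq_ennreal_measure less_top)
  qed
qed

section \<open>Identification of the given local time with the canonical one\<close>

locale regular_local_time = local_time_setup P0 L + occupation_scale \<epsilon>
  for P0 :: "(real \<Rightarrow> real) measure" and L :: "real \<Rightarrow> (real \<Rightarrow> real) \<Rightarrow> real measure" and \<epsilon> :: "nat \<Rightarrow> real" +
  assumes occupation_converges: "AE x in lborel. AE w in P0. \<forall>q\<in>\<rat>.
    (\<lambda>k. occupation (\<epsilon> k) (vshift (- x) w) (min 0 q) (max 0 q)) \<longlonglongrightarrow> window_density (min 0 q) (max 0 q) w x"
begin

definition ltm :: "(real \<Rightarrow> real) \<Rightarrow> real measure" where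
  "ltm w = interval_measure (ltime w)"

text \<open>Agreement on countably many intervals keeps the property measurable, and it already
  implies \<open>L 0 w = ltm w\<close>.\<close>

definition good :: "(real \<Rightarrow> real) \<Rightarrow> bool" where
  "good w \<longleftrightarrow> reg w \<and> (\<forall>p\<in>\<rat>. \<forall>q\<in>\<rat>. p \<le> q \<longrightarrow> emeasure (L 0 w) {p<..q} = ennreal (ltime w q - ltime w p))"

lemma ltime_eval_measurable[measurable]: "(\<lambda>w. ltime w t) \<in> borel_measurable path_space"
  by (rule measurable_fst_path_space[OF ltime_measurable])

lemma borel_measurable_eq_pred:
  fixes f g :: "'x \<Rightarrow> ennreal"
  assumes [measurable]: "f \<in> borel_measurable M" "g \<in> borel_measurable M"
  shows "Measurable.pred M (\<lambda>x. f x = g x)"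
  by measurable

lemma good_measurable[measurable]: "Measurable.pred path_space good"
proof -
  have "Measurable.pred path_space (\<lambda>w. emeasure (L 0 w) {p<..q} = ennreal (ltime w q - ltime w p))" for p q
  proof -
    have "(\<lambda>w. emeasure (L 0 w) {p<..q}) \<in> borel_measurable path_space" by (rule emeasure_L_measurable) simp
    moreover have "(\<lambda>w. ennreal (ltime w q - ltime w p)) \<in> borel_measurable path_space" by measurable
    ultimately show ?thesis by (rule borel_measurable_eq_pred)
  qed
  then have "Measurable.pred path_space (\<lambda>w. \<forall>p\<in>\<rat>. \<forall>q\<in>\<rat>. p \<le> q \<longrightarrow> emeasure (L 0 w) {p<..q} = ennreal (ltime w q - ltime w p))"
    by (intro pred_Ball_countable[OF countable_rat] pred_intros_imp')
  then show ?thesis unfolding good_def by measurable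
qed

lemma good_imp_L:
  assumes c: "continuous_on UNIV w" and g: "good w"
  shows "L 0 w = ltm w"
  unfolding ltm_def
proof (rule real_measure_eqI_Rats)
  note D = distribution_function_ltime[OF c]
  show "sets (L 0 w) = sets borel" by (rule sets_L[OF c])
  show "emeasure (L 0 w) {p<..q} = emeasure (interval_measure (ltime w)) {p<..q}" if "p \<in> \<rat>" "q \<in> \<rat>" "p \<le> q" for p q
    using g that emeasure_Ioc[OF D that(3)] by (simp add: good_def)
  show "emeasure (interval_measure (ltime w)) {p<..q} < \<infinity>" for p q by (rule emeasure_Ioc_finite[OF D])
qed simp

lemma AE_lborel_uminus:
  assumes "AE x in lborel. Q (- x :: real)" shows "AE x in lborel. Q x"
proof -
  have "AE x in distr lborel borel uminus. Q (- x)" using assms by (subst lborel_distr_uminus)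
  then have "AE x in lborel. Q (- (- x))" by (intro AE_distrD[of uminus lborel borel "\<lambda>x. Q (- x)"]) simp_all
  then show ?thesis by simp
qed

text \<open>For almost every level the occupation times converge at rational times to the
  distribution function of the given local time. That function is continuous because the local time
  is diffuse, so monotonicity makes the convergence locally uniform.\<close>

lemma AE_good: "AE x in lborel. AE w in P0. good (vshift x w)"
proof (rule AE_lborel_uminus)
  show "AE x in lborel. AE w in P0. good (vshift (- x) w)"
    using occupation_converges
  proof eventually_elim
    case (elim x)
    show ?case using elim L_finite[of "- x"] L_diffuse[of "- x"] AE_space
    proof eventually_elim
      case (elim w)
      let ?w = "vshift (- x) w"
      have c: "continuous_on UNIV ?w" using elim(4) by (simp add: space_P0)
      define G where "G t = (if 0 \<le> t then measure (L 0 ?w) {0<..t} else - measure (L 0 ?w) {t<..0})" for t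
      have G: "distribution_function G" "L 0 ?w = interval_measure G"
        unfolding G_def using distribution_function_of_measure[OF sets_L[OF c, of 0]] elim by blast+
      have lim: "(\<lambda>k. occ k ?w 0 q) \<longlonglongrightarrow> G q" if "q \<in> \<rat>" for q
      proof (cases "0 \<le> q")
        case True
        then show ?thesis using elim(1) that by (auto simp: G_def window_density_def measure_def)
      next
        case False
        have "(\<lambda>k. - occ k ?w q 0) \<longlonglongrightarrow> - window_density q 0 w x"
          using elim(1) that False by (intro tendsto_minus) (auto simp: min_def max_def dest!: bspec)
        moreover have "- occ k ?w q 0 = occ k ?w 0 q" for k
          using occupation_add[OF c, of "\<epsilon> k" 0 q 0] by (simp add: occupation_self)
        ultimately show ?thesis using False by (simp add: G_def window_density_def measure_def)
      qed
      have r: "reg ?w" "ltime ?w = G" using regularI[OF c G(1) lim] by auto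
      then show ?case using G emeasure_Ioc[OF G(1)] by (auto simp: good_def)
    qed
  qed
qed

lemma kernel_ltm: "locally_finite_kernel path_space ltm"
  unfolding ltm_def[abs_def]
  by (intro locally_finite_kernel_interval_measure) (auto intro: distribution_function_ltime)

lemma sets_ltm[simp]: "sets (ltm w) = sets borel"
  by (simp add: ltm_def)

lemma AE_occupation_ltm:
  assumes D: "D \<in> sets (borel \<Otimes>\<^sub>M borel)"
  shows "AE w in P0. (\<integral>\<^sup>+s. indicator D (w s, s) \<partial>lborel) = (\<integral>\<^sup>+x. (\<integral>\<^sup>+s. indicator D (x, s) \<partial>ltm (vshift (- x) w)) \<partial>lborel)"
proof -
  interpret PP: pair_sigma_finite lborel P0 ..
  have "D \<in> sets borel" using D by (simp only: borel_prod)
  then have 1: "AE w in P0. (\<integral>\<^sup>+s. ennreal (indicator D (w s, s)) \<partial>lborel) = (\<integral>\<^sup>+x. (\<integral>\<^sup>+s. ennreal (indicator D (x, s)) \<partial>L x w) \<partial>lborel)"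
    by (intro L_occupation) auto
  have "AE x in lborel. AE w in P0. good (vshift (- x) w)" using AE_lborel_uminus[of "\<lambda>x. AE w in P0. good (vshift (- x) w)"] AE_good by simp
  moreover have "Measurable.pred (lborel \<Otimes>\<^sub>M P0) (\<lambda>z. good (vshift (- fst z) (snd z)))" by measurable
  ultimately have "AE w in P0. AE x in lborel. good (vshift (- x) w)"
    by (subst PP.AE_commute[symmetric]) (simp_all add: Measurable.pred_def)
  then show ?thesis using 1 AE_space
  proof eventually_elim
    case (elim w)
    then have c: "continuous_on UNIV w" by (simp add: space_P0)
    have "AE x in lborel. L x w = ltm (vshift (- x) w)"
      using elim(1) by eventually_elim (simp add: L_level[OF c] good_imp_L c)
    then have "(\<integral>\<^sup>+x. (\<integral>\<^sup>+s. ennreal (indicator D (x, s)) \<partial>L x w) \<partial>lborel) = (\<integral>\<^sup>+x. (\<integral>\<^sup>+s. indicator D (x, s) \<partial>ltm (vshift (- x) w)) \<partial>lborel)"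
      by (intro nn_integral_cong_AE) (auto elim!: AE_mp simp: ennreal_indicator)
    then show ?case using elim(2) by (simp add: ennreal_indicator)
  qed
qed

lemma kernel_ltm_shifted: "locally_finite_kernel (P0 \<Otimes>\<^sub>M lborel) (\<lambda>z. ltm (vshift (- snd z) (fst z)))"
  by (rule locally_finite_kernel_comp[OF kernel_ltm]) measurable

text \<open>The exceptional set of the occupation formula depends on the integrand, so an integrand
  that involves the path cannot be inserted path by path. Integrated over \<open>P0\<close>, both
  sides are measures on triples (path, level, time) that agree on rectangles and are finite on
  bounded time windows.\<close>

lemma nn_integral_occupation:
  assumes k: "k \<in> borel_measurable (path_space \<Otimes>\<^sub>M (borel \<Otimes>\<^sub>M borel))"
  shows "(\<integral>\<^sup>+w. \<integral>\<^sup>+x. \<integral>\<^sup>+s. k (w, x, s) \<partial>ltm (vshift (- x) w) \<partial>lborel \<partial>P0) = (\<integral>\<^sup>+w. \<integral>\<^sup>+s. k (w, w s, s) \<partial>lborel \<partial>P0)"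
proof -
  let ?T = "path_space \<Otimes>\<^sub>M (borel \<Otimes>\<^sub>M borel) :: ((real \<Rightarrow> real) \<times> real \<times> real) measure"
  let ?f = "\<lambda>z :: (real \<Rightarrow> real) \<times> real. (fst z, fst z (snd z), snd z)"
  let ?g = "\<lambda>z :: ((real \<Rightarrow> real) \<times> real) \<times> real. (fst (fst z), snd (fst z), snd z)"
  let ?K = "\<lambda>z :: (real \<Rightarrow> real) \<times> real. ltm (vshift (- snd z) (fst z))"
  let ?N = "kernel_prod (P0 \<Otimes>\<^sub>M lborel) ?K"
  have [measurable]: "(\<lambda>z. fst z (snd z)) \<in> borel_measurable (P0 \<Otimes>\<^sub>M lborel)"
    by (rule measurable_path_space_eval) measurable
  have f: "?f \<in> measurable (P0 \<Otimes>\<^sub>M lborel) ?T" by measurable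
  have "?g \<in> measurable ((P0 \<Otimes>\<^sub>M lborel) \<Otimes>\<^sub>M borel) ?T" by measurable
  then have g: "?g \<in> measurable ?N ?T" by (simp add: measurable_cong_sets[OF sets_kernel_prod refl])
  have spN: "space ?N = (space P0 \<times> UNIV) \<times> UNIV"
    by (subst sets_eq_imp_space_eq[OF sets_kernel_prod]) (simp add: space_pair_measure)
  have sK: "sets (?K z) = sets borel" for z by simp
  have ef: "emeasure (distr (P0 \<Otimes>\<^sub>M lborel) ?T ?f) (A \<times> D) = (\<integral>\<^sup>+w. indicator A w * (\<integral>\<^sup>+s. indicator D (w s, s) \<partial>lborel) \<partial>P0)"
    if [measurable]: "A \<in> sets path_space" "D \<in> sets (borel \<Otimes>\<^sub>M borel)" for A D
  proof -
    have "emeasure (distr (P0 \<Otimes>\<^sub>M lborel) ?T ?f) (A \<times> D) = (\<integral>\<^sup>+w. indicator (A \<times> D) w \<partial>distr (P0 \<Otimes>\<^sub>M lborel) ?T ?f)" by simp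
    also have "\<dots> = (\<integral>\<^sup>+z. indicator (A \<times> D) (?f z) \<partial>(P0 \<Otimes>\<^sub>M lborel))"
      by (rule nn_integral_distr[OF f]) simp
    also have "\<dots> = (\<integral>\<^sup>+w. \<integral>\<^sup>+s. indicator (A \<times> D) (?f (w, s)) \<partial>lborel \<partial>P0)"
      by (rule lborel.nn_integral_fst[symmetric]) (rule measurable_compose[OF f], simp)
    also have "\<dots> = (\<integral>\<^sup>+w. indicator A w * (\<integral>\<^sup>+s. indicator D (w s, s) \<partial>lborel) \<partial>P0)"
    proof (rule nn_integral_cong)
      fix w assume "w \<in> space P0"
      then have [measurable]: "w \<in> borel_measurable borel" by (intro continuous_borel_measurable) (simp add: space_P0)
      have "(\<integral>\<^sup>+s. indicator (A \<times> D) (?f (w, s)) \<partial>lborel) = (\<integral>\<^sup>+s. indicator A w * indicator D (w s, s) \<partial>lborel)"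
        by (intro nn_integral_cong) (auto simp: indicator_def)
      also have "\<dots> = indicator A w * (\<integral>\<^sup>+s. indicator D (w s, s) \<partial>lborel)"
        by (rule nn_integral_cmult) measurable
      finally show "(\<integral>\<^sup>+s. indicator (A \<times> D) (?f (w, s)) \<partial>lborel) = indicator A w * (\<integral>\<^sup>+s. indicator D (w s, s) \<partial>lborel)" .
    qed
    finally show ?thesis .
  qed
  have eg: "emeasure (distr ?N ?T ?g) (A \<times> D)
     = (\<integral>\<^sup>+w. indicator A w * (\<integral>\<^sup>+x. \<integral>\<^sup>+s. indicator D (x, s) \<partial>ltm (vshift (- x) w) \<partial>lborel) \<partial>P0)"
    if [measurable]: "A \<in> sets path_space" "D \<in> sets (borel \<Otimes>\<^sub>M borel)" for A D
  proof -
    have inner[measurable]: "(\<lambda>z. \<integral>\<^sup>+s. indicator D (snd z, s) \<partial>?K z) \<in> borel_measurable (P0 \<Otimes>\<^sub>M lborel)"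
      by (rule locally_finite_kernel_measurable[OF kernel_ltm_shifted]) measurable
    have "emeasure (distr ?N ?T ?g) (A \<times> D) = (\<integral>\<^sup>+w. indicator (A \<times> D) w \<partial>distr ?N ?T ?g)" by simp
    also have "\<dots> = (\<integral>\<^sup>+z. indicator (A \<times> D) (?g z) \<partial>?N)"
      by (rule nn_integral_distr[OF g]) simp
    also have "\<dots> = (\<integral>\<^sup>+z. \<integral>\<^sup>+s. indicator (A \<times> D) (?g (z, s)) \<partial>?K z \<partial>(P0 \<Otimes>\<^sub>M lborel))"
      by (rule nn_integral_kernel_prod[OF kernel_ltm_shifted]) measurable
    also have "\<dots> = (\<integral>\<^sup>+z. indicator A (fst z) * (\<integral>\<^sup>+s. indicator D (snd z, s) \<partial>?K z) \<partial>(P0 \<Otimes>\<^sub>M lborel))"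
    proof (rule nn_integral_cong)
      fix z :: "(real \<Rightarrow> real) \<times> real"
      have "(\<integral>\<^sup>+s. indicator (A \<times> D) (?g (z, s)) \<partial>?K z) = (\<integral>\<^sup>+s. indicator A (fst z) * indicator D (snd z, s) \<partial>?K z)"
        by (intro nn_integral_cong) (auto simp: indicator_def)
      also have "\<dots> = indicator A (fst z) * (\<integral>\<^sup>+s. indicator D (snd z, s) \<partial>?K z)"
      proof (rule nn_integral_cmult)
        have "(\<lambda>s. indicator D (snd z, s) :: ennreal) \<in> borel_measurable borel" by measurable
        then show "(\<lambda>s. indicator D (snd z, s) :: ennreal) \<in> borel_measurable (?K z)" by (simp add: measurable_cong_sets[OF sK refl])
      qed
      finally show "(\<integral>\<^sup>+s. indicator (A \<times> D) (?g (z, s)) \<partial>?K z) = indicator A (fst z) * (\<integral>\<^sup>+s. indicator D (snd z, s) \<partial>?K z)" .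
    qed
    also have "\<dots> = (\<integral>\<^sup>+w. \<integral>\<^sup>+x. indicator A w * (\<integral>\<^sup>+s. indicator D (x, s) \<partial>ltm (vshift (- x) w)) \<partial>lborel \<partial>P0)"
      by (subst lborel.nn_integral_fst[symmetric]) simp_all
    also have "\<dots> = (\<integral>\<^sup>+w. indicator A w * (\<integral>\<^sup>+x. \<integral>\<^sup>+s. indicator D (x, s) \<partial>ltm (vshift (- x) w) \<partial>lborel) \<partial>P0)"
    proof (rule nn_integral_cong, rule nn_integral_cmult)
      fix w assume "w \<in> space P0"
      then show "(\<lambda>x. \<integral>\<^sup>+s. indicator D (x, s) \<partial>ltm (vshift (- x) w)) \<in> borel_measurable lborel"
        using measurable_compose[OF measurable_Pair1' inner, of w] by simp
    qed
    finally show ?thesis .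
  qed
  have eq: "distr ?N ?T ?g = distr (P0 \<Otimes>\<^sub>M lborel) ?T ?f"
  proof (rule measure_eqI_generator_eq[OF Int_stable_pair_measure_generator[of path_space "borel \<Otimes>\<^sub>M borel :: (real \<times> real) measure"],
        where \<Omega>="space path_space \<times> UNIV" and A="\<lambda>n. space path_space \<times> (UNIV \<times> {-real n..real n})"])
    show "emeasure (distr ?N ?T ?g) X = emeasure (distr (P0 \<Otimes>\<^sub>M lborel) ?T ?f) X"
      if "X \<in> {a \<times> b |a b. a \<in> sets path_space \<and> b \<in> sets (borel \<Otimes>\<^sub>M borel :: (real \<times> real) measure)}" for X
    proof -
      from that obtain A D where X: "X = A \<times> D" and AD: "A \<in> sets path_space" "D \<in> sets (borel \<Otimes>\<^sub>M borel)" by auto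
      show ?thesis unfolding X ef[OF AD] eg[OF AD]
      proof (rule nn_integral_cong_AE)
        show "AE w in P0. indicator A w * (\<integral>\<^sup>+x. \<integral>\<^sup>+s. indicator D (x, s) \<partial>ltm (vshift (- x) w) \<partial>lborel) = indicator A w * (\<integral>\<^sup>+s. indicator D (w s, s) \<partial>lborel)"
          using AE_occupation_ltm[OF AD(2)] by eventually_elim simp
      qed
    qed
    show "emeasure (distr ?N ?T ?g) (space path_space \<times> (UNIV \<times> {-real i..real i})) \<noteq> \<infinity>" for i
    proof -
      have AD: "space path_space \<in> sets path_space" "UNIV \<times> {-real i..real i} \<in> sets (borel \<Otimes>\<^sub>M borel :: (real \<times> real) measure)"
        by (auto intro!: pair_measureI simp del: space_path_space)
      have "emeasure (distr ?N ?T ?g) (space path_space \<times> (UNIV \<times> {-real i..real i}))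
        = (\<integral>\<^sup>+w. indicator (space path_space) w * (\<integral>\<^sup>+s. indicator (UNIV \<times> {-real i..real i}) (w s, s) \<partial>lborel) \<partial>P0)"
        unfolding eg[OF AD]
      proof (rule nn_integral_cong_AE)
        show "AE w in P0. indicator (space path_space) w * (\<integral>\<^sup>+x. \<integral>\<^sup>+s. indicator (UNIV \<times> {-real i..real i}) (x, s) \<partial>ltm (vshift (- x) w) \<partial>lborel)
          = indicator (space path_space) w * (\<integral>\<^sup>+s. indicator (UNIV \<times> {-real i..real i}) (w s, s) \<partial>lborel)"
          using AE_occupation_ltm[OF AD(2)] by eventually_elim simp
      qed
      also have "\<dots> \<le> (\<integral>\<^sup>+w. (\<integral>\<^sup>+s. indicator {-real i..real i} s \<partial>lborel) \<partial>P0)"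
        by (intro nn_integral_mono) (auto simp: indicator_def)
      also have "\<dots> < \<infinity>" by (simp add: emeasure_space_1 ennreal_mult_less_top)
      finally show ?thesis by simp
    qed
    show "(\<Union>i. space path_space \<times> (UNIV \<times> {-real i..real i})) = space path_space \<times> UNIV"
    proof -
      have "\<exists>i. - real i \<le> s \<and> s \<le> real i" for s
        using real_arch_simple[of "\<bar>s\<bar>"] by (auto simp: abs_le_iff minus_le_iff)
      then show ?thesis by auto
    qed
    show "{a \<times> b |a b. a \<in> sets path_space \<and> b \<in> sets (borel \<Otimes>\<^sub>M borel :: (real \<times> real) measure)} \<subseteq> Pow (space path_space \<times> UNIV)"
      using sets.sets_into_space by fastforce
    show "range (\<lambda>n. space path_space \<times> (UNIV \<times> {-real n..real n})) \<subseteq> {a \<times> b |a b. a \<in> sets path_space \<and> b \<in> sets (borel \<Otimes>\<^sub>M borel :: (real \<times> real) measure)}"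
    proof (rule image_subsetI)
      fix n :: nat
      have "space path_space \<in> sets path_space" "UNIV \<times> {-real n..real n} \<in> sets (borel \<Otimes>\<^sub>M borel :: (real \<times> real) measure)"
        by (auto intro!: pair_measureI simp del: space_path_space)
      then show "space path_space \<times> (UNIV \<times> {-real n..real n}) \<in> {a \<times> b |a b. a \<in> sets path_space \<and> b \<in> sets (borel \<Otimes>\<^sub>M borel :: (real \<times> real) measure)}"
        by blast
    qed
  qed (simp_all add: sets_pair_measure space_pair_measure)
  have "(\<integral>\<^sup>+w. \<integral>\<^sup>+x. \<integral>\<^sup>+s. k (w, x, s) \<partial>ltm (vshift (- x) w) \<partial>lborel \<partial>P0) = (\<integral>\<^sup>+z. \<integral>\<^sup>+s. k (?g (z, s)) \<partial>?K z \<partial>(P0 \<Otimes>\<^sub>M lborel))"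
  proof -
    have "(\<lambda>z. \<integral>\<^sup>+s. k (?g (z, s)) \<partial>?K z) \<in> borel_measurable (P0 \<Otimes>\<^sub>M lborel)"
    proof (rule locally_finite_kernel_measurable[OF kernel_ltm_shifted])
      show "(\<lambda>(z, s). k (?g (z, s))) \<in> borel_measurable ((P0 \<Otimes>\<^sub>M lborel) \<Otimes>\<^sub>M borel)"
        unfolding case_prod_beta' by (rule measurable_compose[OF _ k]) measurable
    qed
    then show ?thesis by (subst lborel.nn_integral_fst[symmetric]) simp_all
  qed
  also have "\<dots> = (\<integral>\<^sup>+z. k (?g z) \<partial>?N)"
  proof (rule nn_integral_kernel_prod[OF kernel_ltm_shifted, symmetric])
    show "(\<lambda>z. k (?g z)) \<in> borel_measurable ((P0 \<Otimes>\<^sub>M lborel) \<Otimes>\<^sub>M borel)"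
      by (rule measurable_compose[OF _ k]) measurable
  qed
  also have "\<dots> = (\<integral>\<^sup>+w. k w \<partial>distr ?N ?T ?g)" by (rule nn_integral_distr[OF g, symmetric]) (simp add: k)
  also have "\<dots> = (\<integral>\<^sup>+z. k (?f z) \<partial>(P0 \<Otimes>\<^sub>M lborel))" unfolding eq by (rule nn_integral_distr[OF f]) (simp add: k)
  also have "\<dots> = (\<integral>\<^sup>+w. \<integral>\<^sup>+s. k (w, w s, s) \<partial>lborel \<partial>P0)"
    by (subst lborel.nn_integral_fst[symmetric]) (simp_all add: measurable_compose[OF f k])
  finally show ?thesis .
qed

end

section \<open>Palm formulas\<close>

context regular_local_time
begin

lemma vshift_vshift[simp]: "vshift x (vshift y w) = vshift (x + y) w"
  by (simp add: vshift_def fun_eq_iff)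

lemma path_shift_vshift: "path_shift t (vshift x w) = vshift x (path_shift t w)"
  by (simp add: vshift_def path_shift_def)

lemma path_shift_path_shift[simp]: "path_shift s (path_shift t w) = path_shift (t + s) w"
  by (simp add: path_shift_def add.assoc)

lemma nn_integral_stationary_vshift:
  assumes [measurable]: "f \<in> borel_measurable path_space"
  shows "(\<integral>\<^sup>+w. f (vshift y w) \<partial>stationary) = (\<integral>\<^sup>+w. f w \<partial>stationary)"
proof -
  have "(\<integral>\<^sup>+w. f w \<partial>stationary) = (\<integral>\<^sup>+x. \<integral>\<^sup>+w. f (vshift x w) \<partial>P0 \<partial>lborel)"
    by (rule nn_integral_stationary) measurable
  also have "\<dots> = (\<integral>\<^sup>+x. \<integral>\<^sup>+w. f (vshift (y + x) w) \<partial>P0 \<partial>lborel)"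
    using nn_integral_real_affine[of "\<lambda>x. \<integral>\<^sup>+w. f (vshift x w) \<partial>P0" 1 y] by simp
  also have "\<dots> = (\<integral>\<^sup>+w. f (vshift y w) \<partial>stationary)"
  proof -
    have "(\<integral>\<^sup>+w. f (vshift y w) \<partial>stationary) = (\<integral>\<^sup>+x. \<integral>\<^sup>+w. f (vshift y (vshift x w)) \<partial>P0 \<partial>lborel)"
      by (rule nn_integral_stationary) measurable
    then show ?thesis by simp
  qed
  finally show ?thesis by simp
qed

lemma nn_integral_stationary_fubini:
  assumes M: "sigma_finite_measure M" and f[measurable]: "f \<in> borel_measurable (path_space \<Otimes>\<^sub>M M)"
  shows "(\<integral>\<^sup>+w. \<integral>\<^sup>+y. f (w, y) \<partial>M \<partial>stationary) = (\<integral>\<^sup>+y. \<integral>\<^sup>+w. f (w, y) \<partial>stationary \<partial>M)"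
proof -
  interpret M: sigma_finite_measure M by (rule M)
  interpret A: pair_sigma_finite P0 M ..
  interpret B: pair_sigma_finite lborel M ..
  have [measurable]: "(\<lambda>w. \<integral>\<^sup>+y. f (w, y) \<partial>M) \<in> borel_measurable path_space" by (rule M.borel_measurable_nn_integral_fst) measurable
  have "(\<integral>\<^sup>+w. \<integral>\<^sup>+y. f (w, y) \<partial>M \<partial>stationary) = (\<integral>\<^sup>+x. \<integral>\<^sup>+w. \<integral>\<^sup>+y. f (vshift x w, y) \<partial>M \<partial>P0 \<partial>lborel)"
    by (rule nn_integral_stationary) measurable
  also have "\<dots> = (\<integral>\<^sup>+x. \<integral>\<^sup>+y. \<integral>\<^sup>+w. f (vshift x w, y) \<partial>P0 \<partial>M \<partial>lborel)"
    by (intro nn_integral_cong A.Fubini'[symmetric]) measurable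
  also have "\<dots> = (\<integral>\<^sup>+y. \<integral>\<^sup>+x. \<integral>\<^sup>+w. f (vshift x w, y) \<partial>P0 \<partial>lborel \<partial>M)"
    by (rule B.Fubini'[symmetric]) measurable
  also have "\<dots> = (\<integral>\<^sup>+y. \<integral>\<^sup>+w. f (w, y) \<partial>stationary \<partial>M)"
    by (intro nn_integral_cong nn_integral_stationary[symmetric]) measurable
  finally show ?thesis .
qed

lemma path_functional_measurable:
  assumes "g \<in> borel_measurable (path_space \<Otimes>\<^sub>M borel)" "h \<in> measurable M path_space" "r \<in> borel_measurable M"
  shows "(\<lambda>x. g (h x, r x)) \<in> borel_measurable M"
  by (rule measurable_compose[OF measurable_Pair[OF assms(2,3)] assms(1)])

lemma ltm_nn_integral_measurable:
  assumes g: "g \<in> borel_measurable (path_space \<Otimes>\<^sub>M borel)" and k: "k \<in> measurable M path_space" and h: "h \<in> measurable M path_space"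
  shows "(\<lambda>x. \<integral>\<^sup>+s. g (path_shift s (k x), s) \<partial>ltm (h x)) \<in> borel_measurable M"
proof (rule locally_finite_kernel_measurable[OF locally_finite_kernel_comp[OF kernel_ltm h]])
  have "(\<lambda>z. path_shift (snd z) (k (fst z))) \<in> measurable (M \<Otimes>\<^sub>M borel) path_space"
    by (rule path_shift_measurable[OF measurable_snd measurable_compose[OF measurable_fst k]])
  then show "(\<lambda>(x, s). g (path_shift s (k x), s)) \<in> borel_measurable (M \<Otimes>\<^sub>M borel)"
    unfolding case_prod_beta' by (rule path_functional_measurable[OF g _ measurable_snd])
qed

text \<open>The path seen from a typical point of the zero set, under the stationary measure, is
  Brownian motion started at the origin.\<close>

lemma palm_zero:
  assumes g: "g \<in> borel_measurable (path_space \<Otimes>\<^sub>M borel)"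
  shows "(\<integral>\<^sup>+w. \<integral>\<^sup>+s. g (path_shift s w, s) \<partial>ltm w \<partial>stationary) = (\<integral>\<^sup>+s. \<integral>\<^sup>+w. g (w, s) \<partial>P0 \<partial>lborel)"
proof -
  interpret PP: pair_sigma_finite lborel P0 ..
  have F: "(\<lambda>w. \<integral>\<^sup>+s. g (path_shift s w, s) \<partial>ltm w) \<in> borel_measurable path_space"
    by (rule ltm_nn_integral_measurable[OF g measurable_ident measurable_ident, unfolded id_def])
  have vm: "(\<lambda>z. vshift (fst z) (snd z)) \<in> measurable (borel \<Otimes>\<^sub>M P0) path_space"
      "(\<lambda>z. vshift (- fst z) (snd z)) \<in> measurable (lborel \<Otimes>\<^sub>M P0) path_space" by measurable
  note F' = ltm_nn_integral_measurable[OF g vm(2) vm(2)]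
  have F1: "(\<lambda>x. \<integral>\<^sup>+w. \<integral>\<^sup>+s. g (path_shift s (vshift x w), s) \<partial>ltm (vshift x w) \<partial>P0) \<in> borel_measurable borel"
    using borel_measurable_nn_integral_fst[OF ltm_nn_integral_measurable[OF g vm(1) vm(1)]] by simp
  have "(\<integral>\<^sup>+w. \<integral>\<^sup>+s. g (path_shift s w, s) \<partial>ltm w \<partial>stationary)
    = (\<integral>\<^sup>+x. \<integral>\<^sup>+w. \<integral>\<^sup>+s. g (path_shift s (vshift x w), s) \<partial>ltm (vshift x w) \<partial>P0 \<partial>lborel)"
    by (rule nn_integral_stationary[OF F])
  \<comment> \<open>Reflecting \<open>x\<close> makes the zeros of the shifted path the visits of
    \<open>w\<close> to the level \<open>x\<close>, the form required by the occupation
    formula.\<close>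
  also have "\<dots> = (\<integral>\<^sup>+x. \<integral>\<^sup>+w. \<integral>\<^sup>+s. g (path_shift s (vshift (- x) w), s) \<partial>ltm (vshift (- x) w) \<partial>P0 \<partial>lborel)"
    using nn_integral_real_affine[OF F1, of "- 1" 0] by simp
  also have "\<dots> = (\<integral>\<^sup>+w. \<integral>\<^sup>+x. \<integral>\<^sup>+s. g (path_shift s (vshift (- x) w), s) \<partial>ltm (vshift (- x) w) \<partial>lborel \<partial>P0)"
    using PP.Fubini[OF F'] by simp
  \<comment> \<open>The occupation formula replaces the integral over levels and local times by one
    over time, with \<open>w s\<close> in place of the level.\<close>
  also have "\<dots> = (\<integral>\<^sup>+w. \<integral>\<^sup>+s. g (path_shift s (vshift (- w s) w), s) \<partial>lborel \<partial>P0)"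
  proof -
    have "(\<lambda>z :: (real \<Rightarrow> real) \<times> real \<times> real. g (path_shift (snd (snd z)) (vshift (- fst (snd z)) (fst z)), snd (snd z))) \<in> borel_measurable (path_space \<Otimes>\<^sub>M (borel \<Otimes>\<^sub>M borel))"
      by (rule path_functional_measurable[OF g]) measurable
    from nn_integral_occupation[OF this] show ?thesis by simp
  qed
  also have "\<dots> = (\<integral>\<^sup>+w. \<integral>\<^sup>+s. g (recenter s w, s) \<partial>lborel \<partial>P0)"
    by (simp add: path_shift_vshift recenter_def)
  also have "\<dots> = (\<integral>\<^sup>+s. \<integral>\<^sup>+w. g (recenter s w, s) \<partial>P0 \<partial>lborel)"
  proof -
    have "(\<lambda>z. g (recenter (fst z) (snd z), fst z)) \<in> borel_measurable (lborel \<Otimes>\<^sub>M P0)"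
      by (rule path_functional_measurable[OF g]) measurable
    from PP.Fubini[OF this] show ?thesis by simp
  qed
  also have "\<dots> = (\<integral>\<^sup>+s. \<integral>\<^sup>+w. g (w, s) \<partial>P0 \<partial>lborel)"
  proof (rule nn_integral_cong)
    fix s
    have "(\<lambda>w. g (w, s)) \<in> borel_measurable path_space" using measurable_compose[OF measurable_Pair2' g] by simp
    then show "(\<integral>\<^sup>+w. g (recenter s w, s) \<partial>P0) = (\<integral>\<^sup>+w. g (w, s) \<partial>P0)" by (rule nn_integral_recenter)
  qed
  finally show ?thesis .
qed

lemma palm_level:
  assumes g: "g \<in> borel_measurable (path_space \<Otimes>\<^sub>M borel)"
  shows "(\<integral>\<^sup>+w. \<integral>\<^sup>+s. g (path_shift s w, s) \<partial>ltm (vshift (- y) w) \<partial>stationary) = (\<integral>\<^sup>+s. \<integral>\<^sup>+w. g (vshift y w, s) \<partial>P0 \<partial>lborel)"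
proof -
  let ?g = "\<lambda>z. g (vshift y (fst z), snd z)"
  have g': "?g \<in> borel_measurable (path_space \<Otimes>\<^sub>M borel)" by (rule measurable_compose[OF _ g]) measurable
  have "(\<lambda>w. \<integral>\<^sup>+s. ?g (path_shift s w, s) \<partial>ltm w) \<in> borel_measurable path_space"
    by (rule ltm_nn_integral_measurable[OF g' measurable_ident measurable_ident, unfolded id_def])
  from nn_integral_stationary_vshift[OF this, of "- y"] palm_zero[OF g'] show ?thesis
    by (simp add: path_shift_vshift vshift_0)
qed

text \<open>The Palm formula at level \<open>y\<close> expresses probabilities for the starting
  point \<open>y\<close> through shifted paths under the stationary measure. A set avoided by all
  shifts of almost every path is therefore null for every starting point, not only for almost every
  one.\<close>

lemma null_transfer:
  assumes N[measurable]: "N \<in> sets path_space" and ae: "AE x in lborel. AE w in P0. \<forall>s. path_shift s (vshift x w) \<notin> N"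
  shows "AE w in P0. vshift y w \<notin> N"
proof -
  let ?g = "\<lambda>z :: (real \<Rightarrow> real) \<times> real. indicator N (fst z) * indicator {0..1} (snd z) :: ennreal"
  have g: "?g \<in> borel_measurable (path_space \<Otimes>\<^sub>M borel)" by measurable
  have F: "(\<lambda>w. \<integral>\<^sup>+s. ?g (path_shift s w, s) \<partial>ltm (vshift (- y) w)) \<in> borel_measurable path_space"
  proof (rule ltm_nn_integral_measurable[OF g])
    show "(\<lambda>w. w) \<in> measurable path_space path_space" "vshift (- y) \<in> measurable path_space path_space" by measurable
  qed
  have "(\<integral>\<^sup>+w. \<integral>\<^sup>+s. ?g (path_shift s w, s) \<partial>ltm (vshift (- y) w) \<partial>stationary) =
    (\<integral>\<^sup>+x. \<integral>\<^sup>+w. \<integral>\<^sup>+s. ?g (path_shift s (vshift x w), s) \<partial>ltm (vshift (- y) (vshift x w)) \<partial>P0 \<partial>lborel)"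
    by (rule nn_integral_stationary[OF F])
  also have "\<dots> = (\<integral>\<^sup>+(x::real). 0 \<partial>lborel)"
  proof (rule nn_integral_cong_AE)
    show "AE x in lborel. (\<integral>\<^sup>+w. \<integral>\<^sup>+s. ?g (path_shift s (vshift x w), s) \<partial>ltm (vshift (- y) (vshift x w)) \<partial>P0) = 0"
      using ae
    proof eventually_elim
      case (elim x)
      have "(\<integral>\<^sup>+w. \<integral>\<^sup>+s. ?g (path_shift s (vshift x w), s) \<partial>ltm (vshift (- y) (vshift x w)) \<partial>P0) = (\<integral>\<^sup>+w. 0 \<partial>P0)"
      proof (rule nn_integral_cong_AE)
        show "AE w in P0. (\<integral>\<^sup>+s. ?g (path_shift s (vshift x w), s) \<partial>ltm (vshift (- y) (vshift x w))) = 0"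
          using elim by eventually_elim simp
      qed
      then show ?case by simp
    qed
  qed
  finally have "(\<integral>\<^sup>+s. \<integral>\<^sup>+w. ?g (vshift y w, s) \<partial>P0 \<partial>lborel) = 0" using palm_level[OF g, of y] by simp
  moreover have "(\<integral>\<^sup>+w. ?g (vshift y w, s) \<partial>P0) = (\<integral>\<^sup>+w. indicator N (vshift y w) \<partial>P0) * indicator {0..1} s" for s :: real
    unfolding fst_conv snd_conv by (rule nn_integral_multc) measurable
  ultimately have "(\<integral>\<^sup>+(s::real). (\<integral>\<^sup>+w. indicator N (vshift y w) \<partial>P0) * indicator {0..1} s \<partial>lborel) = 0"
    by (simp only:)
  also have "(\<integral>\<^sup>+(s::real). (\<integral>\<^sup>+w. indicator N (vshift y w) \<partial>P0) * indicator {0..1} s \<partial>lborel)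
    = (\<integral>\<^sup>+w. indicator N (vshift y w) \<partial>P0) * emeasure lborel {0..1::real}"
    by (rule nn_integral_cmult_indicator) simp
  finally have "(\<integral>\<^sup>+w. indicator N (vshift y w) \<partial>P0) = (0::ennreal)" by simp
  moreover have "(\<lambda>w. indicator N (vshift y w) :: ennreal) \<in> borel_measurable P0" by measurable
  ultimately have "AE w in P0. indicator N (vshift y w) = (0::ennreal)" by (simp only: nn_integral_0_iff_AE)
  then show ?thesis by eventually_elim (simp add: indicator_eq_0_iff)
qed

lemma good_path_shift:
  assumes c: "continuous_on UNIV w" and g: "good w"
    and sh: "\<forall>t. \<forall>C\<in>sets borel. emeasure (L 0 (path_shift t w)) ((\<lambda>s. s - t) ` C) = emeasure (L 0 w) C"
  shows "good (path_shift t w)"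
  unfolding good_def
proof (intro conjI ballI impI)
  show "reg (path_shift t w)" using g regular_path_shift[OF c] by (simp add: good_def)
  fix p q :: real assume "p \<le> q"
  have "(\<lambda>s. s - t) ` {p + t<..q + t} = {p<..q}"
  proof (intro set_eqI iffI)
    fix x assume "x \<in> {p<..q}"
    then have "x = (x + t) - t" "x + t \<in> {p + t<..q + t}" by auto
    then show "x \<in> (\<lambda>s. s - t) ` {p + t<..q + t}" by (rule image_eqI)
  qed auto
  then have "emeasure (L 0 (path_shift t w)) {p<..q} = emeasure (L 0 w) {p + t<..q + t}"
    using sh[rule_format, of "{p + t<..q + t}" t] by simp
  also have "\<dots> = ennreal (ltime w (q + t) - ltime w (p + t))"
    unfolding good_imp_L[OF c g] ltm_def using \<open>p \<le> q\<close> by (intro emeasure_Ioc distribution_function_ltime c) simp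
  finally show "emeasure (L 0 (path_shift t w)) {p<..q} = ennreal (ltime (path_shift t w) q - ltime (path_shift t w) p)"
    by (simp add: ltime_path_shift[OF c] add.commute)
qed

text \<open>Almost surely all shifts of a good path are good, since the exceptional set in the shift
  covariance of \<open>L\<close> does not depend on the shift; this is the situation of
  \<open>null_transfer\<close>.\<close>

lemma AE_good_all: "AE w in P0. good (vshift y w)"
proof -
  let ?N = "{w \<in> space path_space. \<not> good w}"
  have "?N \<in> sets path_space" by measurable
  moreover have "AE x in lborel. AE w in P0. \<forall>s. path_shift s (vshift x w) \<notin> ?N"
    using AE_good
  proof eventually_elim
    case (elim x)
    show ?case using elim L_shift[of x] AE_space
    proof eventually_elim
      case (elim w)
      then have "continuous_on UNIV (vshift x w)" by (simp add: space_P0)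
      from good_path_shift[OF this] elim show ?case by simp
    qed
  qed
  ultimately have "AE w in P0. vshift y w \<notin> ?N" by (rule null_transfer)
  then show ?thesis using AE_space by eventually_elim (simp add: space_P0)
qed

end

section \<open>The mixed local time\<close>

locale balancing_setup = regular_local_time P0 L \<epsilon> + nu: prob_space \<nu>
  for P0 :: "(real \<Rightarrow> real) measure" and L :: "real \<Rightarrow> (real \<Rightarrow> real) \<Rightarrow> real measure" and \<epsilon> :: "nat \<Rightarrow> real"
    and \<nu> :: "real measure" +
  assumes sets_nu[simp, measurable_cong]: "sets \<nu> = sets borel" and nu_zero: "emeasure \<nu> {0} = 0"
begin

abbreviation level_time :: "(real \<Rightarrow> real) \<Rightarrow> real \<Rightarrow> real \<Rightarrow> real" where
  "level_time w y t \<equiv> ltime (vshift (- y) w) t"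

text \<open>The masses of the windows have a \<nu>-integral in \<open>ennreal\<close> that is
  measurable in the path. The condition amounts to \<nu>-integrability of the level times at every
  time.\<close>

definition summable_levels :: "(real \<Rightarrow> real) \<Rightarrow> bool" where
  "summable_levels w \<longleftrightarrow> (\<forall>n::nat. (\<integral>\<^sup>+y. ennreal (level_time w y (real n) - level_time w y (- real n)) \<partial>\<nu>) < \<infinity>)"

definition mtime :: "(real \<Rightarrow> real) \<Rightarrow> real \<Rightarrow> real" where
  "mtime w t = (if summable_levels w then (\<integral>y. level_time w y t \<partial>\<nu>) else 0)"

definition mtm :: "(real \<Rightarrow> real) \<Rightarrow> real measure" where
  "mtm w = interval_measure (mtime w)"

lemma level_time_measurable2: "(\<lambda>z. level_time (fst z) (snd z) t) \<in> borel_measurable (path_space \<Otimes>\<^sub>M \<nu>)"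
  by (rule measurable_compose[OF _ ltime_eval_measurable]) measurable

lemma vshift_measurable1: "continuous_on UNIV w \<Longrightarrow> (\<lambda>y. vshift (- y) w) \<in> measurable \<nu> path_space"
  by (rule vshift_measurable) auto

lemma level_time_measurable1:
  assumes c: "continuous_on UNIV w"
  shows "(\<lambda>y. level_time w y t) \<in> borel_measurable \<nu>"
  by (rule measurable_compose[OF vshift_measurable1[OF c] ltime_eval_measurable])

lemma summable_levels_measurable[measurable]: "Measurable.pred path_space summable_levels"
proof -
  have [measurable]: "(\<lambda>z. ennreal (level_time (fst z) (snd z) a - level_time (fst z) (snd z) b)) \<in> borel_measurable (path_space \<Otimes>\<^sub>M \<nu>)" for a b
    using level_time_measurable2[of a] level_time_measurable2[of b] by measurable
  have "(\<lambda>w. \<integral>\<^sup>+y. ennreal (level_time w y a - level_time w y b) \<partial>\<nu>) \<in> borel_measurable path_space" for a b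
    using nu.borel_measurable_nn_integral_fst[of "\<lambda>z. ennreal (level_time (fst z) (snd z) a - level_time (fst z) (snd z) b)" path_space] by simp
  then show ?thesis unfolding summable_levels_def by measurable
qed

lemma level_time_mono: "continuous_on UNIV w \<Longrightarrow> s \<le> t \<Longrightarrow> level_time w y s \<le> level_time w y t"
  by (rule distribution_functionD(1)[OF distribution_function_ltime[OF continuous_vshift]])

lemma level_time_bound:
  assumes c: "continuous_on UNIV w" and "\<bar>t\<bar> \<le> b"
  shows "\<bar>level_time w y t\<bar> \<le> level_time w y b - level_time w y (- b)"
  using assms(2) level_time_mono[OF c, of t b y] level_time_mono[OF c, of "- b" t y] level_time_mono[OF c, of 0 b y]
    level_time_mono[OF c, of "- b" 0 y] by (auto simp: ltime_zero abs_le_iff)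

lemma summable_levels_iff:
  assumes c: "continuous_on UNIV w"
  shows "summable_levels w \<longleftrightarrow> (\<forall>t. integrable \<nu> (\<lambda>y. level_time w y t))"
proof (intro iffI allI)
  fix t assume s: "summable_levels w"
  obtain n :: nat where n: "\<bar>t\<bar> \<le> real n" using real_arch_simple by blast
  have "(\<integral>\<^sup>+y. ennreal (norm (level_time w y t)) \<partial>\<nu>) \<le> (\<integral>\<^sup>+y. ennreal (level_time w y (real n) - level_time w y (- real n)) \<partial>\<nu>)"
    using level_time_bound[OF c n] by (intro nn_integral_mono ennreal_leI) simp
  also have "\<dots> < \<infinity>" using s by (simp add: summable_levels_def)
  finally show "integrable \<nu> (\<lambda>y. level_time w y t)" by (intro integrableI_bounded level_time_measurable1[OF c])
next
  assume I: "\<forall>t. integrable \<nu> (\<lambda>y. level_time w y t)"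
  show "summable_levels w" unfolding summable_levels_def
  proof
    fix n :: nat
    have "(\<integral>\<^sup>+y. ennreal (level_time w y (real n) - level_time w y (- real n)) \<partial>\<nu>)
      = ennreal (\<integral>y. level_time w y (real n) - level_time w y (- real n) \<partial>\<nu>)"
      using I level_time_mono[OF c, of "- real n" "real n"] by (intro nn_integral_eq_integral Bochner_Integration.integrable_diff) auto
    then show "(\<integral>\<^sup>+y. ennreal (level_time w y (real n) - level_time w y (- real n)) \<partial>\<nu>) < \<infinity>" by simp
  qed
qed

lemma level_time_path_shift:
  assumes c: "continuous_on UNIV w"
  shows "level_time (path_shift u w) y t = level_time w y (u + t) - level_time w y u"
  by (simp add: path_shift_vshift[symmetric] ltime_path_shift c)

lemma level_time_reverse_path:
  assumes c: "continuous_on UNIV w"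
  shows "level_time (reverse_path w) y t = - level_time w y (- t)"
proof -
  have "vshift (- y) (reverse_path w) = reverse_path (vshift (- y) w)" by (simp add: vshift_def reverse_path_def)
  then show ?thesis using ltime_reverse_path[OF continuous_vshift[OF c]] by simp
qed

lemma summable_levels_path_shift:
  assumes c: "continuous_on UNIV w"
  shows "summable_levels (path_shift u w) \<longleftrightarrow> summable_levels w"
proof -
  have *: "summable_levels (path_shift u w)" if "summable_levels w" and c: "continuous_on UNIV w" for u w
    using that by (simp add: summable_levels_iff level_time_path_shift)
  have e: "path_shift (- u) (path_shift u w) = w" by (simp add: path_shift_def)
  show ?thesis using *[OF _ c, of u] *[OF _ continuous_path_shift[OF c], of u "- u", unfolded e] by blast
qed

lemma summable_levels_reverse_path:
  assumes c: "continuous_on UNIV w"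
  shows "summable_levels (reverse_path w) \<longleftrightarrow> summable_levels w"
proof -
  have *: "summable_levels (reverse_path w)" if "summable_levels w" and c: "continuous_on UNIV w" for w
    using that by (simp add: summable_levels_iff level_time_reverse_path)
  have e: "reverse_path (reverse_path w) = w" by (simp add: reverse_path_def)
  show ?thesis using *[OF _ c] *[OF _ continuous_reverse_path[OF c], unfolded e] by blast
qed

text \<open>By the Palm formula the local time at any level gives (-n,n] the mean mass 2n under the
  stationary measure, so the mean over \<nu> is finite as well. The property is shift invariant and
  thus passes from almost every starting point to every one.\<close>

lemma AE_summable_levels: "AE w in P0. summable_levels (vshift x w)"
proof -
  have "AE w in stationary. (\<integral>\<^sup>+y. ennreal (level_time w y (real n) - level_time w y (- real n)) \<partial>\<nu>) \<noteq> \<infinity>" for n :: nat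
  proof (rule nn_integral_noteq_infinite)
    let ?f = "\<lambda>z. ennreal (level_time (fst z) (snd z) (real n) - level_time (fst z) (snd z) (- real n))"
    have m: "?f \<in> borel_measurable (path_space \<Otimes>\<^sub>M \<nu>)"
      using level_time_measurable2[of "real n"] level_time_measurable2[of "- real n"] by measurable
    show "(\<lambda>w. \<integral>\<^sup>+y. ennreal (level_time w y (real n) - level_time w y (- real n)) \<partial>\<nu>) \<in> borel_measurable stationary"
      using nu.borel_measurable_nn_integral_fst[OF m] by (simp add: measurable_cong_sets[OF sets_stationary refl])
    have "(\<integral>\<^sup>+w. \<integral>\<^sup>+y. ?f (w, y) \<partial>\<nu> \<partial>stationary) = (\<integral>\<^sup>+y. \<integral>\<^sup>+w. ?f (w, y) \<partial>stationary \<partial>\<nu>)"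
      by (rule nn_integral_stationary_fubini[OF _ m]) (rule nu.sigma_finite_measure_axioms)
    also have "\<dots> = (\<integral>\<^sup>+y. ennreal (2 * real n) \<partial>\<nu>)"
    proof (rule nn_integral_cong)
      fix y
      let ?g = "\<lambda>z :: (real \<Rightarrow> real) \<times> real. indicator {- real n<..real n} (snd z) :: ennreal"
      have g: "?g \<in> borel_measurable (path_space \<Otimes>\<^sub>M borel)" by measurable
      have "(\<integral>\<^sup>+w. ?f (w, y) \<partial>stationary) = (\<integral>\<^sup>+w. \<integral>\<^sup>+s. ?g (path_shift s w, s) \<partial>ltm (vshift (- y) w) \<partial>stationary)"
      proof (rule nn_integral_cong)
        fix w assume "w \<in> space stationary"
        then have c: "continuous_on UNIV (vshift (- y) w)" by (simp add: space_stationary)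
        show "?f (w, y) = (\<integral>\<^sup>+s. ?g (path_shift s w, s) \<partial>ltm (vshift (- y) w))"
          using emeasure_Ioc[OF distribution_function_ltime[OF c], of "- real n" "real n"]
          unfolding ltm_def snd_conv fst_conv by (subst nn_integral_indicator) simp_all
      qed
      also have "\<dots> = (\<integral>\<^sup>+s. \<integral>\<^sup>+w. ?g (vshift y w, s) \<partial>P0 \<partial>lborel)" by (rule palm_level[OF g])
      also have "\<dots> = (\<integral>\<^sup>+s. indicator {- real n<..real n} s \<partial>lborel)" by (simp add: emeasure_space_1 del: nn_integral_indicator)
      also have "\<dots> = ennreal (2 * real n)" by (subst nn_integral_indicator) (simp_all add: emeasure_lborel_Ioc)
      finally show "(\<integral>\<^sup>+w. ?f (w, y) \<partial>stationary) = ennreal (2 * real n)" .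
    qed
    also have "\<dots> < \<infinity>" by (simp add: nu.emeasure_space_1 ennreal_mult_less_top)
    finally show "(\<integral>\<^sup>+w. \<integral>\<^sup>+y. ennreal (level_time w y (real n) - level_time w y (- real n)) \<partial>\<nu> \<partial>stationary) \<noteq> \<infinity>" by simp
  qed
  then have "AE w in stationary. summable_levels w"
    unfolding summable_levels_def by (simp add: AE_all_countable less_top)
  then have s: "AE x in lborel. AE w in P0. summable_levels (vshift x w)" by (subst (asm) AE_stationary) simp_all
  let ?N = "{w \<in> space path_space. \<not> summable_levels w}"
  have "?N \<in> sets path_space" by measurable
  moreover have "AE x in lborel. AE w in P0. \<forall>s. path_shift s (vshift x w) \<notin> ?N"
    using s
  proof eventually_elim
    case (elim x)
    show ?case using elim AE_space
    proof eventually_elim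
      case (elim w)
      then have "continuous_on UNIV (vshift x w)" by (simp add: space_P0)
      from summable_levels_path_shift[OF this] elim show ?case by simp
    qed
  qed
  ultimately have "AE w in P0. vshift x w \<notin> ?N" by (rule null_transfer)
  then show ?thesis using AE_space by eventually_elim (simp add: space_P0)
qed

text \<open>Continuity is dominated convergence over the levels, with the mass of a bounded window
  as majorant.\<close>

lemma distribution_function_mtime:
  assumes c: "continuous_on UNIV w"
  shows "distribution_function (mtime w)"
proof (cases "summable_levels w")
  case False
  then show ?thesis by (simp add: mtime_def[abs_def] distribution_function_def mono_def)
next
  case True
  then have I: "integrable \<nu> (\<lambda>y. level_time w y t)" for t by (simp add: summable_levels_iff[OF c])
  have e: "mtime w = (\<lambda>t. \<integral>y. level_time w y t \<partial>\<nu>)" using True by (simp add: mtime_def[abs_def])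
  have "mono (mtime w)" unfolding e by (intro monoI integral_mono I level_time_mono[OF c])
  moreover have "continuous_on UNIV (mtime w)" unfolding e
  proof (rule continuous_at_imp_continuous_on, rule ballI, rule continuous_at_sequentiallyI)
    fix t and u :: "nat \<Rightarrow> real" assume u: "u \<longlonglongrightarrow> t"
    obtain b where "\<forall>n. norm (u n) \<le> b" using convergent_imp_Bseq[OF convergentI[OF u]] by (rule BseqE)
    then have b: "\<bar>u n\<bar> \<le> b" for n by simp
    show "(\<lambda>n. \<integral>y. level_time w y (u n) \<partial>\<nu>) \<longlonglongrightarrow> (\<integral>y. level_time w y t \<partial>\<nu>)"
    proof (rule integral_dominated_convergence[where w="\<lambda>y. level_time w y b - level_time w y (- b)"])
      show "AE y in \<nu>. (\<lambda>n. level_time w y (u n)) \<longlonglongrightarrow> level_time w y t"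
        by (rule AE_I2, rule isCont_tendsto_compose[OF distribution_functionD(3)[OF distribution_function_ltime[OF continuous_vshift[OF c]]] u])
      show "AE y in \<nu>. norm (level_time w y (u n)) \<le> level_time w y b - level_time w y (- b)" for n
        unfolding real_norm_def by (rule AE_I2, rule level_time_bound[OF c b])
      show "integrable \<nu> (\<lambda>y. level_time w y b - level_time w y (- b))"
        by (rule Bochner_Integration.integrable_diff[OF I I])
    qed (rule level_time_measurable1[OF c])+
  qed
  ultimately show ?thesis by (simp add: distribution_function_def)
qed

lemma mtime_path_shift:
  assumes c: "continuous_on UNIV w"
  shows "mtime (path_shift u w) t = mtime w (u + t) - mtime w u"
proof (cases "summable_levels w")
  case True
  then have I: "integrable \<nu> (\<lambda>y. level_time w y t)" for t by (simp add: summable_levels_iff[OF c])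
  show ?thesis using True I by (simp add: mtime_def summable_levels_path_shift[OF c] level_time_path_shift[OF c])
qed (simp add: mtime_def summable_levels_path_shift[OF c])

lemma mtime_reverse_path:
  assumes c: "continuous_on UNIV w"
  shows "mtime (reverse_path w) t = - mtime w (- t)"
  by (simp add: mtime_def summable_levels_reverse_path[OF c] level_time_reverse_path[OF c])

lemma mtime_zero: "mtime w 0 = 0"
  by (simp add: mtime_def ltime_zero)

lemma mtime_eval_measurable[measurable]: "(\<lambda>w. mtime w t) \<in> borel_measurable path_space"
proof -
  have "(\<lambda>w. \<integral>y. level_time w y t \<partial>\<nu>) \<in> borel_measurable path_space"
    by (rule nu.borel_measurable_lebesgue_integral) (use level_time_measurable2[of t] in \<open>simp add: case_prod_beta'\<close>)
  then show ?thesis unfolding mtime_def by measurable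
qed

lemma kernel_mtm: "locally_finite_kernel path_space mtm"
  unfolding mtm_def[abs_def]
  by (intro locally_finite_kernel_interval_measure) (auto intro: distribution_function_mtime)

lemma sets_mtm[simp]: "sets (mtm w) = sets borel"
  by (simp add: mtm_def)

lemma kernel_levels:
  assumes c: "continuous_on UNIV w"
  shows "locally_finite_kernel \<nu> (\<lambda>y. ltm (vshift (- y) w))"
  by (rule locally_finite_kernel_comp[OF kernel_ltm vshift_measurable1[OF c]])

text \<open>The mixture over \<nu> of the level measures is the time marginal of a
  \<open>kernel_prod\<close>, and its distribution function is \<open>mtime\<close>.\<close>

lemma nn_integral_mtm:
  assumes c: "continuous_on UNIV w" and s: "summable_levels w" and f: "f \<in> borel_measurable borel"
  shows "(\<integral>\<^sup>+t. f t \<partial>mtm w) = (\<integral>\<^sup>+y. \<integral>\<^sup>+t. f t \<partial>ltm (vshift (- y) w) \<partial>\<nu>)"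
proof -
  have I: "integrable \<nu> (\<lambda>y. level_time w y t)" for t using s by (simp add: summable_levels_iff[OF c])
  let ?K = "kernel_prod \<nu> (\<lambda>y. ltm (vshift (- y) w))"
  have m: "snd \<in> measurable ?K borel" by (simp add: measurable_cong_sets[OF sets_kernel_prod refl])
  have sp: "space ?K = UNIV" by (subst sets_eq_imp_space_eq[OF sets_kernel_prod]) (simp add: space_pair_measure sets_eq_imp_space_eq[OF sets_nu])
  have "distr ?K borel snd = mtm w" unfolding mtm_def
  proof (rule interval_measure_eqI[OF distribution_function_mtime[OF c]])
    fix a b :: real assume ab: "a \<le> b"
    have "emeasure (distr ?K borel snd) {a<..b} = emeasure ?K (UNIV \<times> {a<..b})"
      using m by (subst emeasure_distr) (auto simp: sp intro!: arg_cong[where f="emeasure ?K"])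
    also have "\<dots> = (\<integral>\<^sup>+y. emeasure (ltm (vshift (- y) w)) (Pair y -` (UNIV \<times> {a<..b})) \<partial>\<nu>)"
      by (rule emeasure_kernel_prod[OF kernel_levels[OF c]]) simp
    also have "\<dots> = (\<integral>\<^sup>+y. ennreal (level_time w y b - level_time w y a) \<partial>\<nu>)"
    proof (rule nn_integral_cong)
      fix y :: real
      have "Pair y -` (UNIV \<times> {a<..b}) = {a<..b}" by auto
      then show "emeasure (ltm (vshift (- y) w)) (Pair y -` (UNIV \<times> {a<..b})) = ennreal (level_time w y b - level_time w y a)"
        using emeasure_Ioc[OF distribution_function_ltime[OF continuous_vshift[OF c]] ab] by (simp add: ltm_def)
    qed
    also have "\<dots> = ennreal (\<integral>y. level_time w y b - level_time w y a \<partial>\<nu>)"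
      using I level_time_mono[OF c ab] by (intro nn_integral_eq_integral Bochner_Integration.integrable_diff) auto
    also have "\<dots> = ennreal (mtime w b - mtime w a)" using I s by (simp add: mtime_def)
    finally show "emeasure (distr ?K borel snd) {a<..b} = ennreal (mtime w b - mtime w a)" .
  qed simp
  then have "(\<integral>\<^sup>+t. f t \<partial>mtm w) = (\<integral>\<^sup>+t. f t \<partial>distr ?K borel snd)" by simp
  also have "\<dots> = (\<integral>\<^sup>+z. f (snd z) \<partial>?K)" by (rule nn_integral_distr[OF m]) (simp add: f)
  also have "\<dots> = (\<integral>\<^sup>+y. \<integral>\<^sup>+t. f (snd (y, t)) \<partial>ltm (vshift (- y) w) \<partial>\<nu>)"
    by (rule nn_integral_kernel_prod[OF kernel_levels[OF c]]) (rule measurable_compose[OF measurable_snd f])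
  finally show ?thesis by simp
qed

text \<open>The local time at \<open>y\<close> lives on the visits to \<open>y\<close>, and
  \<nu>-almost every level differs from 0; hence the mixed local time does not charge the zero
  set.\<close>

lemma singular_times:
  assumes c: "continuous_on UNIV w"
  shows "singular_pair (ltime w) (mtime w) {s. w s = 0}"
proof
  have [measurable]: "w \<in> borel_measurable borel" by (rule continuous_borel_measurable) (rule c)
  show "distribution_function (ltime w)" "distribution_function (mtime w)"
    by (rule distribution_function_ltime[OF c] distribution_function_mtime[OF c])+
  show A: "{s. w s = 0} \<in> sets borel" by measurable
  have "- {s. w s = 0} = {s. w s \<noteq> 0}" by auto
  then show "emeasure (interval_measure (ltime w)) (- {s. w s = 0}) = 0" using emeasure_ltime_support[OF c] by simp
  show "emeasure (interval_measure (mtime w)) {s. w s = 0} = 0"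
  proof (cases "summable_levels w")
    case True
    have "emeasure (mtm w) {s. w s = 0} = (\<integral>\<^sup>+t. indicator {s. w s = 0} t \<partial>mtm w)" using A by simp
    also have "\<dots> = (\<integral>\<^sup>+y. \<integral>\<^sup>+t. indicator {s. w s = 0} t \<partial>ltm (vshift (- y) w) \<partial>\<nu>)"
      by (rule nn_integral_mtm[OF c True]) (use A in simp)
    also have "\<dots> = (\<integral>\<^sup>+y. 0 \<partial>\<nu>)"
    proof (rule nn_integral_cong_AE)
      have "AE y in \<nu>. y \<noteq> 0" using nu_zero by (intro AE_I[of _ _ "{0}"]) auto
      then show "AE y in \<nu>. (\<integral>\<^sup>+t. indicator {s. w s = 0} t \<partial>ltm (vshift (- y) w)) = 0"
      proof eventually_elim
        case (elim y)
        have "emeasure (ltm (vshift (- y) w)) {s. w s = 0} \<le> emeasure (ltm (vshift (- y) w)) {s. vshift (- y) w s \<noteq> 0}"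
        proof (rule emeasure_mono)
          show "{s. w s = 0} \<subseteq> {s. vshift (- y) w s \<noteq> 0}" using elim by (auto simp: vshift_def)
          have "{s. vshift (- y) w s \<noteq> 0} \<in> sets borel" unfolding vshift_def by measurable
          then show "{s. vshift (- y) w s \<noteq> 0} \<in> sets (ltm (vshift (- y) w))" by simp
        qed
        also have "\<dots> = 0" unfolding ltm_def by (rule emeasure_ltime_support[OF continuous_vshift[OF c]])
        finally show ?case using A by simp
      qed
    qed
    finally show ?thesis by (simp add: mtm_def)
  next
    case False
    then have "mtime w = (\<lambda>t. 0)" by (simp add: mtime_def[abs_def])
    moreover have "null_measure borel = interval_measure (\<lambda>t. 0)"
      by (rule interval_measure_eqI) (auto simp: distribution_function_def mono_def)
    ultimately show ?thesis by (metis emeasure_null_measure)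
  qed
qed

lemma palm_mixed:
  assumes g: "g \<in> borel_measurable (path_space \<Otimes>\<^sub>M borel)"
  shows "(\<integral>\<^sup>+w. \<integral>\<^sup>+s. g (path_shift s w, s) \<partial>mtm w \<partial>stationary) = (\<integral>\<^sup>+y. \<integral>\<^sup>+s. \<integral>\<^sup>+w. g (vshift y w, s) \<partial>P0 \<partial>lborel \<partial>\<nu>)"
proof -
  have s: "AE w in stationary. summable_levels w" by (rule AE_stationaryI[OF _ AE_summable_levels]) measurable
  have "(\<integral>\<^sup>+w. \<integral>\<^sup>+s. g (path_shift s w, s) \<partial>mtm w \<partial>stationary)
    = (\<integral>\<^sup>+w. \<integral>\<^sup>+y. \<integral>\<^sup>+s. g (path_shift s w, s) \<partial>ltm (vshift (- y) w) \<partial>\<nu> \<partial>stationary)"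
  proof (rule nn_integral_cong_AE)
    show "AE w in stationary. (\<integral>\<^sup>+s. g (path_shift s w, s) \<partial>mtm w) = (\<integral>\<^sup>+y. \<integral>\<^sup>+s. g (path_shift s w, s) \<partial>ltm (vshift (- y) w) \<partial>\<nu>)"
      using s AE_space
    proof eventually_elim
      case (elim w)
      then have c: "continuous_on UNIV w" by (simp add: space_stationary)
      have "(\<lambda>s. path_shift s w) \<in> measurable borel path_space" by (rule path_shift_measurable) (use c in auto)
      then show ?case by (intro nn_integral_mtm c elim path_functional_measurable[OF g]) simp_all
    qed
  qed
  also have "\<dots> = (\<integral>\<^sup>+y. \<integral>\<^sup>+w. \<integral>\<^sup>+s. g (path_shift s w, s) \<partial>ltm (vshift (- y) w) \<partial>stationary \<partial>\<nu>)"
  proof -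
    have "(\<lambda>z :: (real \<Rightarrow> real) \<times> real. \<integral>\<^sup>+s. g (path_shift s (fst z), s) \<partial>ltm (vshift (- snd z) (fst z))) \<in> borel_measurable (path_space \<Otimes>\<^sub>M \<nu>)"
      by (rule ltm_nn_integral_measurable[OF g]) measurable
    from nn_integral_stationary_fubini[OF nu.sigma_finite_measure_axioms this] show ?thesis by simp
  qed
  also have "\<dots> = (\<integral>\<^sup>+y. \<integral>\<^sup>+s. \<integral>\<^sup>+w. g (vshift y w, s) \<partial>P0 \<partial>lborel \<partial>\<nu>)"
    by (simp add: palm_level[OF g])
  finally show ?thesis .
qed

end

section \<open>The first return of the balance\<close>

lemma ereal_eqI_above:
  fixes x y :: ereal
  assumes "ereal s \<le> x" "ereal s \<le> y" and iff: "\<And>d. s < d \<Longrightarrow> x \<le> ereal d \<longleftrightarrow> y \<le> ereal d"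
  shows "x = y"
proof -
  have *: False if lt: "u < v" and s: "ereal s \<le> u" and i: "\<And>d. s < d \<Longrightarrow> u \<le> ereal d \<longleftrightarrow> v \<le> ereal d" for u v :: ereal
  proof -
    obtain d where d: "u < ereal d" "ereal d < v" using ereal_dense2[OF lt] by auto
    then have "ereal s < ereal d" using s by (rule_tac le_less_trans)
    then show False using i[of d] d by auto
  qed
  show ?thesis using *[of x y] *[of y x] assms by (cases x y rule: linorder_cases) auto
qed

text \<open>By compactness a continuous function has a zero in [a,d] as soon as it takes arbitrarily
  small values there, and by continuity rational points suffice. This is a countable description, as
  measurability requires.\<close>

lemma zero_in_Icc_iff:
  fixes h :: "real \<Rightarrow> real"
  assumes h: "continuous_on UNIV h" and "a < d"
  shows "(\<exists>t\<in>{a..d}. h t = 0) \<longleftrightarrow> (\<forall>k::nat. \<exists>q\<in>\<rat>. q \<in> {a..d} \<and> \<bar>h q\<bar> < 1 / real (Suc k))"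
proof
  assume "\<exists>t\<in>{a..d}. h t = 0"
  then obtain t where t: "a \<le> t" "t \<le> d" "h t = 0" by auto
  show "\<forall>k::nat. \<exists>q\<in>\<rat>. q \<in> {a..d} \<and> \<bar>h q\<bar> < 1 / real (Suc k)"
  proof
    fix k :: nat
    have "isCont h t" using h by (simp add: continuous_on_eq_continuous_at)
    then obtain e where e: "0 < e" "\<And>s. \<bar>s - t\<bar> < e \<Longrightarrow> \<bar>h s - h t\<bar> < 1 / real (Suc k)"
      unfolding continuous_at_eps_delta dist_real_def by (metis of_nat_0_less_iff zero_less_Suc zero_less_divide_1_iff)
    obtain q where q: "q \<in> \<rat>" "max a (t - e) < q" "q < min d (t + e)"
      using Rats_dense_in_real[of "max a (t - e)" "min d (t + e)"] t e \<open>a < d\<close> by auto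
    then have "\<bar>h q\<bar> < 1 / real (Suc k)" using e(2)[of q] t by auto
    then show "\<exists>q\<in>\<rat>. q \<in> {a..d} \<and> \<bar>h q\<bar> < 1 / real (Suc k)" using q by (intro bexI[of _ q]) auto
  qed
next
  assume R: "\<forall>k::nat. \<exists>q\<in>\<rat>. q \<in> {a..d} \<and> \<bar>h q\<bar> < 1 / real (Suc k)"
  have "continuous_on {a..d} (\<lambda>t. \<bar>h t\<bar>)" by (intro continuous_intros continuous_on_subset[OF h]) auto
  then obtain m where m: "m \<in> {a..d}" "\<And>t. t \<in> {a..d} \<Longrightarrow> \<bar>h m\<bar> \<le> \<bar>h t\<bar>"
    using continuous_attains_inf[of "{a..d}" "\<lambda>t. \<bar>h t\<bar>"] \<open>a < d\<close> by auto
  have "\<not> 0 < \<bar>h m\<bar>"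
  proof
    assume "0 < \<bar>h m\<bar>"
    then obtain k where k: "1 / real (Suc k) < \<bar>h m\<bar>" using nat_approx_posE by blast
    from R obtain q where q: "q \<in> {a..d}" "\<bar>h q\<bar> < 1 / real (Suc k)" by blast
    then show False using m(2)[OF q(1)] k by linarith
  qed
  then show "\<exists>t\<in>{a..d}. h t = 0" using m by auto
qed

text \<open>Both sides are integrals of \<open>f\<close> over (0,1]: on the left against the image
  of \<open>F\<close> under the matching, on the right against \<open>G\<close>. By
  \<open>eq\<close> these measures agree on intervals.\<close>

lemma matched_integral:
  fixes F G :: "real measure" and \<tau> :: "real \<Rightarrow> ereal" and f :: "real \<Rightarrow> ennreal"
  assumes [simp, measurable_cong]: "sets F = sets borel" "sets G = sets borel" and [measurable]: "\<tau> \<in> borel_measurable borel" "f \<in> borel_measurable borel"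
    and fin: "emeasure G {0<..1} < \<infinity>"
    and eq: "\<And>c d. 0 \<le> c \<Longrightarrow> c \<le> d \<Longrightarrow> d \<le> 1 \<Longrightarrow> emeasure F {s. ereal c < \<tau> s \<and> \<tau> s \<le> ereal d} = emeasure G {c<..d}"
  shows "(\<integral>\<^sup>+s. indicator {s. 0 < \<tau> s \<and> \<tau> s \<le> 1} s * f (real_of_ereal (\<tau> s)) \<partial>F) = (\<integral>\<^sup>+s. indicator {0<..1} s * f s \<partial>G)"
proof -
  let ?A = "{s. 0 < \<tau> s \<and> \<tau> s \<le> 1}"
  have A[measurable]: "?A \<in> sets borel" by measurable
  define M1 where "M1 = distr (density F (indicator ?A)) borel (\<lambda>s. real_of_ereal (\<tau> s))"
  define M2 where "M2 = density G (indicator {0<..1})"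
  have e2: "emeasure M2 {c<..d} = emeasure G {max c 0<..min d 1}" for c d
  proof -
    have "emeasure M2 {c<..d} = (\<integral>\<^sup>+s. indicator {0<..1} s * indicator {c<..d} s \<partial>G)"
      unfolding M2_def by (subst emeasure_density) simp_all
    also have "\<dots> = (\<integral>\<^sup>+s. indicator {max c 0<..min d 1} s \<partial>G)"
      by (intro nn_integral_cong) (auto simp: indicator_def)
    finally show ?thesis by simp
  qed
  have e1: "emeasure M1 {c<..d} = emeasure F {s. ereal (max c 0) < \<tau> s \<and> \<tau> s \<le> ereal (min d 1)}" for c d
  proof -
    have "(\<lambda>s. real_of_ereal (\<tau> s)) \<in> borel_measurable borel" by measurable
    from measurable_sets[OF this, of "{c<..d}"] have [measurable]: "(\<lambda>s. real_of_ereal (\<tau> s)) -` {c<..d} \<in> sets borel" by simp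
    have "emeasure M1 {c<..d} = (\<integral>\<^sup>+s. indicator ?A s * indicator ((\<lambda>s. real_of_ereal (\<tau> s)) -` {c<..d}) s \<partial>F)"
      unfolding M1_def by (subst emeasure_distr, simp, simp) (subst emeasure_density, simp_all add: sets_eq_imp_space_eq[of F borel])
    also have "\<dots> = (\<integral>\<^sup>+s. indicator {s. ereal (max c 0) < \<tau> s \<and> \<tau> s \<le> ereal (min d 1)} s \<partial>F)"
    proof (rule nn_integral_cong)
      fix s
      show "indicator ?A s * indicator ((\<lambda>s. real_of_ereal (\<tau> s)) -` {c<..d}) s = (indicator {s. ereal (max c 0) < \<tau> s \<and> \<tau> s \<le> ereal (min d 1)} s :: ennreal)"
        by (cases "\<tau> s") (auto simp: indicator_def one_ereal_def zero_ereal_def)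
    qed
    finally show ?thesis by simp
  qed
  have eqM: "emeasure M1 {a<..b} = emeasure M2 {a<..b} \<and> emeasure M2 {a<..b} < \<infinity>" for a b
    proof (cases "max a 0 \<le> min b 1")
      case True
      have "emeasure G {max a 0<..min b 1} \<le> emeasure G {0<..1}" by (rule emeasure_mono) auto
      then show ?thesis unfolding e1 e2 using eq[of "max a 0" "min b 1"] True fin by (auto intro: le_less_trans)
    next
      case False
      have A: "{s. ereal (max a 0) < \<tau> s \<and> \<tau> s \<le> ereal (min b 1)} = {}"
      proof (intro equals0I)
        fix s assume "s \<in> {s. ereal (max a 0) < \<tau> s \<and> \<tau> s \<le> ereal (min b 1)}"
        then show False using False by (cases "\<tau> s") auto
      qed
      have B: "{max a 0<..min b 1} = {}" using False by auto
      show ?thesis unfolding e1 e2 A B by simp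
    qed
  have "M1 = M2" by (rule real_measure_eqI_Ioc) (simp add: M1_def, simp add: M2_def, simp_all only: eqM)
  then have "(\<integral>\<^sup>+s. f s \<partial>M1) = (\<integral>\<^sup>+s. f s \<partial>M2)" by simp
  moreover have "(\<integral>\<^sup>+s. f s \<partial>M1) = (\<integral>\<^sup>+s. f (real_of_ereal (\<tau> s)) \<partial>density F (indicator ?A))"
    unfolding M1_def by (rule nn_integral_distr) measurable
  moreover have "\<dots> = (\<integral>\<^sup>+s. indicator ?A s * f (real_of_ereal (\<tau> s)) \<partial>F)"
    by (rule nn_integral_density) measurable
  moreover have "(\<integral>\<^sup>+s. f s \<partial>M2) = (\<integral>\<^sup>+s. indicator {0<..1} s * f s \<partial>G)"
    unfolding M2_def by (rule nn_integral_density) measurable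
  ultimately show ?thesis by (simp only:)
qed

text \<open>The inequality holds on each of (0,c], (c,d] and (d,1], and the three add up to an
  equality of finite masses, so there is no slack in any of them.\<close>

lemma matched_squeeze:
  fixes F G :: "real measure" and \<tau> :: "real \<Rightarrow> ereal"
  assumes [simp, measurable_cong]: "sets F = sets borel" "sets G = sets borel" and [measurable]: "\<tau> \<in> borel_measurable borel"
    and fin: "emeasure G {0<..1} < \<infinity>"
    and le: "\<And>c d. c \<le> d \<Longrightarrow> emeasure F {s. ereal c < \<tau> s \<and> \<tau> s \<le> ereal d} \<le> emeasure G {c<..d}"
    and eq: "emeasure F {s. ereal 0 < \<tau> s \<and> \<tau> s \<le> ereal 1} = emeasure G {0<..1}"
    and cd: "0 \<le> c" "c \<le> d" "d \<le> 1"
  shows "emeasure F {s. ereal c < \<tau> s \<and> \<tau> s \<le> ereal d} = emeasure G {c<..d}"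
proof -
  let ?f = "\<lambda>c d. emeasure F {s. ereal c < \<tau> s \<and> \<tau> s \<le> ereal d}" and ?g = "\<lambda>c d. emeasure G {c<..d}"
  have f: "?f a b + ?f b c = ?f a c" if "a \<le> b" "b \<le> c" for a b c
  proof (subst plus_emeasure)
    show "emeasure F ({s. ereal a < \<tau> s \<and> \<tau> s \<le> ereal b} \<union> {s. ereal b < \<tau> s \<and> \<tau> s \<le> ereal c}) = ?f a c"
    proof (rule arg_cong[where f="emeasure F"])
      show "{s. ereal a < \<tau> s \<and> \<tau> s \<le> ereal b} \<union> {s. ereal b < \<tau> s \<and> \<tau> s \<le> ereal c} = {s. ereal a < \<tau> s \<and> \<tau> s \<le> ereal c}"
      proof (rule set_eqI)
        fix s show "s \<in> {s. ereal a < \<tau> s \<and> \<tau> s \<le> ereal b} \<union> {s. ereal b < \<tau> s \<and> \<tau> s \<le> ereal c} \<longleftrightarrow> s \<in> {s. ereal a < \<tau> s \<and> \<tau> s \<le> ereal c}"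
          using that by (cases "\<tau> s") auto
      qed
    qed
  qed auto
  have g: "?g a b + ?g b c = ?g a c" if "a \<le> b" "b \<le> c" for a b c
  proof (subst plus_emeasure)
    show "emeasure G ({a<..b} \<union> {b<..c}) = ?g a c" using that by (intro arg_cong[where f="emeasure G"]) auto
  qed auto
  have gf: "?g a b < \<infinity>" if "0 \<le> a" "b \<le> 1" for a b
    by (rule le_less_trans[OF emeasure_mono fin]) (use that in auto)
  have real: "\<exists>r\<ge>0. x = ennreal r" if "x < \<infinity>" for x :: ennreal
    using that by (cases x) auto
  obtain a1 a2 a3 where a: "?g 0 c = ennreal a1" "?g c d = ennreal a2" "?g d 1 = ennreal a3" "0 \<le> a1" "0 \<le> a2" "0 \<le> a3"
    using real[OF gf[of 0 c]] real[OF gf[of c d]] real[OF gf[of d 1]] cd by fastforce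
  have ff: "?f a b < \<infinity>" if "0 \<le> a" "b \<le> 1" "a \<le> b" for a b
    using le[OF that(3)] gf[OF that(1,2)] by (rule le_less_trans)
  obtain b1 b2 b3 where b: "?f 0 c = ennreal b1" "?f c d = ennreal b2" "?f d 1 = ennreal b3" "0 \<le> b1" "0 \<le> b2" "0 \<le> b3"
    using real[OF ff[of 0 c]] real[OF ff[of c d]] real[OF ff[of d 1]] cd by fastforce
  have "b1 \<le> a1" "b2 \<le> a2" "b3 \<le> a3" using le[of 0 c] le[of c d] le[of d 1] cd unfolding a(1-3) b(1-3) by (simp_all add: a b)
  moreover have "b1 + b2 + b3 = a1 + a2 + a3"
  proof -
    have "?f 0 c + ?f c d + ?f d 1 = ?g 0 c + ?g c d + ?g d 1"
      using f[of 0 c d] f[of 0 d 1] g[of 0 c d] g[of 0 d 1] cd eq by simp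
    then show ?thesis unfolding a(1-3) b(1-3) by (simp add: a b ennreal_plus[symmetric] del: ennreal_plus)
  qed
  ultimately have "b2 = a2" by linarith
  then show ?thesis unfolding a(2) b(2) by (rule arg_cong)
qed

lemma nn_integral_eq_imp_AE_eq:
  assumes [measurable]: "f \<in> borel_measurable M" "g \<in> borel_measurable M" and le: "AE x in M. f x \<le> g x"
    and fin: "(\<integral>\<^sup>+x. f x \<partial>M) < \<infinity>" and eq: "(\<integral>\<^sup>+x. f x \<partial>M) = (\<integral>\<^sup>+x. g x \<partial>M)"
  shows "AE x in M. f x = g x"
proof -
  have "(\<integral>\<^sup>+x. g x - f x \<partial>M) = (\<integral>\<^sup>+x. g x \<partial>M) - (\<integral>\<^sup>+x. f x \<partial>M)"
    using fin le by (intro nn_integral_diff) auto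
  then have "(\<integral>\<^sup>+x. g x - f x \<partial>M) = 0" using eq fin by simp
  then have "AE x in M. g x - f x = 0" by (subst (asm) nn_integral_0_iff_AE) auto
  then show ?thesis using le by eventually_elim (auto simp: diff_eq_0_iff_ennreal)
qed

section \<open>The first return as a functional of the path, and its mass transport\<close>

context balancing_setup
begin

abbreviation balance :: "(real \<Rightarrow> real) \<Rightarrow> real \<Rightarrow> real" where
  "balance w \<equiv> \<lambda>t. ltime w t - mtime w t"

definition first_return :: "(real \<Rightarrow> real) \<Rightarrow> ereal" where
  "first_return w = return_time (balance w) 0"

lemma continuous_balance: "continuous_on UNIV w \<Longrightarrow> continuous_on A (balance w)"
  by (intro continuous_intros distribution_functionD(2)[OF distribution_function_ltime] distribution_functionD(2)[OF distribution_function_mtime])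

lemma balance_path_shift: "continuous_on UNIV w \<Longrightarrow> balance (path_shift s w) t = balance w (s + t) - balance w s"
  by (simp add: ltime_path_shift mtime_path_shift)

lemma balance_zero: "balance w 0 = 0"
  by (simp add: ltime_zero mtime_zero)

lemma first_return_nonneg: "0 \<le> first_return w"
  using return_time_ge[of 0 "balance w"] by (simp add: first_return_def zero_ereal_def)

lemma first_return_le_iff:
  assumes c: "continuous_on UNIV w" and "0 < d"
  shows "first_return w \<le> ereal d \<longleftrightarrow> (\<exists>t\<in>{0<..d}. balance w t = 0)"
  unfolding first_return_def using return_time_le_iff[OF continuous_balance[OF c] \<open>0 < d\<close>] balance_zero[of w] by simp

text \<open>The balance of the shifted path is the increment of the balance, so the return time from
  \<open>s\<close> is a functional of the path seen from \<open>s\<close>. Both sides are compared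
  with bounds above \<open>s\<close> only, where they are characterized by actual returns.\<close>

lemma return_time_balance:
  assumes c: "continuous_on UNIV w"
  shows "return_time (balance w) s = ereal s + first_return (path_shift s w)"
proof (rule ereal_eqI_above[of s])
  show "ereal s \<le> return_time (balance w) s" by (rule return_time_ge)
  show "ereal s \<le> ereal s + first_return (path_shift s w)"
    using first_return_nonneg[of "path_shift s w"] by (cases "first_return (path_shift s w)") auto
  fix d assume d: "s < d"
  have "ereal s + first_return (path_shift s w) \<le> ereal d \<longleftrightarrow> first_return (path_shift s w) \<le> ereal (d - s)"
    by (cases "first_return (path_shift s w)") auto
  also have "\<dots> \<longleftrightarrow> (\<exists>t\<in>{0<..d - s}. balance w (s + t) = balance w s)"
    using d balance_path_shift[OF c, of s] by (subst first_return_le_iff[OF continuous_path_shift[OF c]]) auto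
  also have "\<dots> \<longleftrightarrow> (\<exists>t\<in>{s<..d}. balance w t = balance w s)"
  proof
    assume "\<exists>t\<in>{0<..d - s}. balance w (s + t) = balance w s"
    then obtain t where t: "0 < t" "t \<le> d - s" "balance w (s + t) = balance w s" by auto
    show "\<exists>t\<in>{s<..d}. balance w t = balance w s" by (rule bexI[of _ "s + t"]) (use t in auto)
  next
    assume "\<exists>t\<in>{s<..d}. balance w t = balance w s"
    then obtain t where t: "s < t" "t \<le> d" "balance w t = balance w s" by auto
    show "\<exists>t\<in>{0<..d - s}. balance w (s + t) = balance w s" by (rule bexI[of _ "t - s"]) (use t in auto)
  qed
  finally show "return_time (balance w) s \<le> ereal d \<longleftrightarrow> ereal s + first_return (path_shift s w) \<le> ereal d"
    using return_time_le_iff[OF continuous_balance[OF c] d] by simp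
qed

lemma first_return_measurable[measurable]: "first_return \<in> borel_measurable path_space"
proof (rule borel_measurableI_le)
  have pos: "{w \<in> space path_space. first_return w \<le> ereal d} \<in> sets path_space" if d: "0 < d" for d
  proof -
    \<comment> \<open>The balance vanishes at 0 itself, so zeros are searched for in compact
      intervals that stay away from 0.\<close>
    have "{w \<in> space path_space. first_return w \<le> ereal d}
      = {w \<in> space path_space. \<exists>n::nat. 1 / real (Suc n) < d \<and>
          (\<forall>k::nat. \<exists>q\<in>\<rat>. q \<in> {1 / real (Suc n)..d} \<and> \<bar>balance w q\<bar> < 1 / real (Suc k))}"
    proof (intro Collect_cong conj_cong refl)
      fix w assume "w \<in> space path_space"
      then have c: "continuous_on UNIV w" by simp
      have "first_return w \<le> ereal d \<longleftrightarrow> (\<exists>n::nat. 1 / real (Suc n) < d \<and> (\<exists>t\<in>{1 / real (Suc n)..d}. balance w t = 0))"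
        unfolding first_return_le_iff[OF c d]
      proof
        assume "\<exists>t\<in>{0<..d}. balance w t = 0"
        then obtain t where t: "0 < t" "t \<le> d" "balance w t = 0" by auto
        obtain n where "1 / real (Suc n) < t" using nat_approx_posE[OF t(1)] by blast
        then have "1 / real (Suc n) < d" "t \<in> {1 / real (Suc n)..d}" using t by auto
        then show "\<exists>n::nat. 1 / real (Suc n) < d \<and> (\<exists>t\<in>{1 / real (Suc n)..d}. balance w t = 0)" using t(3) by blast
      next
        assume "\<exists>n::nat. 1 / real (Suc n) < d \<and> (\<exists>t\<in>{1 / real (Suc n)..d}. balance w t = 0)"
        then obtain n t where t: "t \<in> {1 / real (Suc n)..d}" "balance w t = 0" by blast
        have "0 < 1 / real (Suc n)" by simp
        then have "t \<in> {0<..d}" using t(1) unfolding greaterThanAtMost_iff atLeastAtMost_iff by linarith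
        then show "\<exists>t\<in>{0<..d}. balance w t = 0" using t(2) by blast
      qed
      then show "first_return w \<le> ereal d \<longleftrightarrow> (\<exists>n::nat. 1 / real (Suc n) < d \<and>
          (\<forall>k::nat. \<exists>q\<in>\<rat>. q \<in> {1 / real (Suc n)..d} \<and> \<bar>balance w q\<bar> < 1 / real (Suc k)))"
        by (simp only: zero_in_Icc_iff[OF continuous_balance[OF c]] cong: conj_cong)
    qed
    also have "\<dots> \<in> sets path_space"
    proof -
      have *: "Measurable.pred path_space (\<lambda>w. \<exists>q\<in>\<rat>. q \<in> {1 / real (Suc n)..d} \<and> \<bar>balance w q\<bar> < 1 / real (Suc k))" for n k
      proof -
        have "Measurable.pred path_space (\<lambda>w. \<not> (q \<in> {1 / real (Suc n)..d} \<and> \<bar>balance w q\<bar> < 1 / real (Suc k)))" for q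
        proof -
          have "Measurable.pred path_space (\<lambda>w. \<bar>balance w q\<bar> < 1 / real (Suc k))" by measurable
          then show ?thesis by (intro pred_intros_logic(2) pred_intros_conj1')
        qed
        then have "Measurable.pred path_space (\<lambda>w. \<forall>q\<in>\<rat>. \<not> (q \<in> {1 / real (Suc n)..d} \<and> \<bar>balance w q\<bar> < 1 / real (Suc k)))"
          by (rule pred_Ball_countable[OF countable_rat])
        then have "Measurable.pred path_space (\<lambda>w. \<not> (\<forall>q\<in>\<rat>. \<not> (q \<in> {1 / real (Suc n)..d} \<and> \<bar>balance w q\<bar> < 1 / real (Suc k))))"
          by (rule pred_intros_logic(2))
        moreover have "(\<lambda>w. \<exists>q\<in>\<rat>. q \<in> {1 / real (Suc n)..d} \<and> \<bar>balance w q\<bar> < 1 / real (Suc k)) =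
          (\<lambda>w. \<not> (\<forall>q\<in>\<rat>. \<not> (q \<in> {1 / real (Suc n)..d} \<and> \<bar>balance w q\<bar> < 1 / real (Suc k))))" by blast
        ultimately show ?thesis by (simp only:)
      qed
      have "Measurable.pred path_space (\<lambda>w. \<exists>n::nat. 1 / real (Suc n) < d \<and>
          (\<forall>k::nat. \<exists>q\<in>\<rat>. q \<in> {1 / real (Suc n)..d} \<and> \<bar>balance w q\<bar> < 1 / real (Suc k)))"
        by (intro pred_intros_countable pred_intros_conj1' *)
      then show ?thesis unfolding pred_def .
    qed
    finally show ?thesis .
  qed
  fix y :: ereal
  show "{w \<in> space path_space. first_return w \<le> y} \<in> sets path_space"
  proof (cases y)
    case (real r)
    consider "r < 0" | "r = 0" | "0 < r" by linarith
    then show ?thesis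
    proof cases
      case 1
      have "\<not> first_return w \<le> y" for w
      proof
        assume "first_return w \<le> y"
        with first_return_nonneg have "0 \<le> y" by (rule order_trans)
        then show False using 1 real by simp
      qed
      then show ?thesis by simp
    next
      case 2
      \<comment> \<open>At the threshold 0 no single return characterizes the event; it is the
        intersection over positive thresholds.\<close>
      have z: "first_return w \<le> 0 \<longleftrightarrow> (\<forall>n::nat. first_return w \<le> ereal (1 / real (Suc n)))" for w
      proof
        assume "first_return w \<le> 0"
        moreover have "0 \<le> ereal (1 / real (Suc n))" for n by simp
        ultimately show "\<forall>n::nat. first_return w \<le> ereal (1 / real (Suc n))" by (blast intro: order_trans)
      next
        assume a: "\<forall>n::nat. first_return w \<le> ereal (1 / real (Suc n))"
        show "first_return w \<le> 0"
        proof (rule ccontr)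
          assume "\<not> first_return w \<le> 0"
          then have "0 < first_return w" by (simp only: not_le)
          from ereal_dense2[OF this] obtain e where e: "0 < ereal e" "ereal e < first_return w" by blast
          then have "0 < e" by simp
          then obtain n where "1 / real (Suc n) < e" by (rule nat_approx_posE)
          then have "ereal (1 / real (Suc n)) < ereal e" by simp
          from less_trans[OF this e(2)] a show False by (meson leD)
        qed
      qed
      have y: "y = 0" using real 2 by (simp add: zero_ereal_def)
      have "Measurable.pred path_space (\<lambda>w. \<forall>n::nat. first_return w \<le> ereal (1 / real (Suc n)))"
        by (intro pred_intros_countable, unfold pred_def) (rule pos, simp)
      then show ?thesis unfolding y z pred_def .
    next
      case 3
      then show ?thesis using pos real by simp
    qed
  next
    case MInf
    have "\<not> first_return w \<le> y" for w using first_return_nonneg[of w] MInf by auto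
    then show ?thesis by simp
  next
    case PInf
    have "{w \<in> space path_space. first_return w \<le> y} = space path_space" using PInf by auto
    then show ?thesis by (simp only: sets.top)
  qed
qed

lemma return_time_measurable:
  assumes c: "continuous_on UNIV w"
  shows "(\<lambda>s. return_time (balance w) s) \<in> borel_measurable borel"
proof -
  have p: "(\<lambda>s. path_shift s w) \<in> measurable borel path_space" by (rule path_shift_measurable) (use c in auto)
  show ?thesis unfolding return_time_balance[OF c]
    by (intro borel_measurable_ereal_add borel_measurable_ereal measurable_compose[OF p first_return_measurable] measurable_ident_sets refl)
qed

definition return_path :: "(real \<Rightarrow> real) \<Rightarrow> real \<Rightarrow> real" where
  "return_path w = path_shift (real_of_ereal (first_return w)) w"

lemma return_path_measurable[measurable]: "return_path \<in> measurable path_space path_space"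
  unfolding return_path_def[abs_def] by (rule path_shift_measurable) measurable

text \<open>Palm calculus in the other direction: the path seen from the first return time is the path
  seen from the return times of the points of the zero set that fall into the unit interval.\<close>

lemma transport_return:
  assumes g: "g \<in> borel_measurable path_space"
  shows "(\<integral>\<^sup>+w. indicator {w. first_return w < \<infinity>} w * g (return_path w) \<partial>P0)
    = (\<integral>\<^sup>+w. \<integral>\<^sup>+s. indicator {s. 0 < return_time (balance w) s \<and> return_time (balance w) s \<le> 1} s
        * g (path_shift (real_of_ereal (return_time (balance w) s)) w) \<partial>ltm w \<partial>stationary)"
proof -
  interpret PP: pair_sigma_finite lborel P0 ..
  \<comment> \<open>For finite T = \<open>first_return w\<close> the times \<open>s\<close> with s +
    T in (0,1] form an interval of length one. Averaging over them opens the way to the Palm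
    formula, after which s + T becomes the return time from \<open>s\<close>.\<close>
  let ?A = "{z :: (real \<Rightarrow> real) \<times> real. 0 < ereal (snd z) + first_return (fst z) \<and> ereal (snd z) + first_return (fst z) \<le> 1}"
  let ?k = "\<lambda>z. indicator ?A z * g (return_path (fst z))"
  have gr: "(\<lambda>w. g (return_path w)) \<in> borel_measurable path_space" by (rule measurable_compose[OF return_path_measurable g])
  have A: "Measurable.pred (path_space \<Otimes>\<^sub>M borel) (\<lambda>z. z \<in> ?A)" by measurable
  have iA: "(\<lambda>z. indicator ?A z :: ennreal) \<in> borel_measurable (path_space \<Otimes>\<^sub>M borel)"
    by (rule borel_measurable_indicator') (use A in \<open>simp add: pred_def\<close>)
  have k: "?k \<in> borel_measurable (path_space \<Otimes>\<^sub>M borel)"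
    by (intro borel_measurable_times_ennreal iA measurable_compose[OF measurable_fst gr])
  have "(\<integral>\<^sup>+w. indicator {w. first_return w < \<infinity>} w * g (return_path w) \<partial>P0) = (\<integral>\<^sup>+w. \<integral>\<^sup>+s. ?k (w, s) \<partial>lborel \<partial>P0)"
  proof (rule nn_integral_cong)
    fix w
    show "indicator {w. first_return w < \<infinity>} w * g (return_path w) = (\<integral>\<^sup>+s. ?k (w, s) \<partial>lborel)"
    proof (cases "first_return w")
      case (real r)
      have "(\<integral>\<^sup>+s. ?k (w, s) \<partial>lborel) = (\<integral>\<^sup>+s. g (return_path w) * indicator {- r<..1 - r} s \<partial>lborel)"
        using real by (intro nn_integral_cong) (auto simp: indicator_def one_ereal_def zero_ereal_def)
      also have "\<dots> = g (return_path w)" by (subst nn_integral_cmult_indicator) simp_all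
      finally show ?thesis using real by simp
    next
      case PInf
      then show ?thesis by (simp add: indicator_def)
    next
      case MInf
      then show ?thesis using first_return_nonneg[of w] by simp
    qed
  qed
  also have "\<dots> = (\<integral>\<^sup>+s. \<integral>\<^sup>+w. ?k (w, s) \<partial>P0 \<partial>lborel)"
  proof -
    have "(\<lambda>z. ?k (snd z, fst z)) \<in> borel_measurable (lborel \<Otimes>\<^sub>M P0)"
      by (rule measurable_compose[OF _ k]) measurable
    from PP.Fubini[OF this] show ?thesis by (simp only: fst_conv snd_conv)
  qed
  also have "\<dots> = (\<integral>\<^sup>+w. \<integral>\<^sup>+s. ?k (path_shift s w, s) \<partial>ltm w \<partial>stationary)" by (rule palm_zero[OF k, symmetric])
  also have "\<dots> = (\<integral>\<^sup>+w. \<integral>\<^sup>+s. indicator {s. 0 < return_time (balance w) s \<and> return_time (balance w) s \<le> 1} s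
        * g (path_shift (real_of_ereal (return_time (balance w) s)) w) \<partial>ltm w \<partial>stationary)"
  proof (rule nn_integral_cong, rule nn_integral_cong)
    fix w s assume "w \<in> space stationary"
    then have c: "continuous_on UNIV w" by (simp add: space_stationary)
    show "?k (path_shift s w, s) = indicator {s. 0 < return_time (balance w) s \<and> return_time (balance w) s \<le> 1} s
        * g (path_shift (real_of_ereal (return_time (balance w) s)) w)"
      unfolding return_time_balance[OF c] return_path_def
      by (cases "first_return (path_shift s w)") (auto simp: indicator_def)
  qed
  finally show ?thesis .
qed

lemma emeasure_return_times:
  "emeasure P0 {w \<in> space P0. first_return w < \<infinity>}
    = (\<integral>\<^sup>+w. emeasure (ltm w) {s. ereal 0 < return_time (balance w) s \<and> return_time (balance w) s \<le> ereal 1} \<partial>stationary)"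
proof -
  have "emeasure P0 {w \<in> space P0. first_return w < \<infinity>} = (\<integral>\<^sup>+w. indicator {w \<in> space P0. first_return w < \<infinity>} w \<partial>P0)"
    by (rule nn_integral_indicator[symmetric]) measurable
  also have "\<dots> = (\<integral>\<^sup>+w. indicator {w. first_return w < \<infinity>} w * 1 \<partial>P0)"
    by (intro nn_integral_cong) (auto simp: indicator_def)
  also have "\<dots> = (\<integral>\<^sup>+w. \<integral>\<^sup>+s. indicator {s. 0 < return_time (balance w) s \<and> return_time (balance w) s \<le> 1} s * 1 \<partial>ltm w \<partial>stationary)"
    by (rule transport_return[where g="\<lambda>_. 1"]) simp
  also have "\<dots> = (\<integral>\<^sup>+w. emeasure (ltm w) {s. ereal 0 < return_time (balance w) s \<and> return_time (balance w) s \<le> ereal 1} \<partial>stationary)"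
  proof (rule nn_integral_cong)
    fix w assume "w \<in> space stationary"
    then have c: "continuous_on UNIV w" by (simp add: space_stationary)
    note [measurable] = return_time_measurable[OF c]
    have "{s. ereal 0 < return_time (balance w) s \<and> return_time (balance w) s \<le> ereal 1} \<in> sets borel" by measurable
    then show "(\<integral>\<^sup>+s. indicator {s. 0 < return_time (balance w) s \<and> return_time (balance w) s \<le> 1} s * 1 \<partial>ltm w)
      = emeasure (ltm w) {s. ereal 0 < return_time (balance w) s \<and> return_time (balance w) s \<le> ereal 1}"
      unfolding mult_1_right by (simp add: zero_ereal_def one_ereal_def)
  qed
  finally show ?thesis .
qed

lemma transport_mixed:
  assumes g: "g \<in> borel_measurable path_space"
  shows "(\<integral>\<^sup>+w. \<integral>\<^sup>+s. indicator {0<..1} s * g (path_shift s w) \<partial>mtm w \<partial>stationary) = (\<integral>\<^sup>+y. \<integral>\<^sup>+w. g (vshift y w) \<partial>P0 \<partial>\<nu>)"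
proof -
  let ?k = "\<lambda>z :: (real \<Rightarrow> real) \<times> real. indicator {0<..1} (snd z) * g (fst z)"
  have k: "?k \<in> borel_measurable (path_space \<Otimes>\<^sub>M borel)"
    by (intro borel_measurable_times_ennreal measurable_compose[OF measurable_fst g] measurable_compose[OF measurable_snd borel_measurable_indicator]) simp
  have gv: "(\<lambda>w. g (vshift y w)) \<in> borel_measurable P0" for y
    by (rule measurable_compose[OF _ g]) measurable
  have "(\<integral>\<^sup>+w. \<integral>\<^sup>+s. indicator {0<..1} s * g (path_shift s w) \<partial>mtm w \<partial>stationary)
    = (\<integral>\<^sup>+y. \<integral>\<^sup>+(s::real). \<integral>\<^sup>+w. indicator {0<..1} s * g (vshift y w) \<partial>P0 \<partial>lborel \<partial>\<nu>)"
    using palm_mixed[OF k] by (simp only: fst_conv snd_conv)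
  also have "\<dots> = (\<integral>\<^sup>+y. \<integral>\<^sup>+w. g (vshift y w) \<partial>P0 \<partial>\<nu>)"
  proof (rule nn_integral_cong)
    fix y
    have "(\<integral>\<^sup>+s. \<integral>\<^sup>+w. indicator {0<..1::real} s * g (vshift y w) \<partial>P0 \<partial>lborel) = (\<integral>\<^sup>+s. (\<integral>\<^sup>+w. g (vshift y w) \<partial>P0) * indicator {0<..1::real} s \<partial>lborel)"
      by (intro nn_integral_cong) (subst nn_integral_cmult[OF gv], simp add: mult.commute)
    also have "\<dots> = (\<integral>\<^sup>+w. g (vshift y w) \<partial>P0)" by (subst nn_integral_cmult_indicator) simp_all
    finally show "(\<integral>\<^sup>+s. \<integral>\<^sup>+w. indicator {0<..1::real} s * g (vshift y w) \<partial>P0 \<partial>lborel) = (\<integral>\<^sup>+w. g (vshift y w) \<partial>P0)" .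
  qed
  finally show ?thesis .
qed

lemma emeasure_mixed_times: "(\<integral>\<^sup>+w. emeasure (mtm w) {0<..1} \<partial>stationary) = 1"
proof -
  have "(\<integral>\<^sup>+w. emeasure (mtm w) {0<..1} \<partial>stationary) = (\<integral>\<^sup>+w. \<integral>\<^sup>+s. indicator {0<..1} s * 1 \<partial>mtm w \<partial>stationary)"
    unfolding mult_1_right by (intro nn_integral_cong nn_integral_indicator[symmetric]) simp
  also have "\<dots> = (\<integral>\<^sup>+y. \<integral>\<^sup>+w. 1 \<partial>P0 \<partial>\<nu>)" by (rule transport_mixed) simp
  also have "\<dots> = 1" by (simp add: emeasure_space_1 nu.emeasure_space_1)
  finally show ?thesis .
qed

text \<open>Matched mass is dominated by the mixed mass on every window. On (0,1] both have mean
  one, the matched mass because returns are almost surely finite; hence they agree for almost every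
  path, and the two transport formulas may be equated.\<close>

lemma nn_integral_return_path:
  assumes fin: "AE w in P0. first_return w < \<infinity>" and g: "g \<in> borel_measurable path_space"
  shows "(\<integral>\<^sup>+w. g (return_path w) \<partial>P0) = (\<integral>\<^sup>+y. \<integral>\<^sup>+w. g (vshift y w) \<partial>P0 \<partial>\<nu>)"
proof -
  let ?F = "\<lambda>w. emeasure (ltm w) {s. ereal 0 < return_time (balance w) s \<and> return_time (balance w) s \<le> ereal 1}"
  let ?G = "\<lambda>w. emeasure (mtm w) {0<..1}"
  have F1: "(\<integral>\<^sup>+w. ?F w \<partial>stationary) = 1"
    unfolding emeasure_return_times[symmetric]
  proof (rule emeasure_eq_1_AE)
    show "{w \<in> space P0. first_return w < \<infinity>} \<in> sets P0" by measurable
    show "AE w in P0. w \<in> {w \<in> space P0. first_return w < \<infinity>}" using fin AE_space by eventually_elim simp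
  qed
  have "AE w in stationary. ?F w = ?G w"
  proof (rule nn_integral_eq_imp_AE_eq)
    \<comment> \<open>The matched mass is rewritten as an integral over shifted paths to see that it
      is measurable in \<open>w\<close>.\<close>
    let ?k = "\<lambda>z :: (real \<Rightarrow> real) \<times> real. indicator {z. ereal 0 < ereal (snd z) + first_return (fst z) \<and> ereal (snd z) + first_return (fst z) \<le> ereal 1} z :: ennreal"
    have "Measurable.pred (path_space \<Otimes>\<^sub>M borel) (\<lambda>z. z \<in> {z. ereal 0 < ereal (snd z) + first_return (fst z) \<and> ereal (snd z) + first_return (fst z) \<le> ereal 1})"
      by measurable
    then have k: "?k \<in> borel_measurable (path_space \<Otimes>\<^sub>M borel)"
      by (intro borel_measurable_indicator') (simp add: pred_def)
    have "(\<lambda>w. \<integral>\<^sup>+s. ?k (path_shift s w, s) \<partial>ltm w) \<in> borel_measurable path_space"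
      by (rule ltm_nn_integral_measurable[OF k measurable_ident measurable_ident, unfolded id_def])
    moreover have "?F w = (\<integral>\<^sup>+s. ?k (path_shift s w, s) \<partial>ltm w)" if "w \<in> space path_space" for w
    proof -
      from that have c: "continuous_on UNIV w" by simp
      note [measurable] = return_time_measurable[OF c]
      have "{s. ereal 0 < return_time (balance w) s \<and> return_time (balance w) s \<le> ereal 1} \<in> sets (ltm w)" unfolding sets_ltm by measurable
      then have e: "?F w = (\<integral>\<^sup>+s. indicator {s. ereal 0 < return_time (balance w) s \<and> return_time (balance w) s \<le> ereal 1} s \<partial>ltm w)"
        by (rule nn_integral_indicator[symmetric])
      also have "\<dots> = (\<integral>\<^sup>+s. ?k (path_shift s w, s) \<partial>ltm w)"
        unfolding return_time_balance[OF c] by (intro nn_integral_cong) (simp add: indicator_def)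
      finally show ?thesis .
    qed
    ultimately have "?F \<in> borel_measurable path_space" by (rule measurable_cong[THEN iffD2, rotated])
    then show "?F \<in> borel_measurable stationary" by (simp only: measurable_cong_sets[OF sets_stationary refl])
    have "?G \<in> borel_measurable path_space" using kernel_mtm by (simp add: locally_finite_kernel_def)
    then show "?G \<in> borel_measurable stationary" by (simp only: measurable_cong_sets[OF sets_stationary refl])
    show "AE w in stationary. ?F w \<le> ?G w"
    proof (rule AE_I2)
      fix w assume "w \<in> space stationary"
      then have c: "continuous_on UNIV w" by (simp add: space_stationary)
      show "?F w \<le> ?G w"
        using singular_pair.emeasure_matched_le[OF singular_times[OF c] return_time_measurable[OF c], of 0 1]
          emeasure_Ioc[OF distribution_function_mtime[OF c], of 0 1] by (simp add: ltm_def mtm_def)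
    qed
    show "(\<integral>\<^sup>+w. ?F w \<partial>stationary) < \<infinity>" by (simp add: F1)
    show "(\<integral>\<^sup>+w. ?F w \<partial>stationary) = (\<integral>\<^sup>+w. ?G w \<partial>stationary)" by (simp only: F1 emeasure_mixed_times)
  qed
  then have ae: "AE w in stationary. (\<integral>\<^sup>+s. indicator {s. 0 < return_time (balance w) s \<and> return_time (balance w) s \<le> 1} s
        * g (path_shift (real_of_ereal (return_time (balance w) s)) w) \<partial>ltm w) = (\<integral>\<^sup>+s. indicator {0<..1} s * g (path_shift s w) \<partial>mtm w)"
    using AE_space
  proof eventually_elim
    case (elim w)
    then have c: "continuous_on UNIV w" by (simp add: space_stationary)
    have ps: "(\<lambda>s. path_shift s w) \<in> measurable borel path_space" by (rule path_shift_measurable) (use c in auto)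
    have G1: "emeasure (mtm w) {0<..1} < \<infinity>" unfolding mtm_def by (rule emeasure_Ioc_finite[OF distribution_function_mtime[OF c]])
    show ?case
    proof (rule matched_integral[OF sets_ltm sets_mtm return_time_measurable[OF c] measurable_compose[OF ps g] G1])
      fix a d :: real assume ad: "0 \<le> a" "a \<le> d" "d \<le> 1"
      show "emeasure (ltm w) {s. ereal a < return_time (balance w) s \<and> return_time (balance w) s \<le> ereal d} = emeasure (mtm w) {a<..d}"
      proof (rule matched_squeeze[OF sets_ltm sets_mtm return_time_measurable[OF c] G1 _ elim(1) ad])
        fix a d :: real assume "a \<le> d"
        then show "emeasure (ltm w) {s. ereal a < return_time (balance w) s \<and> return_time (balance w) s \<le> ereal d} \<le> emeasure (mtm w) {a<..d}"
          using singular_pair.emeasure_matched_le[OF singular_times[OF c] return_time_measurable[OF c], of a d]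
          emeasure_Ioc[OF distribution_function_mtime[OF c], of a d] by (simp add: ltm_def mtm_def)
      qed
    qed
  qed
  have "(\<integral>\<^sup>+w. g (return_path w) \<partial>P0) = (\<integral>\<^sup>+w. indicator {w. first_return w < \<infinity>} w * g (return_path w) \<partial>P0)"
  proof (rule nn_integral_cong_AE)
    show "AE w in P0. g (return_path w) = indicator {w. first_return w < \<infinity>} w * g (return_path w)"
      using fin by eventually_elim simp
  qed
  also have "\<dots> = (\<integral>\<^sup>+w. \<integral>\<^sup>+s. indicator {0<..1} s * g (path_shift s w) \<partial>mtm w \<partial>stationary)"
    unfolding transport_return[OF g] by (rule nn_integral_cong_AE[OF ae])
  also have "\<dots> = (\<integral>\<^sup>+y. \<integral>\<^sup>+w. g (vshift y w) \<partial>P0 \<partial>\<nu>)" by (rule transport_mixed[OF g])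
  finally show ?thesis .
qed

end

section \<open>Finiteness of the first return\<close>

lemma continuous_eq_Rats:
  fixes f g :: "real \<Rightarrow> real"
  assumes f: "continuous_on UNIV f" and g: "continuous_on UNIV g" and eq: "\<And>q. q \<in> \<rat> \<Longrightarrow> f q = g q"
  shows "f t = g t"
proof -
  have "closed {t. f t = g t}" by (intro closed_Collect_eq f g)
  then have "closure \<rat> \<subseteq> {t. f t = g t}" using eq by (intro closure_minimal) auto
  then show ?thesis by (auto simp: Rats_closure_real)
qed

context balancing_setup
begin

text \<open>Almost every path forgets its past: its local times after time zero are those of the path
  frozen before time zero.\<close>

definition future_exact :: "(real \<Rightarrow> real) \<Rightarrow> bool" where
  "future_exact w \<longleftrightarrow> (\<forall>q\<in>\<rat>. ltime (future_path w) q = ltime w (max q 0) \<and> mtime (future_path w) q = mtime w (max q 0))"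

lemma future_exactD:
  assumes c: "continuous_on UNIV w" and e: "future_exact w"
  shows "ltime (future_path w) t = ltime w (max t 0)" "mtime (future_path w) t = mtime w (max t 0)"
proof -
  note [continuous_intros] = continuous_on_compose2[OF distribution_functionD(2)[OF distribution_function_ltime[OF c], of UNIV] _ subset_UNIV]
    continuous_on_compose2[OF distribution_functionD(2)[OF distribution_function_mtime[OF c], of UNIV] _ subset_UNIV]
  have m: "continuous_on UNIV (\<lambda>t::real. max t 0)" by (intro continuous_intros)
  show "ltime (future_path w) t = ltime w (max t 0)"
  proof (rule continuous_eq_Rats[of "ltime (future_path w)" "\<lambda>t. ltime w (max t 0)"])
    show "continuous_on UNIV (ltime (future_path w))" by (rule distribution_functionD(2)[OF distribution_function_ltime[OF continuous_future_path[OF c]]])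
    show "continuous_on UNIV (\<lambda>t. ltime w (max t 0))"
      by (rule continuous_on_compose2[OF distribution_functionD(2)[OF distribution_function_ltime[OF c], of UNIV] m]) simp
  qed (use e in \<open>simp add: future_exact_def\<close>)
  show "mtime (future_path w) t = mtime w (max t 0)"
  proof (rule continuous_eq_Rats[of "mtime (future_path w)" "\<lambda>t. mtime w (max t 0)"])
    show "continuous_on UNIV (mtime (future_path w))" by (rule distribution_functionD(2)[OF distribution_function_mtime[OF continuous_future_path[OF c]]])
    show "continuous_on UNIV (\<lambda>t. mtime w (max t 0))"
      by (rule continuous_on_compose2[OF distribution_functionD(2)[OF distribution_function_mtime[OF c], of UNIV] m]) simp
  qed (use e in \<open>simp add: future_exact_def\<close>)
qed

lemma future_exact_measurable[measurable]: "Measurable.pred path_space future_exact"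
proof -
  have f: "future_path \<in> measurable path_space path_space" by measurable
  have *: "(\<lambda>w. ltime (future_path w) q) \<in> borel_measurable path_space" "(\<lambda>w. mtime (future_path w) q) \<in> borel_measurable path_space" for q
    by (rule measurable_compose[OF f ltime_eval_measurable] measurable_compose[OF f mtime_eval_measurable])+
  have "Measurable.pred path_space (\<lambda>w. ltime (future_path w) q = ltime w (max q 0) \<and> mtime (future_path w) q = mtime w (max q 0))" for q
    by (intro pred_intros_logic borel_measurable_eq[unfolded pred_def[symmetric]] * ltime_eval_measurable mtime_eval_measurable)
  then show ?thesis unfolding future_exact_def by (intro pred_Ball_countable[OF countable_rat])
qed

text \<open>Freezing is harmless for the local times at regular levels other than
  \<open>w 0\<close>; the assumptions say that 0 and \<nu>-almost every level are of this
  kind.\<close>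

lemma future_exactI:
  assumes c: "continuous_on UNIV w" and r: "reg w" "w 0 \<noteq> 0" and s: "summable_levels w"
    and ae: "AE y in \<nu>. reg (vshift (- y) w) \<and> w 0 \<noteq> y"
  shows "future_exact w"
proof -
  have lev: "AE y in \<nu>. level_time (future_path w) y t = level_time w y (max t 0)" for t
    using ae
  proof eventually_elim
    case (elim y)
    have "vshift (- y) (future_path w) = future_path (vshift (- y) w)" by (simp add: vshift_def future_path_def)
    then show ?case using ltime_future_path[OF continuous_vshift[OF c], of "- y" t] elim by (simp add: vshift_def)
  qed
  have cf: "continuous_on UNIV (future_path w)" using c by simp
  have sf: "summable_levels (future_path w)"
    unfolding summable_levels_iff[OF cf]
  proof
    fix t
    have "integrable \<nu> (\<lambda>y. level_time w y (max t 0))" using s summable_levels_iff[OF c] by blast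
    then show "integrable \<nu> (\<lambda>y. level_time (future_path w) y t)"
      using integrable_cong_AE[OF level_time_measurable1[OF cf] level_time_measurable1[OF c] lev] by blast
  qed
  have "mtime (future_path w) t = mtime w (max t 0)" for t
    using integral_cong_AE[OF level_time_measurable1[OF cf] level_time_measurable1[OF c] lev] s sf by (simp add: mtime_def)
  then show ?thesis using ltime_future_path[OF c r] by (simp add: future_exact_def)
qed

lemma AE_eval_neq:
  assumes t: "0 < t" shows "AE w in P0. w t \<noteq> a"
proof -
  have [measurable]: "(\<lambda>w. w t) \<in> borel_measurable P0" using eval_measurable by measurable
  have "(\<integral>\<^sup>+w. indicator {a} (w t) \<partial>P0) = (\<integral>\<^sup>+x. ennreal (normal_density 0 (sqrt t) x) * indicator {a} x \<partial>lborel)"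
    by (rule nn_integral_eval[OF _ t]) simp
  also have "\<dots> = (\<integral>\<^sup>+(x::real). 0 \<partial>lborel)"
  proof (rule nn_integral_cong_AE)
    have "AE x in lborel. x \<noteq> a" by (rule AE_lborel_singleton)
    then show "AE x in lborel. ennreal (normal_density 0 (sqrt t) x) * indicator {a} x = 0"
      by eventually_elim simp
  qed
  finally have "(\<integral>\<^sup>+w. indicator {a} (w t) \<partial>P0) = (0::ennreal)" by simp
  moreover have "(\<lambda>w. indicator {a} (w t) :: ennreal) \<in> borel_measurable P0" by measurable
  ultimately have "AE w in P0. indicator {a} (w t) = (0::ennreal)" by (simp only: nn_integral_0_iff_AE)
  then show ?thesis by eventually_elim (simp add: indicator_eq_0_iff)
qed

lemma AE_levels_regular:
  assumes t: "0 < t"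
  shows "AE w in P0. AE y in \<nu>. reg (vshift (- y) (vshift z w)) \<and> vshift z w t \<noteq> y"
proof -
  interpret PN: pair_sigma_finite P0 \<nu> ..
  have "{x \<in> space (P0 \<Otimes>\<^sub>M \<nu>). reg (vshift (- snd x) (vshift z (fst x))) \<and> vshift z (fst x) t \<noteq> snd x} \<in> sets (P0 \<Otimes>\<^sub>M \<nu>)"
  proof -
    have "(\<lambda>x. vshift (- snd x) (vshift z (fst x))) \<in> measurable (P0 \<Otimes>\<^sub>M \<nu>) path_space" by measurable
    from measurable_compose[OF this regular_measurable]
    have 1: "Measurable.pred (P0 \<Otimes>\<^sub>M \<nu>) (\<lambda>x. reg (vshift (- snd x) (vshift z (fst x))))" .
    have "(\<lambda>x. vshift z (fst x)) \<in> measurable (P0 \<Otimes>\<^sub>M \<nu>) path_space" by measurable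
    from measurable_fst_path_space[OF this] have [measurable]: "(\<lambda>x. vshift z (fst x) t) \<in> borel_measurable (P0 \<Otimes>\<^sub>M \<nu>)" .
    have 2: "Measurable.pred (P0 \<Otimes>\<^sub>M \<nu>) (\<lambda>x. vshift z (fst x) t \<noteq> snd x)" by measurable
    show ?thesis using pred_intros_logic(3)[OF 1 2] by (simp add: pred_def)
  qed
  then have "(AE w in P0. AE y in \<nu>. reg (vshift (- y) (vshift z w)) \<and> vshift z w t \<noteq> y) \<longleftrightarrow>
    (AE y in \<nu>. AE w in P0. reg (vshift (- y) (vshift z w)) \<and> vshift z w t \<noteq> y)"
    by (rule PN.AE_commute)
  moreover have "AE w in P0. reg (vshift (- y) (vshift z w)) \<and> vshift z w t \<noteq> y" for y
    using AE_good_all[of "- y + z"] AE_eval_neq[OF t, of "y - z"]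
  proof eventually_elim
    case (elim w)
    have "reg (vshift (- y) (vshift z w))" using elim(1) unfolding vshift_vshift good_def by blast
    moreover have "vshift z w t \<noteq> y" using elim(2) by (auto simp: vshift_def)
    ultimately show ?case by blast
  qed
  ultimately show ?thesis by simp
qed

text \<open>The time is strictly positive because the starting point may be 0 or an atom of \<nu>,
  whereas the value at a later time has a density and almost surely misses any given level.\<close>

lemma AE_future_exact:
  assumes t: "0 < t"
  shows "AE w in P0. future_exact (path_shift t (vshift z w))"
  using AE_levels_regular[OF t, of z] AE_good_all[of z] AE_summable_levels[of z] AE_eval_neq[OF t, of "- z"] AE_space
proof eventually_elim
  case (elim w)
  then have c: "continuous_on UNIV (vshift z w)" by (simp add: space_P0)
  show ?case
  proof (rule future_exactI)
    show "continuous_on UNIV (path_shift t (vshift z w))" using c by (rule continuous_path_shift)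
    show "reg (path_shift t (vshift z w))" using elim by (simp add: regular_path_shift[OF c] good_def)
    show "path_shift t (vshift z w) 0 \<noteq> 0" using elim by (simp add: path_shift_def vshift_def add_eq_0_iff2)
    show "summable_levels (path_shift t (vshift z w))" using elim by (simp add: summable_levels_path_shift[OF c])
    show "AE y in \<nu>. reg (vshift (- y) (path_shift t (vshift z w))) \<and> path_shift t (vshift z w) 0 \<noteq> y"
      using elim(1)
    proof eventually_elim
      case (elim y)
      have "vshift (- y) (path_shift t (vshift z w)) = path_shift t (vshift (- y) (vshift z w))" by (simp only: path_shift_vshift)
      moreover have "reg (path_shift t (vshift (- y) (vshift z w)))"
        using elim regular_path_shift[OF continuous_vshift[OF c]] by blast
      moreover have "path_shift t (vshift z w) 0 = vshift z w t" by (simp add: path_shift_def)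
      ultimately show ?case using elim by (simp only: simp_thms)
    qed
  qed
qed

lemma AE_stationary_path_shift:
  assumes Q: "Measurable.pred path_space Q" and ae: "AE w in stationary. Q w"
  shows "AE w in stationary. Q (path_shift t w)"
proof -
  let ?f = "\<lambda>w. indicator {w \<in> space path_space. \<not> Q w} w :: ennreal"
  have N: "{w \<in> space path_space. \<not> Q w} \<in> sets path_space" using Q by measurable
  then have m: "?f \<in> borel_measurable path_space" by (rule borel_measurable_indicator)
  have ms: "path_shift t \<in> measurable path_space path_space" by measurable
  have "(\<integral>\<^sup>+w. ?f (path_shift t w) \<partial>stationary) = (\<integral>\<^sup>+w. ?f w \<partial>stationary)" by (rule nn_integral_stationary_path_shift[OF m])
  also have "\<dots> = (\<integral>\<^sup>+w. 0 \<partial>stationary)"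
  proof (rule nn_integral_cong_AE)
    show "AE w in stationary. ?f w = 0" using ae by eventually_elim (simp add: indicator_def)
  qed
  finally have "(\<integral>\<^sup>+w. ?f (path_shift t w) \<partial>stationary) = 0" by simp
  moreover have "(\<lambda>w. ?f (path_shift t w)) \<in> borel_measurable stationary"
    using measurable_compose[OF ms m] by (simp only: measurable_cong_sets[OF sets_stationary refl])
  ultimately have "AE w in stationary. ?f (path_shift t w) = 0" by (simp only: nn_integral_0_iff_AE)
  then show ?thesis using AE_space
  proof eventually_elim
    case (elim w)
    then have "path_shift t w \<notin> {w \<in> space path_space. \<not> Q w}" by (simp add: indicator_eq_0_iff)
    moreover have "path_shift t w \<in> space path_space" using elim by (simp add: space_stationary)
    ultimately show ?case by simp
  qed
qed

text \<open>A shift by 1 leads to a positive time, and stationarity undoes it.\<close>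

lemma AE_stationary_future_exact: "AE w in stationary. future_exact w"
proof -
  have m: "Measurable.pred path_space (\<lambda>w. future_exact (path_shift 1 w))"
    by (rule measurable_compose[OF _ future_exact_measurable]) measurable
  have "AE w in stationary. future_exact (path_shift 1 w)"
    by (rule AE_stationaryI[OF m]) (rule AE_future_exact, simp)
  from AE_stationary_path_shift[OF m this, of "- 1"] show ?thesis by (simp add: path_shift_def)
qed

section \<open>Mass of the zero set that is never matched\<close>

definition unmatched :: "real \<Rightarrow> (real \<Rightarrow> real) \<Rightarrow> ennreal" where
  "unmatched a w = emeasure (ltm w) {s. a < s \<and> first_return (path_shift s w) = \<infinity>}"

lemma unmatched_set:
  assumes c: "continuous_on UNIV w"
  shows "{s. a < s \<and> first_return (path_shift s w) = \<infinity>} \<in> sets borel"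
proof -
  have p: "(\<lambda>s. path_shift s w) \<in> measurable borel path_space" by (rule path_shift_measurable) (use c in auto)
  have [measurable]: "(\<lambda>s. first_return (path_shift s w)) \<in> borel_measurable borel" by (rule measurable_compose[OF p first_return_measurable])
  show ?thesis by measurable
qed

lemma unmatched_measurable[measurable]: "unmatched a \<in> borel_measurable path_space"
proof -
  let ?k = "\<lambda>z :: (real \<Rightarrow> real) \<times> real. indicator {a<..} (snd z) * indicator {w \<in> space path_space. first_return w = \<infinity>} (fst z) :: ennreal"
  have I: "{w \<in> space path_space. first_return w = \<infinity>} \<in> sets path_space" by measurable
  have k: "?k \<in> borel_measurable (path_space \<Otimes>\<^sub>M borel)"
    by (intro borel_measurable_times_ennreal measurable_compose[OF measurable_fst borel_measurable_indicator] measurable_compose[OF measurable_snd borel_measurable_indicator] I) simp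
  have "(\<lambda>w. \<integral>\<^sup>+s. ?k (path_shift s w, s) \<partial>ltm w) \<in> borel_measurable path_space"
    by (rule ltm_nn_integral_measurable[OF k measurable_ident measurable_ident, unfolded id_def])
  moreover have "unmatched a w = (\<integral>\<^sup>+s. ?k (path_shift s w, s) \<partial>ltm w)" if "w \<in> space path_space" for w
  proof -
    from that have c: "continuous_on UNIV w" by simp
    then have "{s. a < s \<and> first_return (path_shift s w) = \<infinity>} \<in> sets (ltm w)" unfolding sets_ltm by (rule unmatched_set)
    then have "unmatched a w = (\<integral>\<^sup>+s. indicator {s. a < s \<and> first_return (path_shift s w) = \<infinity>} s \<partial>ltm w)"
      unfolding unmatched_def by (rule nn_integral_indicator[symmetric])
    also have "\<dots> = (\<integral>\<^sup>+s. ?k (path_shift s w, s) \<partial>ltm w)"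
      by (intro nn_integral_cong) (simp add: indicator_def c)
    finally show ?thesis .
  qed
  ultimately show ?thesis by (rule measurable_cong[THEN iffD2, rotated])
qed

lemma unmatched_return_time:
  assumes c: "continuous_on UNIV w"
  shows "{s. a < s \<and> first_return (path_shift s w) = \<infinity>} = {s. a < s \<and> return_time (balance w) s = \<infinity>}"
  by (simp add: return_time_balance[OF c])

lemma unmatched_antimono:
  assumes c: "continuous_on UNIV w" and "a \<le> b"
  shows "unmatched b w \<le> unmatched a w"
  unfolding unmatched_def by (rule emeasure_mono) (use assms unmatched_set[OF c] in auto)

lemma ltm_path_shift:
  assumes c: "continuous_on UNIV w"
  shows "ltm (path_shift t w) = distr (ltm w) borel (\<lambda>s. s - t)"
  unfolding ltm_def
proof (rule interval_measure_eqI[symmetric])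
  show "distribution_function (ltime (path_shift t w))" by (rule distribution_function_ltime[OF continuous_path_shift[OF c]])
  fix a b :: real assume ab: "a \<le> b"
  have "emeasure (distr (interval_measure (ltime w)) borel (\<lambda>s. s - t)) {a<..b} = emeasure (interval_measure (ltime w)) {a + t<..b + t}"
    by (subst emeasure_distr) (auto intro!: arg_cong[where f="emeasure (interval_measure (ltime w))"])
  also have "\<dots> = ennreal (ltime w (b + t) - ltime w (a + t))"
    using ab by (intro emeasure_Ioc[OF distribution_function_ltime[OF c]]) simp
  finally show "emeasure (distr (interval_measure (ltime w)) borel (\<lambda>s. s - t)) {a<..b} = ennreal (ltime (path_shift t w) b - ltime (path_shift t w) a)"
    by (simp add: ltime_path_shift[OF c] add.commute)
qed simp

lemma unmatched_path_shift:
  assumes c: "continuous_on UNIV w"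
  shows "unmatched a (path_shift t w) = unmatched (a + t) w"
proof -
  have m: "(\<lambda>s. s - t) \<in> measurable (ltm w) borel" by (simp add: measurable_cong_sets[OF sets_ltm refl])
  have "(\<lambda>s. s - t) -` {s. a < s \<and> first_return (path_shift (t + s) w) = \<infinity>} \<inter> space (ltm w) = {s. a + t < s \<and> first_return (path_shift s w) = \<infinity>}"
    by (auto simp: ltm_def)
  then show ?thesis
    unfolding unmatched_def ltm_path_shift[OF c] path_shift_path_shift
    using emeasure_distr[OF m, of "{s. a < s \<and> first_return (path_shift (t + s) w) = \<infinity>}"]
      unmatched_set[OF continuous_path_shift[OF c], of a t] by simp
qed

text \<open>Return times from points s > 0 involve only the balance after 0, which freezing leaves
  unchanged. The measures are compared on the windows (0,n] and then in the limit, because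
  coincidence of distribution functions is exploited on bounded sets.\<close>

lemma unmatched_future_path:
  assumes c: "continuous_on UNIV w" and e: "future_exact w"
  shows "unmatched 0 (future_path w) = unmatched 0 w"
proof -
  let ?E = "{s. 0 < s \<and> return_time (balance w) s = \<infinity>}"
  have cf: "continuous_on UNIV (future_path w)" using c by simp
  have rt: "return_time (balance (future_path w)) s = return_time (balance w) s" if "0 < s" for s
  proof -
    have b: "balance (future_path w) t = balance w t" if "0 < t" for t
      using that future_exactD[OF c e, of t] by simp
    have "s < t \<and> balance (future_path w) t = balance (future_path w) s \<longleftrightarrow> s < t \<and> balance w t = balance w s" for t
      using b[of s] b[of t] \<open>0 < s\<close> by auto
    then show ?thesis unfolding return_time_def by (simp only:)
  qed
  have E: "?E \<in> sets borel" using unmatched_set[OF c, of 0] by (simp only: unmatched_return_time[OF c])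
  have fin: "emeasure (ltm (future_path w)) (?E \<inter> {0<..real n}) = emeasure (ltm w) (?E \<inter> {0<..real n})" for n
    unfolding ltm_def
  proof (rule emeasure_eq_on_coincidence_set[OF distribution_function_ltime[OF cf] distribution_function_ltime[OF c]])
    show "?E \<inter> {0<..real n} \<in> sets borel" using E by (rule sets.Int) simp
    show "?E \<inter> {0<..real n} \<subseteq> {0<..real n}" by simp
    show "ltime (future_path w) t = ltime w t" if "t \<in> ?E \<inter> {0<..real n}" for t
      using that future_exactD[OF c e] by (simp add: max_def)
  qed
  have inc: "incseq (\<lambda>n. ?E \<inter> {0<..real n})" by (auto simp: incseq_def)
  have un: "(\<Union>n. ?E \<inter> {0<..real n}) = ?E"
    using real_arch_simple by auto
  have sup: "emeasure (ltm w') ?E = (SUP n. emeasure (ltm w') (?E \<inter> {0<..real n}))" for w'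
  proof -
    have "?E \<inter> {0<..real n} \<in> sets (ltm w')" for n unfolding sets_ltm using E by (rule sets.Int) simp
    then have "range (\<lambda>n. ?E \<inter> {0<..real n}) \<subseteq> sets (ltm w')" by blast
    from SUP_emeasure_incseq[OF this inc] show ?thesis unfolding un by (rule sym)
  qed
  have "{s. 0 < s \<and> return_time (balance (future_path w)) s = \<infinity>} = ?E" using rt by auto
  then show ?thesis
    unfolding unmatched_def unmatched_return_time[OF cf] unmatched_return_time[OF c] by (simp only: sup fin)
qed

section \<open>The alternative between bounded and unbounded balance\<close>

definition unbounded_paths :: "(real \<Rightarrow> real) set" where
  "unbounded_paths = {w \<in> space path_space. \<forall>n::nat. \<exists>q\<in>\<rat>. 0 \<le> q \<and> real n < balance w q}"

lemma unbounded_paths_measurable: "unbounded_paths \<in> sets path_space"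
proof -
  have "Measurable.pred path_space (\<lambda>w. \<not> (0 \<le> q \<and> real n < balance w q))" for q n
  proof -
    have "Measurable.pred path_space (\<lambda>w. real n < balance w q)" by measurable
    then show ?thesis by (intro pred_intros_logic(2) pred_intros_conj1')
  qed
  then have "Measurable.pred path_space (\<lambda>w. \<forall>q\<in>\<rat>. \<not> (0 \<le> q \<and> real n < balance w q))" for n
    by (rule pred_Ball_countable[OF countable_rat])
  then have "Measurable.pred path_space (\<lambda>w. \<not> (\<forall>q\<in>\<rat>. \<not> (0 \<le> q \<and> real n < balance w q)))" for n
    by (rule pred_intros_logic(2))
  then have "Measurable.pred path_space (\<lambda>w. \<forall>n. \<not> (\<forall>q\<in>\<rat>. \<not> (0 \<le> q \<and> real n < balance w q)))"
    by (rule pred_intros_countable)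
  moreover have "(\<lambda>w. \<forall>n. \<not> (\<forall>q\<in>\<rat>. \<not> (0 \<le> q \<and> real n < balance w q))) = (\<lambda>w. \<forall>n. \<exists>q\<in>\<rat>. 0 \<le> q \<and> real n < balance w q)" by blast
  ultimately show ?thesis unfolding unbounded_paths_def by (simp only: pred_def)
qed

lemma unbounded_paths_iff:
  assumes c: "continuous_on UNIV w"
  shows "w \<in> unbounded_paths \<longleftrightarrow> (\<forall>B. \<exists>t\<ge>0. B < balance w t)"
proof
  assume u: "w \<in> unbounded_paths"
  show "\<forall>B. \<exists>t\<ge>0. B < balance w t"
  proof
    fix B :: real
    obtain n :: nat where n: "B \<le> real n" using real_arch_simple by blast
    from u obtain q where "0 \<le> q" "real n < balance w q" unfolding unbounded_paths_def by blast
    then show "\<exists>t\<ge>0. B < balance w t" using n by (intro exI[of _ q]) auto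
  qed
next
  assume u: "\<forall>B. \<exists>t\<ge>0. B < balance w t"
  have "\<exists>q\<in>\<rat>. 0 \<le> q \<and> real n < balance w q" for n :: nat
  proof -
    obtain t where t: "0 \<le> t" "real n < balance w t" using u by blast
    have "isCont (balance w) t" using continuous_balance[OF c, of UNIV] by (simp add: continuous_on_eq_continuous_at)
    then obtain d where d: "0 < d" "\<And>s. \<bar>s - t\<bar> < d \<Longrightarrow> \<bar>balance w s - balance w t\<bar> < balance w t - real n"
      using t(2) unfolding continuous_at_eps_delta dist_real_def by (metis diff_gt_0_iff_gt)
    obtain q where q: "q \<in> \<rat>" "t < q" "q < t + d" using Rats_dense_in_real[of t "t + d"] d by auto
    then have "real n < balance w q" using d(2)[of q] by auto
    then show ?thesis using q t by (intro bexI[of _ q]) auto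
  qed
  then show "w \<in> unbounded_paths" using c unfolding unbounded_paths_def by simp
qed

text \<open>The balance is bounded on [0,r], so its large values occur after
  \<open>r\<close>.\<close>

lemma unbounded_paths_path_shift:
  assumes c: "continuous_on UNIV w" and r: "0 \<le> r"
  shows "path_shift r w \<in> unbounded_paths \<longleftrightarrow> w \<in> unbounded_paths"
  unfolding unbounded_paths_iff[OF c] unbounded_paths_iff[OF continuous_path_shift[OF c]] balance_path_shift[OF c]
proof
  assume u: "\<forall>B. \<exists>t\<ge>0. B < balance w (r + t) - balance w r"
  show "\<forall>B. \<exists>t\<ge>0. B < balance w t"
  proof
    fix B
    obtain t where "0 \<le> t" "B - balance w r < balance w (r + t) - balance w r" using u by blast
    then show "\<exists>t\<ge>0. B < balance w t" using r by (intro exI[of _ "r + t"]) auto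
  qed
next
  assume u: "\<forall>B. \<exists>t\<ge>0. B < balance w t"
  show "\<forall>B. \<exists>t\<ge>0. B < balance w (r + t) - balance w r"
  proof
    fix B
    have "\<exists>m\<in>{0..r}. \<forall>t\<in>{0..r}. balance w t \<le> balance w m"
      by (rule continuous_attains_sup) (use continuous_balance[OF c] r in auto)
    then obtain m where m: "\<And>t. t \<in> {0..r} \<Longrightarrow> balance w t \<le> balance w m" by blast
    obtain t where t: "0 \<le> t" "max (balance w m) (B + balance w r) < balance w t" using u by blast
    then have "r < t" using m[of t] by (cases "t \<le> r") auto
    then show "\<exists>t\<ge>0. B < balance w (r + t) - balance w r" using t by (intro exI[of _ "t - r"]) auto
  qed
qed

lemma unbounded_paths_future_path:
  assumes c: "continuous_on UNIV w" and e: "future_exact w"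
  shows "future_path w \<in> unbounded_paths \<longleftrightarrow> w \<in> unbounded_paths"
proof -
  have "balance (future_path w) t = balance w t" if "0 \<le> t" for t using future_exactD[OF c e, of t] that by simp
  then have "(\<exists>t\<ge>0. B < balance (future_path w) t) \<longleftrightarrow> (\<exists>t\<ge>0. B < balance w t)" for B by (simp only: cong: conj_cong)
  then show ?thesis unfolding unbounded_paths_iff[OF c] unbounded_paths_iff[OF continuous_future_path[OF c]] by (simp only:)
qed

lemma unbounded_dichotomy:
  "(\<forall>z. AE w in P0. vshift z w \<notin> unbounded_paths) \<or> (\<forall>z. AE w in P0. vshift z w \<in> unbounded_paths)"
proof (rule zero_one_law[OF unbounded_paths_measurable])
  \<comment> \<open>The unit shift before freezing guarantees a positive time even for r = 0, where
    freezing at the starting point could alter the local times.\<close>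
  let ?f = "\<lambda>w. indicator unbounded_paths (future_path (path_shift 1 w)) :: ennreal"
  have "(\<lambda>w. future_path (path_shift 1 w)) \<in> measurable path_space path_space" by measurable
  from measurable_compose[OF this borel_measurable_indicator[OF unbounded_paths_measurable]]
  show "?f \<in> borel_measurable path_space" .
  fix w :: "real \<Rightarrow> real"
  have "future_path (path_shift 1 (future_path w)) = future_path (path_shift 1 w)"
    by (auto simp: future_path_def path_shift_def fun_eq_iff max_def)
  then show "?f (future_path w) = ?f w" by simp
next
  fix z r :: real assume r: "0 \<le> r"
  have "AE w in P0. future_exact (path_shift (r + 1) (vshift z w))" by (rule AE_future_exact) (use r in simp)
  then show "AE w in P0. indicator unbounded_paths (future_path (path_shift 1 (path_shift r (vshift z w)))) = (indicator unbounded_paths (vshift z w) :: ennreal)"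
    using AE_space
  proof eventually_elim
    case (elim w)
    then have c: "continuous_on UNIV (vshift z w)" by (simp add: space_P0)
    have "future_path (path_shift 1 (path_shift r (vshift z w))) \<in> unbounded_paths \<longleftrightarrow> path_shift (r + 1) (vshift z w) \<in> unbounded_paths"
      unfolding path_shift_path_shift using elim(1) r by (intro unbounded_paths_future_path[OF continuous_path_shift[OF c]]) simp
    also have "\<dots> \<longleftrightarrow> vshift z w \<in> unbounded_paths" using r by (intro unbounded_paths_path_shift[OF c]) simp
    finally show ?case by (simp add: indicator_def)
  qed
qed

text \<open>Reversal turns the balance at \<open>t\<close> into minus the balance at
  \<open>-t\<close>, so unboundedness above in the future becomes unboundedness below in the past.
  Then all mixed mass of (0,1] is matched, and its mean one is the probability of a finite
  return.\<close>

lemma first_return_finite_unbounded: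
  assumes u: "\<And>z. AE w in P0. vshift z w \<in> unbounded_paths"
  shows "AE w in P0. first_return w < \<infinity>"
proof -
  have m: "Measurable.pred path_space (\<lambda>w. w \<in> unbounded_paths)" using unbounded_paths_measurable by simp
  have "AE w in stationary. reverse_path w \<in> unbounded_paths"
    by (rule AE_stationary_reverse_path[OF m AE_stationaryI[OF m u]])
  then have "AE w in stationary. emeasure (ltm w) {s. ereal 0 < return_time (balance w) s \<and> return_time (balance w) s \<le> ereal 1} = emeasure (mtm w) {0<..1}"
    using AE_space
  proof eventually_elim
    case (elim w)
    then have c: "continuous_on UNIV w" by (simp add: space_stationary)
    have "\<exists>a\<le>0. balance w a < B" for B
    proof -
      obtain t where "0 \<le> t" "- B < balance (reverse_path w) t"
        using elim(1) unfolding unbounded_paths_iff[OF continuous_reverse_path[OF c]] by blast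
      then have "balance w (- t) < B" by (simp add: ltime_reverse_path[OF c] mtime_reverse_path[OF c])
      then show ?thesis using \<open>0 \<le> t\<close> by (intro exI[of _ "- t"]) auto
    qed
    from singular_pair.emeasure_matched_eq[OF singular_times[OF c] return_time_measurable[OF c] _ this, of 1]
    show ?case using emeasure_Ioc[OF distribution_function_mtime[OF c], of 0 1] by (simp add: ltm_def mtm_def)
  qed
  then have "emeasure P0 {w \<in> space P0. first_return w < \<infinity>} = 1"
    unfolding emeasure_return_times emeasure_mixed_times[symmetric] by (rule nn_integral_cong_AE)
  moreover have "Measurable.pred P0 (\<lambda>w. first_return w < \<infinity>)" by measurable
  ultimately show ?thesis by (simp only: AE_iff_emeasure_eq_1)
qed

section \<open>Constancy of the unmatched mass in time, and the bounded case\<close>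

text \<open>A nonincreasing sequence crosses a level downwards at most once. The induction carries
  the indicator that the crossing is still to come.\<close>

lemma suminf_crossings:
  fixes X :: "nat \<Rightarrow> ennreal"
  assumes dec: "\<And>n. X (Suc n) \<le> X n"
  shows "(\<Sum>n. indicator {n. \<delta> \<le> X n \<and> X (Suc n) < \<delta>} n) \<le> (1 :: ennreal)"
proof (rule suminf_le_const)
  fix N
  have "(\<Sum>n<N. indicator {n. \<delta> \<le> X n \<and> X (Suc n) < \<delta>} n) + indicator {n. \<delta> \<le> X n} N \<le> (1 :: ennreal)"
  proof (induction N)
    case 0 then show ?case by (simp add: indicator_def)
  next
    case (Suc N)
    have "indicator {n. \<delta> \<le> X n \<and> X (Suc n) < \<delta>} N + indicator {n. \<delta> \<le> X n} (Suc N) \<le> (indicator {n. \<delta> \<le> X n} N :: ennreal)"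
      using order_trans[OF _ dec[of N], of \<delta>] by (auto simp: indicator_def)
    then have "(\<Sum>n<Suc N. indicator {n. \<delta> \<le> X n \<and> X (Suc n) < \<delta>} n) + indicator {n. \<delta> \<le> X n} (Suc N)
      \<le> (\<Sum>n<N. indicator {n. \<delta> \<le> X n \<and> X (Suc n) < \<delta>} n) + (indicator {n. \<delta> \<le> X n} N :: ennreal)"
      unfolding sum.lessThan_Suc add.assoc by (rule add_left_mono)
    also have "\<dots> \<le> 1" by (rule Suc.IH)
    finally show ?case .
  qed
  then show "(\<Sum>n<N. indicator {n. \<delta> \<le> X n \<and> X (Suc n) < \<delta>} n) \<le> (1 :: ennreal)"
    by (rule order_trans[rotated]) simp
qed simp

text \<open>Along integer times the unmatched mass is nonincreasing and crosses \<delta> at most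
  once. The probabilities of a crossing at these times thus sum to at most one, and recurrence makes
  the crossing event null under the stationary measure.\<close>

lemma no_crossing: "AE w in stationary. \<not> (\<delta> \<le> unmatched 0 w \<and> unmatched 1 w < \<delta>)"
proof -
  \<comment> \<open>The event is formulated with frozen paths, so that it depends on the future for
    every path and not only almost surely.\<close>
  let ?C = "{w \<in> space path_space. \<delta> \<le> unmatched 0 (future_path w) \<and> unmatched 0 (future_path (path_shift 1 w)) < \<delta>}"
  have fm: "(\<lambda>w. future_path w) \<in> measurable path_space path_space" "(\<lambda>w. future_path (path_shift 1 w)) \<in> measurable path_space path_space"
    by measurable
  note [measurable] = measurable_compose[OF fm(1) unmatched_measurable[of 0]] measurable_compose[OF fm(2) unmatched_measurable[of 0]]
  have C: "?C \<in> sets path_space" by measurable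
  have "AE w in stationary. indicator ?C w = (0 :: ennreal)"
  proof (rule stationary_null_of_summable)
    show fC: "(\<lambda>w. indicator ?C w :: ennreal) \<in> borel_measurable path_space" by (rule borel_measurable_indicator[OF C])
    show "indicator ?C (future_path w) = (indicator ?C w :: ennreal)" if c: "continuous_on UNIV w" for w
    proof -
      have "future_path (future_path w) = future_path w" "future_path (path_shift 1 (future_path w)) = future_path (path_shift 1 w)"
        by (auto simp: future_path_def path_shift_def fun_eq_iff max_def)
      then show ?thesis using c by (simp add: indicator_def)
    qed
    have pm: "path_shift t \<in> measurable P0 path_space" for t by measurable
    have "(\<Sum>n. \<integral>\<^sup>+w. indicator ?C (path_shift (real (Suc n)) w) \<partial>P0) = (\<integral>\<^sup>+w. (\<Sum>n. indicator ?C (path_shift (real (Suc n)) w)) \<partial>P0)"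
      by (rule nn_integral_suminf[symmetric]) (rule measurable_compose[OF pm fC])
    also have "\<dots> \<le> (\<integral>\<^sup>+w. 1 \<partial>P0)"
    proof (rule nn_integral_mono_AE)
      have "AE w in P0. \<forall>n::nat. future_exact (path_shift (real (Suc n)) w)"
        unfolding AE_all_countable using AE_future_exact[of "real (Suc _)" 0] by (simp add: vshift_0)
      then show "AE w in P0. (\<Sum>n. indicator ?C (path_shift (real (Suc n)) w)) \<le> (1 :: ennreal)"
        using AE_space
      proof eventually_elim
        case (elim w)
        then have c: "continuous_on UNIV w" by (simp add: space_P0)
        have X: "unmatched 0 (future_path (path_shift (real (Suc n)) w)) = unmatched (real (Suc n)) w" for n
          using unmatched_future_path[OF continuous_path_shift[OF c] elim(1)[rule_format]] unmatched_path_shift[OF c, of 0 "real (Suc n)"] by simp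
        have X': "unmatched 0 (future_path (path_shift 1 (path_shift (real (Suc n)) w))) = unmatched (real (Suc (Suc n))) w" for n
          using X[of "Suc n"] unfolding path_shift_path_shift by (simp add: add.commute)
        have "indicator ?C (path_shift (real (Suc n)) w) = (indicator {n. \<delta> \<le> unmatched (real (Suc n)) w \<and> unmatched (real (Suc (Suc n))) w < \<delta>} n :: ennreal)" for n
          unfolding indicator_def mem_Collect_eq X X' using c by simp
        then have "(\<Sum>n. indicator ?C (path_shift (real (Suc n)) w)) = (\<Sum>n. indicator {n. \<delta> \<le> unmatched (real (Suc n)) w \<and> unmatched (real (Suc (Suc n))) w < \<delta>} n :: ennreal)"
          by (simp only:)
        also have "\<dots> \<le> 1" by (rule suminf_crossings) (rule unmatched_antimono[OF c], simp)
        finally show ?case .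
      qed
    qed
    also have "\<dots> < \<infinity>" by (simp add: emeasure_space_1)
    finally show "(\<Sum>n. \<integral>\<^sup>+w. indicator ?C (path_shift (real (Suc n)) w) \<partial>P0) < \<infinity>" .
  qed
  then show ?thesis
    using AE_stationary_future_exact AE_stationary_path_shift[OF future_exact_measurable AE_stationary_future_exact, of 1] AE_space
  proof eventually_elim
    case (elim w)
    then have c: "continuous_on UNIV w" by (simp add: space_stationary)
    have "w \<notin> ?C" using elim(1) by (simp add: indicator_eq_0_iff)
    moreover have "unmatched 0 (future_path w) = unmatched 0 w" by (rule unmatched_future_path[OF c elim(2)])
    moreover have "unmatched 0 (future_path (path_shift 1 w)) = unmatched 1 w"
      using unmatched_future_path[OF continuous_path_shift[OF c] elim(3)] unmatched_path_shift[OF c, of 0 1] by simp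
    ultimately show ?case using c by simp
  qed
qed

text \<open>A decrease between the times 0 and 1 would cross some rational level.\<close>

lemma unmatched_le_shifted: "AE w in stationary. unmatched 0 w \<le> unmatched 1 w"
proof -
  have "AE w in stationary. \<forall>r::rat. \<not> (ennreal (real_of_rat r) \<le> unmatched 0 w \<and> unmatched 1 w < ennreal (real_of_rat r))"
    unfolding AE_all_countable using no_crossing by blast
  then show ?thesis
  proof eventually_elim
    case (elim w)
    show ?case
    proof (rule ccontr)
      assume "\<not> unmatched 0 w \<le> unmatched 1 w"
      then obtain r :: rat where "unmatched 1 w < ennreal (real_of_rat r)" "ennreal (real_of_rat r) < unmatched 0 w"
        using ennreal_rat_dense[of "unmatched 1 w" "unmatched 0 w"] by (auto simp: not_le)
      then show False using elim[rule_format, of r] by (simp add: less_imp_le)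
    qed
  qed
qed

text \<open>A balance bounded above leaves finite unmatched mass after 0, so the mass after
  \<open>n\<close> tends to 0; as it does not decrease along integer times, it is already 0 after
  time 0. The Palm formula for the zero set turns this into a null event for
  \<open>P0\<close>.\<close>

lemma first_return_finite_bounded:
  assumes u: "\<And>z. AE w in P0. vshift z w \<notin> unbounded_paths"
  shows "AE w in P0. first_return w < \<infinity>"
proof -
  have m: "Measurable.pred path_space (\<lambda>w. w \<notin> unbounded_paths)" using unbounded_paths_measurable by simp
  have m': "Measurable.pred path_space (\<lambda>w. unmatched 0 w \<le> unmatched 1 w)"
    unfolding pred_def by (rule borel_measurable_le[OF unmatched_measurable unmatched_measurable])
  have "AE w in stationary. unmatched 0 (path_shift (real n) w) \<le> unmatched 1 (path_shift (real n) w)" for n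
    by (rule AE_stationary_path_shift[OF m' unmatched_le_shifted])
  then have step: "AE w in stationary. \<forall>n. unmatched 0 (path_shift (real n) w) \<le> unmatched 1 (path_shift (real n) w)"
    unfolding AE_all_countable by (rule allI)
  have null: "AE w in stationary. unmatched 0 w = 0"
    using step AE_stationaryI[OF m u] AE_space
  proof eventually_elim
    case (elim w)
    then have c: "continuous_on UNIV w" by (simp add: space_stationary)
    obtain B where B: "\<And>t. 0 \<le> t \<Longrightarrow> balance w t \<le> B"
      using elim(2) unfolding unbounded_paths_iff[OF c] by (auto simp: not_less)
    let ?A = "\<lambda>n::nat. {s. real n < s \<and> first_return (path_shift s w) = \<infinity>}"
    have fin: "emeasure (ltm w) (?A n) \<noteq> \<infinity>" for n
      unfolding ltm_def unmatched_return_time[OF c]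
      using singular_pair.unmatched_finite[OF singular_times[OF c] return_time_measurable[OF c], of "real n" B] B by simp
    have "(\<lambda>n. emeasure (ltm w) (?A n)) \<longlonglongrightarrow> emeasure (ltm w) (\<Inter>n. ?A n)"
    proof (rule Lim_emeasure_decseq)
      show "range ?A \<subseteq> sets (ltm w)" using unmatched_set[OF c] by auto
      show "decseq ?A" by (auto simp: decseq_def)
    qed (rule fin)
    moreover have "(\<Inter>n. ?A n) = {}"
    proof (intro equals0I)
      fix s assume s: "s \<in> (\<Inter>n. ?A n)"
      obtain n :: nat where "s \<le> real n" using real_arch_simple by blast
      moreover have "s \<in> ?A n" using s by blast
      ultimately show False by simp
    qed
    ultimately have lim: "(\<lambda>n. unmatched (real n) w) \<longlonglongrightarrow> 0" by (simp add: unmatched_def)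
    have up: "unmatched 0 w \<le> unmatched (real n) w" for n
    proof (induction n)
      case (Suc n)
      have "unmatched (real n) w \<le> unmatched (real (Suc n)) w"
        using elim(1)[rule_format, of n] unfolding unmatched_path_shift[OF c] by (simp add: add.commute)
      with Suc show ?case by (rule order_trans)
    qed simp
    have "unmatched 0 w \<le> 0" using lim up by (intro LIMSEQ_le_const[OF lim]) auto
    then show ?case by simp
  qed
  let ?I = "{w \<in> space path_space. first_return w = \<infinity>}"
  let ?k = "\<lambda>z :: (real \<Rightarrow> real) \<times> real. indicator ?I (fst z) * indicator {0<..1} (snd z) :: ennreal"
  have I: "?I \<in> sets path_space" by measurable
  have k: "?k \<in> borel_measurable (path_space \<Otimes>\<^sub>M borel)"
    by (intro borel_measurable_times_ennreal measurable_compose[OF measurable_fst borel_measurable_indicator] measurable_compose[OF measurable_snd borel_measurable_indicator] I) simp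
  have iI: "(\<lambda>w. indicator ?I w :: ennreal) \<in> borel_measurable P0"
    using borel_measurable_indicator[OF I] by (simp only: measurable_cong_sets[OF sets_P0 refl])
  have "(\<integral>\<^sup>+w. indicator ?I w \<partial>P0) = (\<integral>\<^sup>+s. (\<integral>\<^sup>+w. indicator ?I w \<partial>P0) * indicator {0<..1::real} s \<partial>lborel)"
    by (subst nn_integral_cmult_indicator) simp_all
  also have "\<dots> = (\<integral>\<^sup>+(s::real). \<integral>\<^sup>+w. ?k (w, s) \<partial>P0 \<partial>lborel)"
    unfolding fst_conv snd_conv by (intro nn_integral_cong nn_integral_multc[symmetric] iI)
  also have "\<dots> = (\<integral>\<^sup>+w. \<integral>\<^sup>+s. ?k (path_shift s w, s) \<partial>ltm w \<partial>stationary)" by (rule palm_zero[OF k, symmetric])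
  also have "\<dots> = (\<integral>\<^sup>+w. 0 \<partial>stationary)"
  proof (rule nn_integral_cong_AE)
    show "AE w in stationary. (\<integral>\<^sup>+s. ?k (path_shift s w, s) \<partial>ltm w) = 0" using null AE_space
    proof eventually_elim
      case (elim w)
      then have c: "continuous_on UNIV w" by (simp add: space_stationary)
      have "(\<integral>\<^sup>+s. ?k (path_shift s w, s) \<partial>ltm w) \<le> (\<integral>\<^sup>+s. indicator {s. 0 < s \<and> first_return (path_shift s w) = \<infinity>} s \<partial>ltm w)"
        by (intro nn_integral_mono) (simp add: indicator_def)
      also have "\<dots> = unmatched 0 w" unfolding unmatched_def
        by (rule nn_integral_indicator) (simp only: sets_ltm unmatched_set[OF c])
      finally show ?case using elim by simp
    qed
  qed
  finally have "(\<integral>\<^sup>+w. indicator ?I w \<partial>P0) = (0::ennreal)" by simp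
  then have "AE w in P0. indicator ?I w = (0::ennreal)" using iI by (simp only: nn_integral_0_iff_AE)
  then show ?thesis using AE_space
  proof eventually_elim
    case (elim w)
    then have "w \<notin> ?I" by (simp add: indicator_eq_0_iff)
    moreover have "continuous_on UNIV w" using elim by (simp add: space_P0)
    ultimately show ?case by (simp add: less_top)
  qed
qed

theorem first_return_finite: "AE w in P0. first_return w < \<infinity>"
  using unbounded_dichotomy first_return_finite_bounded first_return_finite_unbounded by blast

end

section \<open>Law of the path at the first return\<close>

text \<open>For a nonempty index set independence is a statement about the joint law, and
  \<open>R\<close> transports joint laws.\<close>

lemma indep_vars_distr:
  assumes P: "prob_space M" and R: "R \<in> measurable M N"
    and ind: "prob_space.indep_vars (distr M N R) (\<lambda>_. borel) (X :: 'i \<Rightarrow> 'b \<Rightarrow> real) I"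
  shows "prob_space.indep_vars M (\<lambda>_. borel) (\<lambda>i w. X i (R w)) I"
proof -
  interpret M: prob_space M by (rule P)
  interpret D: prob_space "distr M N R" by (rule M.prob_space_distr[OF R])
  show ?thesis
  proof (cases "I = {}")
    case True
    then show ?thesis by (simp add: M.indep_vars_def2 M.indep_sets_def)
  next
    case False
    have X: "X i \<in> borel_measurable N" if "i \<in> I" for i
      using ind that unfolding D.indep_vars_def2 by simp
    have XR: "(\<lambda>w. X i (R w)) \<in> borel_measurable M" if "i \<in> I" for i
      by (rule measurable_compose[OF R X[OF that]])
    have XD: "X i \<in> borel_measurable (distr M N R)" if "i \<in> I" for i using X[OF that] by simp
    have m: "(\<lambda>x. \<lambda>i\<in>I. X i x) \<in> measurable N (\<Pi>\<^sub>M i\<in>I. borel)" by (rule measurable_restrict) (rule X)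
    have "distr (distr M N R) (\<Pi>\<^sub>M i\<in>I. borel) (\<lambda>x. \<lambda>i\<in>I. X i x) = (\<Pi>\<^sub>M i\<in>I. distr (distr M N R) borel (X i))"
      using D.indep_vars_iff_distr_eq_PiM'[OF False, of X "\<lambda>_. borel"] XD ind by blast
    moreover have "distr (distr M N R) (\<Pi>\<^sub>M i\<in>I. borel) (\<lambda>x. \<lambda>i\<in>I. X i x) = distr M (\<Pi>\<^sub>M i\<in>I. borel) (\<lambda>w. \<lambda>i\<in>I. X i (R w))"
      by (subst distr_distr[OF m R]) (simp add: comp_def)
    moreover have "(\<Pi>\<^sub>M i\<in>I. distr (distr M N R) borel (X i)) = (\<Pi>\<^sub>M i\<in>I. distr M borel (\<lambda>w. X i (R w)))"
      by (intro PiM_cong refl) (subst distr_distr[OF X R], simp_all add: comp_def)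
    ultimately show ?thesis
      using M.indep_vars_iff_distr_eq_PiM'[OF False, of "\<lambda>i w. X i (R w)" "\<lambda>_. borel"] XR by simp
  qed
qed

lemma two_sided_brownian_motion_distr:
  assumes P: "prob_space M" and R: "R \<in> measurable M N" and X: "\<And>t. X t \<in> borel_measurable N"
    and B: "two_sided_brownian_motion (distr M N R) X"
  shows "two_sided_brownian_motion M (\<lambda>t w. X t (R w))"
  unfolding two_sided_brownian_motion_def
proof (intro conjI allI impI P)
  show "(\<lambda>w. X t (R w)) \<in> borel_measurable M" for t by (rule measurable_compose[OF R X])
  have "AE x in distr M N R. X 0 x = 0 \<and> continuous_on UNIV (\<lambda>t. X t x)"
    using B unfolding two_sided_brownian_motion_def by blast
  from AE_distrD[OF R this] show "AE w in M. X 0 (R w) = 0 \<and> continuous_on UNIV (\<lambda>t. X t (R w))" .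
  fix s t :: real assume st: "s < t"
  have D: "distributed (distr M N R) lborel (\<lambda>x. X t x - X s x) (normal_density 0 (sqrt (t - s)))"
    using B st unfolding two_sided_brownian_motion_def by blast
  have m: "(\<lambda>x. X t x - X s x) \<in> measurable N lborel" using X[of t] X[of s] by simp
  have "distr (distr M N R) lborel (\<lambda>x. X t x - X s x) = distr M lborel (\<lambda>w. X t (R w) - X s (R w))"
    by (subst distr_distr[OF m R]) (simp add: comp_def)
  then show "distributed M lborel (\<lambda>w. X t (R w) - X s (R w)) (normal_density 0 (sqrt (t - s)))"
    using D measurable_compose[OF R m] unfolding distributed_def by simp
next
  fix s :: "nat \<Rightarrow> real" and n assume "strict_mono s"
  then have "prob_space.indep_vars (distr M N R) (\<lambda>_. borel) (\<lambda>i x. X (s (Suc i)) x - X (s i) x) {..<n}"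
    using B unfolding two_sided_brownian_motion_def by blast
  from indep_vars_distr[OF P R this]
  show "prob_space.indep_vars M (\<lambda>_. borel) (\<lambda>i w. X (s (Suc i)) (R w) - X (s i) (R w)) {..<n}" .
qed

context balancing_setup
begin

definition return_real :: "(real \<Rightarrow> real) \<Rightarrow> real" where
  "return_real w = real_of_ereal (first_return w)"

definition return_increments :: "(real \<Rightarrow> real) \<Rightarrow> real \<Rightarrow> real" where
  "return_increments w = recenter 0 (return_path w)"

lemma return_path_eval: "return_path w t = w (return_real w + t)"
  by (simp add: return_path_def path_shift_def return_real_def)

lemma return_increments_eval: "return_increments w t = w (return_real w + t) - w (return_real w)"
  by (simp add: return_increments_def recenter_def vshift_def path_shift_def return_path_eval)

lemma return_increments_measurable: "return_increments \<in> measurable path_space path_space"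
proof -
  have "recenter 0 \<in> measurable path_space path_space" by measurable
  from measurable_compose[OF return_path_measurable this] show ?thesis unfolding return_increments_def[abs_def] .
qed

lemma return_value_measurable: "(\<lambda>w. w (return_real w)) \<in> borel_measurable path_space"
  using measurable_fst_path_space[OF return_path_measurable, of 0] by (simp add: return_path_eval)

lemma return_real_measurable: "return_real \<in> borel_measurable P0"
proof -
  have "first_return \<in> borel_measurable P0" using first_return_measurable by (simp add: measurable_cong_sets[OF sets_P0 refl])
  then show ?thesis unfolding return_real_def[abs_def] by (rule borel_measurable_real_of_ereal)
qed

text \<open>The law of the path at the return is a mixture over \<nu> of starting points. In the
  coordinates (increments from time 0, initial value) this mixture is the product of
  \<open>P0\<close> and \<nu>, which contains law, embedding and independence at once.\<close>

lemma nn_integral_return: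
  assumes h: "h \<in> borel_measurable (path_space \<Otimes>\<^sub>M borel)"
  shows "(\<integral>\<^sup>+w. h (return_increments w, w (return_real w)) \<partial>P0) = (\<integral>\<^sup>+y. \<integral>\<^sup>+w. h (w, y) \<partial>P0 \<partial>\<nu>)"
proof -
  let ?g = "\<lambda>w. h (recenter 0 w, w 0)"
  have rc: "recenter 0 \<in> measurable path_space path_space" by measurable
  have g: "?g \<in> borel_measurable path_space"
    by (rule path_functional_measurable[OF h rc eval_measurable])
  have "(\<integral>\<^sup>+w. h (return_increments w, w (return_real w)) \<partial>P0) = (\<integral>\<^sup>+w. ?g (return_path w) \<partial>P0)"
    by (simp add: return_increments_def return_path_eval)
  also have "\<dots> = (\<integral>\<^sup>+y. \<integral>\<^sup>+w. ?g (vshift y w) \<partial>P0 \<partial>\<nu>)" by (rule nn_integral_return_path[OF first_return_finite g])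
  also have "\<dots> = (\<integral>\<^sup>+y. \<integral>\<^sup>+w. h (w, y) \<partial>P0 \<partial>\<nu>)"
  proof (rule nn_integral_cong, rule nn_integral_cong_AE)
    fix y
    show "AE w in P0. ?g (vshift y w) = h (w, y)" using AE_zero
    proof eventually_elim
      case (elim w)
      have "recenter 0 (vshift y w) = w" using elim by (auto simp: recenter_def vshift_def path_shift_def fun_eq_iff)
      moreover have "vshift y w 0 = y" using elim by (simp add: vshift_def)
      ultimately show ?case by simp
    qed
  qed
  finally show ?thesis .
qed

lemma emeasure_return:
  assumes A: "A \<in> sets path_space" and C: "C \<in> sets borel"
  shows "emeasure P0 {w \<in> space P0. return_increments w \<in> A \<and> w (return_real w) \<in> C} = emeasure P0 A * emeasure \<nu> C"
proof -
  let ?h = "\<lambda>z :: (real \<Rightarrow> real) \<times> real. indicator A (fst z) * indicator C (snd z) :: ennreal"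
  have h: "?h \<in> borel_measurable (path_space \<Otimes>\<^sub>M borel)"
    by (intro borel_measurable_times_ennreal measurable_compose[OF measurable_fst borel_measurable_indicator[OF A]] measurable_compose[OF measurable_snd borel_measurable_indicator[OF C]])
  have S: "{w \<in> space P0. return_increments w \<in> A \<and> w (return_real w) \<in> C} \<in> sets P0"
  proof -
    have "return_increments -` A \<inter> space path_space \<in> sets path_space" "(\<lambda>w. w (return_real w)) -` C \<inter> space path_space \<in> sets path_space"
      by (rule measurable_sets[OF return_increments_measurable A] measurable_sets[OF return_value_measurable C])+
    then have "(return_increments -` A \<inter> space path_space) \<inter> ((\<lambda>w. w (return_real w)) -` C \<inter> space path_space) \<in> sets path_space" by (rule sets.Int)
    moreover have "(return_increments -` A \<inter> space path_space) \<inter> ((\<lambda>w. w (return_real w)) -` C \<inter> space path_space) = {w \<in> space P0. return_increments w \<in> A \<and> w (return_real w) \<in> C}"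
      by (auto simp: space_P0)
    ultimately show ?thesis by simp
  qed
  have AP: "A \<in> sets P0" using A by simp
  have "emeasure P0 {w \<in> space P0. return_increments w \<in> A \<and> w (return_real w) \<in> C} = (\<integral>\<^sup>+w. ?h (return_increments w, w (return_real w)) \<partial>P0)"
    unfolding nn_integral_indicator[OF S, symmetric] by (intro nn_integral_cong) (auto simp: indicator_def)
  also have "\<dots> = (\<integral>\<^sup>+y. \<integral>\<^sup>+w. ?h (w, y) \<partial>P0 \<partial>\<nu>)" by (rule nn_integral_return[OF h])
  also have "\<dots> = (\<integral>\<^sup>+y. emeasure P0 A * indicator C y \<partial>\<nu>)"
  proof (rule nn_integral_cong)
    fix y
    have "(\<integral>\<^sup>+w. indicator A w * indicator C y \<partial>P0) = (\<integral>\<^sup>+w. indicator A w \<partial>P0) * (indicator C y :: ennreal)"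
      by (rule nn_integral_multc) (rule borel_measurable_indicator[OF AP])
    then show "(\<integral>\<^sup>+w. ?h (w, y) \<partial>P0) = emeasure P0 A * indicator C y" using nn_integral_indicator[OF AP] by (simp only: fst_conv snd_conv)
  qed
  also have "\<dots> = emeasure P0 A * emeasure \<nu> C" by (rule nn_integral_cmult_indicator) (simp add: C)
  finally show ?thesis .
qed

lemma return_embeds: "embeds P0 return_real \<nu>"
  unfolding embeds_def random_time_def
proof (intro conjI return_real_measurable measure_eqI)
  have m: "(\<lambda>w. w (return_real w)) \<in> borel_measurable P0" using return_value_measurable by (simp add: measurable_cong_sets[OF sets_P0 refl])
  fix C assume "C \<in> sets (distr P0 borel (\<lambda>w. w (return_real w)))"
  then have C: "C \<in> sets borel" by simp
  have "emeasure (distr P0 borel (\<lambda>w. w (return_real w))) C = emeasure P0 ((\<lambda>w. w (return_real w)) -` C \<inter> space P0)"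
    by (rule emeasure_distr[OF m C])
  also have "(\<lambda>w. w (return_real w)) -` C \<inter> space P0 = {w \<in> space P0. return_increments w \<in> space path_space \<and> w (return_real w) \<in> C}"
    using measurable_space[OF return_increments_measurable] by (auto simp: space_P0)
  also have "emeasure P0 \<dots> = emeasure P0 (space path_space) * emeasure \<nu> C" by (rule emeasure_return[OF sets.top C])
  also have "emeasure P0 (space path_space) = 1" using emeasure_space_1 by (simp add: space_P0)
  finally show "emeasure (distr P0 borel (\<lambda>w. w (return_real w))) C = emeasure \<nu> C" by simp
qed simp

lemma distr_return_increments: "distr P0 path_space return_increments = P0"
proof (rule measure_eqI)
  have m: "return_increments \<in> measurable P0 path_space" using return_increments_measurable by (simp add: measurable_cong_sets[OF sets_P0 refl])
  fix A assume "A \<in> sets (distr P0 path_space return_increments)"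
  then have A: "A \<in> sets path_space" by simp
  have "emeasure (distr P0 path_space return_increments) A = emeasure P0 (return_increments -` A \<inter> space P0)"
    by (rule emeasure_distr[OF m A])
  also have "return_increments -` A \<inter> space P0 = {w \<in> space P0. return_increments w \<in> A \<and> w (return_real w) \<in> UNIV}" by auto
  also have "emeasure P0 \<dots> = emeasure P0 A * emeasure \<nu> UNIV" by (rule emeasure_return[OF A]) simp
  also have "emeasure \<nu> UNIV = 1" using nu.emeasure_space_1 sets_eq_imp_space_eq[OF sets_nu] by simp
  finally show "emeasure (distr P0 path_space return_increments) A = emeasure P0 A" by simp
qed simp

lemma return_unbiased: "unbiased_shift P0 return_real"
  unfolding unbiased_shift_def random_time_def
proof (intro conjI return_real_measurable)
  have m: "return_increments \<in> measurable P0 path_space" using return_increments_measurable by (simp add: measurable_cong_sets[OF sets_P0 refl])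
  have e: "(\<lambda>w t. w (return_real w + t) - w (return_real w)) = return_increments"
    by (simp add: fun_eq_iff return_increments_eval)
  have "two_sided_brownian_motion (distr P0 path_space return_increments) (\<lambda>t w. w t)"
    unfolding distr_return_increments by (rule bm)
  from two_sided_brownian_motion_distr[OF prob_space_axioms m eval_measurable this]
  show "two_sided_brownian_motion P0 (\<lambda>t w. w (return_real w + t) - w (return_real w))"
    by (simp only: return_increments_eval)
  show "indep_set (sets (vimage_algebra (space P0) (\<lambda>w t. w (return_real w + t) - w (return_real w)) path_space))
     (sets (vimage_algebra (space P0) (\<lambda>w. w (return_real w)) borel))"
    unfolding e
  proof (rule indep_setI)
    have v: "(\<lambda>w. w (return_real w)) \<in> borel_measurable P0" using return_value_measurable by (simp add: measurable_cong_sets[OF sets_P0 refl])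
    have s1: "sets (vimage_algebra (space P0) return_increments path_space) = {return_increments -` A \<inter> space P0 | A. A \<in> sets path_space}"
      by (rule sets_vimage_algebra2) (use measurable_space[OF m] in auto)
    have s2: "sets (vimage_algebra (space P0) (\<lambda>w. w (return_real w)) borel) = {(\<lambda>w. w (return_real w)) -` C \<inter> space P0 | C. C \<in> sets borel}"
      by (rule sets_vimage_algebra2) simp
    show "sets (vimage_algebra (space P0) return_increments path_space) \<subseteq> events"
      unfolding s1 using measurable_sets[OF m] by blast
    show "sets (vimage_algebra (space P0) (\<lambda>w. w (return_real w)) borel) \<subseteq> events"
      unfolding s2 using measurable_sets[OF v] by blast
    fix a b assume "a \<in> sets (vimage_algebra (space P0) return_increments path_space)" "b \<in> sets (vimage_algebra (space P0) (\<lambda>w. w (return_real w)) borel)"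
    then obtain A C where A: "A \<in> sets path_space" "a = return_increments -` A \<inter> space P0" and C: "C \<in> sets borel" "b = (\<lambda>w. w (return_real w)) -` C \<inter> space P0"
      unfolding s1 s2 by blast
    have "a \<inter> b = {w \<in> space P0. return_increments w \<in> A \<and> w (return_real w) \<in> C}" unfolding A(2) C(2) by blast
    then have "emeasure P0 (a \<inter> b) = emeasure P0 A * emeasure \<nu> C" using emeasure_return[OF A(1) C(1)] by (simp only:)
    moreover have "emeasure P0 a = emeasure P0 A"
      using emeasure_distr[OF m A(1)] unfolding distr_return_increments A(2) by (rule sym)
    moreover have "emeasure P0 b = emeasure \<nu> C"
      using emeasure_distr[OF v C(1)] return_embeds unfolding embeds_def C(2) by simp
    ultimately show "prob (a \<inter> b) = prob a * prob b" by (simp add: measure_def enn2real_mult)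
  qed
qed

section \<open>The balancing time and its stopping property\<close>

lemma AE_good_levels: "AE w in P0. AE y in \<nu>. good (vshift (- y) w)"
proof -
  interpret PN: pair_sigma_finite P0 \<nu> ..
  have "(\<lambda>x. vshift (- snd x) (fst x)) \<in> measurable (P0 \<Otimes>\<^sub>M \<nu>) path_space" by measurable
  from measurable_compose[OF this good_measurable]
  have "{x \<in> space (P0 \<Otimes>\<^sub>M \<nu>). good (vshift (- snd x) (fst x))} \<in> sets (P0 \<Otimes>\<^sub>M \<nu>)" by (simp add: pred_def)
  from PN.AE_commute[OF this] show ?thesis using AE_good_all by simp
qed

text \<open>Levels enter only through an integral over \<nu>, so agreement of \<open>L y\<close>
  with the canonical version at \<nu>-almost every level suffices.\<close>

lemma mixed_local_time_eq:
  assumes c: "continuous_on UNIV w" and s: "summable_levels w" and g: "AE y in \<nu>. good (vshift (- y) w)"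
  shows "mixed_local_time L \<nu> w = mtm w"
proof -
  have "mixed_local_time L \<nu> w = measure_of UNIV (sets borel) (emeasure (mtm w))"
    unfolding mixed_local_time_def
  proof (rule measure_of_eq)
    fix C :: "real set" assume "C \<in> sigma_sets UNIV (sets borel)"
    then have C: "C \<in> sets borel" using sets.sigma_sets_eq[of "borel :: real measure"] by simp
    have "emeasure (mtm w) C = (\<integral>\<^sup>+t. indicator C t \<partial>mtm w)" using C by simp
    also have "\<dots> = (\<integral>\<^sup>+y. \<integral>\<^sup>+t. indicator C t \<partial>ltm (vshift (- y) w) \<partial>\<nu>)"
      by (rule nn_integral_mtm[OF c s borel_measurable_indicator[OF C]])
    also have "\<dots> = (\<integral>\<^sup>+y. emeasure (L y w) C \<partial>\<nu>)"
    proof (rule nn_integral_cong_AE)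
      show "AE y in \<nu>. (\<integral>\<^sup>+t. indicator C t \<partial>ltm (vshift (- y) w)) = emeasure (L y w) C"
        using g
      proof eventually_elim
        case (elim y)
        have "L y w = ltm (vshift (- y) w)" using L_level[OF c, of y] good_imp_L[OF continuous_vshift[OF c] elim] by simp
        then show ?case using C by simp
      qed
    qed
    finally show "(\<integral>\<^sup>+y. emeasure (L y w) C \<partial>\<nu>) = emeasure (mtm w) C" by simp
  qed simp
  also have "\<dots> = mtm w" using measure_of_of_measure[of "mtm w"] by (simp add: mtm_def)
  finally show ?thesis .
qed

text \<open>Where \<open>L\<close> is canonical, the masses of [0,t] are the values of
  \<open>ltime\<close> and \<open>mtime\<close> at \<open>t\<close>; both are finite, so their
  equality says that the balance is back at 0.\<close>

lemma AE_balancing_time: "AE w in P0. balancing_time L \<nu> w = ereal (return_real w)"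
  using AE_good_levels AE_good_all[of 0] AE_summable_levels[of 0] first_return_finite AE_space
proof eventually_elim
  case (elim w)
  then have c: "continuous_on UNIV w" by (simp add: space_P0)
  have s: "summable_levels w" and g: "good w" using elim by (simp_all add: vshift_0)
  have "emeasure (L 0 w) {0..t} = emeasure (mixed_local_time L \<nu> w) {0..t} \<longleftrightarrow> balance w t = balance w 0" if "0 < t" for t
  proof -
    have "emeasure (L 0 w) {0..t} = ennreal (ltime w t)"
      unfolding good_imp_L[OF c g] ltm_def using emeasure_Icc[OF distribution_function_ltime[OF c], of 0 t] that by (simp add: ltime_zero)
    moreover have "emeasure (mixed_local_time L \<nu> w) {0..t} = ennreal (mtime w t)"
      unfolding mixed_local_time_eq[OF c s elim(1)] mtm_def using emeasure_Icc[OF distribution_function_mtime[OF c], of 0 t] that by (simp add: mtime_zero)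
    moreover have "0 \<le> ltime w t" "0 \<le> mtime w t"
      using distribution_functionD(1)[OF distribution_function_ltime[OF c], of 0 t] distribution_functionD(1)[OF distribution_function_mtime[OF c], of 0 t] that
      by (simp_all add: ltime_zero mtime_zero)
    ultimately show ?thesis by (simp add: ltime_zero mtime_zero)
  qed
  then have "balancing_time L \<nu> w = first_return w"
    unfolding balancing_time_def first_return_def return_time_def by (simp only: cong: conj_cong)
  also have "\<dots> = ereal (return_real w)"
    using elim(4) first_return_nonneg[of w] unfolding return_real_def by (cases "first_return w") auto
  finally show ?case .
qed

text \<open>A return at time 0 would give the path the value 0 there, but the value at the return
  has law \<nu>, without mass at 0. This settles the stopping events for t \<le> 0.\<close>

lemma AE_first_return_positive: "AE w in P0. 0 < first_return w"
proof -
  have "emeasure P0 {w \<in> space P0. return_increments w \<in> space path_space \<and> w (return_real w) \<in> {0}} = 0"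
    using emeasure_return[OF sets.top, of "{0}"] nu_zero by simp
  moreover have "{w \<in> space P0. return_increments w \<in> space path_space \<and> w (return_real w) \<in> {0}} = {w \<in> space P0. w (return_real w) = 0}"
    using measurable_space[OF return_increments_measurable] by (auto simp: space_P0)
  ultimately have "emeasure P0 {w \<in> space P0. \<not> w (return_real w) \<noteq> 0} = 0" by simp
  moreover have "{w \<in> space P0. \<not> w (return_real w) \<noteq> 0} \<in> sets P0"
  proof -
    have "(\<lambda>w. w (return_real w)) \<in> borel_measurable P0" using return_value_measurable by (simp add: measurable_cong_sets[OF sets_P0 refl])
    from measurable_sets[OF this, of "{0}"] show ?thesis by (simp add: vimage_def Collect_conj_eq Int_commute)
  qed
  ultimately have "AE w in P0. w (return_real w) \<noteq> 0" by (intro AE_I[OF subset_refl])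
  then show ?thesis using AE_zero
  proof eventually_elim
    case (elim w)
    have "first_return w \<noteq> 0"
    proof
      assume "first_return w = 0"
      then have "return_real w = 0" by (simp add: return_real_def)
      then show False using elim by simp
    qed
    then show ?case using first_return_nonneg[of w] by (simp add: order_less_le)
  qed
qed

text \<open>At the fixed time \<open>t\<close> the path is almost surely at none of the relevant
  levels, that is neither at 0 nor, by Fubini, at \<nu>-almost any level; stopping it there freezes
  all the local times involved.\<close>

lemma AE_balance_stopped:
  assumes t: "0 < t"
  shows "AE w in P0. \<forall>u. balance (stopped_path t w) u = balance w (min u t)"
  using AE_levels_regular[OF t, of 0] AE_good_all[of 0] AE_summable_levels[of 0] AE_eval_neq[OF t, of 0] AE_space
proof eventually_elim
  case (elim w)
  then have c: "continuous_on UNIV w" by (simp add: space_P0)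
  have s: "summable_levels w" and r: "reg w" using elim by (simp_all add: vshift_0 good_def)
  have cs: "continuous_on UNIV (stopped_path t w)" using c by simp
  have lev: "AE y in \<nu>. level_time (stopped_path t w) y u = level_time w y (min u t)" for u
    using elim(1)
  proof eventually_elim
    case (elim y)
    have e: "vshift (- y) (stopped_path t w) = stopped_path t (vshift (- y) w)" by (simp add: vshift_def stopped_path_def)
    have "reg (vshift (- y) w)" "vshift (- y) w t \<noteq> 0" using elim by (simp_all add: vshift_def)
    from ltime_stopped_path[OF continuous_vshift[OF c] this] t show ?case unfolding e by simp
  qed
  have ss: "summable_levels (stopped_path t w)"
    unfolding summable_levels_iff[OF cs]
  proof
    fix u
    have "integrable \<nu> (\<lambda>y. level_time w y (min u t))" using s summable_levels_iff[OF c] by blast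
    then show "integrable \<nu> (\<lambda>y. level_time (stopped_path t w) y u)"
      using integrable_cong_AE[OF level_time_measurable1[OF cs] level_time_measurable1[OF c] lev] by blast
  qed
  have "mtime (stopped_path t w) u = mtime w (min u t)" for u
    using integral_cong_AE[OF level_time_measurable1[OF cs] level_time_measurable1[OF c] lev] s ss by (simp add: mtime_def)
  moreover have "ltime (stopped_path t w) u = ltime w (min u t)" for u
    using ltime_stopped_path[OF c r elim(4)] t by simp
  ultimately show ?case by simp
qed

lemma space_path_filtration: "space (path_filtration P0 t) = space P0" (is ?space)
  and sets_path_filtration: "sets (path_filtration P0 t) = sigma_sets (space P0)
     ({(\<lambda>w. w s) -` A \<inter> space P0 | s A. s \<le> t \<and> A \<in> sets borel} \<union> null_sets P0)" (is ?sets)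
proof -
  have "null_sets P0 \<subseteq> Pow (space P0)" using sets.sets_into_space by blast
  then have *: "{(\<lambda>w. w s) -` A \<inter> space P0 | s A. s \<le> t \<and> A \<in> sets borel} \<union> null_sets P0 \<subseteq> Pow (space P0)" by blast
  show ?space unfolding path_filtration_def by (rule space_measure_of[OF *])
  show ?sets unfolding path_filtration_def by (rule sets_measure_of[OF *])
qed

lemma stopped_path_filtration: "stopped_path t \<in> measurable (path_filtration P0 t) path_space"
proof (rule measurable_path_spaceI)
  show "continuous_on UNIV (stopped_path t w)" if "w \<in> space (path_filtration P0 t)" for w
    using that by (simp add: space_path_filtration space_P0)
  show "(\<lambda>w. stopped_path t w s) \<in> borel_measurable (path_filtration P0 t)" for s
  proof (rule measurableI)
    fix A :: "real set" assume A: "A \<in> sets borel"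
    show "(\<lambda>w. stopped_path t w s) -` A \<inter> space (path_filtration P0 t) \<in> sets (path_filtration P0 t)"
      unfolding sets_path_filtration space_path_filtration stopped_path_def
      by (rule sigma_sets.Basic, rule UnI1, rule CollectI, intro exI conjI, rule refl) (use A in auto)
  qed simp
qed

lemma null_sets_path_filtration: "N \<in> null_sets P0 \<Longrightarrow> N \<in> sets (path_filtration P0 t)"
  unfolding sets_path_filtration by (rule sigma_sets.Basic) blast

text \<open>The filtration contains the null events, so it is closed under almost sure
  modification.\<close>

lemma path_filtration_AE_eq:
  assumes E: "E \<in> sets (path_filtration P0 t)" "E \<in> sets P0" and S: "S \<in> sets P0" and eq: "AE w in P0. w \<in> S \<longleftrightarrow> w \<in> E"
  shows "S \<in> sets (path_filtration P0 t)"
proof -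
  have "S - E \<in> null_sets P0" "E - S \<in> null_sets P0"
    using eq S E(2) by (auto intro!: AE_iff_null_sets[THEN iffD2] elim: AE_mp)
  then have "(E - (E - S)) \<union> (S - E) \<in> sets (path_filtration P0 t)"
    by (intro sets.Un sets.Diff E null_sets_path_filtration)
  moreover have "(E - (E - S)) \<union> (S - E) = S" by blast
  ultimately show ?thesis by simp
qed

lemma return_real_nonneg: "0 \<le> return_real w"
  unfolding return_real_def using first_return_nonneg by (rule real_of_ereal_pos)

text \<open>For t > 0 a return by time \<open>t\<close> means a zero of the balance in (0,t], and
  the balance up to \<open>t\<close> is that of the path stopped at \<open>t\<close>. No later time
  enters, so the filtration is used as it is, without right limits.\<close>

lemma return_stopping_time: "nonneg_stopping_time P0 return_real"
  unfolding nonneg_stopping_time_def random_time_def stopping_time_def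
proof (intro conjI allI return_real_measurable)
  show "AE w in P0. 0 \<le> return_real w" using return_real_nonneg by simp
  fix t
  let ?S = "{w \<in> space P0. return_real w \<le> t}"
  have S: "?S \<in> sets P0" using borel_measurable_le[OF return_real_measurable borel_measurable_const[of t]] .
  have fin: "AE w in P0. first_return w = ereal (return_real w)"
    using first_return_finite
  proof eventually_elim
    case (elim w)
    then show ?case using first_return_nonneg[of w] unfolding return_real_def by (cases "first_return w") auto
  qed
  have "?S \<in> sets (path_filtration P0 t)"
  proof (cases "0 < t")
    case True
    let ?F = "{w \<in> space path_space. first_return w \<le> ereal t}"
    let ?E = "stopped_path t -` ?F \<inter> space P0"
    have F: "?F \<in> sets path_space" by measurable
    show ?thesis
    proof (rule path_filtration_AE_eq[OF _ _ S])
      show "?E \<in> sets (path_filtration P0 t)"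
        using measurable_sets[OF stopped_path_filtration F, of t] by (simp only: space_path_filtration)
      have "stopped_path t \<in> measurable P0 path_space" by measurable
      from measurable_sets[OF this F] show "?E \<in> sets P0" .
      show "AE w in P0. w \<in> ?S \<longleftrightarrow> w \<in> ?E"
        using AE_balance_stopped[OF True] fin AE_space
      proof eventually_elim
        case (elim w)
        then have c: "continuous_on UNIV w" by (simp add: space_P0)
        have "return_real w \<le> t \<longleftrightarrow> first_return w \<le> ereal t" unfolding elim(2) by simp
        also have "\<dots> \<longleftrightarrow> (\<exists>u\<in>{0<..t}. balance w u = 0)" by (rule first_return_le_iff[OF c True])
        also have "\<dots> \<longleftrightarrow> (\<exists>u\<in>{0<..t}. balance (stopped_path t w) u = 0)"
          by (intro bex_cong refl) (simp only: elim(1), simp add: min_def)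
        also have "\<dots> \<longleftrightarrow> first_return (stopped_path t w) \<le> ereal t"
          by (rule first_return_le_iff[OF continuous_stopped_path[OF c] True, symmetric])
        finally show ?case using c elim(3) by simp
      qed
    qed
  next
    case False
    have "AE w in P0. w \<in> ?S \<longleftrightarrow> w \<in> {}"
      using fin AE_first_return_positive
    proof eventually_elim
      case (elim w)
      then have "0 < return_real w" by simp
      then show ?case using False by simp
    qed
    from path_filtration_AE_eq[OF sets.empty_sets sets.empty_sets S this] show ?thesis .
  qed
  then show "Measurable.pred (path_filtration P0 t) (\<lambda>w. return_real w \<le> t)"
    unfolding pred_def space_path_filtration .
qed

end

theorem theorem1p3:
  fixes P\<^sub>0 :: "(real \<Rightarrow> real) measure"
    and L :: "real \<Rightarrow> (real \<Rightarrow> real) \<Rightarrow> real measure"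
    and \<nu> :: "real measure"
  assumes "two_sided_wiener_measure P\<^sub>0"
    and "brownian_local_time P\<^sub>0 L"
    and "prob_space \<nu>"
    and "sets \<nu> = sets borel"
    and "emeasure \<nu> {0} = 0"
  shows "\<exists>T. (AE \<omega> in P\<^sub>0. balancing_time L \<nu> \<omega> = ereal (T \<omega>)) \<and>
             nonneg_stopping_time P\<^sub>0 T \<and> embeds P\<^sub>0 T \<nu> \<and> unbiased_shift P\<^sub>0 T"
proof -
  interpret local_time_setup P\<^sub>0 L
    by unfold_locales (rule assms(1), rule assms(2))
  \<comment> \<open>The scale is extracted once from the given \<open>L\<close>; all later
    functionals of the path are built with it.\<close>
  obtain \<epsilon> where \<epsilon>: "occupation_scale \<epsilon>" "AE x in lborel. AE w in P\<^sub>0. \<forall>q\<in>\<rat>.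
    (\<lambda>k. occupation (\<epsilon> k) (vshift (- x) w) (min 0 q) (max 0 q)) \<longlonglongrightarrow> window_density (min 0 q) (max 0 q) w x"
    using occupation_scale_exists by blast
  interpret occupation_scale \<epsilon> by (rule \<epsilon>(1))
  interpret nu: prob_space \<nu> by (rule assms(3))
  interpret balancing_setup P\<^sub>0 L \<epsilon> \<nu>
    by unfold_locales (use \<epsilon>(2) assms(4,5) in auto)
  show ?thesis
    using AE_balancing_time return_stopping_time return_embeds return_unbiased by blast
qed

end
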